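(* Let $n\in\{2,3\}$, $g>0$, $\sigma\ge 0$, and $c=(c',0)\in\mathbb{R}^{n-1}\times\mathbb{R}$ with $c\neq 0$. Let $\eta\in C^2(\mathbb{R}^{n-1})$, let $\Omega=\{(x',x_n)\in\mathbb{R}^{n-1}\times\mathbb{R}: x_n<\eta(x')\}$ with boundary $S=\{x_n=\eta(x')\}$ and outward unit normal $N$, and let $\varphi\in C^2(\overline{\Omega})$. Suppose that \begin{align*} \Delta\varphi&=0 && \text{in }\Omega,\\ \nabla\varphi\cdot N&=c\cdot N && \text{on }S,\\ \tfrac12|\nabla\varphi|^2-c\cdot\nabla\varphi+g\eta&=-\sigma\nabla\cdot N && \text{on }S,\\ \eta&\to0 && \text{as }|x'|\to\infty,\\ \varphi,\nabla\varphi&\to0 && \text{as }|x|\to\infty, \end{align*} and that, for some $\varepsilon\in(0,1)$ and all indices $i,j$, $$\varphi=o\Big(\frac1{|x|^{n-2}}\Big)\ \text{ as }|x|\to\infty,$$ $$\eta=O\Big(\frac1{|x'|^{n-1+\varepsilon}}\Big),\quad \frac{\partial\eta}{\partial x'_i}=O\Big(\frac1{|x'|^{n+\varepsilon}}\Big),\quad \frac{\partial^2\eta}{\partial x'_i\partial x'_j}=O\Big(\frac1{|x'|^{n+1+\varepsilon}}\Big)\ \text{ as }|x'|\to\infty.$$ Then either the angular momentum $\int_\Omega x\times\nabla\varphi\,dx$ is infinite, or the wave is trivial, i.e. $\varphi\equiv0$ and $\eta\equiv0$.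
   Context: Write $x=(x',x_n)\in\mathbb{R}^{n-1}\times\mathbb{R}$, with $x'$ horizontal and $x_n$ vertical. The function $\eta$ is the free surface profile, $\varphi$ the velocity potential, $c$ the wave speed, $g$ the gravitational acceleration, $\sigma$ the coefficient of surface tension. The unit normal pointing out of $\Omega$ depends only on $x'$: $N=N(x')=(-\nabla\eta,1)/\sqrt{1+|\nabla\eta|^2}$, so that $\nabla\cdot N=-\nabla\cdot\big(\nabla\eta/\sqrt{1+|\nabla\eta|^2}\big)$. Limits and asymptotic statements for $\varphi,\nabla\varphi$ as $|x|\to\infty$ are taken over $x\in\overline\Omega$. For $n=3$, $\times$ is the usual cross product; for $n=2$, $a\times b=a_1b_2-a_2b_1$ is the scalar cross product. With $B_r=\{|x|<r\}$, "the angular momentum is infinite" means that $\big|\int_{\Omega\cap B_r}x\times\nabla\varphi\,dx\big|\to\infty$ as $r\to\infty$. *)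

theory Defs
  imports "HOL-Analysis.Analysis" "HOL-Library.Landau_Symbols"
begin

section \<open>Differential operators and classes of continuous differentiability\<close>

definition partial_deriv :: "'a::euclidean_space \<Rightarrow> ('a \<Rightarrow> real) \<Rightarrow> 'a \<Rightarrow> real" where
  "partial_deriv b f x = frechet_derivative f (at x) b"

definition gradient :: "('a::euclidean_space \<Rightarrow> real) \<Rightarrow> 'a \<Rightarrow> 'a" where
  "gradient f x = (\<Sum>b\<in>Basis. partial_deriv b f x *\<^sub>R b)"

definition divergence :: "('a::euclidean_space \<Rightarrow> 'a) \<Rightarrow> 'a \<Rightarrow> real" where
  "divergence F x = (\<Sum>b\<in>Basis. partial_deriv b (\<lambda>y. F y \<bullet> b) x)"

definition laplacian :: "('a::euclidean_space \<Rightarrow> real) \<Rightarrow> 'a \<Rightarrow> real" where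
  "laplacian f x = (\<Sum>b\<in>Basis. partial_deriv b (partial_deriv b f) x)"

text \<open>\<open>C1_on\<close> and \<open>C2_on\<close> are meant for open sets.\<close>

definition C1_on :: "'a::euclidean_space set \<Rightarrow> ('a \<Rightarrow> real) \<Rightarrow> bool" where
  "C1_on U f \<longleftrightarrow>
     (\<forall>x\<in>U. f differentiable (at x)) \<and> (\<forall>b\<in>Basis. continuous_on U (partial_deriv b f))"

definition C2_on :: "'a::euclidean_space set \<Rightarrow> ('a \<Rightarrow> real) \<Rightarrow> bool" where
  "C2_on U f \<longleftrightarrow> C1_on U f \<and> (\<forall>b\<in>Basis. C1_on U (partial_deriv b f))"

definition extends_continuously :: "'a::topological_space set \<Rightarrow> ('a \<Rightarrow> 'b::topological_space) \<Rightarrow> bool"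
  where "extends_continuously U f \<longleftrightarrow> (\<exists>F. continuous_on (closure U) F \<and> (\<forall>x\<in>U. F x = f x))"

text \<open>
  For open \<open>U\<close>, \<open>C2_closure U f\<close> says that \<open>f\<close> belongs to \<open>C\<^sup>2\<close> of the closure of \<open>U\<close>:
  the derivatives up to second order exist and are continuous in \<open>U\<close> and extend continuously
  to the closure. Nothing is said about values of \<open>f\<close> outside the closure, so
  boundary values of the gradient are given by the continuous extension
  \<open>gradient_ext U f\<close>, not by a derivative taken in a full neighbourhood.
\<close>

definition C2_closure :: "'a::euclidean_space set \<Rightarrow> ('a \<Rightarrow> real) \<Rightarrow> bool" where
  "C2_closure U f \<longleftrightarrow>
     C2_on U f \<and> continuous_on (closure U) f \<and>
     (\<forall>i\<in>Basis. extends_continuously U (partial_deriv i f)) \<and>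
     (\<forall>i\<in>Basis. \<forall>j\<in>Basis. extends_continuously U (partial_deriv i (partial_deriv j f)))"

definition gradient_ext :: "'a::euclidean_space set \<Rightarrow> ('a \<Rightarrow> real) \<Rightarrow> 'a \<Rightarrow> 'a" where
  "gradient_ext U f x = Lim (at x within U) (gradient f)"


section \<open>Waves on deep water\<close>

text \<open>
  Space is \<open>'a \<times> real\<close> with \<open>'a\<close> the horizontal factor, so the space dimension
  \<open>n\<close> is \<open>DIM('a \<times> real)\<close>; the product norm is the Euclidean one.
\<close>

definition fluid_domain :: "('a::euclidean_space \<Rightarrow> real) \<Rightarrow> ('a \<times> real) set" where
  "fluid_domain \<eta> = {x. snd x < \<eta> (fst x)}"

definition free_surface :: "('a::euclidean_space \<Rightarrow> real) \<Rightarrow> ('a \<times> real) set" where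
  "free_surface \<eta> = {x. snd x = \<eta> (fst x)}"

text \<open>
  The normal is a function on all of space that is constant in the vertical variable; this
  is the extension for which its divergence is taken.
\<close>

definition unit_normal :: "('a::euclidean_space \<Rightarrow> real) \<Rightarrow> 'a \<times> real \<Rightarrow> 'a \<times> real" where
  "unit_normal \<eta> x =
     (1 / sqrt (1 + (norm (gradient \<eta> (fst x)))\<^sup>2)) *\<^sub>R (- gradient \<eta> (fst x), 1)"

definition at_infinity_in :: "'a::real_normed_vector set \<Rightarrow> 'a filter" where
  "at_infinity_in A = inf at_infinity (principal A)"

definition solitary_wave ::
  "real \<Rightarrow> real \<Rightarrow> 'a::euclidean_space \<times> real \<Rightarrow> ('a \<Rightarrow> real) \<Rightarrow> ('a \<times> real \<Rightarrow> real) \<Rightarrow> bool"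
  where
  "solitary_wave g \<sigma> c \<eta> \<phi> \<longleftrightarrow>
     (let \<Omega> = fluid_domain \<eta>; S = free_surface \<eta>; N = unit_normal \<eta>; D\<phi> = gradient_ext \<Omega> \<phi> in
       C2_on UNIV \<eta> \<and> C2_closure \<Omega> \<phi> \<and>
       (\<forall>x\<in>\<Omega>. laplacian \<phi> x = 0) \<and>
       (\<forall>x\<in>S. D\<phi> x \<bullet> N x = c \<bullet> N x) \<and>
       (\<forall>x\<in>S. 1/2 * (norm (D\<phi> x))\<^sup>2 - c \<bullet> D\<phi> x + g * \<eta> (fst x) = - \<sigma> * divergence N x) \<and>
       (\<eta> \<longlongrightarrow> 0) at_infinity \<and>
       (\<phi> \<longlongrightarrow> 0) (at_infinity_in (closure \<Omega>)) \<and>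
       (D\<phi> \<longlongrightarrow> 0) (at_infinity_in (closure \<Omega>)))"

definition decay_conditions ::
  "real \<Rightarrow> ('a::euclidean_space \<Rightarrow> real) \<Rightarrow> ('a \<times> real \<Rightarrow> real) \<Rightarrow> bool"
  where
  "decay_conditions \<epsilon> \<eta> \<phi> \<longleftrightarrow>
     (let n = DIM('a \<times> real) in
       \<phi> \<in> o[at_infinity_in (closure (fluid_domain \<eta>))](\<lambda>x. 1 / norm x ^ (n - 2)) \<and>
       \<eta> \<in> O[at_infinity](\<lambda>x. 1 / norm x powr (real n - 1 + \<epsilon>)) \<and>
       (\<forall>i\<in>Basis. partial_deriv i \<eta> \<in> O[at_infinity](\<lambda>x. 1 / norm x powr (real n + \<epsilon>))) \<and>
       (\<forall>i\<in>Basis. \<forall>j\<in>Basis. partial_deriv i (partial_deriv j \<eta>)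
          \<in> O[at_infinity](\<lambda>x. 1 / norm x powr (real n + 1 + \<epsilon>))))"

definition cross_planar :: "real \<times> real \<Rightarrow> real \<times> real \<Rightarrow> real" where
  "cross_planar a b = fst a * snd b - snd a * fst b"

definition to_vec3 :: "(real^2) \<times> real \<Rightarrow> real^3" where
  "to_vec3 x = vector [fst x $ 1, fst x $ 2, snd x]"

definition cross_spatial :: "(real^2) \<times> real \<Rightarrow> (real^2) \<times> real \<Rightarrow> real^3" where
  "cross_spatial a b = cross3 (to_vec3 a) (to_vec3 b)"

text \<open>
  The first argument is the cross product, whose values are scalars for \<open>n = 2\<close> and
  vectors for \<open>n = 3\<close>.
\<close>

definition infinite_angular_momentum ::
  "('a::euclidean_space \<times> real \<Rightarrow> 'a \<times> real \<Rightarrow> 'b::euclidean_space) \<Rightarrow>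
    ('a \<Rightarrow> real) \<Rightarrow> ('a \<times> real \<Rightarrow> real) \<Rightarrow> bool"
  where
  "infinite_angular_momentum cross \<eta> \<phi> \<longleftrightarrow>
     filterlim
       (\<lambda>r. norm (LINT x:fluid_domain \<eta> \<inter> ball 0 r|lborel. cross x (gradient \<phi> x)))
       at_top at_top"

definition trivial_wave ::
  "('a::euclidean_space \<Rightarrow> real) \<Rightarrow> ('a \<times> real \<Rightarrow> real) \<Rightarrow> bool"
  where
  "trivial_wave \<eta> \<phi> \<longleftrightarrow> (\<forall>x\<in>closure (fluid_domain \<eta>). \<phi> x = 0) \<and> (\<forall>x. \<eta> x = 0)"

end

theory Submission
  imports Defs
begin

text \<open>
  Write \<open>d\<close> for the dimension of the horizontal space, so \<open>n = d + 1\<close>, and \<open>\<psi> x = \<phi> (x, \<eta> x)\<close>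
  for the potential on the free surface. Everything turns on one vector, the dipole moment
  \<open>p = \<integral> \<psi> \<nabla>\<eta>\<close>. If \<open>p = 0\<close> the wave is trivial, and if \<open>p \<noteq> 0\<close> the angular momentum is infinite.

  The first half is an energy argument. By the kinematic condition the flux of \<open>\<phi> \<nabla>\<phi>\<close> through
  the surface is \<open>- \<integral> \<psi> (c \<bullet> \<nabla>\<eta>) = - p \<bullet> c\<close>, and because \<open>\<phi>\<close> is small compared with
  \<open>|x|\<^sup>2\<^sup>-\<^sup>n\<close> nothing enters from infinity: the cutoff argument of Caccioppoli
  (\<open>energy_bound\<close>) bounds the kinetic energy by a multiple of this flux. So \<open>p = 0\<close> forces
  \<open>\<nabla>\<phi> = 0\<close>, hence \<open>\<phi> = 0\<close>; the kinematic condition then reads \<open>c \<bullet> \<nabla>\<eta> = 0\<close>, so \<open>\<eta>\<close> is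
  constant on lines parallel to \<open>c\<close> and decays along them, which makes it zero
  (\<open>no_dipole_trivial\<close>).

  The second half determines how \<open>\<psi>\<close> decays (\<open>surface_asymptotics\<close>):
  \<open>\<kappa> \<psi> x = p \<bullet> x / |x|\<^sup>n + o(|x|\<^sup>1\<^sup>-\<^sup>n)\<close> for a positive constant \<open>\<kappa>\<close>. To see this, represent
  \<open>\<psi> x\<^sub>0\<close> by Green's identity with the fundamental solution centred at the surface point above
  \<open>x\<^sub>0\<close> (\<open>green_limit\<close>). The identity has two surface terms. The double layer, whose density is
  \<open>\<psi>\<close>, contributes \<open>p \<bullet> x\<^sub>0 / |x\<^sub>0|\<^sup>n\<close> (\<open>double_layer_limit\<close>). The single layer, whose density is
  \<open>c \<bullet> \<nabla>\<eta>\<close>, has total charge zero, and an integration by parts shows that its own dipole moment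
  is a multiple of \<open>\<integral> \<eta>\<close>. That integral vanishes (\<open>total_mass_zero\<close>): integrate the Bernoulli
  condition over the surface; the surface tension term is a divergence, and the velocity terms
  cancel by combining Pohozaev's identity for vertical translations with the symmetry of second
  derivatives. Hence the single layer is negligible (\<open>single_layer_limit\<close>).

  Finally the component of the angular momentum in the plane of \<open>p\<close> and the vertical is the integral of
  a rotational derivative of \<open>\<phi>\<close>. Over \<open>\<Omega> \<inter> ball 0 r\<close> it equals a surface integral, because
  rotations are tangent to the sphere, and its main term is the
  integral of \<open>\<psi> x (p \<bullet> x)\<close> over \<open>|x| < r\<close>. By the asymptotics this grows like a constant times
  the integral of \<open>(p \<bullet> x)\<^sup>2 / |x|\<^sup>n\<close>, that is linearly in \<open>r\<close> (\<open>angular_momentum_grows\<close>).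

  The argument is carried out in every horizontal dimension. The locale \<open>water_wave\<close> fixes the data
  in the form used by the analysis, and \<open>solitary_wave_is_water_wave\<close> extracts them from the
  wave equations.
\<close>

section \<open>Integration of radial powers\<close>

lemma sets_ball_zero[measurable]: "ball (0::'a::euclidean_space) R \<in> sets borel"
  by simp

lemma lborel_integral_affine:
  fixes f :: "'a::euclidean_space \<Rightarrow> real"
  assumes "c \<noteq> 0" "f \<in> borel_measurable borel"
  shows "(\<integral>x. f x \<partial>lborel) = \<bar>c\<bar> ^ DIM('a) * (\<integral>x. f (t + c *\<^sub>R x) \<partial>lborel)"
proof -
  have "(\<integral>x. f x \<partial>lborel)
      = (\<integral>x. f x \<partial>density (distr lborel borel (\<lambda>x. t + c *\<^sub>R x)) (\<lambda>_. ennreal (\<bar>c\<bar>^DIM('a))))"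
    using lborel_affine[OF assms(1), of t] by simp
  also have "\<dots> = (\<integral>x. \<bar>c\<bar>^DIM('a) * f x \<partial>distr lborel borel (\<lambda>x. t + c *\<^sub>R x))"
    using assms(2) by (subst integral_density) (auto simp: measurable_distr_eq1)
  also have "\<dots> = (\<integral>x. \<bar>c\<bar>^DIM('a) * f (t + c *\<^sub>R x) \<partial>lborel)"
    using assms(2) by (subst integral_distr) auto
  finally show ?thesis by simp
qed

lemma lborel_integrable_affine:
  fixes f :: "'a::euclidean_space \<Rightarrow> real"
  assumes "c \<noteq> 0" "integrable lborel f"
  shows "integrable lborel (\<lambda>x. f (t + c *\<^sub>R x))"
proof -
  have f[measurable]: "f \<in> borel_measurable borel" using assms(2) by auto
  have "integrable (density (distr lborel borel (\<lambda>x. t + c *\<^sub>R x)) (\<lambda>_. ennreal (\<bar>c\<bar>^DIM('a)))) f"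
    using assms(2) lborel_affine[OF assms(1), of t] by simp
  then have "integrable (distr lborel borel (\<lambda>x. t + c *\<^sub>R x)) (\<lambda>x. \<bar>c\<bar>^DIM('a) * f x)"
    by (subst (asm) integrable_density) (auto simp: measurable_distr_eq1)
  then have "integrable lborel (\<lambda>x. \<bar>c\<bar>^DIM('a) * f (t + c *\<^sub>R x))"
    by (subst (asm) integrable_distr_eq) auto
  then show ?thesis using assms(1) by simp
qed

lemma lborel_integral_translate:
  fixes f :: "'a::euclidean_space \<Rightarrow> real"
  assumes "f \<in> borel_measurable borel"
  shows "(\<integral>x. f (t + x) \<partial>lborel) = (\<integral>x. f x \<partial>lborel)"
  using lborel_integral_affine[of 1 f t] assms by simp

text \<open>
  A dyadic criterion: the balls may overlap, since a pointwise bound by one member of the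
  family is a bound by the sum. It turns the integrability of powers of the norm, at infinity
  and at the origin, into the convergence of a geometric series, and so avoids polar
  coordinates.
\<close>

lemma integrable_of_shells:
  fixes f :: "'a::euclidean_space \<Rightarrow> real"
  assumes f[measurable]: "f \<in> borel_measurable borel" and "\<And>x. 0 \<le> f x"
    and a: "\<And>k. 0 \<le> a k" and r: "\<And>k. 0 \<le> r k"
    and sm: "summable (\<lambda>k. a k * r k ^ DIM('a))"
    and le: "\<And>x. x \<noteq> 0 \<Longrightarrow> \<exists>k. f x \<le> a k * indicator (ball 0 (r k)) x"
  shows "integrable lborel f"
proof -
  let ?V = "unit_ball_vol (real DIM('a))"
  have V: "0 \<le> ?V" by simp
  have term_le: "F k \<le> suminf F" for F :: "nat \<Rightarrow> ennreal" and k
    using sum_le_suminf[of F "{k}"] by simp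
  have "(\<integral>\<^sup>+(x::'a). ennreal (f x) \<partial>lborel)
      \<le> (\<integral>\<^sup>+(x::'a). (\<Sum>k. ennreal (a k) * indicator (ball 0 (r k)) x) \<partial>lborel)"
  proof (rule nn_integral_mono_AE)
    have "AE x in lborel. x \<noteq> (0::'a)"
      using AE_lborel_singleton[of "0::'a"] by simp
    then show "AE x in lborel. ennreal (f x) \<le> (\<Sum>k. ennreal (a k) * indicator (ball 0 (r k)) x)"
    proof (rule AE_mp, intro AE_I2 impI)
      fix x :: 'a assume "x \<noteq> 0"
      with le obtain k where k: "f x \<le> a k * indicator (ball 0 (r k)) x" by blast
      have "ennreal (f x) \<le> ennreal (a k) * indicator (ball 0 (r k)) x"
        using ennreal_leI[OF k] a[of k] by (auto simp: indicator_def ennreal_neg split: if_splits)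
      also have "\<dots> \<le> (\<Sum>k. ennreal (a k) * indicator (ball 0 (r k)) x)"
        by (rule term_le)
      finally show "ennreal (f x) \<le> (\<Sum>k. ennreal (a k) * indicator (ball 0 (r k)) x)" .
    qed
  qed
  also have "\<dots> = (\<Sum>k. ennreal (a k) * emeasure lborel (ball (0::'a) (r k)))"
    by (subst nn_integral_suminf) (auto simp: nn_integral_cmult_indicator)
  also have "\<dots> = (\<Sum>k. ennreal (?V * (a k * r k ^ DIM('a))))"
    using a r V by (intro suminf_cong) (auto simp: emeasure_ball ennreal_mult[symmetric] mult_ac)
  also have "\<dots> < \<infinity>"
    using summable_mult[OF sm, of ?V] a r V
    by (subst suminf_ennreal2) auto
  finally show ?thesis
    using assms(2) by (intro integrableI_bounded) auto
qed

lemma dyadic_bracket: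
  fixes y :: real
  assumes "1 \<le> y"
  shows "\<exists>k::nat. 2 ^ k \<le> y \<and> y < 2 ^ (Suc k)"
proof -
  define k where "k = nat \<lfloor>log 2 y\<rfloor>"
  have l: "0 \<le> log 2 y" using assms by simp
  have "real k \<le> log 2 y" "log 2 y < real k + 1"
    using l unfolding k_def by linarith+
  then have "2 powr real k \<le> y" "y < 2 powr (real (Suc k))"
    using assms by (auto simp: le_log_iff log_less_iff add.commute)
  then show ?thesis by (auto simp: powr_realpow simp del: power_Suc of_nat_Suc)
qed

lemma integrable_decay:
  assumes "real DIM('a) < \<beta>"
  shows "integrable lborel (\<lambda>x::'a::euclidean_space. (1 + norm x) powr (-\<beta>))"
proof (rule integrable_of_shells[where a="\<lambda>k. (2^k) powr (-\<beta>)" and r="\<lambda>k. 2 * 2^k"])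
  have eq: "(2^k) powr (-\<beta>) * (2 * 2^k) ^ DIM('a) = 2 ^ DIM('a) * (2 powr (real DIM('a) - \<beta>)) ^ k" for k :: nat
  proof -
    have "((2::real)^k) powr (-\<beta>) = 2 powr (- \<beta> * real k)"
      by (simp add: powr_powr powr_realpow[symmetric] mult.commute)
    moreover have "((2::real)^k) ^ DIM('a) = 2 powr (real DIM('a) * real k)"
      by (simp add: powr_realpow[symmetric] powr_powr power_mult[symmetric] mult.commute)
    moreover have "(2 powr (real DIM('a) - \<beta>)) ^ k = 2 powr ((real DIM('a) - \<beta>) * real k)"
      by (simp add: powr_powr powr_realpow[symmetric])
    ultimately show ?thesis
      by (simp add: power_mult_distrib powr_add[symmetric] algebra_simps)
  qed
  have "2 powr (real DIM('a) - \<beta>) < 2 powr 0" using assms by (intro powr_less_mono) auto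
  then show "summable (\<lambda>k. (2^k) powr (-\<beta>) * (2 * 2^k) ^ DIM('a))"
    unfolding eq by (intro summable_mult summable_geometric) auto
next
  fix x :: 'a
  obtain k :: nat where k: "2 ^ k \<le> 1 + norm x" "1 + norm x < 2 ^ Suc k"
    using dyadic_bracket[of "1 + norm x"] by auto
  have "(1 + norm x) powr (-\<beta>) \<le> (2^k) powr (-\<beta>)"
    using k(1) assms by (intro powr_mono2') auto
  then show "\<exists>k::nat. (1 + norm x) powr (-\<beta>) \<le> (2^k) powr (-\<beta>) * indicator (ball 0 (2 * 2^k)) x"
    using k(2) by (intro exI[of _ k]) (auto simp: indicator_def)
qed auto

lemma integrable_singularity:
  assumes "\<beta> < real DIM('a)"
  shows "integrable lborel (\<lambda>x::'a::euclidean_space. indicator (ball 0 1) x * norm x powr (-\<beta>))"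
proof -
  define \<gamma> where "\<gamma> = max \<beta> 0"
  have \<gamma>: "0 \<le> \<gamma>" "\<beta> \<le> \<gamma>" "\<gamma> < real DIM('a)" using assms unfolding \<gamma>_def by auto
  show ?thesis
  proof (rule integrable_of_shells[where a="\<lambda>k. (2 * 2^k) powr \<gamma>" and r="\<lambda>k. 2 * (1/2)^k"])
    have eq: "(2 * 2^k) powr \<gamma> * (2 * (1/2)^k) ^ DIM('a)
        = 2 powr \<gamma> * 2 ^ DIM('a) * (2 powr (\<gamma> - real DIM('a))) ^ k" for k :: nat
    proof -
      have 1: "((2::real)^k) powr \<gamma> = 2 powr (\<gamma> * real k)"
        by (simp add: powr_powr powr_realpow[symmetric] mult.commute)
      have 2: "((1/2::real)^k) ^ DIM('a) = 2 powr (- real DIM('a) * real k)"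
        by (simp add: powr_minus powr_realpow[symmetric] powr_powr power_mult[symmetric] mult.commute
            power_one_over inverse_eq_divide)
      have 3: "(2 powr (\<gamma> - real DIM('a))) ^ k = 2 powr ((\<gamma> - real DIM('a)) * real k)"
        by (simp add: powr_powr powr_realpow[symmetric])
      show ?thesis
        by (simp only: power_mult_distrib powr_mult 1 2 3) (simp add: powr_add[symmetric] algebra_simps)
    qed
    have "2 powr (\<gamma> - real DIM('a)) < 2 powr 0" using \<gamma> by (intro powr_less_mono) auto
    then show "summable (\<lambda>k. (2 * 2^k) powr \<gamma> * (2 * (1/2)^k) ^ DIM('a))"
      unfolding eq by (intro summable_mult summable_geometric) auto
  next
    fix x :: 'a assume x: "x \<noteq> 0"
    show "\<exists>k::nat. indicator (ball 0 1) x * norm x powr (-\<beta>)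
        \<le> (2 * 2^k) powr \<gamma> * indicator (ball 0 (2 * (1/2)^k)) x"
    proof (cases "norm x < 1")
      case True
      obtain k :: nat where k: "2 ^ k \<le> 1 / norm x" "1 / norm x < 2 ^ Suc k"
        using dyadic_bracket[of "1 / norm x"] x True by auto
      have *: "norm x \<le> (1/2)^k" 
        using k(1) x by (simp add: field_simps power_one_over)
      have "norm x powr (-\<beta>) \<le> norm x powr (-\<gamma>)"
        using True x \<gamma> by (intro powr_mono') auto
      also have "\<dots> = (1 / norm x) powr \<gamma>"
        using x by (simp add: powr_minus powr_divide inverse_eq_divide)
      also have "\<dots> \<le> (2 * 2^k) powr \<gamma>"
        using k(2) \<gamma> x by (intro powr_mono2) auto
      finally have "norm x powr (-\<beta>) \<le> (2 * 2^k) powr \<gamma>" .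
      moreover have "norm x < 2 * (1/2)^k"
      proof -
        have "(0::real) < (1/2)^k" by simp
        with * show ?thesis by linarith
      qed
      ultimately show ?thesis
        using True by (intro exI[of _ k]) auto
    qed (auto simp: indicator_def)
  qed auto
qed

text \<open>
  Scaling reduces every radius to the unit ball, so all estimates below are uniform in the
  radius up to an explicit power.
\<close>

lemma integral_ball_powr:
  assumes "\<beta> < real DIM('a)" "0 < R"
  shows "integrable lborel (\<lambda>x::'a::euclidean_space. indicator (ball 0 R) x * norm x powr (-\<beta>))"
    and "(\<integral>(x::'a). indicator (ball 0 R) x * norm x powr (-\<beta>) \<partial>lborel)
       = R powr (real DIM('a) - \<beta>) * (\<integral>(x::'a). indicator (ball 0 1) x * norm x powr (-\<beta>) \<partial>lborel)"
proof -
  have eq: "indicator (ball 0 R) (0 + R *\<^sub>R x) * norm (0 + R *\<^sub>R x) powr (-\<beta>)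
     = R powr (-\<beta>) * (indicator (ball 0 1) x * norm x powr (-\<beta>))" for x :: 'a
    using assms(2) by (auto simp: indicator_def powr_mult)
  have eq2: "indicator (ball 0 1) (0 + (1/R) *\<^sub>R x) * norm (0 + (1/R) *\<^sub>R x) powr (-\<beta>)
     = R powr \<beta> * (indicator (ball 0 R) x * norm x powr (-\<beta>))" for x :: 'a
    using assms(2) by (auto simp: indicator_def powr_mult powr_divide powr_minus field_simps)
  show "integrable lborel (\<lambda>x::'a. indicator (ball 0 R) x * norm x powr (-\<beta>))"
    using lborel_integrable_affine[OF _ integrable_singularity[OF assms(1)], of "1/R" 0] assms(2)
    unfolding eq2 by simp
  show "(\<integral>(x::'a). indicator (ball 0 R) x * norm x powr (-\<beta>) \<partial>lborel)
       = R powr (real DIM('a) - \<beta>) * (\<integral>(x::'a). indicator (ball 0 1) x * norm x powr (-\<beta>) \<partial>lborel)"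
    using assms(2)
    by (subst lborel_integral_affine[of R _ 0], simp, simp)
       (simp only: eq integral_mult_right_zero, simp add: powr_diff powr_minus powr_realpow divide_inverse)
qed

lemma integral_tail_powr:
  assumes "real DIM('a) < \<beta>" "0 < R"
  shows "integrable lborel (\<lambda>x::'a::euclidean_space. indicator (- ball 0 R) x * norm x powr (-\<beta>))"
    and "(\<integral>(x::'a). indicator (- ball 0 R) x * norm x powr (-\<beta>) \<partial>lborel)
       = R powr (real DIM('a) - \<beta>) * (\<integral>(x::'a). indicator (- ball 0 1) x * norm x powr (-\<beta>) \<partial>lborel)"
proof -
  have eq: "indicator (- ball 0 R) (0 + R *\<^sub>R x) * norm (0 + R *\<^sub>R x) powr (-\<beta>)
     = R powr (-\<beta>) * (indicator (- ball 0 1) x * norm x powr (-\<beta>))" for x :: 'a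
    using assms(2) by (auto simp: indicator_def powr_mult)
  have eq2: "indicator (- ball 0 1) (0 + (1/R) *\<^sub>R x) * norm (0 + (1/R) *\<^sub>R x) powr (-\<beta>)
     = R powr \<beta> * (indicator (- ball 0 R) x * norm x powr (-\<beta>))" for x :: 'a
    using assms(2) by (auto simp: indicator_def powr_mult powr_divide powr_minus field_simps)
  have 1: "integrable lborel (\<lambda>x::'a. indicator (- ball 0 1) x * norm x powr (-\<beta>))"
  proof (rule Bochner_Integration.integrable_bound)
    show "integrable lborel (\<lambda>x::'a. 2 powr \<beta> * (1 + norm x) powr (-\<beta>))"
      using integrable_decay[OF assms(1)] by simp
    show "AE x in lborel. norm (indicator (- ball 0 1) x * norm x powr (-\<beta>))
        \<le> norm (2 powr \<beta> * (1 + norm (x::'a)) powr (-\<beta>))"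
    proof (intro AE_I2)
      fix x :: 'a
      have "norm x powr (-\<beta>) \<le> 2 powr \<beta> * (1 + norm x) powr (-\<beta>)" if "1 \<le> norm x"
      proof -
        have b: "0 \<le> \<beta>" using assms(1) by (smt (verit) of_nat_0_le_iff)
        have "norm x powr (-\<beta>) \<le> ((1 + norm x)/2) powr (-\<beta>)"
          using that b by (intro powr_mono2') auto
        also have "\<dots> = 2 powr \<beta> * (1 + norm x) powr (-\<beta>)"
          by (simp add: powr_divide powr_minus field_simps)
        finally show ?thesis .
      qed
      then show "norm (indicator (- ball 0 1) x * norm x powr (-\<beta>)) \<le> norm (2 powr \<beta> * (1 + norm x) powr (-\<beta>))"
        by (auto simp: indicator_def)
    qed
  qed auto
  show "integrable lborel (\<lambda>x::'a. indicator (- ball 0 R) x * norm x powr (-\<beta>))"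
    using lborel_integrable_affine[OF _ 1, of "1/R" 0] assms(2)
    unfolding eq2 by simp
  show "(\<integral>(x::'a). indicator (- ball 0 R) x * norm x powr (-\<beta>) \<partial>lborel)
       = R powr (real DIM('a) - \<beta>) * (\<integral>(x::'a). indicator (- ball 0 1) x * norm x powr (-\<beta>) \<partial>lborel)"
    using assms(2)
    by (subst lborel_integral_affine[of R _ 0], simp, simp)
       (simp only: eq integral_mult_right_zero, simp add: powr_diff powr_minus powr_realpow divide_inverse)
qed

text \<open>
  A function that tends to zero has mean zero in the limit, also for weighted means: after
  rescaling to the unit ball the averages converge by dominated convergence. This is how the
  little-o decay of the potential enters the estimates.
\<close>

lemma cesaro_ball:
  fixes e :: "'a::euclidean_space \<Rightarrow> real"
  assumes e[measurable]: "e \<in> borel_measurable borel" and M: "\<And>x. \<bar>e x\<bar> \<le> M"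
    and lim: "(e \<longlongrightarrow> 0) at_infinity" and \<beta>: "\<beta> < real DIM('a)"
  shows "((\<lambda>\<rho>. \<rho> powr (\<beta> - real DIM('a))
      * (\<integral>x. indicator (ball 0 \<rho>) x * (\<bar>e x\<bar> * norm x powr (-\<beta>)) \<partial>lborel)) \<longlongrightarrow> 0) at_top"
proof -
  have ev: "\<forall>\<^sub>F \<rho> in at_top. (\<integral>x. indicator (ball 0 1) x * (\<bar>e (\<rho> *\<^sub>R x)\<bar> * norm x powr (-\<beta>)) \<partial>lborel)
     = \<rho> powr (\<beta> - real DIM('a)) * (\<integral>x. indicator (ball 0 \<rho>) x * (\<bar>e x\<bar> * norm x powr (-\<beta>)) \<partial>lborel)"
    using eventually_gt_at_top[of 0]
  proof eventually_elim
    case (elim \<rho>)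
    \<comment> \<open>substitute \<open>\<rho> x\<close> for \<open>x\<close>\<close>
    have eq: "indicator (ball 0 \<rho>) (0 + \<rho> *\<^sub>R x) * (\<bar>e (0 + \<rho> *\<^sub>R x)\<bar> * norm (0 + \<rho> *\<^sub>R x) powr (-\<beta>))
      = \<rho> powr (-\<beta>) * (indicator (ball 0 1) x * (\<bar>e (\<rho> *\<^sub>R x)\<bar> * norm x powr (-\<beta>)))" for x :: 'a
      using elim by (auto simp: indicator_def powr_mult)
    have "(\<integral>x. indicator (ball 0 \<rho>) x * (\<bar>e x\<bar> * norm x powr (-\<beta>)) \<partial>lborel)
      = \<bar>\<rho>\<bar> ^ DIM('a) * (\<rho> powr (-\<beta>) * (\<integral>x. indicator (ball 0 1) x * (\<bar>e (\<rho> *\<^sub>R x)\<bar> * norm x powr (-\<beta>)) \<partial>lborel))"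
      using elim by (subst lborel_integral_affine[of \<rho> _ 0], simp, simp) (simp only: eq, simp)
    then show ?case
      using elim by (simp add: powr_diff powr_minus powr_realpow field_simps)
  qed
  have "((\<lambda>\<rho>. \<integral>x. indicator (ball 0 1) x * (\<bar>e (\<rho> *\<^sub>R x)\<bar> * norm x powr (-\<beta>)) \<partial>lborel)
      \<longlongrightarrow> (\<integral>(x::'a). 0 \<partial>lborel)) at_top"
  proof (rule integral_dominated_convergence_at_top)
    show "integrable lborel (\<lambda>x::'a. M * (indicator (ball 0 1) x * norm x powr (-\<beta>)))"
      using integrable_singularity[OF \<beta>] by simp
    show "\<forall>\<^sub>F \<rho> in at_top. AE x in lborel. norm (indicator (ball 0 1) x * (\<bar>e (\<rho> *\<^sub>R x)\<bar> * norm x powr (-\<beta>)))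
        \<le> M * (indicator (ball 0 1) x * norm x powr (-\<beta>))"
      by (intro always_eventually allI AE_I2) (auto simp: indicator_def intro!: mult_right_mono M)
    have "AE x in lborel. x \<noteq> (0::'a)"
      using AE_lborel_singleton[of "0::'a"] by simp
    then show "AE x in lborel. ((\<lambda>\<rho>. indicator (ball 0 1) x * (\<bar>e (\<rho> *\<^sub>R x)\<bar> * norm x powr (-\<beta>))) \<longlongrightarrow> (0::real)) at_top"
    proof (rule AE_mp, intro AE_I2 impI)
      fix x :: 'a assume "x \<noteq> 0"
      have "filterlim (\<lambda>\<rho>. norm (\<rho> *\<^sub>R x)) at_top at_top"
      proof -
        have "filterlim (\<lambda>\<rho>. norm x * \<rho>) at_top at_top"
          using \<open>x \<noteq> 0\<close> by (intro filterlim_tendsto_pos_mult_at_top[OF tendsto_const]) (auto simp: filterlim_ident)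
        then show ?thesis
          by (rule filterlim_at_top_mono) (auto intro!: always_eventually simp: mult.commute mult_right_mono)
      qed
      then have "filterlim (\<lambda>\<rho>. \<rho> *\<^sub>R x) at_infinity at_top"
        by (rule filterlim_norm_at_top_imp_at_infinity)
      from filterlim_compose[OF lim this]
      have "((\<lambda>\<rho>. e (\<rho> *\<^sub>R x)) \<longlongrightarrow> 0) at_top" .
      then have "((\<lambda>\<rho>. \<bar>e (\<rho> *\<^sub>R x)\<bar>) \<longlongrightarrow> 0) at_top" by (simp add: tendsto_rabs_zero)
      then show "((\<lambda>\<rho>. indicator (ball 0 1) x * (\<bar>e (\<rho> *\<^sub>R x)\<bar> * norm x powr (-\<beta>))) \<longlongrightarrow> (0::real)) at_top"
        by (intro tendsto_mult_right_zero tendsto_mult_left_zero)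
    qed
  qed auto
  then have "((\<lambda>\<rho>. \<integral>x. indicator (ball 0 1) x * (\<bar>e (\<rho> *\<^sub>R x)\<bar> * norm x powr (-\<beta>)) \<partial>lborel) \<longlongrightarrow> 0) at_top" by simp
  then show ?thesis by (rule Lim_transform_eventually) (rule ev)
qed

section \<open>The gradient theorem below a graph\<close>

lemma integrable_compact_support:
  fixes f :: "'a::euclidean_space \<Rightarrow> real"
  assumes "continuous_on UNIV f" "\<And>x. r < norm x \<Longrightarrow> f x = 0"
  shows "integrable lborel f"
proof -
  have "integrable lborel (\<lambda>x. indicator (cball 0 r) x *\<^sub>R f x)"
    using assms(1) by (intro borel_integrable_compact) (auto intro: continuous_on_subset)
  also have "(\<lambda>x. indicator (cball 0 r) x *\<^sub>R f x) = f"
    using assms(2) by (auto simp: indicator_def fun_eq_iff not_le)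
  finally show ?thesis .
qed

lemma continuous_bounded_on_compact:
  fixes f :: "'a::metric_space \<Rightarrow> 'b::real_normed_vector"
  assumes "compact S" "continuous_on S f"
  obtains B where "0 \<le> B" "\<And>x. x \<in> S \<Longrightarrow> norm (f x) \<le> B"
proof -
  have "bounded (f ` S)"
    using compact_continuous_image[OF assms(2,1)] by (rule compact_imp_bounded)
  then obtain B where B: "\<And>x. x \<in> S \<Longrightarrow> norm (f x) \<le> B" unfolding bounded_iff by auto
  show ?thesis by (rule that[of "max B 0"]) (auto dest: B)
qed

lemma gderiv_inner: "GDERIV f x :> D \<longleftrightarrow> (f has_derivative inner D) (at x)"
proof -
  have "inner D = (\<lambda>h. h \<bullet> D)" by (simp add: fun_eq_iff inner_commute)
  then show ?thesis by (simp add: gderiv_def)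
qed

lemma GDERIV_line:
  assumes "GDERIV f x :> D"
  shows "((\<lambda>t. f (x + t *\<^sub>R b)) has_real_derivative (D \<bullet> b)) (at 0)"
proof -
  have "((\<lambda>t. f (x + t *\<^sub>R b)) has_derivative (\<lambda>t. D \<bullet> (t *\<^sub>R b))) (at 0)"
    by (rule has_derivative_compose[where f="\<lambda>t. x + t *\<^sub>R b" and g=f])
      (use assms in \<open>auto simp: gderiv_inner intro!: derivative_eq_intros\<close>)
  then show ?thesis
    by (simp add: has_field_derivative_def mult.commute[of _ "D \<bullet> b"] fun_eq_iff)
qed

lemma GDERIV_imp_cont: "(\<And>x. GDERIV f x :> Df x) \<Longrightarrow> continuous_on S f"
  unfolding gderiv_inner by (meson continuous_at_imp_continuous_on has_derivative_continuous)

lemma GDERIV_bound: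
  fixes f :: "'a::euclidean_space \<Rightarrow> real"
  assumes "convex S" "\<And>x. x \<in> S \<Longrightarrow> GDERIV f x :> Df x" "\<And>x. x \<in> S \<Longrightarrow> norm (Df x) \<le> B" "x \<in> S" "y \<in> S"
  shows "\<bar>f x - f y\<bar> \<le> B * norm (x - y)"
proof -
  have "norm (f x - f y) \<le> B * norm (x - y)"
  proof (rule differentiable_bound[OF assms(1) _ _ assms(4,5)])
    show "(f has_derivative inner (Df x)) (at x within S)" if "x \<in> S" for x
      using assms(2)[OF that] unfolding gderiv_inner by (rule has_derivative_at_withinI)
    show "onorm (inner (Df x)) \<le> B" if "x \<in> S" for x
    proof (rule onorm_le)
      fix h
      have "norm (Df x \<bullet> h) \<le> norm (Df x) * norm h" by (simp add: Cauchy_Schwarz_ineq2)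
      also have "\<dots> \<le> B * norm h" using assms(3)[OF that] by (simp add: mult_right_mono)
      finally show "norm (Df x \<bullet> h) \<le> B * norm h" .
    qed
  qed
  then show ?thesis by simp
qed

text \<open>
  The integral of a difference quotient vanishes by translation invariance; the bound on the
  gradient over a large ball permits passing to the limit.
\<close>

lemma integral_gradient_compact_support:
  fixes f :: "'a::euclidean_space \<Rightarrow> real"
  assumes D: "\<And>x. GDERIV f x :> Df x" and c: "continuous_on UNIV Df"
    and supp: "\<And>x. r \<le> norm x \<Longrightarrow> f x = 0"
  shows "(\<integral>x. Df x \<bullet> b \<partial>lborel) = 0"
proof -
  define \<rho> where "\<rho> = \<bar>r\<bar> + 2 * norm b + 1"
  have contf: "continuous_on UNIV f" by (rule GDERIV_imp_cont[OF D])
  then have [measurable]: "f \<in> borel_measurable borel" by (rule borel_measurable_continuous_onI)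
  have fint: "integrable lborel f" using supp by (intro integrable_compact_support[OF contf, of r]) auto
  obtain B where B0: "0 \<le> B" and B: "\<And>x. x \<in> cball 0 \<rho> \<Longrightarrow> norm (Df x) \<le> B"
    using continuous_bounded_on_compact[OF compact_cball continuous_on_subset[OF c]] by blast
  define t where "t k = inverse (real (Suc k))" for k
  have t: "0 < t k" "t k \<le> 1" for k unfolding t_def by (auto simp: field_simps)
  define q where "q k x = (f (x + t k *\<^sub>R b) - f x) / t k" for k x
  have zero: "(\<integral>x. q k x \<partial>lborel) = 0" for k
  proof -
    have "integrable lborel (\<lambda>x. f (x + t k *\<^sub>R b))"
      using lborel_integrable_affine[OF _ fint, of 1 "t k *\<^sub>R b"] by (simp add: add.commute)
    moreover have "(\<integral>x. f (x + t k *\<^sub>R b) \<partial>lborel) = (\<integral>x. f x \<partial>lborel)"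
      using lborel_integral_translate[of f "t k *\<^sub>R b"] by (simp add: add.commute)
    ultimately show ?thesis using fint unfolding q_def by simp
  qed
  have "(\<lambda>k. \<integral>x. q k x \<partial>lborel) \<longlonglongrightarrow> (\<integral>x. Df x \<bullet> b \<partial>lborel)"
  proof (rule integral_dominated_convergence)
    show "(\<lambda>x. Df x \<bullet> b) \<in> borel_measurable lborel"
      using c by (auto intro!: borel_measurable_continuous_onI continuous_intros)
    show "q k \<in> borel_measurable lborel" for k unfolding q_def by measurable
    show "integrable lborel (\<lambda>x::'a. indicator (ball 0 \<rho>) x * (B * norm b))"
      by (auto intro!: integrable_real_indicator emeasure_bounded_finite)
    show "AE x in lborel. (\<lambda>k. q k x) \<longlonglongrightarrow> Df x \<bullet> b"
    proof (rule AE_I2)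
      fix x
      have "((\<lambda>h. (f (x + h *\<^sub>R b) - f x) / h) \<longlongrightarrow> Df x \<bullet> b) (at 0)"
        using GDERIV_line[OF D, of x b] by (simp add: has_field_derivative_iff)
      moreover have "filterlim t (at 0) sequentially"
        using t(1) LIMSEQ_inverse_real_of_nat unfolding t_def
        by (auto simp: filterlim_at)
      ultimately show "(\<lambda>k. q k x) \<longlonglongrightarrow> Df x \<bullet> b"
        unfolding q_def by (rule filterlim_compose)
    qed
    show "AE x in lborel. norm (q k x) \<le> indicator (ball 0 \<rho>) x * (B * norm b)" for k
    proof (rule AE_I2)
      fix x
      have tb: "norm (t k *\<^sub>R b) \<le> norm b" using t[of k] mult_right_mono[of "t k" 1 "norm b"] by simp
      show "norm (q k x) \<le> indicator (ball 0 \<rho>) x * (B * norm b)"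
      proof (cases "norm x < \<bar>r\<bar> + norm b + 1")
        case True
        have "\<bar>f (x + t k *\<^sub>R b) - f x\<bar> \<le> B * norm ((x + t k *\<^sub>R b) - x)"
        proof (rule GDERIV_bound[of "cball 0 \<rho>"])
          show "x + t k *\<^sub>R b \<in> cball 0 \<rho>"
            using True tb norm_triangle_ineq[of x "t k *\<^sub>R b"] unfolding \<rho>_def by simp
          show "x \<in> cball 0 \<rho>" using True unfolding \<rho>_def by simp (smt (verit) norm_ge_zero)
        qed (use B D in auto)
        also have "\<dots> = t k * (B * norm b)" using t[of k] by simp
        finally have "\<bar>q k x\<bar> \<le> B * norm b"
          using t[of k] unfolding q_def by (simp add: divide_le_eq mult.commute)
        then show ?thesis using True unfolding \<rho>_def by (simp add: indicator_def) (smt (verit) norm_ge_zero)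
      next
        case False
        have "norm x \<le> norm (x + t k *\<^sub>R b) + norm (t k *\<^sub>R b)"
          by (metis add_diff_cancel norm_triangle_ineq4)
        with False tb have "\<bar>r\<bar> \<le> norm (x + t k *\<^sub>R b)" "\<bar>r\<bar> \<le> norm x" by (smt (verit) norm_ge_zero)+
        then have "q k x = 0" unfolding q_def using supp by auto
        then show ?thesis using B0 by simp
      qed
    qed
  qed
  then show ?thesis by (simp add: zero LIMSEQ_const_iff)
qed

text \<open>
  Differentiability up to the boundary in the weak form that suits a closed fluid domain: the
  gradient is a continuous function on the closure, but it is a derivative only inside.
\<close>

definition C1_upto :: "'a::euclidean_space set \<Rightarrow> ('a \<Rightarrow> real) \<Rightarrow> ('a \<Rightarrow> 'a) \<Rightarrow> bool" where
  "C1_upto U f Df \<longleftrightarrow>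
     continuous_on (closure U) f \<and> continuous_on (closure U) Df \<and> (\<forall>x\<in>U. GDERIV f x :> Df x)"

lemma C1_uptoI:
  assumes "\<And>x. GDERIV f x :> Df x" "continuous_on UNIV Df"
  shows "C1_upto U f Df"
  using assms GDERIV_imp_cont[of f Df] unfolding C1_upto_def by (auto intro: continuous_on_subset)

lemma C1_upto_add: "C1_upto U f Df \<Longrightarrow> C1_upto U g Dg \<Longrightarrow> C1_upto U (\<lambda>x. f x + g x) (\<lambda>x. Df x + Dg x)"
  unfolding C1_upto_def by (auto intro!: continuous_intros GDERIV_add)

lemma C1_upto_mult: "C1_upto U f Df \<Longrightarrow> C1_upto U g Dg \<Longrightarrow>
  C1_upto U (\<lambda>x. f x * g x) (\<lambda>x. f x *\<^sub>R Dg x + g x *\<^sub>R Df x)"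
  unfolding C1_upto_def by (auto intro!: continuous_intros GDERIV_mult)

lemma C1_upto_const: "C1_upto U (\<lambda>x. c) (\<lambda>x. 0)"
  unfolding C1_upto_def by (auto intro!: continuous_intros GDERIV_const)

lemma C1_upto_inner: "C1_upto U (\<lambda>x. x \<bullet> c) (\<lambda>x. c)"
  unfolding C1_upto_def gderiv_inner
  by (auto intro!: continuous_intros derivative_eq_intros simp: inner_commute)

lemma C1_upto_cmult: "C1_upto U f Df \<Longrightarrow> C1_upto U (\<lambda>x. c * f x) (\<lambda>x. c *\<^sub>R Df x)"
  using C1_upto_mult[OF C1_upto_const[of U c], of f Df] by simp

lemma C1_upto_sum: "(\<And>i. i \<in> I \<Longrightarrow> C1_upto U (f i) (Df i)) \<Longrightarrow> 
  C1_upto U (\<lambda>x. \<Sum>i\<in>I. f i x) (\<lambda>x. \<Sum>i\<in>I. Df i x)"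
  by (induction I rule: infinite_finite_induct) (auto intro: C1_upto_const C1_upto_add)

lemma FTC_interior_lborel:
  fixes F f :: "real \<Rightarrow> real"
  assumes "a \<le> b" "continuous_on {a..b} F" "continuous_on {a..b} f"
    and "\<And>x. a < x \<Longrightarrow> x < b \<Longrightarrow> (F has_real_derivative f x) (at x)"
  shows "(\<integral>x. indicator {a..b} x * f x \<partial>lborel) = F b - F a"
proof -
  have "set_integrable lborel {a..b} f"
    unfolding set_integrable_def by (rule borel_integrable_compact) (use assms in auto)
  from set_borel_integral_eq_integral(2)[OF this]
  have "(\<integral>x. indicator {a..b} x * f x \<partial>lborel) = integral {a..b} f"
    unfolding set_lebesgue_integral_def by simp
  also have "(f has_integral F b - F a) {a..b}"
    using assms by (intro fundamental_theorem_of_calculus_interior)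
      (auto simp: has_real_derivative_iff_has_vector_derivative)
  then have "integral {a..b} f = F b - F a" by (rule integral_unique)
  finally show ?thesis .
qed

text \<open>
  The surface integrals below are written as integrals over the horizontal space. Accordingly
  \<open>nrm\<close> is the normal that is not normalised: its length is the surface element.
\<close>

locale C1_graph =
  fixes \<eta> :: "'a::euclidean_space \<Rightarrow> real" and D\<eta> :: "'a \<Rightarrow> 'a"
  assumes eta_deriv: "\<And>x. GDERIV \<eta> x :> D\<eta> x" and Deta_cont: "continuous_on UNIV D\<eta>"
begin

abbreviation \<Omega> where "\<Omega> \<equiv> fluid_domain \<eta>"

definition surf :: "'a \<Rightarrow> 'a \<times> real" where "surf x = (x, \<eta> x)"

definition nrm :: "'a \<Rightarrow> 'a \<times> real" where "nrm x = (- D\<eta> x, 1)"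

lemma eta_cont: "continuous_on S \<eta>"
  by (rule GDERIV_imp_cont[OF eta_deriv])

lemma eta_meas[measurable]: "\<eta> \<in> borel_measurable borel"
  by (rule borel_measurable_continuous_onI[OF eta_cont])

lemma Deta_meas[measurable]: "D\<eta> \<in> borel_measurable borel"
  by (rule borel_measurable_continuous_onI[OF Deta_cont])

lemma open_fluid: "open \<Omega>"
  unfolding fluid_domain_def
  by (intro open_Collect_less continuous_on_compose2[OF eta_cont[of UNIV]] continuous_intros) auto

lemma sets_fluid[measurable]: "\<Omega> \<in> sets borel"
  using open_fluid by simp

lemma closure_fluid: "closure \<Omega> = {x. snd x \<le> \<eta> (fst x)}"
proof
  have "closed {x. snd x \<le> \<eta> (fst x)}"
    by (intro closed_Collect_le continuous_on_compose2[OF eta_cont[of UNIV]] continuous_intros) auto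
  then show "closure \<Omega> \<subseteq> {x. snd x \<le> \<eta> (fst x)}"
    by (rule closure_minimal[rotated]) (auto simp: fluid_domain_def)
  show "{x. snd x \<le> \<eta> (fst x)} \<subseteq> closure \<Omega>"
  proof
    fix x assume "x \<in> {x. snd x \<le> \<eta> (fst x)}"
    then have "(fst x, snd x - inverse (real (Suc k))) \<in> \<Omega>" for k
      by (auto simp: fluid_domain_def intro: less_le_trans[rotated])
    moreover have "(\<lambda>k. (fst x, snd x - inverse (real (Suc k)))) \<longlonglongrightarrow> (fst x, snd x - 0)"
      by (intro tendsto_intros LIMSEQ_inverse_real_of_nat)
    ultimately show "x \<in> closure \<Omega>"
      unfolding closure_sequential
      by (intro exI[of _ "\<lambda>k. (fst x, snd x - inverse (real (Suc k)))"]) simp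
  qed
qed

lemma surf_in_closure[simp]: "surf x \<in> closure \<Omega>"
  by (simp add: closure_fluid surf_def)

lemma below_in_fluid: "s < 0 \<Longrightarrow> (x, \<eta> x + s) \<in> \<Omega>"
  by (simp add: fluid_domain_def)

lemma below_in_closure: "s \<le> 0 \<Longrightarrow> (x, \<eta> x + s) \<in> closure \<Omega>"
  by (simp add: closure_fluid)

lemma integrable_on_fluid:
  fixes h :: "'a \<times> real \<Rightarrow> real"
  assumes "continuous_on (closure \<Omega>) h" "\<And>x. x \<in> \<Omega> \<Longrightarrow> r < norm x \<Longrightarrow> h x = 0"
  shows "integrable lborel (\<lambda>x. indicator \<Omega> x * h x)"
proof -
  have "integrable lborel (\<lambda>x. indicator (closure \<Omega> \<inter> cball 0 r) x *\<^sub>R h x)"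
    by (rule borel_integrable_compact) (auto intro: continuous_on_subset[OF assms(1)])
  then have "integrable lborel (\<lambda>x. indicator \<Omega> x *\<^sub>R (indicator (closure \<Omega> \<inter> cball 0 r) x *\<^sub>R h x))"
    by (rule integrable_mult_indicator[rotated]) auto
  also have "(\<lambda>x. indicator \<Omega> x *\<^sub>R (indicator (closure \<Omega> \<inter> cball 0 r) x *\<^sub>R h x)) = (\<lambda>x. indicator \<Omega> x * h x)"
  proof
    fix x
    show "indicator \<Omega> x *\<^sub>R (indicator (closure \<Omega> \<inter> cball 0 r) x *\<^sub>R h x) = indicator \<Omega> x * h x"
      using assms(2)[of x] closure_subset[of \<Omega>] by (cases "x \<in> \<Omega>"; cases "r < norm x") (auto simp: indicator_def)
  qed
  finally show ?thesis .
qed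

lemma gradient_zero_outside:
  assumes f: "C1_upto \<Omega> f Df" and supp: "\<And>x. x \<in> closure \<Omega> \<Longrightarrow> r \<le> norm x \<Longrightarrow> f x = 0"
    and x: "x \<in> \<Omega>" "r < norm x"
  shows "Df x = 0"
proof -
  have "GDERIV f x :> Df x" using f x by (auto simp: C1_upto_def)
  moreover have "GDERIV f x :> 0"
  proof -
    have "open (\<Omega> \<inter> - cball 0 r)" using open_fluid by (intro open_Int) auto
    moreover have "f y = 0" if "y \<in> \<Omega> \<inter> - cball 0 r" for y
      using supp[of y] that closure_subset[of \<Omega>] by auto
    moreover have "((\<lambda>_. 0) has_derivative inner 0) (at x)" by (simp add: gderiv_inner[symmetric] GDERIV_const)
    ultimately show ?thesis
      unfolding gderiv_inner using x
      by (auto intro: has_derivative_transform_within_open[of "\<lambda>_. 0" _ _ _ "\<Omega> \<inter> - cball 0 r"])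
  qed
  ultimately have "inner (Df x) = inner 0" unfolding gderiv_inner by (rule has_derivative_unique)
  then show ?thesis by (metis inner_eq_zero_iff inner_zero_left)
qed

text \<open>
  In the coordinates \<open>(x, s)\<close> with \<open>s = x\<^sub>n - \<eta> x\<close> the domain becomes a half space and the
  change of variables preserves volume. Split the direction \<open>v\<close> into a part tangent to the
  level sets of \<open>s\<close>, whose contribution vanishes on each level set, and a vertical part, to
  which the fundamental theorem of calculus applies on vertical lines.
\<close>

lemma gradient_theorem:
  assumes f: "C1_upto \<Omega> f Df" and supp: "\<And>x. x \<in> closure \<Omega> \<Longrightarrow> r \<le> norm x \<Longrightarrow> f x = 0"
  shows "integrable lborel (\<lambda>x. indicator \<Omega> x * (Df x \<bullet> v))"
    and "(\<integral>x. indicator \<Omega> x * (Df x \<bullet> v) \<partial>lborel) = (\<integral>x. f (surf x) * (nrm x \<bullet> v) \<partial>lborel)"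
proof -
  have fc: "continuous_on (closure \<Omega>) f" and Dc: "continuous_on (closure \<Omega>) Df"
    and D: "\<And>x. x \<in> \<Omega> \<Longrightarrow> GDERIV f x :> Df x"
    using f unfolding C1_upto_def by auto
  have Dz: "Df x = 0" if "x \<in> \<Omega>" "r < norm x" for x
    by (rule gradient_zero_outside[OF f supp that])
  let ?h = "\<lambda>x. indicator \<Omega> x * (Df x \<bullet> v)"
  show int: "integrable lborel ?h"
    using Dz by (intro integrable_on_fluid[where r=r] continuous_intros Dc) auto
  then have [measurable]: "?h \<in> borel_measurable (borel \<Otimes>\<^sub>M borel)" by (simp add: borel_prod)
  have lev: "continuous_on S (\<lambda>x. (x, \<eta> x + s))" for S s
    by (intro continuous_intros eta_cont)
  obtain L where L: "\<And>x. norm x \<le> r \<Longrightarrow> r + \<bar>\<eta> x\<bar> \<le> L"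
  proof -
    obtain B where B: "\<And>x. x \<in> cball 0 r \<Longrightarrow> norm (\<eta> x) \<le> B"
      using continuous_bounded_on_compact[OF compact_cball eta_cont] by blast
    show ?thesis by (rule that[of "r + B"]) (use B in auto)
  qed
  have far: "r < norm (x, \<eta> x + s)" if "norm x > r \<or> s < - L" for x s
  proof (cases "r < norm x")
    case True
    have "norm x \<le> norm (x, \<eta> x + s)" using norm_fst_le[of x "\<eta> x + s"] by simp
    then show ?thesis using True by simp
  next
    case False
    then have "r + \<bar>\<eta> x\<bar> \<le> L" "s < -L" using L[of x] that by auto
    then have "r < \<bar>\<eta> x + s\<bar>" by linarith
    also have "\<dots> \<le> norm (x, \<eta> x + s)" using norm_snd_le[of "\<eta> x + s" x] by simp
    finally show ?thesis .
  qed
  \<comment> \<open>every integrand below is supported in the compact set \<open>?K\<close> of flat coordinates\<close>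
  have flat_int: "integrable (lborel \<Otimes>\<^sub>M lborel) (\<lambda>(x, s). indicator {..<0} s * (Df (x, \<eta> x + s) \<bullet> w x))"
    if w: "continuous_on UNIV w" for w
  proof -
    let ?K = "cball (0::'a) r \<times> {-L..0}"
    have "integrable lborel (\<lambda>p. indicator ?K p *\<^sub>R (Df (fst p, \<eta> (fst p) + snd p) \<bullet> w (fst p)))"
    proof (rule borel_integrable_compact)
      show "compact ?K" by (intro compact_Times) auto
      show "continuous_on ?K (\<lambda>p. Df (fst p, \<eta> (fst p) + snd p) \<bullet> w (fst p))"
        by (intro continuous_intros continuous_on_compose2[OF Dc] continuous_on_compose2[OF w]
            continuous_on_compose2[OF eta_cont[of UNIV]])
          (auto simp: below_in_closure)
    qed
    then have "integrable lborel (\<lambda>p. indicator (UNIV \<times> {..<0}) p *\<^sub>R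
        (indicator ?K p *\<^sub>R (Df (fst p, \<eta> (fst p) + snd p) \<bullet> w (fst p))))"
      by (rule integrable_mult_indicator[rotated]) (auto simp: borel_Times)
    also have "(\<lambda>p. indicator (UNIV \<times> {..<0}) p *\<^sub>R
        (indicator ?K p *\<^sub>R (Df (fst p, \<eta> (fst p) + snd p) \<bullet> w (fst p))))
      = (\<lambda>(x, s). indicator {..<0} s * (Df (x, \<eta> x + s) \<bullet> w x))"
    proof (intro ext, clarify)
      fix x :: 'a and s :: real
      show "indicator (UNIV \<times> {..<0}) (x, s) *\<^sub>R (indicator ?K (x, s) *\<^sub>R
          (Df (fst (x, s), \<eta> (fst (x, s)) + snd (x, s)) \<bullet> w (fst (x, s))))
        = indicator {..<0} s * (Df (x, \<eta> x + s) \<bullet> w x)"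
        using Dz[OF below_in_fluid far, of s x]
        by (cases "s < 0"; cases "r < norm x \<or> s < - L") (auto simp: indicator_def)
    qed
    finally show ?thesis by (simp add: lborel_prod)
  qed
  \<comment> \<open>the part of \<open>v\<close> tangent to the translates of the surface\<close>
  define w where "w x = (fst v, D\<eta> x \<bullet> fst v)" for x
  have wc: "continuous_on UNIV w" unfolding w_def by (intro continuous_intros Deta_cont)
  define e :: "'a \<times> real" where "e = (0, 1)"
  let ?k1 = "\<lambda>x s. indicator {..<0} s * (Df (x, \<eta> x + s) \<bullet> w x)"
  let ?k2 = "\<lambda>x s. indicator {..<0} s * (Df (x, \<eta> x + s) \<bullet> ((nrm x \<bullet> v) *\<^sub>R e))"
  have i1: "integrable (lborel \<Otimes>\<^sub>M lborel) (\<lambda>(x, s). ?k1 x s)" by (rule flat_int[OF wc])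
  have i2: "integrable (lborel \<Otimes>\<^sub>M lborel) (\<lambda>(x, s). ?k2 x s)"
    unfolding nrm_def by (intro flat_int continuous_intros Deta_cont)
  have split: "indicator \<Omega> (x, \<eta> x + s) * (Df (x, \<eta> x + s) \<bullet> v) = ?k1 x s + ?k2 x s" for x s
  proof -
    have "v = w x + (nrm x \<bullet> v) *\<^sub>R e"
      by (cases v) (simp add: w_def nrm_def e_def inner_prod_def)
    then have "Df (x, \<eta> x + s) \<bullet> v = Df (x, \<eta> x + s) \<bullet> w x + Df (x, \<eta> x + s) \<bullet> ((nrm x \<bullet> v) *\<^sub>R e)"
      by (metis inner_add_right)
    then show ?thesis by (auto simp: indicator_def fluid_domain_def)
  qed
  have "(\<integral>x. ?h x \<partial>lborel) = (\<integral>x. (\<integral>y. ?h (x, y) \<partial>lborel) \<partial>lborel)"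
    using lborel_pair.integral_fst'[of ?h] int by (simp add: lborel_prod)
  also have "\<dots> = (\<integral>x. (\<integral>s. ?k1 x s + ?k2 x s \<partial>lborel) \<partial>lborel)"
  proof (rule Bochner_Integration.integral_cong[OF refl])
    fix x :: 'a
    have "(\<lambda>y. ?h (x, y)) \<in> borel_measurable borel" by measurable
    then have "(\<integral>y. ?h (x, y) \<partial>lborel) = (\<integral>s. ?h (x, \<eta> x + s) \<partial>lborel)"
      by (rule lborel_integral_translate[symmetric])
    then show "(\<integral>y. ?h (x, y) \<partial>lborel) = (\<integral>s. ?k1 x s + ?k2 x s \<partial>lborel)"
      by (simp only: split)
  qed
  also have "\<dots> = (\<integral>(x, s). ?k1 x s + ?k2 x s \<partial>(lborel \<Otimes>\<^sub>M lborel))"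
    using lborel_pair.integral_fst'[OF Bochner_Integration.integrable_add[OF i1 i2]]
    by (simp add: case_prod_beta')
  also have "\<dots> = (\<integral>(x, s). ?k1 x s \<partial>(lborel \<Otimes>\<^sub>M lborel)) + (\<integral>(x, s). ?k2 x s \<partial>(lborel \<Otimes>\<^sub>M lborel))"
    using i1 i2 by (subst Bochner_Integration.integral_add[symmetric]) (simp_all add: case_prod_beta')
  also have "(\<integral>(x, s). ?k1 x s \<partial>(lborel \<Otimes>\<^sub>M lborel)) = (\<integral>s. (\<integral>x. ?k1 x s \<partial>lborel) \<partial>lborel)"
    by (rule lborel_pair.integral_snd[symmetric, OF i1])
  \<comment> \<open>on a level set the tangential derivative is the gradient of a compactly supported function\<close>
  also have "(\<lambda>s. \<integral>x. ?k1 x s \<partial>lborel) = (\<lambda>s. 0)"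
  proof
    fix s :: real
    show "(\<integral>x. ?k1 x s \<partial>lborel) = 0"
    proof (cases "s < 0")
      case True
      let ?G = "\<lambda>x. fst (Df (x, \<eta> x + s)) + snd (Df (x, \<eta> x + s)) *\<^sub>R D\<eta> x"
      have "(\<integral>x. ?G x \<bullet> fst v \<partial>lborel) = 0"
      proof (rule integral_gradient_compact_support[of "\<lambda>x. f (x, \<eta> x + s)" ?G r])
        fix x :: 'a
        have "(f has_derivative inner (Df (x, \<eta> x + s))) (at (x, \<eta> x + s))"
          using D[OF below_in_fluid[OF True, of x]] by (simp add: gderiv_inner)
        moreover have "((\<lambda>x. (x, \<eta> x + s)) has_derivative (\<lambda>h. (h, D\<eta> x \<bullet> h))) (at x)"
          using eta_deriv[of x] unfolding gderiv_inner by (auto intro!: derivative_eq_intros)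
        ultimately have "((\<lambda>x. f (x, \<eta> x + s)) has_derivative (\<lambda>h. Df (x, \<eta> x + s) \<bullet> (h, D\<eta> x \<bullet> h))) (at x)"
          by (rule has_derivative_compose[rotated])
        moreover have "(\<lambda>h. Df (x, \<eta> x + s) \<bullet> (h, D\<eta> x \<bullet> h)) = inner (?G x)"
          by (auto simp: inner_prod_def inner_add_left)
        ultimately show "GDERIV (\<lambda>x. f (x, \<eta> x + s)) x :> ?G x"
          unfolding gderiv_inner by simp
      next
        show "continuous_on UNIV ?G"
          using True by (intro continuous_intros continuous_on_compose2[OF Dc] lev Deta_cont)
            (auto simp: below_in_closure)
      next
        fix x :: 'a assume "r \<le> norm x"
        then show "f (x, \<eta> x + s) = 0"
          using True norm_fst_le[of x "\<eta> x + s"] by (intro supp below_in_closure) auto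
      qed
      moreover have "?k1 x s = ?G x \<bullet> fst v" for x
        using True by (simp add: w_def inner_prod_def inner_add_left)
      ultimately show ?thesis by simp
    qed simp
  qed
  also have "(\<integral>(x, s). ?k2 x s \<partial>(lborel \<Otimes>\<^sub>M lborel)) = (\<integral>x. (\<integral>s. ?k2 x s \<partial>lborel) \<partial>lborel)"
    by (rule lborel_pair.integral_fst[symmetric, OF i2])
  also have "(\<lambda>x. \<integral>s. ?k2 x s \<partial>lborel) = (\<lambda>x. f (surf x) * (nrm x \<bullet> v))"
  proof
    fix x
    define M where "M = \<bar>r\<bar> + \<bar>\<eta> x\<bar> + 1"
    have Mz: "r < norm (x, \<eta> x + s)" if "s \<le> - M" for s
      using norm_snd_le[of "\<eta> x + s" x] that unfolding M_def by simp
    have "(\<integral>s. indicator {-M..0} s * (Df (x, \<eta> x + s) \<bullet> e) \<partial>lborel)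
        = f (x, \<eta> x + 0) - f (x, \<eta> x + (- M))"
    proof (rule FTC_interior_lborel)
      show "continuous_on {-M..0} (\<lambda>s. f (x, \<eta> x + s))"
        by (intro continuous_on_compose2[OF fc] continuous_intros) (auto simp: below_in_closure)
      show "continuous_on {-M..0} (\<lambda>s. Df (x, \<eta> x + s) \<bullet> e)"
        by (intro continuous_intros continuous_on_compose2[OF Dc]) (auto simp: below_in_closure)
      fix s :: real assume "s < 0"
      have "(f has_derivative inner (Df (x, \<eta> x + s))) (at (x, \<eta> x + s))"
        using D[OF below_in_fluid[OF \<open>s < 0\<close>, of x]] by (simp add: gderiv_inner)
      moreover have "((\<lambda>s. (x, \<eta> x + s)) has_derivative (\<lambda>h. (0, h))) (at s)"
        by (auto intro!: derivative_eq_intros)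
      ultimately have "((\<lambda>s. f (x, \<eta> x + s)) has_derivative (\<lambda>h. Df (x, \<eta> x + s) \<bullet> (0, h))) (at s)"
        by (rule has_derivative_compose[rotated])
      moreover have "(\<lambda>h. Df (x, \<eta> x + s) \<bullet> (0, h)) = (*) (Df (x, \<eta> x + s) \<bullet> e)"
        by (auto simp: e_def inner_prod_def)
      ultimately show "((\<lambda>s. f (x, \<eta> x + s)) has_real_derivative Df (x, \<eta> x + s) \<bullet> e) (at s)"
        by (simp add: has_field_derivative_def)
    qed (auto simp: M_def)
    also have "f (x, \<eta> x + (- M)) = 0"
      using Mz[of "-M"] by (intro supp below_in_closure) (auto simp: M_def)
    finally have *: "(\<integral>s. indicator {-M..0} s * (Df (x, \<eta> x + s) \<bullet> e) \<partial>lborel) = f (surf x)"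
      by (simp add: surf_def)
    have "(\<integral>s. ?k2 x s \<partial>lborel) = (\<integral>s. (nrm x \<bullet> v) * (indicator {-M..0} s * (Df (x, \<eta> x + s) \<bullet> e)) \<partial>lborel)"
    proof (rule integral_discrete_difference[where X="{0}"])
      fix s :: real assume "s \<notin> {0}"
      then show "?k2 x s = (nrm x \<bullet> v) * (indicator {-M..0} s * (Df (x, \<eta> x + s) \<bullet> e))"
        using Dz[OF below_in_fluid Mz, of s] by (cases "-M \<le> s") (auto simp: indicator_def)
    qed auto
    then show "(\<integral>s. ?k2 x s \<partial>lborel) = f (surf x) * (nrm x \<bullet> v)" by (simp add: *)
  qed
  finally show "(\<integral>x. ?h x \<partial>lborel) = (\<integral>x. f (surf x) * (nrm x \<bullet> v) \<partial>lborel)" by simp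
qed

end

section \<open>Smooth cutoffs\<close>

text \<open>
  Powers of the positive part serve as truncations, because they are differentiable with an
  explicit derivative.
\<close>

lemma positive_part_power_deriv:
  "((\<lambda>t::real. max 0 t ^ Suc (Suc k)) has_real_derivative real (Suc (Suc k)) * max 0 t ^ Suc k) (at t)"
proof -
  consider "t > 0" | "t < 0" | "t = 0" by linarith
  then show ?thesis
  proof cases
    case 1
    have "((\<lambda>t::real. t ^ Suc (Suc k)) has_real_derivative real (Suc (Suc k)) * max 0 t ^ Suc k) (at t)"
      using DERIV_pow[of "Suc (Suc k)" t] 1 by (simp add: max_def)
    then show ?thesis
      by (rule has_field_derivative_transform_within_open[of _ _ _ "{0<..}"]) (use 1 in auto)
  next
    case 2
    have "((\<lambda>t::real. 0) has_real_derivative real (Suc (Suc k)) * max 0 t ^ Suc k) (at t)"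
      using 2 by (auto intro!: derivative_eq_intros)
    then show ?thesis
      by (rule has_field_derivative_transform_within_open[of _ _ _ "{..<0}"]) (use 2 in auto)
  next
    case 3
    have "((\<lambda>h::real. max 0 h ^ Suc (Suc k) / h) \<longlongrightarrow> 0) (at 0)"
    proof (rule Lim_null_comparison)
      show "\<forall>\<^sub>F h in at 0. norm (max 0 h ^ Suc (Suc k) / h) \<le> \<bar>h :: real\<bar>"
      proof (rule eventually_mono)
        show "\<forall>\<^sub>F h in at 0. dist h (0::real) < 1" by (rule eventually_at_ball'[THEN eventually_mono]) (auto simp: dist_commute)
        fix h :: real assume "dist h 0 < 1"
        then have "\<bar>max 0 h ^ k\<bar> \<le> 1" by (auto simp: max_def power_le_one)
        then have "\<bar>max 0 h ^ k\<bar> * (max 0 h) \<le> 1 * \<bar>h\<bar>" by (intro mult_mono) auto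
        then show "norm (max 0 h ^ Suc (Suc k) / h) \<le> \<bar>h\<bar>"
          by (cases "h > 0") (auto simp: abs_mult max_def mult_ac)
      qed
      show "((\<lambda>h::real. \<bar>h\<bar>) \<longlongrightarrow> 0) (at 0)" by (auto intro!: tendsto_eq_intros)
    qed
    then show ?thesis using 3 by (simp add: has_field_derivative_iff)
  qed
qed

lemma GDERIV_radial:
  assumes "(F has_real_derivative F') (at ((norm (x - a))\<^sup>2))"
  shows "GDERIV (\<lambda>x. F ((norm (x - a))\<^sup>2)) x :> (2 * F') *\<^sub>R (x - a)"
proof -
  have "((\<lambda>x. (norm (x - a))\<^sup>2) has_derivative (\<lambda>h. 2 * ((x - a) \<bullet> h))) (at x)"
    unfolding power2_norm_eq_inner
    by (auto intro!: derivative_eq_intros simp: inner_commute)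
  moreover have "(F has_derivative (*) F') (at ((norm (x - a))\<^sup>2))"
    using assms by (simp add: has_field_derivative_def)
  ultimately have "((\<lambda>x. F ((norm (x - a))\<^sup>2)) has_derivative (\<lambda>h. F' * (2 * ((x - a) \<bullet> h)))) (at x)"
    by (rule has_derivative_compose)
  moreover have "(\<lambda>h. F' * (2 * ((x - a) \<bullet> h))) = inner ((2 * F') *\<^sub>R (x - a))"
    by (auto simp: mult_ac)
  ultimately show ?thesis by (simp add: gderiv_inner)
qed

text \<open>
  The power four makes the function twice continuously differentiable and, more importantly,
  gives \<open>|\<nabla>bump|\<^sup>2 \<le> C bump\<close> (lemma \<open>bump_grad_square_le\<close>), which the energy estimate needs.
\<close>

definition bump :: "real \<Rightarrow> 'a::euclidean_space \<Rightarrow> real" where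
  "bump m x = max 0 (1 - (norm x)\<^sup>2 / m\<^sup>2) ^ 4"

definition bump_grad :: "real \<Rightarrow> 'a::euclidean_space \<Rightarrow> 'a" where
  "bump_grad m x = (- 8 / m\<^sup>2 * max 0 (1 - (norm x)\<^sup>2 / m\<^sup>2) ^ 3) *\<^sub>R x"

definition bump_hess :: "real \<Rightarrow> 'a::euclidean_space \<Rightarrow> 'a \<Rightarrow> 'a" where
  "bump_hess m v x = (- 8 / m\<^sup>2 * max 0 (1 - (norm x)\<^sup>2 / m\<^sup>2) ^ 3) *\<^sub>R v
     + (48 / (m\<^sup>2 * m\<^sup>2) * max 0 (1 - (norm x)\<^sup>2 / m\<^sup>2) ^ 2 * (x \<bullet> v)) *\<^sub>R x"

lemma GDERIV_bump_power:
  "GDERIV (\<lambda>x. max 0 (1 - (norm x)\<^sup>2 / m\<^sup>2) ^ Suc (Suc k)) x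
     :> (- 2 * real (Suc (Suc k)) / m\<^sup>2 * max 0 (1 - (norm x)\<^sup>2 / m\<^sup>2) ^ Suc k) *\<^sub>R (x::'a::euclidean_space)"
proof -
  have "((\<lambda>s. max 0 (1 - s / m\<^sup>2) ^ Suc (Suc k)) has_real_derivative
     real (Suc (Suc k)) * max 0 (1 - s / m\<^sup>2) ^ Suc k * (- (1 / m\<^sup>2))) (at s)" for s
  proof (rule DERIV_chain2[OF positive_part_power_deriv])
    have "((\<lambda>s. 1 - s / m\<^sup>2) has_real_derivative 0 - 1 / m\<^sup>2) (at s)"
      by (intro DERIV_diff DERIV_const DERIV_cdivide DERIV_ident)
    then show "((\<lambda>s. 1 - s / m\<^sup>2) has_real_derivative - (1 / m\<^sup>2)) (at s)" by simp
  qed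
  from GDERIV_radial[OF this, where x=x and a=0] show ?thesis
    unfolding diff_zero
    by (rule GDERIV_subst) (rule arg_cong[of _ _ "\<lambda>c. c *\<^sub>R x"], simp add: divide_inverse algebra_simps)
qed

lemma GDERIV_bump: "GDERIV (bump m) x :> bump_grad m x"
proof -
  have "bump m = (\<lambda>x::'a. max 0 (1 - (norm x)\<^sup>2 / m\<^sup>2) ^ Suc (Suc 2))"
    by (simp add: bump_def fun_eq_iff numeral_eq_Suc)
  then show ?thesis
    using GDERIV_bump_power[of m 2 x] unfolding bump_grad_def by (simp add: numeral_eq_Suc)
qed

lemma GDERIV_bump_grad: "GDERIV (\<lambda>x. bump_grad m x \<bullet> v) x :> bump_hess m v x"
proof -
  let ?p = "\<lambda>x::'a. max 0 (1 - (norm x)\<^sup>2 / m\<^sup>2)"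
  have eq: "(\<lambda>x. bump_grad m x \<bullet> v) = (\<lambda>x. ((- 8 / m\<^sup>2) * (x \<bullet> v)) * ?p x ^ Suc (Suc 1))"
    by (simp add: bump_grad_def fun_eq_iff numeral_eq_Suc)
  have "GDERIV (\<lambda>x. (- 8 / m\<^sup>2) * (x \<bullet> v)) x :> (- 8 / m\<^sup>2) *\<^sub>R v"
    unfolding gderiv_def inner_scaleR_right
    by (intro has_derivative_mult_right has_derivative_inner_left has_derivative_ident)
  from GDERIV_mult[OF this GDERIV_bump_power[of m 1 x]]
  show ?thesis unfolding eq bump_hess_def
    by (rule GDERIV_subst) (simp add: numeral_eq_Suc algebra_simps)
qed

lemma continuous_bump[continuous_intros]: "continuous_on S (bump m)"
  unfolding bump_def divide_inverse by (intro continuous_intros)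

lemma continuous_bump_grad[continuous_intros]: "continuous_on S (bump_grad m)"
  unfolding bump_grad_def divide_inverse by (intro continuous_intros)

lemma continuous_bump_hess[continuous_intros]: "continuous_on S (bump_hess m v)"
  unfolding bump_hess_def divide_inverse by (intro continuous_intros)

lemma bump_meas[measurable]: "bump m \<in> borel_measurable borel"
  by (intro borel_measurable_continuous_onI continuous_bump)

lemma bump_grad_meas[measurable]: "bump_grad m \<in> borel_measurable borel"
  by (intro borel_measurable_continuous_onI continuous_bump_grad)

lemma bump_nonneg: "0 \<le> bump m x" and bump_le_1: "bump m x \<le> 1"
  unfolding bump_def by (auto intro!: power_le_one)

lemma bump_mult_le: "\<bar>bump m x * c\<bar> \<le> \<bar>c\<bar>"
  using mult_right_mono[OF bump_le_1[of m x], of "\<bar>c\<bar>"] bump_nonneg[of m x] by (simp add: abs_mult)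

lemma bump_outside:
  assumes "0 < m" "m \<le> norm x" 
  shows "bump m x = 0" "bump_grad m x = 0" "bump_hess m v x = 0"
proof -
  have "m\<^sup>2 \<le> (norm x)\<^sup>2" using assms by (simp add: power_mono)
  then have "1 - (norm x)\<^sup>2 / m\<^sup>2 \<le> 0" using assms by simp
  then have "max 0 (1 - (norm x)\<^sup>2 / m\<^sup>2) = 0" by simp
  then show "bump m x = 0" "bump_grad m x = 0" "bump_hess m v x = 0"
    unfolding bump_def bump_grad_def bump_hess_def by auto
qed

lemma bump_grad_le:
  assumes "0 < m"
  shows "norm (bump_grad m x) \<le> 8 * norm x / m\<^sup>2 * indicator (ball 0 m) x"
proof (cases "norm x < m")
  case True
  have "max 0 (1 - (norm x)\<^sup>2 / m\<^sup>2) ^ 3 \<le> 1" by (intro power_le_one) auto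
  then have "max 0 (1 - (norm x)\<^sup>2 / m\<^sup>2) ^ 3 * (8 * norm x / m\<^sup>2) \<le> 1 * (8 * norm x / m\<^sup>2)"
    by (intro mult_right_mono) auto
  then show ?thesis using True by (simp add: bump_grad_def abs_mult mult_ac)
next
  case False
  then have "bump_grad m x = 0" by (intro bump_outside(2) assms) auto
  then show ?thesis using False by simp
qed

lemma bump_grad_le_const:
  assumes "0 < m" shows "norm (bump_grad m x) \<le> 8 / m"
proof (cases "norm x < m")
  case True
  have "8 * norm x / m\<^sup>2 \<le> 8 * m / m\<^sup>2" using True assms by (intro divide_right_mono) auto
  also have "\<dots> = 8 / m" by (simp add: power2_eq_square)
  finally show ?thesis using bump_grad_le[OF assms, of x] True by simp
next
  case False
  then have "bump_grad m x = 0" by (intro bump_outside(2) assms) auto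
  then show ?thesis using assms by simp
qed

lemma bump_grad_square_le:
  assumes "0 < m"
  shows "(norm (bump_grad m x))\<^sup>2 \<le> bump m x * (64 * (norm x)\<^sup>2 / (m\<^sup>2 * m\<^sup>2) * indicator (ball 0 m) x)"
proof (cases "norm x < m")
  case True
  let ?p = "max 0 (1 - (norm x)\<^sup>2 / m\<^sup>2)"
  have "(norm (bump_grad m x))\<^sup>2 = 64 * (norm x)\<^sup>2 / (m\<^sup>2 * m\<^sup>2) * ?p ^ 6"
    by (simp add: bump_grad_def abs_mult power_mult_distrib power_divide power2_eq_square
        power_mult[symmetric] field_simps)
  also have "?p ^ 6 \<le> ?p ^ 4" by (intro power_decreasing) auto
  then have "64 * (norm x)\<^sup>2 / (m\<^sup>2 * m\<^sup>2) * ?p ^ 6 \<le> 64 * (norm x)\<^sup>2 / (m\<^sup>2 * m\<^sup>2) * ?p ^ 4"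
    by (intro mult_left_mono) auto
  finally show ?thesis using True by (simp add: bump_def mult_ac)
next
  case False
  then have "bump_grad m x = 0" by (intro bump_outside(2) assms) auto
  then show ?thesis using False by simp
qed

lemma bump_tendsto: "((\<lambda>m. bump m x) \<longlongrightarrow> 1) at_top"
proof -
  have "((\<lambda>m. (norm x)\<^sup>2 / m\<^sup>2) \<longlongrightarrow> 0) at_top"
    by (intro tendsto_divide_0[OF tendsto_const] filterlim_at_top_imp_at_infinity
        filterlim_pow_at_top filterlim_ident) auto
  then have "((\<lambda>m. max 0 (1 - (norm x)\<^sup>2 / m\<^sup>2) ^ 4) \<longlongrightarrow> (max 0 (1 - 0)) ^ 4) at_top"
    by (intro tendsto_intros)
  then show ?thesis unfolding bump_def by simp
qed

lemma bump_ge_half_ball: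
  assumes "0 < m" "2 * norm x \<le> m" shows "1/4 \<le> bump m x"
proof -
  have "(2 * norm x)\<^sup>2 \<le> m\<^sup>2" using assms by (intro power_mono) auto
  then have "(norm x)\<^sup>2 / m\<^sup>2 \<le> 1/4" using assms by (simp add: field_simps)
  then have *: "3/4 \<le> max 0 (1 - (norm x)\<^sup>2 / m\<^sup>2)" by linarith
  have "(3/4)^4 \<le> bump m x" unfolding bump_def by (rule power_mono[OF *]) simp
  then show ?thesis by (simp add: power4_eq_xxxx)
qed

text \<open>
  Compact support can be relaxed to decay: when the integral is cut off at radius \<open>m\<close>, the
  error contains the gradient of the cutoff, which lives on \<open>|x| \<le> m\<close> and is at most \<open>8/m\<close>, so
  it is dominated by \<open>f / (1 + |x|)\<close>.
\<close>

lemma integral_gradient_decay: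
  fixes f :: "'a::euclidean_space \<Rightarrow> real"
  assumes D: "\<And>x. GDERIV f x :> Df x" and c: "continuous_on UNIV Df"
    and i0: "integrable lborel (\<lambda>x. f x / (1 + norm x))" and i1: "integrable lborel (\<lambda>x. Df x \<bullet> b)"
  shows "(\<integral>x. Df x \<bullet> b \<partial>lborel) = 0"
proof -
  have contf: "continuous_on S f" for S by (rule GDERIV_imp_cont[OF D])
  have [measurable]: "f \<in> borel_measurable borel" "Df \<in> borel_measurable borel"
    by (auto intro!: borel_measurable_continuous_onI contf c)
  have eq: "(\<integral>x. bump m x * (Df x \<bullet> b) \<partial>lborel) = - (\<integral>x. f x * (bump_grad m x \<bullet> b) \<partial>lborel)" if "1 \<le> m" for m
  proof -
    have "(\<integral>x. (bump m x *\<^sub>R Df x + f x *\<^sub>R bump_grad m x) \<bullet> b \<partial>lborel) = 0"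
    proof (rule integral_gradient_compact_support[where r=m])
      show "GDERIV (\<lambda>x. bump m x * f x) x :> bump m x *\<^sub>R Df x + f x *\<^sub>R bump_grad m x" for x
        by (intro GDERIV_mult GDERIV_bump D)
      show "bump m x * f x = 0" if "m \<le> norm x" for x
        using \<open>1 \<le> m\<close> that by (simp add: bump_outside)
    qed (intro continuous_intros contf c)
    moreover have "integrable lborel (\<lambda>x. bump m x * (Df x \<bullet> b))"
      using that by (intro integrable_compact_support[where r=m] continuous_intros c) (simp add: bump_outside)
    moreover have "integrable lborel (\<lambda>x. f x * (bump_grad m x \<bullet> b))"
      using that by (intro integrable_compact_support[where r=m] continuous_intros contf) (simp add: bump_outside)
    ultimately show ?thesis by (simp add: inner_add_left)
  qed
  have l1: "((\<lambda>m. \<integral>x. bump m x * (Df x \<bullet> b) \<partial>lborel) \<longlongrightarrow> (\<integral>x. Df x \<bullet> b \<partial>lborel)) at_top"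
  proof (rule integral_dominated_convergence_at_top[where w="\<lambda>x. \<bar>Df x \<bullet> b\<bar>"])
    show "AE x in lborel. ((\<lambda>m. bump m x * (Df x \<bullet> b)) \<longlongrightarrow> Df x \<bullet> b) at_top"
      by (intro AE_I2) (auto intro!: tendsto_eq_intros bump_tendsto)
    show "\<forall>\<^sub>F m in at_top. AE x in lborel. norm (bump m x * (Df x \<bullet> b)) \<le> \<bar>Df x \<bullet> b\<bar>"
      by (intro always_eventually allI AE_I2) (simp only: real_norm_def bump_mult_le)
  qed (use i1 in auto)
  have l2: "((\<lambda>m. \<integral>x. f x * (bump_grad m x \<bullet> b) \<partial>lborel) \<longlongrightarrow> (\<integral>(x::'a). 0 \<partial>lborel)) at_top"
  proof (rule integral_dominated_convergence_at_top[where w="\<lambda>x. 16 * norm b * \<bar>f x / (1 + norm x)\<bar>"])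
    have "((\<lambda>m. f x * (bump_grad m x \<bullet> b)) \<longlongrightarrow> 0) at_top" for x
    proof (rule Lim_null_comparison)
      show "\<forall>\<^sub>F m in at_top. norm (f x * (bump_grad m x \<bullet> b)) \<le> \<bar>f x\<bar> * (8 / m * norm b)"
        using eventually_gt_at_top[of 0]
      proof eventually_elim
        case (elim m)
        have "\<bar>bump_grad m x \<bullet> b\<bar> \<le> norm (bump_grad m x) * norm b" by (rule Cauchy_Schwarz_ineq2)
        also have "\<dots> \<le> 8 / m * norm b" using bump_grad_le_const[OF elim] by (intro mult_right_mono) auto
        finally have "\<bar>f x\<bar> * \<bar>bump_grad m x \<bullet> b\<bar> \<le> \<bar>f x\<bar> * (8 / m * norm b)"
          by (rule mult_left_mono) auto
        then show ?case by (simp only: real_norm_def abs_mult)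
      qed
      show "((\<lambda>m. \<bar>f x\<bar> * (8 / m * norm b)) \<longlongrightarrow> 0) at_top"
        by (intro tendsto_mult_right_zero tendsto_mult_left_zero tendsto_divide_0[OF tendsto_const]
            filterlim_at_top_imp_at_infinity filterlim_ident)
    qed
    then show "AE x in lborel. ((\<lambda>m. f x * (bump_grad m x \<bullet> b)) \<longlongrightarrow> 0) at_top" by simp
    show "\<forall>\<^sub>F m in at_top. AE x in lborel. norm (f x * (bump_grad m x \<bullet> b)) \<le> 16 * norm b * \<bar>f x / (1 + norm x)\<bar>"
      using eventually_ge_at_top[of 1]
    proof eventually_elim
      case (elim m)
      show ?case
      proof (rule AE_I2)
        fix x :: 'a
        have *: "norm (bump_grad m x) \<le> 16 / (1 + norm x)"
        proof (cases "norm x < m")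
          case True
          have "norm (bump_grad m x) \<le> 8 / m" using elim by (intro bump_grad_le_const) auto
          also have "8 / m = 16 / (2 * m)" by simp
          also have "\<dots> \<le> 16 / (1 + norm x)" using True elim by (intro frac_le) (auto intro: add_pos_nonneg)
          finally show ?thesis .
        next
          case False
          then have "bump_grad m x = 0" using elim by (intro bump_outside) auto
          then show ?thesis using norm_ge_zero[of x] by simp
        qed
        have "\<bar>bump_grad m x \<bullet> b\<bar> \<le> norm (bump_grad m x) * norm b" by (rule Cauchy_Schwarz_ineq2)
        also have "\<dots> \<le> 16 / (1 + norm x) * norm b" using * by (intro mult_right_mono) auto
        finally have "\<bar>f x\<bar> * \<bar>bump_grad m x \<bullet> b\<bar> \<le> \<bar>f x\<bar> * (16 / (1 + norm x) * norm b)"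
          by (intro mult_left_mono) auto
        then show "norm (f x * (bump_grad m x \<bullet> b)) \<le> 16 * norm b * \<bar>f x / (1 + norm x)\<bar>"
          using norm_ge_zero[of x] by (simp add: abs_mult mult_ac)
      qed
    qed
    show "integrable lborel (\<lambda>x. 16 * norm b * \<bar>f x / (1 + norm x)\<bar>)"
      by (intro integrable_mult_right integrable_abs i0)
  qed auto
  have "((\<lambda>m. \<integral>x. bump m x * (Df x \<bullet> b) \<partial>lborel) \<longlongrightarrow> 0) at_top"
  proof (rule Lim_transform_eventually)
    show "((\<lambda>m. - (\<integral>x. f x * (bump_grad m x \<bullet> b) \<partial>lborel)) \<longlongrightarrow> 0) at_top"
      using tendsto_minus[OF l2] by simp
    show "\<forall>\<^sub>F m in at_top. - (\<integral>x. f x * (bump_grad m x \<bullet> b) \<partial>lborel) = (\<integral>x. bump m x * (Df x \<bullet> b) \<partial>lborel)"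
      using eventually_ge_at_top[of 1] by eventually_elim (simp add: eq)
  qed
  with l1 show ?thesis using tendsto_unique[OF trivial_limit_at_top_linorder] by blast
qed

section \<open>Fluxes and the kinetic energy\<close>

context C1_graph
begin

lemma continuous_surf: "continuous_on S surf"
  unfolding surf_def by (intro continuous_intros eta_cont)

lemma continuous_nrm: "continuous_on S nrm"
  unfolding nrm_def by (intro continuous_intros continuous_on_subset[OF Deta_cont]) auto

lemma continuous_on_surf:
  fixes f :: "'a \<times> real \<Rightarrow> 'b::topological_space"
  shows "continuous_on (closure \<Omega>) f \<Longrightarrow> continuous_on UNIV (\<lambda>x. f (surf x))"
  by (rule continuous_on_compose2[OF _ continuous_surf]) auto

lemma norm_le_norm_surf: "norm x \<le> norm (surf x)"
  unfolding surf_def by (rule norm_fst_le)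

lemma integrable_on_surf:
  fixes f :: "'a \<times> real \<Rightarrow> real"
  assumes "continuous_on (closure \<Omega>) f" "\<And>x. x \<in> closure \<Omega> \<Longrightarrow> r \<le> norm x \<Longrightarrow> f x = 0"
    and "continuous_on UNIV w"
  shows "integrable lborel (\<lambda>x. f (surf x) * w x)"
proof (rule integrable_compact_support[where r=r])
  show "continuous_on UNIV (\<lambda>x. f (surf x) * w x)"
    by (intro continuous_intros continuous_on_surf assms)
  show "f (surf x) * w x = 0" if "r < norm x" for x
    using assms(2)[of "surf x"] norm_le_norm_surf[of x] that by simp
qed

text \<open>
  The divergence theorem for the field \<open>f G\<close>, obtained by summing the gradient theorem over
  the components.
\<close>

lemma flux_of_product:
  assumes f: "C1_upto \<Omega> f Df" and G: "\<And>b. C1_upto \<Omega> (\<lambda>x. G x \<bullet> b) (HG b)"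
    and supp: "\<And>x. x \<in> closure \<Omega> \<Longrightarrow> r \<le> norm x \<Longrightarrow> f x = 0 \<or> G x = 0"
  shows "integrable lborel (\<lambda>x. indicator \<Omega> x * (f x * (\<Sum>b\<in>Basis. HG b x \<bullet> b) + Df x \<bullet> G x))"
    and "(\<integral>x. indicator \<Omega> x * (f x * (\<Sum>b\<in>Basis. HG b x \<bullet> b) + Df x \<bullet> G x) \<partial>lborel)
      = (\<integral>x. f (surf x) * (G (surf x) \<bullet> nrm x) \<partial>lborel)"
proof -
  let ?D = "\<lambda>b x. f x *\<^sub>R HG b x + (G x \<bullet> b) *\<^sub>R Df x"
  have C: "C1_upto \<Omega> (\<lambda>x. f x * (G x \<bullet> b)) (?D b)" for b by (rule C1_upto_mult[OF f G])
  have supp': "f x * (G x \<bullet> b) = 0" if "x \<in> closure \<Omega>" "r \<le> norm x" for x b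
    using supp[OF that] by auto
  have eq: "(\<Sum>b\<in>Basis. indicator \<Omega> x * (?D b x \<bullet> b))
     = indicator \<Omega> x * (f x * (\<Sum>b\<in>Basis. HG b x \<bullet> b) + Df x \<bullet> G x)" for x
    by (simp add: sum_distrib_left[symmetric] inner_add_left sum.distrib
        euclidean_inner[of "Df x" "G x"] mult.commute)
  note g = gradient_theorem[OF C supp', of r]
  show "integrable lborel (\<lambda>x. indicator \<Omega> x * (f x * (\<Sum>b\<in>Basis. HG b x \<bullet> b) + Df x \<bullet> G x))"
    using Bochner_Integration.integrable_sum[of Basis lborel "\<lambda>b x. indicator \<Omega> x * (?D b x \<bullet> b)"] g(1)
    unfolding eq by simp
  have "(\<integral>x. (\<Sum>b\<in>Basis. indicator \<Omega> x * (?D b x \<bullet> b)) \<partial>lborel)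
     = (\<Sum>b\<in>Basis. \<integral>x. indicator \<Omega> x * (?D b x \<bullet> b) \<partial>lborel)"
    by (rule Bochner_Integration.integral_sum) (use g(1) in auto)
  also have "\<dots> = (\<Sum>b\<in>Basis. \<integral>x. f (surf x) * (G (surf x) \<bullet> b) * (nrm x \<bullet> b) \<partial>lborel)"
    using g(2) by simp
  also have "\<dots> = (\<integral>x. (\<Sum>b\<in>Basis. f (surf x) * (G (surf x) \<bullet> b) * (nrm x \<bullet> b)) \<partial>lborel)"
  proof (intro Bochner_Integration.integral_sum[symmetric])
    fix b :: "'a \<times> real"
    have "continuous_on (closure \<Omega>) (\<lambda>x. f x * (G x \<bullet> b))" using C[of b] by (simp add: C1_upto_def)
    moreover have "continuous_on UNIV (\<lambda>x. nrm x \<bullet> b)" by (intro continuous_intros continuous_nrm)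
    ultimately show "integrable lborel (\<lambda>x. f (surf x) * (G (surf x) \<bullet> b) * (nrm x \<bullet> b))"
      using integrable_on_surf[of "\<lambda>x. f x * (G x \<bullet> b)" r "\<lambda>x. nrm x \<bullet> b"] supp' by blast
  qed
  also have "(\<lambda>x. \<Sum>b\<in>Basis. f (surf x) * (G (surf x) \<bullet> b) * (nrm x \<bullet> b)) = (\<lambda>x. f (surf x) * (G (surf x) \<bullet> nrm x))"
    by (simp add: sum_distrib_left[symmetric] mult.assoc euclidean_inner[of "G _" "nrm _"])
  finally show "(\<integral>x. indicator \<Omega> x * (f x * (\<Sum>b\<in>Basis. HG b x \<bullet> b) + Df x \<bullet> G x) \<partial>lborel)
      = (\<integral>x. f (surf x) * (G (surf x) \<bullet> nrm x) \<partial>lborel)" unfolding eq .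
qed

end

lemma bounded_of_limit:
  fixes f :: "'a::euclidean_space \<Rightarrow> real"
  assumes S: "closed S" and f: "continuous_on S f"
    and lim: "((\<lambda>x. indicator S x * f x) \<longlongrightarrow> 0) at_infinity"
  obtains M where "0 \<le> M" "\<And>x. x \<in> S \<Longrightarrow> \<bar>f x\<bar> \<le> M"
proof -
  have "\<forall>\<^sub>F x in at_infinity. \<bar>indicator S x * f x\<bar> < 1"
    using tendstoD[OF lim, of 1] by simp
  then obtain b where b: "\<And>x. b \<le> norm x \<Longrightarrow> \<bar>indicator S x * f x\<bar> < 1"
    unfolding eventually_at_infinity by blast
  have "compact (S \<inter> cball 0 b)" using S by (intro closed_Int_compact) auto
  then obtain B where B: "0 \<le> B" "\<And>x. x \<in> S \<inter> cball 0 b \<Longrightarrow> norm (f x) \<le> B"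
    using continuous_bounded_on_compact[of "S \<inter> cball 0 b" f] f
    by (metis continuous_on_subset inf_le1)
  have "\<bar>f x\<bar> \<le> B + 1" if "x \<in> S" for x
  proof (cases "norm x \<le> b")
    case True then show ?thesis using B(2)[of x] that by simp
  next
    case False then show ?thesis using b[of x] that B(1) by simp
  qed
  then show ?thesis using that[of "B + 1"] B(1) by simp
qed

text \<open>
  The form of the hypotheses used in the analysis. \<open>D\<phi>\<close> is the velocity, continuous up to the
  surface, and \<open>H v\<close> is the gradient of its component along \<open>v\<close>; so \<open>H_sym\<close> states that second
  derivatives commute and \<open>harmonic\<close> that their trace vanishes. \<open>D\<nu> i\<close> is the gradient of the
  \<open>i\<close>-th component of \<open>\<nabla>\<eta> / sqrt (1 + |\<nabla>\<eta>|\<^sup>2)\<close>. The decay of second derivatives of \<open>\<eta>\<close> enters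
  only through the Taylor estimate \<open>eta_taylor\<close>.
\<close>

locale water_wave = C1_graph \<eta> D\<eta>
  for \<eta> :: "'a::euclidean_space \<Rightarrow> real" and D\<eta> +
  fixes \<phi> :: "'a \<times> real \<Rightarrow> real" and D\<phi> :: "'a \<times> real \<Rightarrow> 'a \<times> real"
    and H :: "'a \<times> real \<Rightarrow> 'a \<times> real \<Rightarrow> 'a \<times> real"
    and c :: 'a and D\<nu> :: "'a \<Rightarrow> 'a \<Rightarrow> 'a" and g \<sigma> \<epsilon> K :: real
  assumes phi: "C1_upto \<Omega> \<phi> D\<phi>"
    and Dphi: "\<And>v. C1_upto \<Omega> (\<lambda>x. D\<phi> x \<bullet> v) (H v)"
    and H_sym: "\<And>x v w. x \<in> \<Omega> \<Longrightarrow> H v x \<bullet> w = H w x \<bullet> v"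
    and harmonic: "\<And>x. x \<in> \<Omega> \<Longrightarrow> (\<Sum>b\<in>Basis. H b x \<bullet> b) = 0"
    and kinematic: "\<And>x. D\<phi> (surf x) \<bullet> nrm x = - (c \<bullet> D\<eta> x)"
    and dynamic: "\<And>x. 1/2 * (norm (D\<phi> (surf x)))\<^sup>2 - D\<phi> (surf x) \<bullet> (c, 0) + g * \<eta> x
        = \<sigma> * (\<Sum>i\<in>Basis. D\<nu> i x \<bullet> i)"
    and nu: "\<And>i x. i \<in> Basis \<Longrightarrow> GDERIV (\<lambda>x. (D\<eta> x \<bullet> i) / sqrt (1 + (norm (D\<eta> x))\<^sup>2)) x :> D\<nu> i x"
    and nu_cont: "\<And>i. i \<in> Basis \<Longrightarrow> continuous_on UNIV (D\<nu> i)"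
    and phi_lim: "((\<lambda>x. indicator (closure \<Omega>) x * \<phi> x) \<longlongrightarrow> 0) at_infinity"
    and phi_decay: "((\<lambda>x. indicator (closure \<Omega>) x * (\<phi> x * norm x ^ (DIM('a) - 1))) \<longlongrightarrow> 0) at_infinity"
    and eps_pos: "0 < \<epsilon>" and g_pos: "0 < g" and K_nonneg: "0 \<le> K"
    and eta_decay: "\<And>x. \<bar>\<eta> x\<bar> \<le> K * (1 + norm x) powr (- (real DIM('a) + \<epsilon>))"
    and Deta_decay: "\<And>x. norm (D\<eta> x) \<le> K * (1 + norm x) powr (- (real DIM('a) + 1 + \<epsilon>))"
    and eta_taylor: "\<And>x y. 1 \<le> norm y \<Longrightarrow> norm (x - y) \<le> norm y / 2 \<Longrightarrow>
        \<bar>\<eta> x - \<eta> y - D\<eta> x \<bullet> (x - y)\<bar> \<le> K * norm y powr (- (real DIM('a) + 2 + \<epsilon>)) * (norm (x - y))\<^sup>2"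
begin

definition \<psi> :: "'a \<Rightarrow> real" where "\<psi> x = \<phi> (surf x)"

lemma phi_cont: "continuous_on (closure \<Omega>) \<phi>" and Dphi_cont: "continuous_on (closure \<Omega>) D\<phi>"
  using phi by (auto simp: C1_upto_def)

lemma psi_cont: "continuous_on UNIV \<psi>"
  unfolding \<psi>_def by (intro continuous_on_surf phi_cont)

lemma psi_meas[measurable]: "\<psi> \<in> borel_measurable borel"
  by (rule borel_measurable_continuous_onI[OF psi_cont])

lemma phi_bounded: obtains M where "0 \<le> M" "\<And>x. x \<in> closure \<Omega> \<Longrightarrow> \<bar>\<phi> x\<bar> \<le> M"
  by (rule bounded_of_limit[OF closed_closure phi_cont phi_lim]) (rule that)

lemma phi_decay_bounded:
  obtains M where "0 \<le> M" "\<And>x. x \<in> closure \<Omega> \<Longrightarrow> \<bar>\<phi> x * norm x ^ (DIM('a) - 1)\<bar> \<le> M"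
proof (rule bounded_of_limit[OF closed_closure _ phi_decay])
  show "continuous_on (closure \<Omega>) (\<lambda>x. \<phi> x * norm x ^ (DIM('a) - 1))"
    by (intro continuous_intros phi_cont)
qed (rule that)

lemma psi_bounded: obtains M where "0 \<le> M" "\<And>x. \<bar>\<psi> x\<bar> \<le> M"
  using phi_bounded unfolding \<psi>_def by (metis surf_in_closure)

lemma eta_integrable: "integrable lborel \<eta>"
proof (rule Bochner_Integration.integrable_bound)
  show "integrable lborel (\<lambda>x::'a. K * (1 + norm x) powr (- (real DIM('a) + \<epsilon>)))"
    using integrable_decay[where 'a='a, of "real DIM('a) + \<epsilon>"] eps_pos by simp
  show "AE x in lborel. norm (\<eta> x) \<le> norm (K * (1 + norm x) powr (- (real DIM('a) + \<epsilon>)))"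
    using eta_decay K_nonneg by (intro AE_I2) (simp add: abs_mult)
qed simp

lemma norm_Deta_integrable: "integrable lborel (\<lambda>x. norm (D\<eta> x))"
proof (rule Bochner_Integration.integrable_bound)
  show "integrable lborel (\<lambda>x::'a. K * (1 + norm x) powr (- (real DIM('a) + 1 + \<epsilon>)))"
    using integrable_decay[where 'a='a, of "real DIM('a) + 1 + \<epsilon>"] eps_pos by simp
  show "AE x in lborel. norm (norm (D\<eta> x)) \<le> norm (K * (1 + norm x) powr (- (real DIM('a) + 1 + \<epsilon>)))"
    using Deta_decay K_nonneg by (intro AE_I2) (simp add: abs_mult)
qed simp

lemma bounded_Deta_integrable:
  assumes [measurable]: "w \<in> borel_measurable borel" and w: "\<And>x. \<bar>w x\<bar> \<le> M"
  shows "integrable lborel (\<lambda>x. w x * (D\<eta> x \<bullet> v))"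
proof (rule Bochner_Integration.integrable_bound)
  show "integrable lborel (\<lambda>x::'a. M * norm v * norm (D\<eta> x))"
    using norm_Deta_integrable by simp
  have "\<bar>w x\<bar> * \<bar>D\<eta> x \<bullet> v\<bar> \<le> M * (norm (D\<eta> x) * norm v)" for x
    using w[of x] by (intro mult_mono w Cauchy_Schwarz_ineq2) auto
  moreover have "0 \<le> M" using w[of 0] by linarith
  ultimately show "AE x in lborel. norm (w x * (D\<eta> x \<bullet> v)) \<le> norm (M * norm v * norm (D\<eta> x))"
    by (intro AE_I2) (simp add: abs_mult mult_ac)
qed simp

text \<open>
  Since \<open>\<phi>\<close> is harmonic, \<open>\<nabla>f \<bullet> \<nabla>\<phi>\<close> is the divergence of \<open>f \<nabla>\<phi>\<close>, whose flux is given by the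
  kinematic condition.
\<close>

lemma flux_phi:
  assumes "C1_upto \<Omega> f Df" and "\<And>x. x \<in> closure \<Omega> \<Longrightarrow> r \<le> norm x \<Longrightarrow> f x = 0"
  shows "integrable lborel (\<lambda>x. indicator \<Omega> x * (Df x \<bullet> D\<phi> x))"
    and "(\<integral>x. indicator \<Omega> x * (Df x \<bullet> D\<phi> x) \<partial>lborel) = - (\<integral>x. f (surf x) * (D\<eta> x \<bullet> c) \<partial>lborel)"
proof -
  have eq: "(\<lambda>x. indicator \<Omega> x * (f x * (\<Sum>b\<in>Basis. H b x \<bullet> b) + Df x \<bullet> D\<phi> x)) = (\<lambda>x. indicator \<Omega> x * (Df x \<bullet> D\<phi> x))"
    using harmonic by (auto simp: indicator_def fun_eq_iff)
  note fl = flux_of_product[where r=r, OF assms(1) Dphi disjI1[OF assms(2)], unfolded eq]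
  from fl(1) show "integrable lborel (\<lambda>x. indicator \<Omega> x * (Df x \<bullet> D\<phi> x))" by simp
  from fl(2) show "(\<integral>x. indicator \<Omega> x * (Df x \<bullet> D\<phi> x) \<partial>lborel) = - (\<integral>x. f (surf x) * (D\<eta> x \<bullet> c) \<partial>lborel)"
    unfolding kinematic by (simp add: inner_commute)
qed

lemma C1_bump: "C1_upto \<Omega> (bump m) (bump_grad m)"
  by (intro C1_uptoI GDERIV_bump continuous_bump_grad)

definition energy_flux :: real where "energy_flux = - (\<integral>x. \<psi> x * (D\<eta> x \<bullet> c) \<partial>lborel)"

lemma truncated_flux_tendsto:
  assumes [measurable]: "w \<in> borel_measurable borel" and w: "\<And>x. \<bar>w x\<bar> \<le> M"
  shows "((\<lambda>m. \<integral>x. bump m (surf x) * (w x * (D\<eta> x \<bullet> v)) \<partial>lborel) \<longlongrightarrow> (\<integral>x. w x * (D\<eta> x \<bullet> v) \<partial>lborel)) at_top"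
proof (rule integral_dominated_convergence_at_top[where w="\<lambda>x. \<bar>w x * (D\<eta> x \<bullet> v)\<bar>"])
  have [measurable]: "surf \<in> borel_measurable borel" by (rule borel_measurable_continuous_onI[OF continuous_surf])
  show "(\<lambda>x. bump m (surf x) * (w x * (D\<eta> x \<bullet> v))) \<in> borel_measurable lborel" for m by measurable
  show "integrable lborel (\<lambda>x. \<bar>w x * (D\<eta> x \<bullet> v)\<bar>)"
    using bounded_Deta_integrable[OF assms] by (rule integrable_abs)
  show "AE x in lborel. ((\<lambda>m. bump m (surf x) * (w x * (D\<eta> x \<bullet> v))) \<longlongrightarrow> w x * (D\<eta> x \<bullet> v)) at_top"
    by (intro AE_I2) (auto intro!: tendsto_eq_intros bump_tendsto)
  show "\<forall>\<^sub>F m in at_top. AE x in lborel. norm (bump m (surf x) * (w x * (D\<eta> x \<bullet> v))) \<le> \<bar>w x * (D\<eta> x \<bullet> v)\<bar>"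
    by (intro always_eventually allI AE_I2) (simp only: real_norm_def bump_mult_le)
qed measurable

text \<open>
  With \<open>\<phi>\<close> bounded and \<open>\<phi> = o(|x|\<^sup>2\<^sup>-\<^sup>n)\<close>, the square satisfies \<open>\<phi>\<^sup>2 = o(|x|\<^sup>2\<^sup>-\<^sup>n)\<close>, and the
  integral of \<open>|x|\<^sup>4\<^sup>-\<^sup>n\<close> over \<open>|x| < m\<close> is a multiple of \<open>m\<^sup>4\<close>. The left side bounds the
  error that the cutoff produces in the energy estimate.
\<close>

lemma phi_square_cesaro:
  "((\<lambda>m. \<integral>x. indicator \<Omega> x * (indicator (ball 0 m) x * (64 * (norm x)\<^sup>2 / (m\<^sup>2 * m\<^sup>2) * (\<phi> x)\<^sup>2)) \<partial>lborel) \<longlongrightarrow> 0) at_top"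
proof -
  let ?n = "real DIM('a \<times> real)"
  define e where "e x = indicator \<Omega> x * ((\<phi> x)\<^sup>2 * norm x ^ (DIM('a) - 1))" for x
  obtain M where M: "0 \<le> M" "\<And>x. x \<in> closure \<Omega> \<Longrightarrow> \<bar>\<phi> x\<bar> \<le> M" using phi_bounded by blast
  obtain M' where M': "0 \<le> M'" "\<And>x. x \<in> closure \<Omega> \<Longrightarrow> \<bar>\<phi> x * norm x ^ (DIM('a) - 1)\<bar> \<le> M'"
    using phi_decay_bounded by blast
  have e_eq: "e x = indicator \<Omega> x * (\<phi> x * (\<phi> x * norm x ^ (DIM('a) - 1)))" for x
    by (simp add: e_def power2_eq_square mult_ac)
  have em: "e \<in> borel_measurable borel"
  proof -
    have "(\<lambda>x. indicator \<Omega> x *\<^sub>R ((\<phi> x)\<^sup>2 * norm x ^ (DIM('a) - 1))) \<in> borel_measurable borel"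
      using continuous_on_subset[OF phi_cont closure_subset]
      by (intro borel_measurable_continuous_on_indicator continuous_intros) auto
    then show ?thesis unfolding e_def by simp
  qed
  have eb: "\<bar>e x\<bar> \<le> M * M'" for x
  proof (cases "x \<in> \<Omega>")
    case True
    then have "x \<in> closure \<Omega>" using closure_subset by blast
    then have "\<bar>\<phi> x\<bar> * \<bar>\<phi> x * norm x ^ (DIM('a) - 1)\<bar> \<le> M * M'"
      using M M' by (intro mult_mono) auto
    then show ?thesis using True unfolding e_eq by (simp add: abs_mult)
  qed (use M(1) M'(1) in \<open>simp add: e_eq\<close>)
  have "(e \<longlongrightarrow> 0) at_infinity"
  proof (rule Lim_null_comparison)
    show "\<forall>\<^sub>F x in at_infinity. norm (e x) \<le> M * \<bar>indicator (closure \<Omega>) x * (\<phi> x * norm x ^ (DIM('a) - 1))\<bar>"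
    proof (intro always_eventually allI)
      fix x
      have "\<bar>\<phi> x\<bar> * \<bar>\<phi> x * norm x ^ (DIM('a) - 1)\<bar> \<le> M * \<bar>\<phi> x * norm x ^ (DIM('a) - 1)\<bar>" if "x \<in> \<Omega>"
        using M(2)[of x] that closure_subset[of \<Omega>] by (intro mult_right_mono) auto
      then show "norm (e x) \<le> M * \<bar>indicator (closure \<Omega>) x * (\<phi> x * norm x ^ (DIM('a) - 1))\<bar>"
        using M(1) closure_subset[of \<Omega>] unfolding e_eq by (auto simp: indicator_def abs_mult)
    qed
    show "((\<lambda>x. M * \<bar>indicator (closure \<Omega>) x * (\<phi> x * norm x ^ (DIM('a) - 1))\<bar>) \<longlongrightarrow> 0) at_infinity"
      by (intro tendsto_mult_right_zero tendsto_rabs_zero phi_decay)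
  qed
  \<comment> \<open>\<open>|x|\<^sup>2 \<phi>\<^sup>2 = e x |x|\<^sup>4\<^sup>-\<^sup>n\<close>\<close>
  from cesaro_ball[OF em eb this, of "?n - 4"]
  have "((\<lambda>m. 64 * (m powr (- 4) * (\<integral>x. indicator (ball 0 m) x * (\<bar>e x\<bar> * norm x powr (- (?n - 4))) \<partial>lborel))) \<longlongrightarrow> 0) at_top"
    by (intro tendsto_mult_right_zero) simp
  then show ?thesis
  proof (rule Lim_transform_eventually)
    show "\<forall>\<^sub>F m in at_top. 64 * (m powr (- 4) * (\<integral>x. indicator (ball 0 m) x * (\<bar>e x\<bar> * norm x powr (- (?n - 4))) \<partial>lborel))
       = (\<integral>x. indicator \<Omega> x * (indicator (ball 0 m) x * (64 * (norm x)\<^sup>2 / (m\<^sup>2 * m\<^sup>2) * (\<phi> x)\<^sup>2)) \<partial>lborel)"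
      using eventually_gt_at_top[of 0]
    proof eventually_elim
      case (elim m)
      have m4: "m powr (- 4) = 1 / (m\<^sup>2 * m\<^sup>2)"
        using elim by (simp add: powr_minus inverse_eq_divide power2_eq_square)
          (simp add: powr_numeral power4_eq_xxxx)
      have "norm x ^ (DIM('a) - 1) * norm x powr (- (?n - 4)) = (norm x)\<^sup>2" if "x \<noteq> 0" for x :: "'a \<times> real"
      proof -
        have "norm x ^ (DIM('a) - 1) = norm x powr (real DIM('a) - 1)"
          using that by (subst powr_realpow[symmetric]) (auto simp: of_nat_diff Suc_leI)
        then have "norm x ^ (DIM('a) - 1) * norm x powr (- (?n - 4)) = norm x powr 2"
          by (simp add: powr_add[symmetric])
        then show ?thesis using that by simp
      qed
      then have eq: "64 * (1 / (m\<^sup>2 * m\<^sup>2)) * (indicator (ball 0 m) x * (\<bar>e x\<bar> * norm x powr (- (?n - 4))))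
         = indicator \<Omega> x * (indicator (ball 0 m) x * (64 * (norm x)\<^sup>2 / (m\<^sup>2 * m\<^sup>2) * (\<phi> x)\<^sup>2))" for x
        by (cases "x = 0") (auto simp: e_def indicator_def abs_mult mult_ac)
      have "64 * (m powr (- 4) * (\<integral>x. indicator (ball 0 m) x * (\<bar>e x\<bar> * norm x powr (- (?n - 4))) \<partial>lborel))
        = (\<integral>x. 64 * (1 / (m\<^sup>2 * m\<^sup>2)) * (indicator (ball 0 m) x * (\<bar>e x\<bar> * norm x powr (- (?n - 4)))) \<partial>lborel)"
        by (simp only: m4 integral_mult_right_zero mult.assoc)
      then show ?case by (simp only: eq)
    qed
  qed
qed

text \<open>
  Caccioppoli's inequality. Test the equation with \<open>bump m \<phi>\<close>. By Cauchy--Schwarz the term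
  with the gradient of the cutoff is at most half of the energy plus a multiple of
  \<open>m\<^sup>-\<^sup>4 \<integral> |x|\<^sup>2 \<phi>\<^sup>2\<close>, and the latter tends to zero. The factor \<open>8\<close> is \<open>2\<close> for the absorbed
  half times \<open>4\<close> for the lower bound \<open>1/4\<close> of the cutoff on the inner ball.
\<close>

lemma energy_bound:
  shows "integrable lborel (\<lambda>x. indicator (\<Omega> \<inter> ball 0 r) x * (norm (D\<phi> x))\<^sup>2)"
    and "(\<integral>x. indicator (\<Omega> \<inter> ball 0 r) x * (norm (D\<phi> x))\<^sup>2 \<partial>lborel) \<le> 8 * energy_flux"
proof -
  have int: "integrable lborel (\<lambda>x. indicator \<Omega> x * (bump m x * (norm (D\<phi> x))\<^sup>2))" if "0 < m" for m
    using that by (intro integrable_on_fluid[where r=m] continuous_intros Dphi_cont) (auto simp: bump_outside)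
  show ir: "integrable lborel (\<lambda>x. indicator (\<Omega> \<inter> ball 0 r) x * (norm (D\<phi> x))\<^sup>2)" for r
  proof -
    define m where "m = 2 * \<bar>r\<bar> + 1"
    have m: "0 < m" unfolding m_def by linarith
    show ?thesis
    proof (rule Bochner_Integration.integrable_bound)
      show "integrable lborel (\<lambda>x. 4 * (indicator \<Omega> x * (bump m x * (norm (D\<phi> x))\<^sup>2)))"
        using int[OF m] by simp
      have "(\<lambda>x. indicator (\<Omega> \<inter> ball 0 r) x *\<^sub>R (norm (D\<phi> x))\<^sup>2) \<in> borel_measurable borel"
        using continuous_on_subset[OF Dphi_cont, of "\<Omega> \<inter> ball 0 r"] closure_subset[of \<Omega>]
        by (intro borel_measurable_continuous_on_indicator continuous_intros) auto
      then show "(\<lambda>x. indicator (\<Omega> \<inter> ball 0 r) x * (norm (D\<phi> x))\<^sup>2) \<in> borel_measurable lborel" by simp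
      show "AE x in lborel. norm (indicator (\<Omega> \<inter> ball 0 r) x * (norm (D\<phi> x))\<^sup>2)
          \<le> norm (4 * (indicator \<Omega> x * (bump m x * (norm (D\<phi> x))\<^sup>2)))"
      proof (rule AE_I2)
        fix x :: "'a \<times> real"
        show "norm (indicator (\<Omega> \<inter> ball 0 r) x * (norm (D\<phi> x))\<^sup>2)
          \<le> norm (4 * (indicator \<Omega> x * (bump m x * (norm (D\<phi> x))\<^sup>2)))"
        proof (cases "norm x < r")
          case True
          have "1/4 \<le> bump m x" using True m by (intro bump_ge_half_ball) (auto simp: m_def)
          then have "1 * (norm (D\<phi> x))\<^sup>2 \<le> (4 * bump m x) * (norm (D\<phi> x))\<^sup>2"
            by (intro mult_right_mono) auto
          then show ?thesis by (auto simp: indicator_def abs_mult bump_nonneg)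
        qed (auto simp: indicator_def)
      qed
    qed
  qed
  have half_split: "1/2 * u \<le> u + t + 1/2 * s" if "\<bar>t\<bar> \<le> 1/2 * (u + s)" for t u s :: real
    using abs_ge_minus_self[of t] that by (simp add: field_simps)
  obtain M where M: "0 \<le> M" "\<And>x. \<bar>\<psi> x\<bar> \<le> M" using psi_bounded by blast
  let ?A = "\<lambda>m. - (\<integral>x. bump m (surf x) * (\<psi> x * (D\<eta> x \<bullet> c)) \<partial>lborel)"
  let ?w = "\<lambda>m x. 64 * (norm x)\<^sup>2 / (m\<^sup>2 * m\<^sup>2)"
  let ?B = "\<lambda>m. \<integral>x. indicator \<Omega> x * (indicator (ball 0 m) x * (?w m x * (\<phi> x)\<^sup>2)) \<partial>lborel"
  have lim: "((\<lambda>m. 8 * (?A m + 1/2 * ?B m)) \<longlongrightarrow> 8 * (energy_flux + 1/2 * 0)) at_top"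
    unfolding energy_flux_def
    by (intro tendsto_intros truncated_flux_tendsto[of _ M] phi_square_cesaro M) measurable
  have "\<forall>\<^sub>F m in at_top. (\<integral>x. indicator (\<Omega> \<inter> ball 0 r) x * (norm (D\<phi> x))\<^sup>2 \<partial>lborel) \<le> 8 * (?A m + 1/2 * ?B m)"
    using eventually_ge_at_top[of "2 * \<bar>r\<bar> + 1"]
  proof eventually_elim
    case (elim m)
    then have m: "0 < m" by linarith
    let ?D = "\<lambda>x. bump m x *\<^sub>R D\<phi> x + \<phi> x *\<^sub>R bump_grad m x"
    have fl: "integrable lborel (\<lambda>x. indicator \<Omega> x * (?D x \<bullet> D\<phi> x))"
       "(\<integral>x. indicator \<Omega> x * (?D x \<bullet> D\<phi> x) \<partial>lborel) = - (\<integral>x. (bump m (surf x) * \<phi> (surf x)) * (D\<eta> x \<bullet> c) \<partial>lborel)"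
      using flux_phi[OF C1_upto_mult[OF C1_bump[of m] phi], of m] bump_outside(1)[OF m] by auto
    \<comment> \<open>absorb the cutoff term with \<open>|bump_grad|\<^sup>2 \<le> bump ?v\<close>\<close>
    have ptw: "1/2 * (indicator \<Omega> x * (bump m x * (norm (D\<phi> x))\<^sup>2))
       \<le> indicator \<Omega> x * (?D x \<bullet> D\<phi> x) + 1/2 * (indicator \<Omega> x * (indicator (ball 0 m) x * (?w m x * (\<phi> x)\<^sup>2)))" for x
    proof -
      let ?u = "norm (D\<phi> x)" and ?s = "norm (bump_grad m x)" and ?v = "?w m x * indicator (ball 0 m) x"
      have "\<bar>\<phi> x * (bump_grad m x \<bullet> D\<phi> x)\<bar> \<le> \<bar>\<phi> x\<bar> * (?s * ?u)"
        unfolding abs_mult by (intro mult_left_mono Cauchy_Schwarz_ineq2) auto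
      also have "\<dots> \<le> \<bar>\<phi> x\<bar> * ((sqrt (bump m x) * sqrt ?v) * ?u)"
      proof (intro mult_left_mono mult_right_mono)
        have "?s \<le> sqrt (bump m x * ?v)" by (rule real_le_rsqrt[OF bump_grad_square_le[OF m]])
        then show "?s \<le> sqrt (bump m x) * sqrt ?v" by (simp only: real_sqrt_mult)
      qed auto
      also have "\<dots> = (sqrt (bump m x) * ?u) * (\<bar>\<phi> x\<bar> * sqrt ?v)" by (simp add: mult_ac)
      also have "\<dots> \<le> 1/2 * ((sqrt (bump m x) * ?u)\<^sup>2 + (\<bar>\<phi> x\<bar> * sqrt ?v)\<^sup>2)"
        using sum_squares_bound[of "sqrt (bump m x) * ?u" "\<bar>\<phi> x\<bar> * sqrt ?v"] by simp
      also have "\<dots> = 1/2 * (bump m x * ?u\<^sup>2 + \<phi> x ^ 2 * ?v)"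
        by (simp add: power_mult_distrib bump_nonneg)
      finally have "\<bar>\<phi> x * (bump_grad m x \<bullet> D\<phi> x)\<bar> \<le> 1/2 * (bump m x * ?u\<^sup>2 + \<phi> x ^ 2 * ?v)" .
      then have "1/2 * (bump m x * ?u\<^sup>2) \<le> bump m x * ?u\<^sup>2 + \<phi> x * (bump_grad m x \<bullet> D\<phi> x) + 1/2 * (\<phi> x ^ 2 * ?v)"
        by (rule half_split)
      then show ?thesis
        by (cases "x \<in> \<Omega>") (simp_all add: inner_add_left power2_norm_eq_inner[symmetric] mult_ac)
    qed
    have iw: "integrable lborel (\<lambda>x. indicator \<Omega> x * (indicator (ball 0 m) x * (?w m x * (\<phi> x)\<^sup>2)))"
    proof -
      have "integrable lborel (\<lambda>x. indicator (ball 0 m) x *\<^sub>R (indicator (closure \<Omega> \<inter> cball 0 m) x *\<^sub>R (?w m x * (\<phi> x)\<^sup>2)))"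
        by (intro integrable_mult_indicator[OF _ borel_integrable_compact])
          (use m in \<open>auto intro!: continuous_intros continuous_on_subset[OF phi_cont]\<close>)
      then have "integrable lborel (\<lambda>x. indicator \<Omega> x *\<^sub>R (indicator (ball 0 m) x *\<^sub>R (indicator (closure \<Omega> \<inter> cball 0 m) x *\<^sub>R (?w m x * (\<phi> x)\<^sup>2))))"
        by (rule integrable_mult_indicator[rotated]) simp
      also have "(\<lambda>x. indicator \<Omega> x *\<^sub>R (indicator (ball 0 m) x *\<^sub>R (indicator (closure \<Omega> \<inter> cball 0 m) x *\<^sub>R (?w m x * (\<phi> x)\<^sup>2))))
        = (\<lambda>x. indicator \<Omega> x * (indicator (ball 0 m) x * (?w m x * (\<phi> x)\<^sup>2)))"
        using closure_subset[of \<Omega>] by (auto simp: indicator_def fun_eq_iff)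
      finally show ?thesis .
    qed
    have "(\<integral>x. indicator (\<Omega> \<inter> ball 0 r) x * (norm (D\<phi> x))\<^sup>2 \<partial>lborel)
       \<le> (\<integral>x. 4 * (indicator \<Omega> x * (bump m x * (norm (D\<phi> x))\<^sup>2)) \<partial>lborel)"
    proof (rule integral_mono[OF ir])
      show "integrable lborel (\<lambda>x. 4 * (indicator \<Omega> x * (bump m x * (norm (D\<phi> x))\<^sup>2)))" using int[OF m] by simp
      fix x :: "'a \<times> real"
      show "indicator (\<Omega> \<inter> ball 0 r) x * (norm (D\<phi> x))\<^sup>2 \<le> 4 * (indicator \<Omega> x * (bump m x * (norm (D\<phi> x))\<^sup>2))"
      proof (cases "norm x < r")
        case True
        have "1/4 \<le> bump m x" using True m elim by (intro bump_ge_half_ball) auto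
        then have "1 * (norm (D\<phi> x))\<^sup>2 \<le> (4 * bump m x) * (norm (D\<phi> x))\<^sup>2"
          by (intro mult_right_mono) auto
        then show ?thesis using True by (auto simp: indicator_def)
      qed (auto simp: indicator_def bump_nonneg)
    qed
    also have "\<dots> = 8 * (\<integral>x. 1/2 * (indicator \<Omega> x * (bump m x * (norm (D\<phi> x))\<^sup>2)) \<partial>lborel)" by simp
    also have "\<dots> \<le> 8 * (\<integral>x. indicator \<Omega> x * (?D x \<bullet> D\<phi> x) + 1/2 * (indicator \<Omega> x * (indicator (ball 0 m) x * (?w m x * (\<phi> x)\<^sup>2))) \<partial>lborel)"
      by (intro mult_left_mono integral_mono ptw Bochner_Integration.integrable_add
          integrable_mult_right int[OF m] fl(1) iw) simp
    also have "\<dots> = 8 * (?A m + 1/2 * ?B m)"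
      using fl(2) Bochner_Integration.integral_add[OF fl(1) integrable_mult_right[OF iw, of "1/2"]]
      by (simp only: \<psi>_def mult.assoc integral_mult_right_zero)
    finally show ?case .
  qed
  from tendsto_lowerbound[OF lim this trivial_limit_at_top_linorder]
  show "(\<integral>x. indicator (\<Omega> \<inter> ball 0 r) x * (norm (D\<phi> x))\<^sup>2 \<partial>lborel) \<le> 8 * energy_flux" by simp
qed

end

section \<open>The displaced mass vanishes\<close>

lemma bump_hess_sym: "bump_hess m v x \<bullet> w = bump_hess m w x \<bullet> v"
  by (simp only: bump_hess_def inner_add_left inner_scaleR_left)
    (simp add: inner_commute[of v w] inner_commute[of x])

context water_wave
begin

lemma eta_bounded: "\<bar>\<eta> x\<bar> \<le> K" and Deta_bounded: "norm (D\<eta> x) \<le> K"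
proof -
  have le: "K * (1 + norm x) powr (- p) \<le> K" if "0 \<le> p" for p
  proof -
    have "(1 + norm x) powr (- p) \<le> (1 + norm x) powr 0" using that by (intro powr_mono) auto
    also have "\<dots> = 1" using norm_ge_zero[of x] by (simp add: add_nonneg_eq_0_iff)
    finally show ?thesis using mult_left_mono[OF _ K_nonneg] by fastforce
  qed
  show "\<bar>\<eta> x\<bar> \<le> K" using order_trans[OF eta_decay le] eps_pos by simp
  show "norm (D\<eta> x) \<le> K" using order_trans[OF Deta_decay le] eps_pos by simp
qed

abbreviation up :: "'a \<times> real" where "up \<equiv> (0, 1)"

lemma nrm_up: "nrm x \<bullet> up = 1"
  by (simp add: nrm_def)

lemma nrm_horizontal: "nrm x \<bullet> (v, 0) = - (D\<eta> x \<bullet> v)"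
  by (simp add: nrm_def)

lemma C1_bump_grad: "C1_upto \<Omega> (\<lambda>x. bump_grad m x \<bullet> v) (bump_hess m v)"
  by (intro C1_uptoI GDERIV_bump_grad continuous_bump_hess)

lemma surf_meas[measurable]: "surf \<in> borel_measurable borel"
  by (rule borel_measurable_continuous_onI[OF continuous_surf])

lemma integrable_bump_surf:
  fixes f :: "'a \<times> real \<Rightarrow> real"
  assumes "0 < m" "continuous_on (closure \<Omega>) f" "continuous_on UNIV w"
  shows "integrable lborel (\<lambda>x. bump m (surf x) * (f (surf x) * w x))"
  using integrable_on_surf[of "\<lambda>x. bump m x * f x" m w] assms
  by (simp add: bump_outside continuous_intros mult.assoc)

text \<open>
  The field \<open>1/2 |\<nabla>\<phi>|\<^sup>2 up - (\<nabla>\<phi> \<bullet> up) \<nabla>\<phi>\<close> is divergence free for harmonic \<open>\<phi>\<close>; it is the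
  Noether current of vertical translations. Its flux through the surface, localised by the
  cutoff, is the left side, and the right side is what the gradient of the cutoff contributes.
\<close>

lemma pohozaev_identity:
  assumes m: "0 < m"
  shows "(\<integral>x. bump m (surf x) * (1/2 * (norm (D\<phi> (surf x)))\<^sup>2) \<partial>lborel)
      + (\<integral>x. bump m (surf x) * ((D\<phi> (surf x) \<bullet> up) * (D\<eta> x \<bullet> c)) \<partial>lborel)
    = (\<integral>x. indicator \<Omega> x * (1/2 * (norm (D\<phi> x))\<^sup>2 * (bump_grad m x \<bullet> up)
        - (D\<phi> x \<bullet> up) * (bump_grad m x \<bullet> D\<phi> x)) \<partial>lborel)"
proof -
  let ?q = "\<lambda>x. 1/2 * (\<Sum>b\<in>Basis. (D\<phi> x \<bullet> b) * (D\<phi> x \<bullet> b))"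
  let ?Dq = "\<lambda>x. (1/2) *\<^sub>R (\<Sum>b\<in>Basis. (D\<phi> x \<bullet> b) *\<^sub>R H b x + (D\<phi> x \<bullet> b) *\<^sub>R H b x)"
  have q: "C1_upto \<Omega> ?q ?Dq" by (intro C1_upto_cmult C1_upto_sum C1_upto_mult Dphi)
  have q_eq: "?q x = 1/2 * (norm (D\<phi> x))\<^sup>2" for x
    by (simp add: power2_norm_eq_inner euclidean_inner[of "D\<phi> x" "D\<phi> x"])
  \<comment> \<open>symmetry of the second derivatives moves the vertical derivative onto one factor\<close>
  have Dq_up: "?Dq x \<bullet> up = D\<phi> x \<bullet> H up x" if "x \<in> \<Omega>" for x
  proof -
    have "?Dq x \<bullet> up = (\<Sum>b\<in>Basis. (D\<phi> x \<bullet> b) * (H b x \<bullet> up))"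
      by (simp add: inner_sum_left inner_add_left sum_distrib_left)
    also have "\<dots> = (\<Sum>b\<in>Basis. (D\<phi> x \<bullet> b) * (H up x \<bullet> b))"
      using H_sym[OF that, of _ up] by simp
    finally show ?thesis by (simp only: euclidean_inner[of "D\<phi> x" "H up x"])
  qed
  have z: "bump m x * y = 0" if "x \<in> closure \<Omega>" "m \<le> norm x" for x :: "'a \<times> real" and y using that m by (simp add: bump_outside)
  let ?D1 = "\<lambda>x. bump m x *\<^sub>R ?Dq x + ?q x *\<^sub>R bump_grad m x"
  let ?D2 = "\<lambda>x. bump m x *\<^sub>R H up x + (D\<phi> x \<bullet> up) *\<^sub>R bump_grad m x"
  have g1: "integrable lborel (\<lambda>x. indicator \<Omega> x * (?D1 x \<bullet> up))"
    "(\<integral>x. indicator \<Omega> x * (?D1 x \<bullet> up) \<partial>lborel) = (\<integral>x. bump m (surf x) * ?q (surf x) * (nrm x \<bullet> up) \<partial>lborel)"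
    using gradient_theorem[where r=m and v=up, OF C1_upto_mult[OF C1_bump[of m] q]] z by blast+
  have g2: "integrable lborel (\<lambda>x. indicator \<Omega> x * (?D2 x \<bullet> D\<phi> x))"
    "(\<integral>x. indicator \<Omega> x * (?D2 x \<bullet> D\<phi> x) \<partial>lborel)
      = - (\<integral>x. bump m (surf x) * (D\<phi> (surf x) \<bullet> up) * (D\<eta> x \<bullet> c) \<partial>lborel)"
    using flux_phi[where r=m, OF C1_upto_mult[OF C1_bump[of m] Dphi[of up]]] z by blast+
  have eq: "indicator \<Omega> x * (1/2 * (norm (D\<phi> x))\<^sup>2 * (bump_grad m x \<bullet> up)
        - (D\<phi> x \<bullet> up) * (bump_grad m x \<bullet> D\<phi> x))
     = indicator \<Omega> x * ((bump m x *\<^sub>R ?Dq x + ?q x *\<^sub>R bump_grad m x) \<bullet> up)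
      - indicator \<Omega> x * ((bump m x *\<^sub>R H up x + (D\<phi> x \<bullet> up) *\<^sub>R bump_grad m x) \<bullet> D\<phi> x)" for x
  proof (cases "x \<in> \<Omega>")
    case True
    have "(bump m x *\<^sub>R ?Dq x + ?q x *\<^sub>R bump_grad m x) \<bullet> up
      = bump m x * (D\<phi> x \<bullet> H up x) + 1/2 * (norm (D\<phi> x))\<^sup>2 * (bump_grad m x \<bullet> up)"
      by (simp only: inner_add_left inner_scaleR_left Dq_up[OF True, simplified] Dq_up[OF True] q_eq)
    moreover have "(bump m x *\<^sub>R H up x + (D\<phi> x \<bullet> up) *\<^sub>R bump_grad m x) \<bullet> D\<phi> x
      = bump m x * (D\<phi> x \<bullet> H up x) + (D\<phi> x \<bullet> up) * (bump_grad m x \<bullet> D\<phi> x)"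
      by (simp only: inner_add_left inner_scaleR_left inner_commute[of "H up x" "D\<phi> x"])
    ultimately show ?thesis using True by simp
  qed simp
  have "(\<integral>x. indicator \<Omega> x * (1/2 * (norm (D\<phi> x))\<^sup>2 * (bump_grad m x \<bullet> up)
        - (D\<phi> x \<bullet> up) * (bump_grad m x \<bullet> D\<phi> x)) \<partial>lborel)
    = (\<integral>x. bump m (surf x) * ?q (surf x) * (nrm x \<bullet> up) \<partial>lborel)
      - - (\<integral>x. bump m (surf x) * (D\<phi> (surf x) \<bullet> up) * (D\<eta> x \<bullet> c) \<partial>lborel)"
    unfolding eq g1(2)[symmetric] g2(2)[symmetric] by (rule Bochner_Integration.integral_diff[OF g1(1) g2(1)])
  then show ?thesis unfolding nrm_up q_eq by (simp add: mult.assoc)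
qed

text \<open>
  The defect is at most a constant times \<open>1/m\<close> times the energy, and the energy is finite.
\<close>

lemma pohozaev_defect_tendsto:
  "((\<lambda>m. \<integral>x. indicator \<Omega> x * (1/2 * (norm (D\<phi> x))\<^sup>2 * (bump_grad m x \<bullet> up)
        - (D\<phi> x \<bullet> up) * (bump_grad m x \<bullet> D\<phi> x)) \<partial>lborel) \<longlongrightarrow> 0) at_top"
proof (rule Lim_null_comparison)
  show "\<forall>\<^sub>F m in at_top. norm (\<integral>x. indicator \<Omega> x * (1/2 * (norm (D\<phi> x))\<^sup>2 * (bump_grad m x \<bullet> up)
        - (D\<phi> x \<bullet> up) * (bump_grad m x \<bullet> D\<phi> x)) \<partial>lborel) \<le> 12 / m * (8 * energy_flux)"
    using eventually_gt_at_top[of 0]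
  proof eventually_elim
    case (elim m)
    have "norm (\<integral>x. indicator \<Omega> x * (1/2 * (norm (D\<phi> x))\<^sup>2 * (bump_grad m x \<bullet> up)
        - (D\<phi> x \<bullet> up) * (bump_grad m x \<bullet> D\<phi> x)) \<partial>lborel)
      \<le> (\<integral>x. 12 / m * (indicator (\<Omega> \<inter> ball 0 m) x * (norm (D\<phi> x))\<^sup>2) \<partial>lborel)"
    proof (rule Bochner_Integration.integral_norm_bound_integral)
      show "integrable lborel (\<lambda>x. 12 / m * (indicator (\<Omega> \<inter> ball 0 m) x * (norm (D\<phi> x))\<^sup>2))"
        by (intro integrable_mult_right energy_bound)
      show "integrable lborel (\<lambda>x. indicator \<Omega> x * (1/2 * (norm (D\<phi> x))\<^sup>2 * (bump_grad m x \<bullet> up)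
        - (D\<phi> x \<bullet> up) * (bump_grad m x \<bullet> D\<phi> x)))"
        using elim by (intro integrable_on_fluid[where r=m] continuous_intros Dphi_cont) (auto simp: bump_outside)
      fix x :: "'a \<times> real"
      let ?u = "norm (D\<phi> x)"
      have up: "norm up = 1" by (simp add: norm_Pair)
      have k: "norm (bump_grad m x) \<le> 8 / m" by (rule bump_grad_le_const[OF elim])
      have a: "\<bar>bump_grad m x \<bullet> up\<bar> \<le> 8 / m"
        using Cauchy_Schwarz_ineq2[of "bump_grad m x" up] k up by simp
      have b: "\<bar>D\<phi> x \<bullet> up\<bar> \<le> ?u" using Cauchy_Schwarz_ineq2[of "D\<phi> x" up] up by simp
      have c: "\<bar>bump_grad m x \<bullet> D\<phi> x\<bar> \<le> 8 / m * ?u"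
        using order_trans[OF Cauchy_Schwarz_ineq2[of "bump_grad m x" "D\<phi> x"] mult_right_mono[OF k]] by simp
      have "\<bar>1/2 * ?u\<^sup>2 * (bump_grad m x \<bullet> up) - (D\<phi> x \<bullet> up) * (bump_grad m x \<bullet> D\<phi> x)\<bar>
         \<le> \<bar>1/2 * ?u\<^sup>2 * (bump_grad m x \<bullet> up)\<bar> + \<bar>(D\<phi> x \<bullet> up) * (bump_grad m x \<bullet> D\<phi> x)\<bar>"
        by (rule abs_triangle_ineq4)
      also have "\<dots> \<le> 1/2 * ?u\<^sup>2 * (8 / m) + ?u * (8 / m * ?u)"
        unfolding abs_mult by (intro add_mono mult_mono a b c) (use elim in auto)
      also have "\<dots> = 12 / m * ?u\<^sup>2" by (simp add: power2_eq_square)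
      finally have "\<bar>1/2 * ?u\<^sup>2 * (bump_grad m x \<bullet> up) - (D\<phi> x \<bullet> up) * (bump_grad m x \<bullet> D\<phi> x)\<bar> \<le> 12 / m * ?u\<^sup>2" .
      moreover have "bump_grad m x = 0" if "\<not> norm x < m" using that elim by (simp add: bump_outside)
      ultimately show "norm (indicator \<Omega> x * (1/2 * (norm (D\<phi> x))\<^sup>2 * (bump_grad m x \<bullet> up)
        - (D\<phi> x \<bullet> up) * (bump_grad m x \<bullet> D\<phi> x))) \<le> 12 / m * (indicator (\<Omega> \<inter> ball 0 m) x * (norm (D\<phi> x))\<^sup>2)"
        by (cases "norm x < m") (auto simp: indicator_def)
    qed
    also have "\<dots> \<le> 12 / m * (8 * energy_flux)"
      unfolding integral_mult_right_zero using energy_bound(2)[of m] elim by (intro mult_left_mono) auto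
    finally show ?case .
  qed
  show "((\<lambda>m. 12 / m * (8 * energy_flux)) \<longlongrightarrow> 0) at_top"
    by (intro tendsto_mult_left_zero tendsto_divide_0[OF tendsto_const] filterlim_at_top_imp_at_infinity filterlim_ident)
qed

text \<open>
  The field \<open>F = \<nabla>(bump m \<phi>)\<close> is curl free, so \<open>\<partial>\<^sub>u\<^sub>p\<close> of its \<open>c\<close>-component and \<open>\<partial>\<^sub>c\<close> of its
  vertical component agree in the fluid. Integrating both by the gradient theorem equates two
  surface integrals.
\<close>

lemma curl_identity:
  assumes m: "0 < m"
  shows "(\<integral>x. bump m (surf x) * ((D\<phi> (surf x) \<bullet> up) * (D\<eta> x \<bullet> c)) \<partial>lborel)
      + (\<integral>x. bump m (surf x) * (D\<phi> (surf x) \<bullet> (c, 0)) \<partial>lborel)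
    = - (\<integral>x. \<psi> x * (bump_grad m (surf x) \<bullet> (c, D\<eta> x \<bullet> c)) \<partial>lborel)"
proof -
  let ?F = "\<lambda>v x. bump m x * (D\<phi> x \<bullet> v) + \<phi> x * (bump_grad m x \<bullet> v)"
  let ?DF = "\<lambda>v x. (bump m x *\<^sub>R H v x + (D\<phi> x \<bullet> v) *\<^sub>R bump_grad m x)
      + (\<phi> x *\<^sub>R bump_hess m v x + (bump_grad m x \<bullet> v) *\<^sub>R D\<phi> x)"
  have F: "C1_upto \<Omega> (?F v) (?DF v)" for v
    by (intro C1_upto_add C1_upto_mult C1_bump C1_bump_grad phi Dphi)
  have z: "?F v x = 0" if "x \<in> closure \<Omega>" "m \<le> norm x" for x v using that m by (simp add: bump_outside)
  \<comment> \<open>the derivative matrix of \<open>F\<close> is the Hessian of \<open>bump m \<phi>\<close>\<close>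
  have sym: "?DF v x \<bullet> w = ?DF w x \<bullet> v" if "x \<in> \<Omega>" for x v w
    using H_sym[OF that, of v w] bump_hess_sym[of m v x w]
    by (simp add: inner_add_left mult.commute)
  let ?c = "(c, 0) :: 'a \<times> real"
  have "(\<integral>x. ?F up (surf x) * (nrm x \<bullet> ?c) \<partial>lborel) = (\<integral>x. indicator \<Omega> x * (?DF up x \<bullet> ?c) \<partial>lborel)"
    by (rule gradient_theorem(2)[OF F z, symmetric])
  also have "(\<lambda>x. indicator \<Omega> x * (?DF up x \<bullet> ?c)) = (\<lambda>x. indicator \<Omega> x * (?DF ?c x \<bullet> up))"
    using sym by (intro ext) (simp add: indicator_def del: inner_Pair)
  also have "(\<integral>x. indicator \<Omega> x * (?DF ?c x \<bullet> up) \<partial>lborel) = (\<integral>x. ?F ?c (surf x) * (nrm x \<bullet> up) \<partial>lborel)"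
    by (rule gradient_theorem(2)[OF F z])
  finally have main: "(\<integral>x. ?F up (surf x) * (nrm x \<bullet> ?c) \<partial>lborel) = (\<integral>x. ?F ?c (surf x) * (nrm x \<bullet> up) \<partial>lborel)" .
  have cD: "continuous_on UNIV (\<lambda>x. D\<eta> x \<bullet> c)" by (intro continuous_intros Deta_cont)
  have cb: "continuous_on UNIV (\<lambda>x. bump_grad m (surf x))"
    by (rule continuous_on_compose2[OF continuous_bump_grad[of UNIV] continuous_surf]) simp
  have i1: "integrable lborel (\<lambda>x. bump m (surf x) * ((D\<phi> (surf x) \<bullet> up) * (D\<eta> x \<bullet> c)))"
    by (rule integrable_bump_surf[OF m]) (intro continuous_intros Dphi_cont cD)+
  have i2: "integrable lborel (\<lambda>x. bump m (surf x) * (D\<phi> (surf x) \<bullet> ?c))"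
    using integrable_bump_surf[OF m, of "\<lambda>x. D\<phi> x \<bullet> ?c" "\<lambda>x. 1"] Dphi_cont by (simp add: continuous_intros)
  have i3: "integrable lborel (\<lambda>x. \<psi> x * (bump_grad m (surf x) \<bullet> v) * w x)" if "continuous_on UNIV w" for v w
  proof (rule integrable_compact_support[where r=m])
    show "continuous_on UNIV (\<lambda>x. \<psi> x * (bump_grad m (surf x) \<bullet> v) * w x)"
      by (intro continuous_intros psi_cont cb that)
    show "\<psi> x * (bump_grad m (surf x) \<bullet> v) * w x = 0" if "m < norm x" for x
      using that m norm_le_norm_surf[of x] by (simp add: bump_outside)
  qed
  have i4: "integrable lborel (\<lambda>x. \<psi> x * (bump_grad m (surf x) \<bullet> up) * (D\<eta> x \<bullet> c))" by (rule i3[OF cD])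
  have i5: "integrable lborel (\<lambda>x. \<psi> x * (bump_grad m (surf x) \<bullet> ?c))"
    using i3[of "\<lambda>_. 1" ?c] by simp
  have l: "(\<integral>x. ?F up (surf x) * (nrm x \<bullet> ?c) \<partial>lborel)
      = - (\<integral>x. bump m (surf x) * ((D\<phi> (surf x) \<bullet> up) * (D\<eta> x \<bullet> c)) \<partial>lborel)
        - (\<integral>x. \<psi> x * (bump_grad m (surf x) \<bullet> up) * (D\<eta> x \<bullet> c) \<partial>lborel)"
    unfolding nrm_horizontal integral_minus[symmetric]
    by (subst Bochner_Integration.integral_diff[symmetric])
      (use i1 i4 in \<open>auto simp: \<psi>_def algebra_simps simp del: inner_Pair intro!: Bochner_Integration.integral_cong\<close>)
  have r: "(\<integral>x. ?F ?c (surf x) * (nrm x \<bullet> up) \<partial>lborel)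
      = (\<integral>x. bump m (surf x) * (D\<phi> (surf x) \<bullet> ?c) \<partial>lborel)
        + (\<integral>x. \<psi> x * (bump_grad m (surf x) \<bullet> ?c) \<partial>lborel)"
    unfolding nrm_up using Bochner_Integration.integral_add[OF i2 i5] by (simp add: \<psi>_def del: inner_Pair)
  have s: "bump_grad m (surf x) \<bullet> (c, D\<eta> x \<bullet> c)
     = bump_grad m (surf x) \<bullet> ?c + (bump_grad m (surf x) \<bullet> up) * (D\<eta> x \<bullet> c)" for x
    by (simp add: inner_prod_def)
  have t: "(\<integral>x. \<psi> x * (bump_grad m (surf x) \<bullet> (c, D\<eta> x \<bullet> c)) \<partial>lborel)
     = (\<integral>x. \<psi> x * (bump_grad m (surf x) \<bullet> ?c) \<partial>lborel)
        + (\<integral>x. \<psi> x * (bump_grad m (surf x) \<bullet> up) * (D\<eta> x \<bullet> c) \<partial>lborel)"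
    unfolding s using Bochner_Integration.integral_add[OF i5 i4]
    by (simp only: distrib_left mult.assoc)
  show ?thesis using main unfolding l r t by linarith
qed

lemma psi_decay: "((\<lambda>x. \<psi> x * norm x ^ (DIM('a) - 1)) \<longlongrightarrow> 0) at_infinity"
proof (rule Lim_null_comparison)
  have "filterlim surf at_infinity at_infinity"
    by (rule filterlim_norm_at_top_imp_at_infinity, rule filterlim_at_top_mono[OF filterlim_norm_at_top])
      (simp add: norm_le_norm_surf)
  from filterlim_compose[OF phi_decay this]
  have "((\<lambda>x. \<phi> (surf x) * norm (surf x) ^ (DIM('a) - 1)) \<longlongrightarrow> 0) at_infinity" by simp
  then show "((\<lambda>x. \<bar>\<phi> (surf x) * norm (surf x) ^ (DIM('a) - 1)\<bar>) \<longlongrightarrow> 0) at_infinity"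
    by (rule tendsto_rabs_zero)
  show "\<forall>\<^sub>F x in at_infinity. norm (\<psi> x * norm x ^ (DIM('a) - 1)) \<le> \<bar>\<phi> (surf x) * norm (surf x) ^ (DIM('a) - 1)\<bar>"
    by (intro always_eventually allI)
      (auto simp: \<psi>_def abs_mult intro!: mult_left_mono power_mono norm_le_norm_surf)
qed

text \<open>
  On the surface \<open>bump_grad m\<close> is of size \<open>|x|/m\<^sup>2\<close>, and \<open>\<psi> = o(|x|\<^sup>1\<^sup>-\<^sup>d)\<close>, so the main part
  is an average of a function that tends to zero; the part with the vertical component of the
  surface point carries the integrable factor \<open>\<nabla>\<eta>\<close>.
\<close>

lemma curl_defect_tendsto:
  "((\<lambda>m. \<integral>x. \<psi> x * (bump_grad m (surf x) \<bullet> (c, D\<eta> x \<bullet> c)) \<partial>lborel) \<longlongrightarrow> 0) at_top"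
proof -
  let ?d = "real DIM('a)"
  obtain M where M: "0 \<le> M" "\<And>x. \<bar>\<psi> x\<bar> \<le> M" using psi_bounded by blast
  obtain M' where M': "\<And>x. \<bar>\<psi> x * norm x ^ (DIM('a) - 1)\<bar> \<le> M'"
  proof -
    have "continuous_on UNIV (\<lambda>x. \<psi> x * norm x ^ (DIM('a) - 1))" by (intro continuous_intros psi_cont)
    from bounded_of_limit[OF closed_UNIV this] psi_decay that show thesis by auto
  qed
  let ?e = "\<lambda>x. \<psi> x * norm x ^ (DIM('a) - 1)"
  let ?I = "\<lambda>m. m powr ((?d - 2) - ?d) * (\<integral>x. indicator (ball 0 m) x * (\<bar>?e x\<bar> * norm x powr (- (?d - 2))) \<partial>lborel)"
  have I: "(?I \<longlongrightarrow> 0) at_top" by (rule cesaro_ball[OF _ M' psi_decay]) auto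
  have e_eq: "\<bar>?e x\<bar> * norm x powr (- (?d - 2)) = \<bar>\<psi> x\<bar> * norm x" for x
  proof (cases "x = 0")
    case False
    have "norm x ^ (DIM('a) - 1) = norm x powr (?d - 1)"
      using False by (subst powr_realpow[symmetric]) (auto simp: of_nat_diff Suc_leI)
    then have "norm x ^ (DIM('a) - 1) * norm x powr (- (?d - 2)) = norm x powr 1"
      by (simp add: powr_add[symmetric])
    then show ?thesis using False by (simp add: abs_mult mult.assoc)
  qed simp
  have I_eq: "?I m = 1 / m\<^sup>2 * (\<integral>x. indicator (ball 0 m) x * (\<bar>\<psi> x\<bar> * norm x) \<partial>lborel)" if "0 < m" for m
    unfolding e_eq using that by (simp add: powr_minus divide_inverse powr_numeral)
  let ?J = "\<integral>x. \<bar>(\<psi> x * \<eta> x) * (D\<eta> x \<bullet> c)\<bar> \<partial>lborel"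
  have psieta: "\<bar>\<psi> x * \<eta> x\<bar> \<le> M * K" for x
    using M eta_bounded by (auto simp: abs_mult intro!: mult_mono)
  have iJ: "integrable lborel (\<lambda>x. \<bar>(\<psi> x * \<eta> x) * (D\<eta> x \<bullet> c)\<bar>)"
    by (intro integrable_abs bounded_Deta_integrable[OF _ psieta]) measurable
  show ?thesis
  proof (rule Lim_null_comparison)
    show "\<forall>\<^sub>F m in at_top. norm (\<integral>x. \<psi> x * (bump_grad m (surf x) \<bullet> (c, D\<eta> x \<bullet> c)) \<partial>lborel)
       \<le> 8 * norm c * ?I m + 8 / m\<^sup>2 * ?J"
      using eventually_gt_at_top[of 0]
    proof eventually_elim
      case (elim m)
      have ip: "integrable lborel (\<lambda>x. indicator (ball 0 m) x * (\<bar>\<psi> x\<bar> * norm x))"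
      proof -
        have "integrable lborel (\<lambda>x. indicator (ball 0 m) x *\<^sub>R (indicator (cball 0 m) x *\<^sub>R (\<bar>\<psi> x\<bar> * norm x)))"
          by (intro integrable_mult_indicator[OF _ borel_integrable_compact])
            (auto intro!: continuous_intros continuous_on_subset[OF psi_cont])
        also have "(\<lambda>x. indicator (ball 0 m) x *\<^sub>R (indicator (cball 0 m) x *\<^sub>R (\<bar>\<psi> x\<bar> * norm x)))
           = (\<lambda>x. indicator (ball 0 m) x * (\<bar>\<psi> x\<bar> * norm x))" by (auto simp: indicator_def fun_eq_iff)
        finally show ?thesis .
      qed
      have "norm (\<integral>x. \<psi> x * (bump_grad m (surf x) \<bullet> (c, D\<eta> x \<bullet> c)) \<partial>lborel)
        \<le> (\<integral>x. 8 * norm c / m\<^sup>2 * (indicator (ball 0 m) x * (\<bar>\<psi> x\<bar> * norm x)) + 8 / m\<^sup>2 * \<bar>(\<psi> x * \<eta> x) * (D\<eta> x \<bullet> c)\<bar> \<partial>lborel)"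
      proof (rule Bochner_Integration.integral_norm_bound_integral)
        show "integrable lborel (\<lambda>x. \<psi> x * (bump_grad m (surf x) \<bullet> (c, D\<eta> x \<bullet> c)))"
        proof (rule integrable_compact_support[where r=m])
          show "continuous_on UNIV (\<lambda>x. \<psi> x * (bump_grad m (surf x) \<bullet> (c, D\<eta> x \<bullet> c)))"
            by (intro continuous_intros psi_cont Deta_cont continuous_on_compose2[OF continuous_bump_grad[of UNIV] continuous_surf]) auto
          show "\<psi> x * (bump_grad m (surf x) \<bullet> (c, D\<eta> x \<bullet> c)) = 0" if "m < norm x" for x
            using that elim norm_le_norm_surf[of x] by (simp add: bump_outside)
        qed
        show "integrable lborel (\<lambda>x. 8 * norm c / m\<^sup>2 * (indicator (ball 0 m) x * (\<bar>\<psi> x\<bar> * norm x)) + 8 / m\<^sup>2 * \<bar>(\<psi> x * \<eta> x) * (D\<eta> x \<bullet> c)\<bar>)"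
          by (intro Bochner_Integration.integrable_add integrable_mult_right ip iJ)
        fix x :: 'a
        show "norm (\<psi> x * (bump_grad m (surf x) \<bullet> (c, D\<eta> x \<bullet> c)))
          \<le> 8 * norm c / m\<^sup>2 * (indicator (ball 0 m) x * (\<bar>\<psi> x\<bar> * norm x)) + 8 / m\<^sup>2 * \<bar>(\<psi> x * \<eta> x) * (D\<eta> x \<bullet> c)\<bar>"
        proof (cases "norm x < m")
          case True
          define k where "k = - 8 / m\<^sup>2 * max 0 (1 - (norm (surf x))\<^sup>2 / m\<^sup>2) ^ 3"
          have k: "\<bar>k\<bar> \<le> 8 / m\<^sup>2"
          proof -
            have "max 0 (1 - (norm (surf x))\<^sup>2 / m\<^sup>2) ^ 3 \<le> 1" by (intro power_le_one) auto
            then have "8 / m\<^sup>2 * max 0 (1 - (norm (surf x))\<^sup>2 / m\<^sup>2) ^ 3 \<le> 8 / m\<^sup>2 * 1"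
              by (intro mult_left_mono) auto
            then show ?thesis unfolding k_def by (simp add: abs_mult)
          qed
          have "bump_grad m (surf x) \<bullet> (c, D\<eta> x \<bullet> c) = k * (x \<bullet> c + \<eta> x * (D\<eta> x \<bullet> c))"
            unfolding bump_grad_def k_def[symmetric] by (simp add: surf_def distrib_left)
          then have "norm (\<psi> x * (bump_grad m (surf x) \<bullet> (c, D\<eta> x \<bullet> c)))
            = \<bar>k\<bar> * (\<bar>\<psi> x\<bar> * \<bar>x \<bullet> c + \<eta> x * (D\<eta> x \<bullet> c)\<bar>)" by (simp add: abs_mult mult_ac)
          also have "\<dots> \<le> 8 / m\<^sup>2 * (\<bar>\<psi> x\<bar> * (norm x * norm c + \<bar>\<eta> x * (D\<eta> x \<bullet> c)\<bar>))"
            using Cauchy_Schwarz_ineq2[of x c]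
            by (intro mult_mono k mult_left_mono order_trans[OF abs_triangle_ineq]) auto
          also have "\<dots> = 8 * norm c / m\<^sup>2 * (\<bar>\<psi> x\<bar> * norm x) + 8 / m\<^sup>2 * \<bar>(\<psi> x * \<eta> x) * (D\<eta> x \<bullet> c)\<bar>"
            by (simp add: abs_mult algebra_simps add_divide_distrib)
          finally show ?thesis using True by simp
        next
          case False
          then have "bump_grad m (surf x) = 0"
            using elim norm_le_norm_surf[of x] by (intro bump_outside) auto
          then show ?thesis using False by simp
        qed
      qed
      also have "\<dots> = 8 * norm c * ?I m + 8 / m\<^sup>2 * ?J"
        unfolding I_eq[OF elim]
        by (subst Bochner_Integration.integral_add[OF integrable_mult_right[OF ip] integrable_mult_right[OF iJ]])
          (simp only: integral_mult_right_zero, simp)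
      finally show ?case .
    qed
    have "((\<lambda>m. 8 / m\<^sup>2) \<longlongrightarrow> 0) (at_top :: real filter)"
      by (intro tendsto_divide_0[OF tendsto_const] filterlim_at_top_imp_at_infinity filterlim_pow_at_top filterlim_ident) auto
    then have "((\<lambda>m. 8 * norm c * ?I m + 8 / m\<^sup>2 * ?J) \<longlongrightarrow> 8 * norm c * 0 + 0 * ?J) at_top"
      by (intro tendsto_intros I)
    then show "((\<lambda>m. 8 * norm c * ?I m + 8 / m\<^sup>2 * ?J) \<longlongrightarrow> 0) at_top" by simp
  qed
qed

text \<open>
  The integrand is a divergence of a vector field bounded by \<open>|\<nabla>\<eta>|\<close>, which is integrable.
  After integration by parts the cutoff contributes at most \<open>8/m\<close>.
\<close>

lemma surface_tension_tendsto:
  "((\<lambda>m. \<integral>x. bump m (surf x) * (\<Sum>i\<in>Basis. D\<nu> i x \<bullet> i) \<partial>lborel) \<longlongrightarrow> 0) at_top"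
proof -
  define \<nu> where "\<nu> i x = (D\<eta> x \<bullet> i) / sqrt (1 + (norm (D\<eta> x))\<^sup>2)" for i x
  let ?Db = "\<lambda>m x. fst (bump_grad m (surf x)) + snd (bump_grad m (surf x)) *\<^sub>R D\<eta> x"
  have nu_le: "\<bar>\<nu> i x\<bar> \<le> norm (D\<eta> x)" if "i \<in> Basis" for i x
  proof -
    let ?s = "sqrt (1 + (norm (D\<eta> x))\<^sup>2)"
    have a: "\<bar>D\<eta> x \<bullet> i\<bar> \<le> norm (D\<eta> x)" by (rule Basis_le_norm[OF that])
    have "\<bar>D\<eta> x \<bullet> i\<bar> / ?s \<le> norm (D\<eta> x) / 1" by (rule frac_le[OF _ a]) auto
    then show ?thesis by (simp add: \<nu>_def)
  qed
  have dnu: "GDERIV (\<nu> i) x :> D\<nu> i x" if "i \<in> Basis" for i x using nu[OF that] unfolding \<nu>_def .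
  have cnu: "continuous_on UNIV (\<nu> i)" if "i \<in> Basis" for i by (rule GDERIV_imp_cont[OF dnu[OF that]])
  \<comment> \<open>chain rule along the graph\<close>
  have dS: "GDERIV (\<lambda>x. bump m (surf x)) x :> ?Db m x" for m x
  proof -
    have "(surf has_derivative (\<lambda>h. (h, D\<eta> x \<bullet> h))) (at x)"
      using eta_deriv[of x] unfolding gderiv_inner surf_def[abs_def] by (auto intro!: derivative_eq_intros)
    moreover have "(bump m has_derivative inner (bump_grad m (surf x))) (at (surf x))"
      using GDERIV_bump[of m "surf x"] by (simp add: gderiv_inner)
    ultimately have "((\<lambda>x. bump m (surf x)) has_derivative (\<lambda>h. bump_grad m (surf x) \<bullet> (h, D\<eta> x \<bullet> h))) (at x)"
      by (rule has_derivative_compose)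
    moreover have "(\<lambda>h. bump_grad m (surf x) \<bullet> (h, D\<eta> x \<bullet> h)) = inner (?Db m x)"
      by (auto simp: inner_prod_def inner_add_left)
    ultimately show ?thesis by (simp add: gderiv_inner)
  qed
  have cDb: "continuous_on UNIV (?Db m)" for m
    by (intro continuous_intros Deta_cont continuous_on_compose2[OF continuous_bump_grad[of UNIV] continuous_surf]) auto
  have cb: "continuous_on UNIV (\<lambda>x. bump m (surf x))" for m
    by (rule continuous_on_compose2[OF continuous_bump[of UNIV] continuous_surf]) simp
  have single: "((\<lambda>m. \<integral>x. bump m (surf x) * (D\<nu> i x \<bullet> i) \<partial>lborel) \<longlongrightarrow> 0) at_top" if i: "i \<in> Basis" for i
  proof (rule Lim_null_comparison)
    show "\<forall>\<^sub>F m in at_top. norm (\<integral>x. bump m (surf x) * (D\<nu> i x \<bullet> i) \<partial>lborel)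
        \<le> 8 / m * ((1 + K) * (\<integral>x. norm (D\<eta> x) \<partial>lborel))"
      using eventually_gt_at_top[of 0]
    proof eventually_elim
      case (elim m)
      have z: "bump m (surf x) = 0" "?Db m x = 0" if "m \<le> norm x" for x
        using that elim norm_le_norm_surf[of x] by (auto simp: bump_outside)
      have i1: "integrable lborel (\<lambda>x. bump m (surf x) * (D\<nu> i x \<bullet> i))"
        by (rule integrable_compact_support[where r=m]) (use z in \<open>auto intro!: continuous_intros cb nu_cont i\<close>)
      have i2: "integrable lborel (\<lambda>x. \<nu> i x * (?Db m x \<bullet> i))"
        using z by (intro integrable_compact_support[where r=m] continuous_intros cDb cnu i) (simp del: fst_add)
      have "(\<integral>x. (bump m (surf x) *\<^sub>R D\<nu> i x + \<nu> i x *\<^sub>R ?Db m x) \<bullet> i \<partial>lborel) = 0"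
      proof (rule integral_gradient_compact_support[where r=m and f="\<lambda>x. bump m (surf x) * \<nu> i x"])
        show "GDERIV (\<lambda>x. bump m (surf x) * \<nu> i x) x :> bump m (surf x) *\<^sub>R D\<nu> i x + \<nu> i x *\<^sub>R ?Db m x" for x
          by (intro GDERIV_mult dS dnu i)
        show "continuous_on UNIV (\<lambda>x. bump m (surf x) *\<^sub>R D\<nu> i x + \<nu> i x *\<^sub>R ?Db m x)"
          by (intro continuous_on_add continuous_on_scaleR cb nu_cont cnu cDb i)
      qed (simp add: z)
      then have "(\<integral>x. bump m (surf x) * (D\<nu> i x \<bullet> i) \<partial>lborel) = - (\<integral>x. \<nu> i x * (?Db m x \<bullet> i) \<partial>lborel)"
        using Bochner_Integration.integral_add[OF i1 i2] by (simp add: inner_add_left)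
      then have "norm (\<integral>x. bump m (surf x) * (D\<nu> i x \<bullet> i) \<partial>lborel) = norm (\<integral>x. \<nu> i x * (?Db m x \<bullet> i) \<partial>lborel)"
        by simp
      also have "\<dots> \<le> (\<integral>x. 8 / m * ((1 + K) * norm (D\<eta> x)) \<partial>lborel)"
      proof (rule Bochner_Integration.integral_norm_bound_integral[OF i2])
        show "integrable lborel (\<lambda>x. 8 / m * ((1 + K) * norm (D\<eta> x)))"
          by (intro integrable_mult_right norm_Deta_integrable)
        fix x :: 'a
        let ?k = "bump_grad m (surf x)"
        have k: "norm ?k \<le> 8 / m" by (rule bump_grad_le_const[OF elim])
        have "norm (fst ?k) \<le> 8 / m" "\<bar>snd ?k\<bar> \<le> 8 / m"
          using k norm_fst_le[of "fst ?k" "snd ?k"] norm_snd_le[of "snd ?k" "fst ?k"] by auto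
        then have "norm (?Db m x) \<le> 8 / m + 8 / m * K"
          using Deta_bounded[of x] elim
          mult_mono[of "\<bar>snd ?k\<bar>" "8 / m" "norm (D\<eta> x)" K]
          by (intro order_trans[OF norm_triangle_ineq] add_mono) auto
        then have "\<bar>?Db m x \<bullet> i\<bar> \<le> 8 / m * (1 + K)"
          using Basis_le_norm[OF i, of "?Db m x"] by (simp add: distrib_left)
        then have "\<bar>\<nu> i x\<bar> * \<bar>?Db m x \<bullet> i\<bar> \<le> norm (D\<eta> x) * (8 / m * (1 + K))"
          by (intro mult_mono nu_le i) auto
        also have "\<dots> = 8 / m * ((1 + K) * norm (D\<eta> x))" by (simp only: mult_ac)
        finally show "norm (\<nu> i x * (?Db m x \<bullet> i)) \<le> 8 / m * ((1 + K) * norm (D\<eta> x))"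
          by (simp only: real_norm_def abs_mult)
      qed
      finally show ?case by (simp only: integral_mult_right_zero)
    qed
    show "((\<lambda>m. 8 / m * ((1 + K) * (\<integral>x. norm (D\<eta> x) \<partial>lborel))) \<longlongrightarrow> 0) at_top"
      by (intro tendsto_mult_left_zero tendsto_divide_0[OF tendsto_const] filterlim_at_top_imp_at_infinity filterlim_ident)
  qed
  have "((\<lambda>m. \<Sum>i\<in>Basis. \<integral>x. bump m (surf x) * (D\<nu> i x \<bullet> i) \<partial>lborel) \<longlongrightarrow> (\<Sum>i\<in>(Basis::'a set). 0)) at_top"
    by (intro tendsto_sum single)
  then have "((\<lambda>m. \<Sum>i\<in>Basis. \<integral>x. bump m (surf x) * (D\<nu> i x \<bullet> i) \<partial>lborel) \<longlongrightarrow> 0) at_top" by simp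
  then show ?thesis
  proof (rule Lim_transform_eventually)
    show "\<forall>\<^sub>F m in at_top. (\<Sum>i\<in>Basis. \<integral>x. bump m (surf x) * (D\<nu> i x \<bullet> i) \<partial>lborel)
       = (\<integral>x. bump m (surf x) * (\<Sum>i\<in>Basis. D\<nu> i x \<bullet> i) \<partial>lborel)"
      using eventually_gt_at_top[of 0]
    proof eventually_elim
      case (elim m)
      have "integrable lborel (\<lambda>x. bump m (surf x) * (D\<nu> i x \<bullet> i))" if "i \<in> Basis" for i
        using elim norm_le_norm_surf
        by (intro integrable_compact_support[where r=m] continuous_intros cb nu_cont that)
          (metis bump_outside(1) less_imp_le mult_eq_0_iff order_trans)
      then show ?case
        unfolding sum_distrib_left by (rule Bochner_Integration.integral_sum[symmetric])
    qed
  qed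
qed

text \<open>
  Integrate the Bernoulli condition against the cutoff. Subtracting the identities above shows
  that \<open>\<integral> (1/2 |\<nabla>\<phi>|\<^sup>2 - c \<bullet> \<nabla>\<phi>)\<close> equals the sum of their two defects, and the surface tension
  drops out as well; what remains is \<open>g \<integral> \<eta> = 0\<close>.
\<close>

lemma total_mass_zero: "(\<integral>x. \<eta> x \<partial>lborel) = 0"
proof -
  let ?P = "\<lambda>m. \<integral>x. indicator \<Omega> x * (1/2 * (norm (D\<phi> x))\<^sup>2 * (bump_grad m x \<bullet> up)
        - (D\<phi> x \<bullet> up) * (bump_grad m x \<bullet> D\<phi> x)) \<partial>lborel"
  let ?Z = "\<lambda>m. \<integral>x. \<psi> x * (bump_grad m (surf x) \<bullet> (c, D\<eta> x \<bullet> c)) \<partial>lborel"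
  let ?T = "\<lambda>m. \<integral>x. bump m (surf x) * (\<Sum>i\<in>Basis. D\<nu> i x \<bullet> i) \<partial>lborel"
  have eq: "g * (\<integral>x. bump m (surf x) * \<eta> x \<partial>lborel) = \<sigma> * ?T m - (?P m + ?Z m)" if m: "0 < m" for m
  proof -
    let ?A = "\<lambda>x. bump m (surf x) * (1/2 * (norm (D\<phi> (surf x)))\<^sup>2)"
    let ?B = "\<lambda>x. bump m (surf x) * (D\<phi> (surf x) \<bullet> (c, 0))"
    have cN: "continuous_on (closure \<Omega>) (\<lambda>x. 1/2 * (norm (D\<phi> x))\<^sup>2)" by (intro continuous_intros Dphi_cont)
    have cC: "continuous_on (closure \<Omega>) (\<lambda>x. D\<phi> x \<bullet> (c, 0))" by (intro continuous_intros Dphi_cont)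
    have iA: "integrable lborel ?A"
      using integrable_bump_surf[OF m cN continuous_on_const[of UNIV 1]] by simp
    have iB: "integrable lborel ?B"
      using integrable_bump_surf[OF m cC continuous_on_const[of UNIV 1]] by simp
    have iE: "integrable lborel (\<lambda>x. bump m (surf x) * \<eta> x)"
      using integrable_bump_surf[OF m continuous_on_const[of "closure \<Omega>" 1] eta_cont] by simp
    have "\<sigma> * ?T m = (\<integral>x. bump m (surf x) * (\<sigma> * (\<Sum>i\<in>Basis. D\<nu> i x \<bullet> i)) \<partial>lborel)"
      by (simp add: mult.left_commute)
    also have "\<dots> = (\<integral>x. (?A x - ?B x) + g * (bump m (surf x) * \<eta> x) \<partial>lborel)"
      unfolding dynamic[symmetric] by (simp add: algebra_simps del: inner_Pair)
    also have "\<dots> = ((\<integral>x. ?A x \<partial>lborel) - (\<integral>x. ?B x \<partial>lborel)) + g * (\<integral>x. bump m (surf x) * \<eta> x \<partial>lborel)"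
      unfolding Bochner_Integration.integral_add[OF Bochner_Integration.integrable_diff[OF iA iB] integrable_mult_right[OF iE]]
        Bochner_Integration.integral_diff[OF iA iB] integral_mult_right_zero by (rule refl)
    finally show ?thesis using pohozaev_identity[OF m] curl_identity[OF m] by linarith
  qed
  have "((\<lambda>m. \<sigma> * ?T m - (?P m + ?Z m)) \<longlongrightarrow> \<sigma> * 0 - (0 + 0)) at_top"
    by (intro tendsto_intros surface_tension_tendsto pohozaev_defect_tendsto curl_defect_tendsto)
  then have "((\<lambda>m. \<sigma> * ?T m - (?P m + ?Z m)) \<longlongrightarrow> 0) at_top" by simp
  then have "((\<lambda>m. g * (\<integral>x. bump m (surf x) * \<eta> x \<partial>lborel)) \<longlongrightarrow> 0) at_top"
  proof (rule Lim_transform_eventually)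
    show "\<forall>\<^sub>F m in at_top. \<sigma> * ?T m - (?P m + ?Z m) = g * (\<integral>x. bump m (surf x) * \<eta> x \<partial>lborel)"
      using eventually_gt_at_top[of 0] by eventually_elim (simp only: eq)
  qed
  moreover have "((\<lambda>m. g * (\<integral>x. bump m (surf x) * \<eta> x \<partial>lborel)) \<longlongrightarrow> g * (\<integral>x. \<eta> x \<partial>lborel)) at_top"
  proof (intro tendsto_mult_left integral_dominated_convergence_at_top[where w="\<lambda>x. \<bar>\<eta> x\<bar>"])
    show "AE x in lborel. ((\<lambda>m. bump m (surf x) * \<eta> x) \<longlongrightarrow> \<eta> x) at_top"
      by (intro AE_I2) (auto intro!: tendsto_eq_intros bump_tendsto)
    show "\<forall>\<^sub>F m in at_top. AE x in lborel. norm (bump m (surf x) * \<eta> x) \<le> \<bar>\<eta> x\<bar>"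
      by (intro always_eventually allI AE_I2) (simp only: real_norm_def bump_mult_le)
  qed (use eta_integrable in auto)
  ultimately have "g * (\<integral>x. \<eta> x \<partial>lborel) = 0"
    using tendsto_unique[OF trivial_limit_at_top_linorder] by blast
  then show ?thesis using g_pos by simp
qed

end

section \<open>Green's identity at a surface point\<close>

lemma square_powr: "0 \<le> t \<Longrightarrow> (t\<^sup>2) powr a = t powr (2 * a)" for t :: real
proof (cases "t = 0")
  case False
  assume "0 \<le> t"
  then have "t\<^sup>2 = t powr 2" using False by simp
  then show ?thesis by (simp only: powr_powr)
qed simp

text \<open>
  As functions of the squared distance \<open>s\<close>, these are the first two derivatives of a
  regularised fundamental solution. Without the last factor and without \<open>1/m\<^sup>2\<close>,
  \<open>kernel_deriv\<close> is \<open>1/2 s\<^sup>-\<^sup>n\<^sup>/\<^sup>2\<close>, and the gradient of the corresponding radial function is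
  \<open>x / |x|\<^sup>n\<close> in every dimension, logarithmic or not. The shift by \<open>1/m\<^sup>2\<close> smooths the
  singularity, while the factor with the positive part truncates at distance \<open>m\<close>. One
  parameter governs both.
\<close>

definition kernel_deriv :: "real \<Rightarrow> real \<Rightarrow> real \<Rightarrow> real" where
  "kernel_deriv n m s = 1/2 * (s + 1/m\<^sup>2) powr (- n/2) * max 0 (1 - s/m\<^sup>2) ^ 2"

definition kernel_deriv2 :: "real \<Rightarrow> real \<Rightarrow> real \<Rightarrow> real" where
  "kernel_deriv2 n m s = - (n/4) * (s + 1/m\<^sup>2) powr (- n/2 - 1) * max 0 (1 - s/m\<^sup>2) ^ 2
     - (s + 1/m\<^sup>2) powr (- n/2) * max 0 (1 - s/m\<^sup>2) / m\<^sup>2"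

text \<open>
  The primitive that vanishes for \<open>s \<ge> m\<^sup>2\<close>. The integral starts at a negative point so that
  \<open>s = 0\<close> is an interior point and the derivative there is two-sided; at \<open>- 1/(2 m\<^sup>2)\<close> the
  base \<open>s + 1/m\<^sup>2\<close> is still positive.
\<close>

definition kernel :: "real \<Rightarrow> real \<Rightarrow> real \<Rightarrow> real" where
  "kernel n m s = integral {- (1/(2 * m\<^sup>2))..s} (kernel_deriv n m)
     - integral {- (1/(2 * m\<^sup>2))..m\<^sup>2} (kernel_deriv n m)"

lemma kernel_base_pos: "0 < m \<Longrightarrow> - (1/(2 * m\<^sup>2)) \<le> s \<Longrightarrow> 0 < s + 1/(m::real)\<^sup>2"
proof -
  assume m: "0 < m" and s: "- (1/(2 * m\<^sup>2)) \<le> s"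
  have "1/(2 * m\<^sup>2) < 1/m\<^sup>2" using m by (simp add: field_simps)
  then show ?thesis using s by linarith
qed

lemma kernel_deriv_continuous:
  assumes "0 < m" shows "continuous_on {- (1/(2 * m\<^sup>2))..} (kernel_deriv n m)"
  unfolding kernel_deriv_def using assms kernel_base_pos[OF assms]
  by (intro continuous_intros) (auto simp: less_imp_neq[symmetric])

lemma kernel_deriv2_continuous:
  assumes "0 < m" shows "continuous_on {- (1/(2 * m\<^sup>2))..} (kernel_deriv2 n m)"
  unfolding kernel_deriv2_def using assms kernel_base_pos[OF assms]
  by (intro continuous_intros) (auto simp: less_imp_neq[symmetric])

lemma kernel_has_deriv:
  assumes m: "0 < m" and s: "0 \<le> s"
  shows "(kernel n m has_real_derivative kernel_deriv n m s) (at s)"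
proof -
  let ?a = "- (1/(2 * m\<^sup>2))"
  have a: "?a < 0" using m by simp
  have "((\<lambda>u. integral {?a..u} (kernel_deriv n m)) has_vector_derivative kernel_deriv n m s) (at s within {?a..s+1})"
    using s order_trans[OF less_imp_le[OF a] s]
    by (intro integral_has_vector_derivative continuous_on_subset[OF kernel_deriv_continuous[OF m]]) auto
  then have "((\<lambda>u. integral {?a..u} (kernel_deriv n m)) has_vector_derivative kernel_deriv n m s) (at s)"
    using s less_le_trans[OF a s] by (subst (asm) at_within_interior) auto
  then have "((\<lambda>u. integral {?a..u} (kernel_deriv n m)) has_real_derivative kernel_deriv n m s) (at s)"
    by (simp add: has_real_derivative_iff_has_vector_derivative)
  then show ?thesis
    unfolding kernel_def[abs_def] by (auto intro!: derivative_eq_intros)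
qed

lemma kernel_deriv_has_deriv:
  assumes m: "0 < m" and s: "0 \<le> s"
  shows "(kernel_deriv n m has_real_derivative kernel_deriv2 n m s) (at s)"
proof -
  have p: "0 < s + 1/m\<^sup>2" using m s by (intro add_nonneg_pos) auto
  have 1: "((\<lambda>s. s + 1/m\<^sup>2) has_real_derivative 1 + 0) (at s)"
    by (intro DERIV_add DERIV_ident DERIV_const)
  have 2: "((\<lambda>s. (s + 1/m\<^sup>2) powr (- n/2)) has_real_derivative (- n/2) * (s + 1/m\<^sup>2) powr (- n/2 - 1)) (at s)"
    using DERIV_fun_powr[OF 1 p, of "- n/2"] by simp
  have 3: "((\<lambda>s. 1 - s/m\<^sup>2) has_real_derivative 0 - 1/m\<^sup>2) (at s)"
    by (intro DERIV_diff DERIV_const DERIV_cdivide DERIV_ident)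
  have 4: "((\<lambda>s. max 0 (1 - s/m\<^sup>2) ^ 2) has_real_derivative 2 * max 0 (1 - s/m\<^sup>2) * (0 - 1/m\<^sup>2)) (at s)"
    using DERIV_chain2[OF positive_part_power_deriv[of 0] 3] by (simp add: numeral_2_eq_2)
  show ?thesis
    unfolding kernel_deriv_def[abs_def] kernel_deriv2_def
    by (rule DERIV_cong[OF DERIV_mult[OF DERIV_cmult[OF 2, of "1/2"] 4]]) (simp add: field_simps)
qed

lemma kernel_deriv_outside: "0 < m \<Longrightarrow> m\<^sup>2 \<le> s \<Longrightarrow> kernel_deriv n m s = 0 \<and> kernel_deriv2 n m s = 0"
  by (simp add: kernel_deriv_def kernel_deriv2_def max_def field_simps)

lemma kernel_outside:
  assumes m: "0 < m" and s: "m\<^sup>2 \<le> s" shows "kernel n m s = 0"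
proof -
  let ?a = "- (1/(2 * m\<^sup>2))"
  have a: "?a < 0" "0 < m\<^sup>2" using m by auto
  have "kernel_deriv n m integrable_on {?a..s}"
    using a s by (intro integrable_continuous_real continuous_on_subset[OF kernel_deriv_continuous[OF m]]) auto
  then have "integral {?a..m\<^sup>2} (kernel_deriv n m) + integral {m\<^sup>2..s} (kernel_deriv n m) = integral {?a..s} (kernel_deriv n m)"
    using s less_trans[OF a] by (intro Henstock_Kurzweil_Integration.integral_combine) (auto intro: less_imp_le)
  moreover have "integral {m\<^sup>2..s} (kernel_deriv n m) = integral {m\<^sup>2..s} (\<lambda>_. 0)"
    using kernel_deriv_outside[OF m] by (intro Henstock_Kurzweil_Integration.integral_cong) auto
  ultimately show ?thesis unfolding kernel_def by simp
qed

lemma kernel_deriv_nonneg: "0 \<le> kernel_deriv n m s"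
  by (simp add: kernel_deriv_def)

lemma kernel_deriv_le:
  assumes "0 < m" "0 < s" "0 \<le> n" shows "kernel_deriv n m s \<le> 1/2 * s powr (- n/2)"
proof (cases "s < m\<^sup>2")
  case True
  have "(s + 1/m\<^sup>2) powr (- n/2) \<le> s powr (- n/2)"
    using assms by (intro powr_mono2') auto
  moreover have "max 0 (1 - s/m\<^sup>2) ^ 2 \<le> 1" using assms by (intro power_le_one) auto
  ultimately have "(s + 1/m\<^sup>2) powr (- n/2) * max 0 (1 - s/m\<^sup>2) ^ 2 \<le> s powr (- n/2) * 1"
    by (intro mult_mono) auto
  then show ?thesis by (simp add: kernel_deriv_def)
qed (use assms kernel_deriv_outside[of m s n] in auto)

text \<open>
  The Laplacian of the radial function with profile \<open>kernel n m\<close> is \<open>2 n k' + 4 s k''\<close>. Its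
  first term concentrates at the centre as \<open>m\<close> grows; the second is the error made by
  truncating.
\<close>

definition kernel_laplacian :: "real \<Rightarrow> real \<Rightarrow> real \<Rightarrow> real" where
  "kernel_laplacian n m s = n/m\<^sup>2 * (s + 1/m\<^sup>2) powr (- n/2 - 1) * max 0 (1 - s/m\<^sup>2) ^ 2
     - 4 * s * (s + 1/m\<^sup>2) powr (- n/2) * max 0 (1 - s/m\<^sup>2) / m\<^sup>2"

lemma kernel_laplacian_eq:
  assumes "0 < m" "0 \<le> s"
  shows "2 * n * kernel_deriv n m s + 4 * s * kernel_deriv2 n m s = kernel_laplacian n m s"
proof -
  have p: "0 < s + 1/m\<^sup>2" using assms by (intro add_nonneg_pos) auto
  have "(s + 1/m\<^sup>2) powr (- n/2) = (s + 1/m\<^sup>2) powr (- n/2 - 1) * (s + 1/m\<^sup>2)"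
    using p by (simp add: powr_diff)
  then have e: "2 * n * kernel_deriv n m s = n * ((s + 1/m\<^sup>2) powr (- n/2 - 1) * (s + 1/m\<^sup>2)) * max 0 (1 - s/m\<^sup>2) ^ 2"
    by (simp add: kernel_deriv_def)
  show ?thesis unfolding e kernel_deriv2_def kernel_laplacian_def
    by (simp add: algebra_simps)
qed

definition green_test :: "real \<Rightarrow> 'a::euclidean_space \<Rightarrow> 'a \<Rightarrow> real" where
  "green_test m a x = kernel (real DIM('a)) m ((norm (x - a))\<^sup>2)"

definition green_test_grad :: "real \<Rightarrow> 'a::euclidean_space \<Rightarrow> 'a \<Rightarrow> 'a" where
  "green_test_grad m a x = (2 * kernel_deriv (real DIM('a)) m ((norm (x - a))\<^sup>2)) *\<^sub>R (x - a)"

definition green_test_hess :: "real \<Rightarrow> 'a::euclidean_space \<Rightarrow> 'a \<Rightarrow> 'a \<Rightarrow> 'a" where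
  "green_test_hess m a v x = (2 * kernel_deriv (real DIM('a)) m ((norm (x - a))\<^sup>2)) *\<^sub>R v
     + (((x - a) \<bullet> v) * (4 * kernel_deriv2 (real DIM('a)) m ((norm (x - a))\<^sup>2))) *\<^sub>R (x - a)"

lemma GDERIV_green_test:
  assumes "0 < m" shows "GDERIV (green_test m a) x :> green_test_grad m a x"
  unfolding green_test_def[abs_def] green_test_grad_def
  by (rule GDERIV_radial[OF kernel_has_deriv[OF assms]]) simp

lemma GDERIV_green_test_grad:
  assumes "0 < m" shows "GDERIV (\<lambda>x. green_test_grad m a x \<bullet> v) x :> green_test_hess m a v x"
proof -
  let ?k = "kernel_deriv (real DIM('a)) m" and ?k2 = "kernel_deriv2 (real DIM('a)) m"
  have 1: "GDERIV (\<lambda>x. ?k ((norm (x - a))\<^sup>2)) x :> (2 * ?k2 ((norm (x - a))\<^sup>2)) *\<^sub>R (x - a)"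
    by (rule GDERIV_radial[OF kernel_deriv_has_deriv[OF assms]]) simp
  have 2: "GDERIV (\<lambda>x. 2 * ((x - a) \<bullet> v)) x :> 2 *\<^sub>R v"
    unfolding gderiv_def by (auto intro!: derivative_eq_intros)
  show ?thesis
    using GDERIV_mult[OF 2 1] unfolding green_test_grad_def green_test_hess_def
    by (simp add: mult_ac add.commute)
qed

lemma continuous_kernel_norm:
  assumes "0 < m"
  shows "continuous_on S (\<lambda>x. kernel_deriv n m ((norm (x - a))\<^sup>2))"
    "continuous_on S (\<lambda>x. kernel_deriv2 n m ((norm (x - a))\<^sup>2))"
proof -
  have "- (1/(2 * m\<^sup>2)) \<le> (norm (x - a))\<^sup>2" for x
    by (rule order_trans[of _ 0]) auto
  then show "continuous_on S (\<lambda>x. kernel_deriv n m ((norm (x - a))\<^sup>2))"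
    "continuous_on S (\<lambda>x. kernel_deriv2 n m ((norm (x - a))\<^sup>2))"
    by (auto intro!: continuous_on_compose2[OF kernel_deriv_continuous[OF assms]]
        continuous_on_compose2[OF kernel_deriv2_continuous[OF assms]] continuous_intros)
qed

lemma green_test_continuous:
  assumes "0 < m"
  shows "continuous_on S (green_test_grad m a)" "continuous_on S (green_test_hess m a v)"
    "continuous_on S (green_test m a)"
proof -
  show "continuous_on S (green_test m a)" by (rule GDERIV_imp_cont[OF GDERIV_green_test[OF assms]])
qed (auto simp: green_test_grad_def[abs_def] green_test_hess_def[abs_def]
    intro!: continuous_intros continuous_kernel_norm assms)

lemma green_test_outside:
  assumes "0 < m" "m + norm a \<le> norm x"
  shows "green_test m a x = 0" "green_test_grad m a x = 0" "green_test_hess m a v x = 0"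
proof -
  have "m \<le> norm (x - a)" using assms norm_triangle_ineq2[of x a] by linarith
  then have "m\<^sup>2 \<le> (norm (x - a))\<^sup>2" using assms by (intro power_mono) auto
  then show "green_test m a x = 0" "green_test_grad m a x = 0" "green_test_hess m a v x = 0"
    using assms kernel_outside kernel_deriv_outside
    by (auto simp: green_test_def green_test_grad_def green_test_hess_def)
qed

lemma green_test_laplacian:
  fixes a x :: "'a::euclidean_space"
  assumes "0 < m"
  shows "(\<Sum>b\<in>Basis. green_test_hess m a b x \<bullet> b)
    = kernel_laplacian (real DIM('a)) m ((norm (x - a))\<^sup>2)"
proof -
  let ?k = "kernel_deriv (real DIM('a)) m ((norm (x - a))\<^sup>2)" and ?k2 = "kernel_deriv2 (real DIM('a)) m ((norm (x - a))\<^sup>2)"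
  have "(\<Sum>b\<in>Basis. green_test_hess m a b x \<bullet> b)
     = (\<Sum>b\<in>(Basis::'a set). 2 * ?k + 4 * ?k2 * (((x - a) \<bullet> b) * ((x - a) \<bullet> b)))"
    unfolding green_test_hess_def
    by (intro sum.cong refl) (simp add: inner_add_left mult_ac)
  also have "\<dots> = 2 * real DIM('a) * ?k + 4 * ?k2 * ((x - a) \<bullet> (x - a))"
    unfolding sum.distrib sum_distrib_left[symmetric] euclidean_inner[of "x - a" "x - a"] by simp
  also have "\<dots> = kernel_laplacian (real DIM('a)) m ((norm (x - a))\<^sup>2)"
    unfolding power2_norm_eq_inner[symmetric]
    by (subst kernel_laplacian_eq[symmetric]) (use assms in auto)
  finally show ?thesis .
qed

text \<open>
  Reflection exchanges the two half spaces, and the hyperplane between them is a null set.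
\<close>

lemma even_half_space_integral:
  fixes h :: "'b::euclidean_space \<Rightarrow> real"
  assumes h: "integrable lborel h" and even: "\<And>y. h (- y) = h y" and w: "w \<noteq> 0"
  shows "(\<integral>y. indicator {y. w \<bullet> y < 0} y * h y \<partial>lborel) = 1/2 * (\<integral>y. h y \<partial>lborel)"
    and "AE y in lborel. w \<bullet> y \<noteq> 0"
proof -
  have [measurable]: "h \<in> borel_measurable borel" using h by auto
  have s[measurable]: "{y. w \<bullet> y < 0} \<in> sets borel" "{y. w \<bullet> y > 0} \<in> sets borel" "{y. w \<bullet> y = 0} \<in> sets borel"
    by (auto intro!: borel_open borel_closed open_Collect_less closed_Collect_eq continuous_intros)
  have "negligible {y. w \<bullet> y = 0}" by (rule negligible_hyperplane) (use w in auto)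
  then have "{y. w \<bullet> y = 0} \<in> null_sets lebesgue" by (simp add: negligible_iff_null_sets)
  then have "{y. w \<bullet> y = 0} \<in> null_sets lborel" using s(3) by (auto simp: null_sets_def)
  then show ae: "AE y in lborel. w \<bullet> y \<noteq> 0" by (rule AE_I') auto
  have i1: "integrable lborel (\<lambda>y. indicator {y. w \<bullet> y < 0} y * h y)"
    and i2: "integrable lborel (\<lambda>y. indicator {y. w \<bullet> y > 0} y * h y)"
    using integrable_mult_indicator[OF _ h, of "{y. w \<bullet> y < 0}"] integrable_mult_indicator[OF _ h, of "{y. w \<bullet> y > 0}"] by auto
  have "(\<integral>y. indicator {y. w \<bullet> y < 0} y * h y \<partial>lborel) = (\<integral>y. indicator {y. w \<bullet> y < 0} (0 + (-1) *\<^sub>R y) * h (0 + (-1) *\<^sub>R y) \<partial>lborel)"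
    by (subst lborel_integral_affine[of "-1" _ 0]) auto
  also have "\<dots> = (\<integral>y. indicator {y. w \<bullet> y > 0} y * h y \<partial>lborel)"
    by (intro Bochner_Integration.integral_cong refl) (auto simp: even indicator_def)
  finally have eq: "(\<integral>y. indicator {y. w \<bullet> y < 0} y * h y \<partial>lborel) = (\<integral>y. indicator {y. w \<bullet> y > 0} y * h y \<partial>lborel)" .
  have "(\<integral>y. h y \<partial>lborel) = (\<integral>y. indicator {y. w \<bullet> y < 0} y * h y + indicator {y. w \<bullet> y > 0} y * h y \<partial>lborel)"
  proof (rule integral_cong_AE)
    show "AE y in lborel. h y = indicator {y. w \<bullet> y < 0} y * h y + indicator {y. w \<bullet> y > 0} y * h y"
      using ae by eventually_elim (auto simp: indicator_def)
  qed measurable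
  also have "\<dots> = (\<integral>y. indicator {y. w \<bullet> y < 0} y * h y \<partial>lborel) + (\<integral>y. indicator {y. w \<bullet> y > 0} y * h y \<partial>lborel)"
    using i1 i2 by simp
  finally show "(\<integral>y. indicator {y. w \<bullet> y < 0} y * h y \<partial>lborel) = 1/2 * (\<integral>y. h y \<partial>lborel)"
    using eq by simp
qed

text \<open>
  Half of the mass that the Laplacian of the regularised fundamental solution concentrates at
  its centre, after rescaling. Only half appears because at small scales the fluid fills a
  half space near a point of its surface.
\<close>

definition half_mass :: "'b::euclidean_space itself \<Rightarrow> real" where
  "half_mass _ = 1/2 * (\<integral>(y::'b). real DIM('b) * (1 + (norm y)\<^sup>2) powr (- real DIM('b)/2 - 1) \<partial>lborel)"

lemma half_mass_integrable:
  "integrable lborel (\<lambda>y::'b::euclidean_space. (1 + (norm y)\<^sup>2) powr (- real DIM('b)/2 - 1))"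
proof (rule Bochner_Integration.integrable_bound)
  let ?q = "real DIM('b) + 2"
  show "integrable lborel (\<lambda>y::'b. 2 powr (?q/2) * (1 + norm y) powr (- ?q))"
    using integrable_decay[where 'a='b, of ?q] by simp
  have "(1 + (norm y)\<^sup>2) powr (- real DIM('b)/2 - 1) \<le> 2 powr (?q/2) * (1 + norm y) powr (- ?q)" for y :: 'b
  proof -
    have p: "0 < 1 + norm y" by (intro add_pos_nonneg) auto
    have "(1 + norm y)\<^sup>2 \<le> 2 * (1 + (norm y)\<^sup>2)"
      using sum_squares_bound[of 1 "norm y"] by (simp add: power2_sum)
    then have "(1 + (norm y)\<^sup>2) powr (- (?q/2)) \<le> ((1 + norm y)\<^sup>2 / 2) powr (- (?q/2))"
      using p by (intro powr_mono2') auto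
    also have "\<dots> = 2 powr (?q/2) * ((1 + norm y)\<^sup>2) powr (- (?q/2))"
      by (simp add: powr_divide powr_minus field_simps)
    also have "((1 + norm y)\<^sup>2) powr (- (?q/2)) = (1 + norm y) powr (- ?q)"
    proof -
      have "2 * (- (q/2)) = - q" for q :: real by simp
      then show ?thesis using square_powr[OF less_imp_le[OF p], of "- (?q/2)"] by (simp only:)
    qed
    finally show ?thesis by (simp add: add_divide_distrib)
  qed
  then show "AE y in lborel. norm ((1 + (norm y)\<^sup>2) powr (- real DIM('b)/2 - 1)) \<le> norm (2 powr (?q/2) * (1 + norm (y::'b)) powr (- ?q))"
    by (intro AE_I2) simp
qed measurable

lemma half_mass_pos: "0 < half_mass TYPE('b::euclidean_space)"
proof -
  let ?h = "\<lambda>y::'b. real DIM('b) * (1 + (norm y)\<^sup>2) powr (- real DIM('b)/2 - 1)"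
  have int: "integrable lborel ?h" using half_mass_integrable by simp
  have pos: "0 < ?h y" for y
  proof -
    have "0 < 1 + (norm y)\<^sup>2" by (intro add_pos_nonneg) auto
    then show ?thesis by (simp only: powr_gt_zero zero_less_mult_iff) simp
  qed
  have "(\<integral>y. ?h y \<partial>lborel) \<noteq> 0"
  proof
    assume "(\<integral>y. ?h y \<partial>lborel) = 0"
    then have "AE y in lborel. ?h y = 0"
      using integral_nonneg_eq_0_iff_AE[OF int] pos by (auto simp: less_imp_le)
    then have "AE y in (lborel :: 'b measure). False" by eventually_elim (use pos in \<open>metis less_irrefl\<close>)
    then have "ae_filter (lborel :: 'b measure) = bot" by (simp only: eventually_False)
    then show False by (simp add: ae_filter_eq_bot_iff emeasure_lborel_UNIV)
  qed
  moreover have "0 \<le> (\<integral>y. ?h y \<partial>lborel)" by (intro integral_nonneg_AE AE_I2 less_imp_le pos)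
  ultimately show ?thesis by (simp only: half_mass_def)
qed

context water_wave
begin

text \<open>
  The single layer has no net charge, which permits subtracting a constant from the kernel.
\<close>

lemma integral_Deta_zero: "(\<integral>x. D\<eta> x \<bullet> v \<partial>lborel) = 0"
proof (rule integral_gradient_decay[OF eta_deriv Deta_cont])
  show "integrable lborel (\<lambda>x. \<eta> x / (1 + norm x))"
  proof (rule Bochner_Integration.integrable_bound[OF eta_integrable])
    show "AE x in lborel. norm (\<eta> x / (1 + norm x)) \<le> norm (\<eta> x)"
    proof (rule AE_I2)
      fix x :: 'a
      have "\<bar>\<eta> x\<bar> / (1 + norm x) \<le> \<bar>\<eta> x\<bar> / 1" by (intro divide_left_mono) (auto intro: add_pos_nonneg)
      then show "norm (\<eta> x / (1 + norm x)) \<le> norm (\<eta> x)" by simp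
    qed
  qed measurable
  show "integrable lborel (\<lambda>x. D\<eta> x \<bullet> v)" using bounded_Deta_integrable[of "\<lambda>_. 1" 1 v] by simp
qed

definition sq_dist :: "'a \<Rightarrow> 'a \<Rightarrow> real" where
  "sq_dist x\<^sub>0 x = (norm (x - x\<^sub>0))\<^sup>2 + (\<eta> x - \<eta> x\<^sub>0)\<^sup>2"

lemma sq_dist_eq: "(norm (surf x - surf x\<^sub>0))\<^sup>2 = sq_dist x\<^sub>0 x"
  by (simp add: surf_def sq_dist_def norm_Pair)

text \<open>
  Green's second identity for \<open>\<phi>\<close> and the regularised kernel centred at \<open>surf x\<^sub>0\<close>. The
  constant \<open>q\<close> is arbitrary because \<open>\<nabla>\<eta>\<close> has integral zero; it will be the value of the kernel
  at distance \<open>|x\<^sub>0|\<close>.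
\<close>

lemma green_identity:
  assumes m: "0 < m"
  shows "(\<integral>x. indicator \<Omega> x * (\<phi> x * kernel_laplacian (real DIM('a \<times> real)) m ((norm (x - surf x\<^sub>0))\<^sup>2)) \<partial>lborel)
    = (\<integral>x. \<psi> x * (2 * kernel_deriv (real DIM('a \<times> real)) m (sq_dist x\<^sub>0 x) * (\<eta> x - \<eta> x\<^sub>0 - D\<eta> x \<bullet> (x - x\<^sub>0))) \<partial>lborel)
      + (\<integral>x. (kernel (real DIM('a \<times> real)) m (sq_dist x\<^sub>0 x) - q) * (D\<eta> x \<bullet> c) \<partial>lborel)"
proof -
  let ?a = "surf x\<^sub>0" 
  let ?T = "green_test m ?a" and ?G = "green_test_grad m ?a" and ?H = "green_test_hess m ?a"
  define r where "r = m + norm ?a"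
  have T: "C1_upto \<Omega> ?T ?G" by (intro C1_uptoI GDERIV_green_test green_test_continuous m)
  have G: "C1_upto \<Omega> (\<lambda>x. ?G x \<bullet> v) (?H v)" for v
    by (intro C1_uptoI GDERIV_green_test_grad green_test_continuous m)
  have z: "?T x = 0" "?G x = 0" if "r \<le> norm x" for x
    using green_test_outside[OF m, of ?a x] that unfolding r_def by auto
  have A: "integrable lborel (\<lambda>x. indicator \<Omega> x * (?G x \<bullet> D\<phi> x))"
    "(\<integral>x. indicator \<Omega> x * (?G x \<bullet> D\<phi> x) \<partial>lborel) = - (\<integral>x. ?T (surf x) * (D\<eta> x \<bullet> c) \<partial>lborel)"
    using flux_phi[OF T, of r] z(1) by blast+
  have B: "integrable lborel (\<lambda>x. indicator \<Omega> x * (\<phi> x * (\<Sum>b\<in>Basis. ?H b x \<bullet> b) + D\<phi> x \<bullet> ?G x))"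
    "(\<integral>x. indicator \<Omega> x * (\<phi> x * (\<Sum>b\<in>Basis. ?H b x \<bullet> b) + D\<phi> x \<bullet> ?G x) \<partial>lborel)
      = (\<integral>x. \<phi> (surf x) * (?G (surf x) \<bullet> nrm x) \<partial>lborel)"
    using flux_of_product[OF phi G, of r] z(2) by blast+
  have eq: "indicator \<Omega> x * (\<phi> x * kernel_laplacian (real DIM('a \<times> real)) m ((norm (x - ?a))\<^sup>2))
    = indicator \<Omega> x * (\<phi> x * (\<Sum>b\<in>Basis. ?H b x \<bullet> b) + D\<phi> x \<bullet> ?G x) - indicator \<Omega> x * (?G x \<bullet> D\<phi> x)" for x
    unfolding green_test_laplacian[OF m] by (simp add: algebra_simps inner_commute)
  have bdry: "?G (surf x) \<bullet> nrm x = 2 * kernel_deriv (real DIM('a \<times> real)) m (sq_dist x\<^sub>0 x) * (\<eta> x - \<eta> x\<^sub>0 - D\<eta> x \<bullet> (x - x\<^sub>0))" for x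
    unfolding green_test_grad_def sq_dist_eq
    by (simp add: surf_def nrm_def inner_commute[of _ "D\<eta> x"] algebra_simps)
  have iT: "integrable lborel (\<lambda>x. ?T (surf x) * (D\<eta> x \<bullet> c))"
    using z(1) by (intro integrable_on_surf[where r=r] green_test_continuous m continuous_intros Deta_cont) auto
  have iD: "integrable lborel (\<lambda>x. q * (D\<eta> x \<bullet> c))"
    using bounded_Deta_integrable[of "\<lambda>_. q" "\<bar>q\<bar>" c] by simp
  have "(\<integral>x. ?T (surf x) * (D\<eta> x \<bullet> c) \<partial>lborel) = (\<integral>x. (?T (surf x) - q) * (D\<eta> x \<bullet> c) \<partial>lborel)"
    unfolding left_diff_distrib Bochner_Integration.integral_diff[OF iT iD]
    by (simp add: integral_Deta_zero)
  then show ?thesis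
    unfolding eq Bochner_Integration.integral_diff[OF B(1) A(1)] A(2) B(2) bdry \<psi>_def[symmetric]
    by (simp add: green_test_def sq_dist_eq)
qed

lemma fluid_phi_meas[measurable]: "(\<lambda>x. indicator \<Omega> x * \<phi> x) \<in> borel_measurable borel"
proof -
  have "(\<lambda>x. indicator \<Omega> x *\<^sub>R \<phi> x) \<in> borel_measurable borel"
    using continuous_on_subset[OF phi_cont closure_subset]
    by (intro borel_measurable_continuous_on_indicator) auto
  then show ?thesis by simp
qed

text \<open>
  Magnify by the factor \<open>m\<close> at the surface point. The magnified fluid domain converges to the
  half space below the tangent plane, since \<open>\<eta>\<close> is differentiable, and the potential converges
  to its boundary value; points on the tangent plane itself form a null set.
\<close>

lemma concentration_limit:
  "((\<lambda>m. \<integral>x. indicator \<Omega> x * (\<phi> x * ((real DIM('a \<times> real))/m\<^sup>2 * ((norm (x - surf x\<^sub>0))\<^sup>2 + 1/m\<^sup>2) powr (- (real DIM('a \<times> real))/2 - 1)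
      * max 0 (1 - (norm (x - surf x\<^sub>0))\<^sup>2/m\<^sup>2) ^ 2)) \<partial>lborel) \<longlongrightarrow> half_mass TYPE('a \<times> real) * \<psi> x\<^sub>0) at_top"
proof -
  let ?a = "surf x\<^sub>0"
  let ?h = "\<lambda>y::'a \<times> real. (real DIM('a \<times> real)) * (1 + (norm y)\<^sup>2) powr (- (real DIM('a \<times> real))/2 - 1)"
  let ?t = "\<lambda>m y::'a \<times> real. max 0 (1 - (norm y)\<^sup>2/(m\<^sup>2 * m\<^sup>2)) ^ 2"
  let ?w = "nrm x\<^sub>0"
  let ?s = "\<lambda>m y. (indicator \<Omega> (?a + (1/m) *\<^sub>R y) * \<phi> (?a + (1/m) *\<^sub>R y)) * (?h y * ?t m y)"
  have hint: "integrable lborel ?h" using half_mass_integrable[where 'b="'a \<times> real"] by simp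
  have w0: "?w \<noteq> 0" by (simp add: nrm_def zero_prod_def)
  have heven: "?h (- y) = ?h y" for y by simp
  note half = even_half_space_integral[OF hint heven w0]
  obtain M where M: "0 \<le> M" "\<And>x. x \<in> closure \<Omega> \<Longrightarrow> \<bar>\<phi> x\<bar> \<le> M" using phi_bounded by blast
  have Mb: "\<bar>indicator \<Omega> x * \<phi> x\<bar> \<le> M" for x
    using M(1) M(2)[of x] closure_subset[of \<Omega>] by (cases "x \<in> \<Omega>") auto
  have "((\<lambda>m. \<integral>y. ?s m y \<partial>lborel) \<longlongrightarrow> (\<integral>y. \<psi> x\<^sub>0 * (indicator {y. ?w \<bullet> y < 0} y * ?h y) \<partial>lborel)) at_top"
  proof (rule integral_dominated_convergence_at_top[where w="\<lambda>y. M * ?h y"])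
    have [measurable]: "{y. ?w \<bullet> y < 0} \<in> sets borel"
      by (auto intro!: borel_open open_Collect_less continuous_intros)
    show "(\<lambda>y. \<psi> x\<^sub>0 * (indicator {y. ?w \<bullet> y < 0} y * ?h y)) \<in> borel_measurable lborel" by measurable
    show "?s m \<in> borel_measurable lborel" for m
    proof -
      have "(\<lambda>y. indicator \<Omega> (?a + (1/m) *\<^sub>R y) * \<phi> (?a + (1/m) *\<^sub>R y)) \<in> borel_measurable borel"
        using measurable_compose[OF _ fluid_phi_meas, of "\<lambda>y. ?a + (1/m) *\<^sub>R y" borel] by simp
      then show ?thesis by measurable
    qed
    show "integrable lborel (\<lambda>y. M * ?h y)" using hint by simp
    show "\<forall>\<^sub>F m in at_top. AE y in lborel. norm (?s m y) \<le> M * ?h y"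
    proof (intro always_eventually allI AE_I2)
      fix m and y :: "'a \<times> real"
      have "?t m y \<le> 1" by (intro power_le_one) auto
      then have "?h y * ?t m y \<le> ?h y * 1" by (intro mult_left_mono) auto
      then show "norm (?s m y) \<le> M * ?h y"
        unfolding real_norm_def abs_mult[of "indicator \<Omega> _ * \<phi> _"]
        by (intro mult_mono Mb) (use M(1) in auto)
    qed
    show "AE y in lborel. ((\<lambda>m. ?s m y) \<longlongrightarrow> \<psi> x\<^sub>0 * (indicator {y. ?w \<bullet> y < 0} y * ?h y)) at_top"
      using half(2)
    proof eventually_elim
      case (elim y)
      have inv: "filterlim (\<lambda>m. 1/m) (at 0) (at_top :: real filter)"
      proof -
        have "((\<lambda>m::real. 1/m) \<longlongrightarrow> 0) at_top"
          by (intro tendsto_divide_0[OF tendsto_const] filterlim_at_top_imp_at_infinity filterlim_ident)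
        then show ?thesis unfolding filterlim_at
          using eventually_gt_at_top[of "0::real"] by (auto elim!: eventually_mono)
      qed
      \<comment> \<open>whether the magnified point lies in the fluid is decided by the sign of \<open>?w \<bullet> y\<close>\<close>
      have "((\<lambda>h. (\<eta> (x\<^sub>0 + h *\<^sub>R fst y) - \<eta> x\<^sub>0) / h) \<longlongrightarrow> D\<eta> x\<^sub>0 \<bullet> fst y) (at 0)"
        using GDERIV_line[OF eta_deriv, of x\<^sub>0 "fst y"] by (simp add: has_field_derivative_iff)
      from filterlim_compose[OF this inv]
      have "((\<lambda>m. (\<eta> (x\<^sub>0 + (1/m) *\<^sub>R fst y) - \<eta> x\<^sub>0) / (1/m) - snd y) \<longlongrightarrow> D\<eta> x\<^sub>0 \<bullet> fst y - snd y) at_top"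
        by (intro tendsto_intros)
      moreover have "D\<eta> x\<^sub>0 \<bullet> fst y - snd y = - (?w \<bullet> y)" by (simp add: nrm_def inner_prod_def)
      ultimately have lim: "((\<lambda>m. (\<eta> (x\<^sub>0 + (1/m) *\<^sub>R fst y) - \<eta> x\<^sub>0) * m - snd y) \<longlongrightarrow> - (?w \<bullet> y)) at_top" by simp
      have mem: "?a + (1/m) *\<^sub>R y \<in> \<Omega> \<longleftrightarrow> 0 < (\<eta> (x\<^sub>0 + (1/m) *\<^sub>R fst y) - \<eta> x\<^sub>0) * m - snd y" if "0 < m" for m
        using that by (simp add: fluid_domain_def surf_def field_simps)
      show ?case
      proof (cases "?w \<bullet> y < 0")
        case True
        have ev: "\<forall>\<^sub>F m in at_top. ?a + (1/m) *\<^sub>R y \<in> \<Omega>"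
          using order_tendstoD(1)[OF lim, of 0, unfolded neg_0_less_iff_less, OF True] eventually_gt_at_top[of 0]
          by eventually_elim (use mem in auto)
        have "((\<lambda>m. ?a + (1/m) *\<^sub>R y) \<longlongrightarrow> ?a + 0 *\<^sub>R y) at_top"
          by (intro tendsto_intros tendsto_divide_0[OF tendsto_const] filterlim_at_top_imp_at_infinity filterlim_ident)
        then have t1: "((\<lambda>m. \<phi> (?a + (1/m) *\<^sub>R y)) \<longlongrightarrow> \<phi> ?a) at_top"
          using ev closure_subset[of \<Omega>]
          by (intro continuous_on_tendsto_compose[OF phi_cont]) (auto elim!: eventually_mono)
        have t2: "((\<lambda>m. ?t m y) \<longlongrightarrow> (max 0 (1 - 0))\<^sup>2) at_top"
          by (intro tendsto_intros tendsto_divide_0[OF tendsto_const] filterlim_at_top_imp_at_infinity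
              filterlim_at_top_mult_at_top filterlim_pow_at_top filterlim_ident) auto
        have "((\<lambda>m. \<phi> (?a + (1/m) *\<^sub>R y) * (?h y * ?t m y)) \<longlongrightarrow> \<phi> ?a * (?h y * (max 0 (1 - 0))\<^sup>2)) at_top"
          by (rule tendsto_mult[OF t1 tendsto_mult[OF tendsto_const t2]])
        then have "((\<lambda>m. ?s m y) \<longlongrightarrow> \<phi> ?a * (?h y * (max 0 (1 - 0))\<^sup>2)) at_top"
          by (rule Lim_transform_eventually) (use ev in \<open>eventually_elim, simp\<close>)
        then show ?thesis using True by (simp add: \<psi>_def)
      next
        case False
        then have pos: "0 < ?w \<bullet> y" using elim by simp
        have "\<forall>\<^sub>F m in at_top. ?s m y = 0"
          using order_tendstoD(2)[OF lim, of 0, unfolded neg_less_0_iff_less, OF pos] eventually_gt_at_top[of 0]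
          by eventually_elim (use mem in auto)
        then have "((\<lambda>m. ?s m y) \<longlongrightarrow> 0) at_top" by (rule tendsto_eventually)
        then show ?thesis using False by simp
      qed
    qed
  qed
  also have "(\<integral>y. \<psi> x\<^sub>0 * (indicator {y. ?w \<bullet> y < 0} y * ?h y) \<partial>lborel) = half_mass TYPE('a \<times> real) * \<psi> x\<^sub>0"
    unfolding integral_mult_right_zero half_mass_def using half(1) by simp
  finally show ?thesis
  proof (rule Lim_transform_eventually)
    show "\<forall>\<^sub>F m in at_top. (\<integral>y. ?s m y \<partial>lborel) = (\<integral>x. indicator \<Omega> x * (\<phi> x * ((real DIM('a \<times> real))/m\<^sup>2 * ((norm (x - ?a))\<^sup>2 + 1/m\<^sup>2) powr (- (real DIM('a \<times> real))/2 - 1)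
      * max 0 (1 - (norm (x - ?a))\<^sup>2/m\<^sup>2) ^ 2)) \<partial>lborel)"
      using eventually_gt_at_top[of 0]
    proof eventually_elim
      case (elim m)
      let ?g = "\<lambda>x. indicator \<Omega> x * (\<phi> x * ((real DIM('a \<times> real))/m\<^sup>2 * ((norm (x - ?a))\<^sup>2 + 1/m\<^sup>2) powr (- (real DIM('a \<times> real))/2 - 1)
          * max 0 (1 - (norm (x - ?a))\<^sup>2/m\<^sup>2) ^ 2))"
      have gm: "?g \<in> borel_measurable borel"
      proof -
        have "?g = (\<lambda>x. (indicator \<Omega> x * \<phi> x) * ((real DIM('a \<times> real))/m\<^sup>2 * ((norm (x - ?a))\<^sup>2 + 1/m\<^sup>2) powr (- (real DIM('a \<times> real))/2 - 1)
          * max 0 (1 - (norm (x - ?a))\<^sup>2/m\<^sup>2) ^ 2))" by (simp add: mult.assoc)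
        then show ?thesis by simp
      qed
      have eq: "(1/m) ^ DIM('a \<times> real) * ?g (?a + (1/m) *\<^sub>R y) = ?s m y" for y
      proof -
        let ?A = "1 + (norm y)\<^sup>2"
        have A: "0 < ?A" by (simp add: add_pos_nonneg)
        have n1: "(norm (?a + (1/m) *\<^sub>R y - ?a))\<^sup>2 = (norm y)\<^sup>2 / m\<^sup>2"
          using elim by (simp add: power_divide)
        have "((norm y)\<^sup>2 / m\<^sup>2 + 1/m\<^sup>2) powr (- (real DIM('a \<times> real))/2 - 1) = (?A / m\<^sup>2) powr (- (real DIM('a \<times> real))/2 - 1)"
          by (simp add: add_divide_distrib add.commute)
        also have "\<dots> = ?A powr (- (real DIM('a \<times> real))/2 - 1) * m powr ((real DIM('a \<times> real)) + 2)"
        proof -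
          have "(m\<^sup>2) powr (- (real DIM('a \<times> real))/2 - 1) = m powr (- ((real DIM('a \<times> real)) + 2))"
          proof -
            have "2 * (- q/2 - 1) = - (q + 2)" for q :: real by simp
            then show ?thesis using square_powr[OF less_imp_le[OF elim]] by (simp only:)
          qed
          moreover have "(?A / m\<^sup>2) powr q = ?A powr q / (m\<^sup>2) powr q" for q
            using A elim by (intro powr_divide)
          moreover have "u / m powr (- k) = u * m powr k" for u k :: real
            by (simp add: powr_minus divide_inverse)
          ultimately show ?thesis by (simp only:)
        qed
        finally have p: "((norm y)\<^sup>2 / m\<^sup>2 + 1/m\<^sup>2) powr (- (real DIM('a \<times> real))/2 - 1) = ?A powr (- (real DIM('a \<times> real))/2 - 1) * m powr ((real DIM('a \<times> real)) + 2)" .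
        have "m powr ((real DIM('a \<times> real)) + 2) = m ^ DIM('a \<times> real) * m\<^sup>2"
          using elim by (simp only: powr_add powr_realpow powr_numeral)
        then have q: "(1/m) ^ DIM('a \<times> real) * ((real DIM('a \<times> real))/m\<^sup>2 * (X * m powr ((real DIM('a \<times> real)) + 2))) = (real DIM('a \<times> real)) * X" for X
          using elim by (simp add: power_one_over field_simps)
        have "(1/m) ^ DIM('a \<times> real) * ?g (?a + (1/m) *\<^sub>R y) =
           indicator \<Omega> (?a + (1/m) *\<^sub>R y) * \<phi> (?a + (1/m) *\<^sub>R y) *
           (((1/m) ^ DIM('a \<times> real) * ((real DIM('a \<times> real))/m\<^sup>2 * (?A powr (- (real DIM('a \<times> real))/2 - 1) * m powr ((real DIM('a \<times> real)) + 2)))) * ?t m y)"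
          unfolding n1 p by (simp add: mult_ac divide_divide_eq_left)
        then show ?thesis unfolding q .
      qed
      have "(\<integral>x. ?g x \<partial>lborel) = (\<integral>y. (1/m) ^ DIM('a \<times> real) * ?g (?a + (1/m) *\<^sub>R y) \<partial>lborel)"
        using elim by (subst lborel_integral_affine[OF _ gm, of "1/m" ?a]) auto
      then show ?case unfolding eq by simp
    qed
  qed
qed

text \<open>
  The integrand is at most \<open>4 m\<^sup>-\<^sup>2 |\<phi>| |x - surf x\<^sub>0|\<^sup>2\<^sup>-\<^sup>n\<close> on the ball of radius \<open>m\<close>, an
  average of a function that tends to zero.
\<close>

lemma truncation_error_tendsto:
  "((\<lambda>m. \<integral>x. indicator \<Omega> x * (\<phi> x * (4 * (norm (x - surf x\<^sub>0))\<^sup>2 * ((norm (x - surf x\<^sub>0))\<^sup>2 + 1/m\<^sup>2) powr (- (real DIM('a \<times> real))/2)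
      * max 0 (1 - (norm (x - surf x\<^sub>0))\<^sup>2/m\<^sup>2) / m\<^sup>2)) \<partial>lborel) \<longlongrightarrow> 0) at_top"
proof -
  let ?a = "surf x\<^sub>0"
  define e where "e y = indicator \<Omega> (?a + y) * \<phi> (?a + y)" for y
  have em[measurable]: "e \<in> borel_measurable borel"
    using measurable_compose[OF _ fluid_phi_meas, of "\<lambda>y. ?a + y" borel] unfolding e_def by simp
  obtain M where M: "0 \<le> M" "\<And>x. x \<in> closure \<Omega> \<Longrightarrow> \<bar>\<phi> x\<bar> \<le> M" using phi_bounded by blast
  have Mb: "\<bar>e y\<bar> \<le> M" for y
    unfolding e_def using M(1) M(2)[of "?a + y"] closure_subset[of \<Omega>] by (cases "?a + y \<in> \<Omega>") auto
  have "(e \<longlongrightarrow> 0) at_infinity"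
  proof (rule Lim_null_comparison)
    have "filterlim (\<lambda>y. ?a + y) at_infinity at_infinity"
      by (rule tendsto_add_filterlim_at_infinity[OF tendsto_const filterlim_ident])
    from filterlim_compose[OF phi_lim this]
    show "((\<lambda>y. \<bar>indicator (closure \<Omega>) (?a + y) * \<phi> (?a + y)\<bar>) \<longlongrightarrow> 0) at_infinity"
      by (rule tendsto_rabs_zero)
    show "\<forall>\<^sub>F y in at_infinity. norm (e y) \<le> \<bar>indicator (closure \<Omega>) (?a + y) * \<phi> (?a + y)\<bar>"
      using closure_subset[of \<Omega>] by (intro always_eventually allI) (auto simp: e_def indicator_def)
  qed
  from cesaro_ball[OF em Mb this, of "(real DIM('a \<times> real)) - 2"]
  have lim: "((\<lambda>m. 4 * (m powr (- 2) * (\<integral>y. indicator (ball 0 m) y * (\<bar>e y\<bar> * norm y powr (- ((real DIM('a \<times> real)) - 2))) \<partial>lborel))) \<longlongrightarrow> 0) at_top"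
    by (intro tendsto_mult_right_zero) simp
  show ?thesis
  proof (rule Lim_null_comparison[OF _ lim])
    show "\<forall>\<^sub>F m in at_top. norm (\<integral>x. indicator \<Omega> x * (\<phi> x * (4 * (norm (x - ?a))\<^sup>2 * ((norm (x - ?a))\<^sup>2 + 1/m\<^sup>2) powr (- (real DIM('a \<times> real))/2)
      * max 0 (1 - (norm (x - ?a))\<^sup>2/m\<^sup>2) / m\<^sup>2)) \<partial>lborel)
      \<le> 4 * (m powr (- 2) * (\<integral>y. indicator (ball 0 m) y * (\<bar>e y\<bar> * norm y powr (- ((real DIM('a \<times> real)) - 2))) \<partial>lborel))"
      using eventually_gt_at_top[of 0]
    proof eventually_elim
      case (elim m)
      let ?g = "\<lambda>x. indicator \<Omega> x * (\<phi> x * (4 * (norm (x - ?a))\<^sup>2 * ((norm (x - ?a))\<^sup>2 + 1/m\<^sup>2) powr (- (real DIM('a \<times> real))/2)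
          * max 0 (1 - (norm (x - ?a))\<^sup>2/m\<^sup>2) / m\<^sup>2))"
      let ?k = "\<lambda>y. 4 * (norm y)\<^sup>2 * ((norm y)\<^sup>2 + 1/m\<^sup>2) powr (- (real DIM('a \<times> real))/2) * max 0 (1 - (norm y)\<^sup>2/m\<^sup>2) / m\<^sup>2"
      have gm: "?g \<in> borel_measurable borel"
      proof -
        have "?g = (\<lambda>x. (indicator \<Omega> x * \<phi> x) * ?k (x - ?a))" by (simp add: mult.assoc)
        then show ?thesis by simp
      qed
      have sh: "(\<integral>x. ?g x \<partial>lborel) = (\<integral>y. e y * ?k y \<partial>lborel)"
        by (subst lborel_integral_translate[OF gm, of ?a, symmetric]) (simp add: e_def mult.assoc)
      have i1: "integrable lborel (\<lambda>y. indicator (ball 0 m) y * (\<bar>e y\<bar> * norm y powr (- ((real DIM('a \<times> real)) - 2))))"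
      proof (rule Bochner_Integration.integrable_bound)
        show "integrable lborel (\<lambda>y::'a \<times> real. M * (indicator (ball 0 m) y * norm y powr (- ((real DIM('a \<times> real)) - 2))))"
          using integral_ball_powr(1)[where 'a="'a \<times> real", of "(real DIM('a \<times> real)) - 2" m] elim by simp
        show "AE y in lborel. norm (indicator (ball 0 m) y * (\<bar>e y\<bar> * norm y powr (- ((real DIM('a \<times> real)) - 2))))
            \<le> norm (M * (indicator (ball 0 m) y * norm y powr (- ((real DIM('a \<times> real)) - 2))))"
          using Mb M(1) by (intro AE_I2) (auto simp: indicator_def abs_mult intro!: mult_right_mono)
      qed measurable
      have ptw: "norm (e y * ?k y) \<le> 4 * (m powr (- 2) * (indicator (ball 0 m) y * (\<bar>e y\<bar> * norm y powr (- ((real DIM('a \<times> real)) - 2)))))" for y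
      proof (cases "norm y < m \<and> y \<noteq> 0")
        case True
        have m2: "m powr (- 2) = 1/m\<^sup>2" using elim by (simp add: powr_minus powr_numeral inverse_eq_divide)
        have "((norm y)\<^sup>2 + 1/m\<^sup>2) powr (- (real DIM('a \<times> real))/2) \<le> ((norm y)\<^sup>2) powr (- (real DIM('a \<times> real))/2)"
          using True by (intro powr_mono2') auto
        also have "\<dots> = norm y powr (- (real DIM('a \<times> real)))"
          by (subst square_powr) (simp_all add: diff_divide_distrib)
        finally have "(norm y)\<^sup>2 * ((norm y)\<^sup>2 + 1/m\<^sup>2) powr (- (real DIM('a \<times> real))/2) \<le> (norm y)\<^sup>2 * norm y powr (- (real DIM('a \<times> real)))"
          by (intro mult_left_mono) auto
        also have "\<dots> = norm y powr (- ((real DIM('a \<times> real)) - 2))"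
          using True powr_add[of "norm y" 2 "- real DIM('a \<times> real)"] by simp
        finally have a: "(norm y)\<^sup>2 * ((norm y)\<^sup>2 + 1/m\<^sup>2) powr (- (real DIM('a \<times> real))/2) \<le> norm y powr (- ((real DIM('a \<times> real)) - 2))" .
        have b: "max 0 (1 - (norm y)\<^sup>2/m\<^sup>2) \<le> 1" by auto
        have "((norm y)\<^sup>2 * ((norm y)\<^sup>2 + 1/m\<^sup>2) powr (- (real DIM('a \<times> real))/2)) * max 0 (1 - (norm y)\<^sup>2/m\<^sup>2) \<le> norm y powr (- ((real DIM('a \<times> real)) - 2)) * 1"
          using a b by (intro mult_mono) auto
        then have "4 / m\<^sup>2 * \<bar>e y\<bar> * (((norm y)\<^sup>2 * ((norm y)\<^sup>2 + 1/m\<^sup>2) powr (- (real DIM('a \<times> real))/2)) * max 0 (1 - (norm y)\<^sup>2/m\<^sup>2))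
           \<le> 4 / m\<^sup>2 * \<bar>e y\<bar> * norm y powr (- ((real DIM('a \<times> real)) - 2))"
          by (intro mult_left_mono) auto
        then show ?thesis using True unfolding m2 by (simp add: abs_mult mult_ac)
      next
        case False
        have "?k y = 0"
        proof (cases "y = 0")
          case False
          then have "m\<^sup>2 \<le> (norm y)\<^sup>2" using \<open>\<not> (norm y < m \<and> y \<noteq> 0)\<close> elim by (intro power_mono) auto
          then have "max 0 (1 - (norm y)\<^sup>2/m\<^sup>2) = 0" using elim by (simp add: max_def)
          then show ?thesis by simp
        qed simp
        then show ?thesis by (simp only: mult_zero_right norm_zero) simp
      qed
      have "norm (\<integral>y. e y * ?k y \<partial>lborel) \<le> (\<integral>y. 4 * (m powr (- 2) * (indicator (ball 0 m) y * (\<bar>e y\<bar> * norm y powr (- ((real DIM('a \<times> real)) - 2))))) \<partial>lborel)"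
      proof (rule Bochner_Integration.integral_norm_bound_integral)
        show "integrable lborel (\<lambda>y. e y * ?k y)"
        proof (rule Bochner_Integration.integrable_bound)
          show "integrable lborel (\<lambda>y. 4 * (m powr (- 2) * (indicator (ball 0 m) y * (\<bar>e y\<bar> * norm y powr (- ((real DIM('a \<times> real)) - 2))))))"
            by (intro integrable_mult_right i1)
          show "AE y in lborel. norm (e y * ?k y) \<le> norm (4 * (m powr (- 2) * (indicator (ball 0 m) y * (\<bar>e y\<bar> * norm y powr (- ((real DIM('a \<times> real)) - 2))))))"
          proof (rule AE_I2)
            fix y
            show "norm (e y * ?k y) \<le> norm (4 * (m powr (- 2) * (indicator (ball 0 m) y * (\<bar>e y\<bar> * norm y powr (- ((real DIM('a \<times> real)) - 2))))))"
              using ptw[of y] by (rule order_trans) (simp only: real_norm_def abs_ge_self)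
          qed
        qed measurable
      next
        show "integrable lborel (\<lambda>y. 4 * (m powr (- 2) * (indicator (ball 0 m) y * (\<bar>e y\<bar> * norm y powr (- ((real DIM('a \<times> real)) - 2))))))"
          by (intro integrable_mult_right i1)
      qed (rule ptw)
      then show ?case unfolding sh integral_mult_right_zero .
    qed
  qed
qed

lemma green_limit:
  "((\<lambda>m. (\<integral>x. \<psi> x * (2 * kernel_deriv (real DIM('a \<times> real)) m (sq_dist x\<^sub>0 x) * (\<eta> x - \<eta> x\<^sub>0 - D\<eta> x \<bullet> (x - x\<^sub>0))) \<partial>lborel)
      + (\<integral>x. (kernel (real DIM('a \<times> real)) m (sq_dist x\<^sub>0 x) - kernel (real DIM('a \<times> real)) m q) * (D\<eta> x \<bullet> c) \<partial>lborel))
    \<longlongrightarrow> half_mass TYPE('a \<times> real) * \<psi> x\<^sub>0) at_top"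
proof -
  let ?a = "surf x\<^sub>0"
  let ?A = "\<lambda>m x. indicator \<Omega> x * (\<phi> x * ((real DIM('a \<times> real))/m\<^sup>2 * ((norm (x - ?a))\<^sup>2 + 1/m\<^sup>2) powr (- (real DIM('a \<times> real))/2 - 1)
      * max 0 (1 - (norm (x - ?a))\<^sup>2/m\<^sup>2) ^ 2))"
  let ?B = "\<lambda>m x. indicator \<Omega> x * (\<phi> x * (4 * (norm (x - ?a))\<^sup>2 * ((norm (x - ?a))\<^sup>2 + 1/m\<^sup>2) powr (- (real DIM('a \<times> real))/2)
      * max 0 (1 - (norm (x - ?a))\<^sup>2/m\<^sup>2) / m\<^sup>2))"
  from tendsto_diff[OF concentration_limit truncation_error_tendsto]
  have "((\<lambda>m. (\<integral>x. ?A m x \<partial>lborel) - (\<integral>x. ?B m x \<partial>lborel)) \<longlongrightarrow> half_mass TYPE('a \<times> real) * \<psi> x\<^sub>0) at_top" by simp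
  then show ?thesis
  proof (rule Lim_transform_eventually)
    show "\<forall>\<^sub>F m in at_top. (\<integral>x. ?A m x \<partial>lborel) - (\<integral>x. ?B m x \<partial>lborel)
      = (\<integral>x. \<psi> x * (2 * kernel_deriv (real DIM('a \<times> real)) m (sq_dist x\<^sub>0 x) * (\<eta> x - \<eta> x\<^sub>0 - D\<eta> x \<bullet> (x - x\<^sub>0))) \<partial>lborel)
      + (\<integral>x. (kernel (real DIM('a \<times> real)) m (sq_dist x\<^sub>0 x) - kernel (real DIM('a \<times> real)) m q) * (D\<eta> x \<bullet> c) \<partial>lborel)"
      using eventually_gt_at_top[of 0]
    proof eventually_elim
      case (elim m)
      have far: "max 0 (1 - (norm (x - ?a))\<^sup>2/m\<^sup>2) = 0" if "m + norm ?a < norm x" for x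
      proof -
        have "m \<le> norm (x - ?a)" using that norm_triangle_ineq2[of x ?a] by linarith
        then have "m\<^sup>2 \<le> (norm (x - ?a))\<^sup>2" using elim by (intro power_mono) auto
        then show ?thesis using elim by (simp add: max_def)
      qed
      have nz: "(norm (x - ?a))\<^sup>2 + 1/m\<^sup>2 \<noteq> 0" for x
        using elim by (intro less_imp_neq[symmetric] add_nonneg_pos) auto
      have iA: "integrable lborel (?A m)"
        using elim nz far
        by (intro integrable_on_fluid[where r="m + norm ?a"] continuous_intros phi_cont) auto
      have iB: "integrable lborel (?B m)"
        using elim nz far
        by (intro integrable_on_fluid[where r="m + norm ?a"] continuous_intros phi_cont) auto
      have eq: "?A m x - ?B m x = indicator \<Omega> x * (\<phi> x * kernel_laplacian (real DIM('a \<times> real)) m ((norm (x - ?a))\<^sup>2))" for x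
        unfolding kernel_laplacian_def by (simp only: right_diff_distrib)
      show ?case
        unfolding Bochner_Integration.integral_diff[OF iA iB, symmetric] eq
        by (rule green_identity[OF elim])
    qed
  qed
qed

end

section \<open>Decay of the double layer\<close>

lemma abs_integral_le:
  fixes f g :: "'b \<Rightarrow> real"
  assumes "f \<in> borel_measurable M" "integrable M g" "AE x in M. \<bar>f x\<bar> \<le> g x"
  shows "\<bar>\<integral>x. f x \<partial>M\<bar> \<le> (\<integral>x. g x \<partial>M)"
proof -
  have f: "integrable M f"
    using assms(3) by (intro Bochner_Integration.integrable_bound[OF assms(2,1)]) (auto elim!: eventually_mono)
  have "(\<integral>x. \<bar>f x\<bar> \<partial>M) \<le> (\<integral>x. g x \<partial>M)"
    by (intro integral_mono_AE integrable_abs f assms(2,3))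
  then show ?thesis using order_trans[OF integral_norm_bound[of M f]] by simp
qed

lemma powr_half: "0 < R \<Longrightarrow> (R/2) powr a = 2 powr (- a) * R powr a" for R :: real
  by (simp add: powr_divide powr_minus field_simps)

lemma integral_shift:
  fixes f :: "'b::euclidean_space \<Rightarrow> real"
  assumes "integrable lborel f"
  shows "integrable lborel (\<lambda>x. f (x - a))" "(\<integral>x. f (x - a) \<partial>lborel) = (\<integral>x. f x \<partial>lborel)"
  using lborel_integrable_affine[OF _ assms, of 1 "- a"] lborel_integral_translate[of f "- a"] assms
  by auto

text \<open>
  The derivative of the kernel is at most \<open>1/2 s\<^sup>-\<^sup>n\<^sup>/\<^sup>2\<close>. Integrating this directly would
  give a logarithm when \<open>n = 2\<close>; giving away a quarter of a power treats all dimensions alike,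
  and the loss is compensated by the powers of \<open>R\<close>. The singularity of the first term stays
  integrable on the surface.
\<close>

lemma kernel_difference_bound:
  assumes m: "0 < m" and n: "2 \<le> n" and R: "0 < R" and s: "0 < s"
  shows "\<bar>kernel n m s - kernel n m (R\<^sup>2)\<bar>
    \<le> 2 * R powr (1/2) * s powr (- (n/2 - 3/4)) + 2 * R powr (3/2 - n) * s powr (1/4)"
proof (cases "s \<le> R\<^sup>2")
  case True
  define a where "a = n/2 - 3/4"
  have a: "1/4 \<le> a" using n unfolding a_def by simp
  \<comment> \<open>the primitive of the majorant \<open>1/2 R\<^sup>1\<^sup>/\<^sup>2 u\<^sup>-\<^sup>a\<^sup>-\<^sup>1\<close> of the derivative on \<open>{s..R\<^sup>2}\<close>\<close>
  define h where "h u = - (1/(2*a)) * R powr (1/2) * u powr (- a)" for u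
  have dh: "(h has_real_derivative 1/2 * R powr (1/2) * u powr (- a - 1)) (at u)" if "0 < u" for u
    unfolding h_def using that a by (auto intro!: derivative_eq_intros simp: powr_diff)
  have le: "kernel_deriv n m u \<le> 1/2 * R powr (1/2) * u powr (- a - 1)" if u: "s \<le> u" "u \<le> R\<^sup>2" for u
  proof -
    have u0: "0 < u" using u s by simp
    have "u powr (1/4) \<le> (R\<^sup>2) powr (1/4)" using u u0 by (intro powr_mono2) auto
    also have "\<dots> = R powr (1/2)" using R by (simp add: square_powr)
    finally have *: "u powr (1/4) \<le> R powr (1/2)" .
    have "u powr (- n/2) = u powr (1/4) * u powr (- a - 1)"
      using u0 by (simp add: powr_add[symmetric] a_def)
    also have "\<dots> \<le> R powr (1/2) * u powr (- a - 1)" using * by (intro mult_right_mono) auto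
    finally show ?thesis using kernel_deriv_le[OF m u0, of n] n by simp
  qed
  have "h s - kernel n m s \<le> h (R\<^sup>2) - kernel n m (R\<^sup>2)"
  proof (rule DERIV_nonneg_imp_nondecreasing[OF True])
    fix u assume u: "s \<le> u" "u \<le> R\<^sup>2"
    have "((\<lambda>u. h u - kernel n m u) has_real_derivative 1/2 * R powr (1/2) * u powr (- a - 1) - kernel_deriv n m u) (at u)"
      using u s by (intro DERIV_diff dh kernel_has_deriv m) auto
    then show "\<exists>y. ((\<lambda>u. h u - kernel n m u) has_real_derivative y) (at u) \<and> 0 \<le> y"
      using le[OF u] by (intro exI conjI) auto
  qed
  moreover have "kernel n m s \<le> kernel n m (R\<^sup>2)"
  proof (rule DERIV_nonneg_imp_nondecreasing[OF True])
    fix u assume "s \<le> u" "u \<le> R\<^sup>2"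
    then show "\<exists>y. (kernel n m has_real_derivative y) (at u) \<and> 0 \<le> y"
      using s kernel_has_deriv[OF m, of u n] kernel_deriv_nonneg[of n m u] by (intro exI conjI) auto
  qed
  moreover have "h (R\<^sup>2) \<le> 0" using a unfolding h_def by (simp add: divide_nonneg_nonneg)
  moreover have "- h s \<le> 2 * R powr (1/2) * s powr (- a)"
  proof -
    have "1/(2*a) \<le> 2" using a by (simp add: field_simps)
    then have "1/(2*a) * (R powr (1/2) * s powr (- a)) \<le> 2 * (R powr (1/2) * s powr (- a))"
      by (intro mult_right_mono) auto
    then show ?thesis unfolding h_def by simp
  qed
  ultimately have "\<bar>kernel n m s - kernel n m (R\<^sup>2)\<bar> \<le> 2 * R powr (1/2) * s powr (- a)" by linarith
  also have "\<dots> \<le> \<dots> + 2 * R powr (3/2 - n) * s powr (1/4)" by simp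
  finally show ?thesis unfolding a_def .
next
  case False
  then have sR: "R\<^sup>2 \<le> s" by simp
  have R2: "0 < R\<^sup>2" using R by simp
  \<comment> \<open>the primitive of a majorant of the derivative on \<open>{R\<^sup>2..s}\<close>\<close>
  define h where "h u = 2 * R powr (3/2 - n) * u powr (1/4)" for u
  have dh: "(h has_real_derivative 1/2 * R powr (3/2 - n) * u powr (-3/4)) (at u)" if "0 < u" for u
    unfolding h_def using that by (auto intro!: derivative_eq_intros)
  have le: "kernel_deriv n m u \<le> 1/2 * R powr (3/2 - n) * u powr (-3/4)" if u: "R\<^sup>2 \<le> u" for u
  proof -
    have u0: "0 < u" by (rule less_le_trans[OF R2 u])
    have "u powr (- (n/2 - 3/4)) \<le> (R\<^sup>2) powr (- (n/2 - 3/4))" using u R2 n by (intro powr_mono2') auto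
    also have "\<dots> = R powr (3/2 - n)" using R by (simp add: square_powr algebra_simps)
    finally have *: "u powr (- (n/2 - 3/4)) \<le> R powr (3/2 - n)" .
    have "u powr (- n/2) = u powr (- (n/2 - 3/4)) * u powr (-3/4)"
      using u0 by (simp add: powr_add[symmetric])
    also have "\<dots> \<le> R powr (3/2 - n) * u powr (-3/4)" using * by (intro mult_right_mono) auto
    finally show ?thesis using kernel_deriv_le[OF m u0, of n] n by simp
  qed
  have "h (R\<^sup>2) - kernel n m (R\<^sup>2) \<le> h s - kernel n m s"
  proof (rule DERIV_nonneg_imp_nondecreasing[OF sR])
    fix u assume u: "R\<^sup>2 \<le> u" "u \<le> s"
    have "((\<lambda>u. h u - kernel n m u) has_real_derivative 1/2 * R powr (3/2 - n) * u powr (-3/4) - kernel_deriv n m u) (at u)"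
      using less_le_trans[OF R2 u(1)] by (intro DERIV_diff dh kernel_has_deriv m) auto
    then show "\<exists>y. ((\<lambda>u. h u - kernel n m u) has_real_derivative y) (at u) \<and> 0 \<le> y"
      using le[OF u(1)] by (intro exI conjI) auto
  qed
  moreover have "kernel n m (R\<^sup>2) \<le> kernel n m s"
  proof (rule DERIV_nonneg_imp_nondecreasing[OF sR])
    fix u assume "R\<^sup>2 \<le> u" "u \<le> s"
    then have "0 \<le> u" using R2 by linarith
    then show "\<exists>y. (kernel n m has_real_derivative y) (at u) \<and> 0 \<le> y"
      using kernel_has_deriv[OF m, of u n] kernel_deriv_nonneg[of n m u] by (intro exI[of _ "kernel_deriv n m u"] conjI) auto
  qed
  moreover have "0 \<le> h (R\<^sup>2)" unfolding h_def by simp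
  ultimately have "\<bar>kernel n m s - kernel n m (R\<^sup>2)\<bar> \<le> h s" by linarith
  also have "\<dots> \<le> 2 * R powr (1/2) * s powr (- (n/2 - 3/4)) + h s" by simp
  finally show ?thesis unfolding h_def .
qed

lemma kernel_mean_value:
  assumes m: "0 < m" and s: "0 \<le> s" "0 \<le> t"
  shows "\<exists>\<xi>. min s t \<le> \<xi> \<and> \<xi> \<le> max s t \<and> kernel n m s - kernel n m t = kernel_deriv n m \<xi> * (s - t)"
proof -
  have main: "\<exists>\<xi>. a \<le> \<xi> \<and> \<xi> \<le> b \<and> kernel n m b - kernel n m a = kernel_deriv n m \<xi> * (b - a)" if "0 \<le> a" "a < b" for a b
    using MVT2[OF that(2), of "kernel n m" "kernel_deriv n m"] kernel_has_deriv[OF m] that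
    by (auto simp: mult.commute) (metis less_imp_le mult.commute)
  consider "s < t" | "s = t" | "t < s" by linarith
  then show ?thesis
  proof cases
    case 1
    then obtain \<xi> where "s \<le> \<xi>" "\<xi> \<le> t" "kernel n m t - kernel n m s = kernel_deriv n m \<xi> * (t - s)"
      using main[of s t] s by auto
    then show ?thesis using 1 by (intro exI[of _ \<xi>]) (auto simp: algebra_simps)
  next
    case 3
    then obtain \<xi> where "t \<le> \<xi>" "\<xi> \<le> s" "kernel n m s - kernel n m t = kernel_deriv n m \<xi> * (s - t)"
      using main[of t s] s by auto
    then show ?thesis using 3 by (intro exI[of _ \<xi>]) auto
  qed auto
qed

text \<open>
  At distances comparable to \<open>R\<close> both regularisations disappear once the parameter \<open>N\<close> is at
  least \<open>R\<^sup>2\<close>: the shift \<open>1/N\<^sup>2\<close> and the ratio \<open>S/N\<^sup>2\<close> are negligible.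
\<close>

lemma scaled_kernel_limit:
  fixes R N S :: "nat \<Rightarrow> real"
  assumes R: "filterlim R at_top sequentially" and R1: "\<And>k. 1 \<le> R k" and N: "\<And>k. (R k)\<^sup>2 \<le> N k"
    and S0: "\<And>k. 0 \<le> S k" and S: "(\<lambda>k. S k / (R k)\<^sup>2) \<longlonglongrightarrow> 1"
  shows "(\<lambda>k. R k powr n * (2 * kernel_deriv n (N k) (S k))) \<longlonglongrightarrow> 1"
proof -
  have Rpos: "0 < R k" for k using R1[of k] by linarith
  have N1: "1 \<le> N k" for k using N[of k] one_le_power[OF R1[of k], of 2] by linarith
  have R2: "(\<lambda>k. 1 / (R k)\<^sup>2) \<longlonglongrightarrow> 0"
    by (intro tendsto_divide_0[OF tendsto_const] filterlim_at_top_imp_at_infinity filterlim_pow_at_top R) auto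
  have a: "(\<lambda>k. 1 / (N k)\<^sup>2 / (R k)\<^sup>2) \<longlonglongrightarrow> 0"
  proof (rule Lim_null_comparison[OF _ R2])
    show "\<forall>\<^sub>F k in sequentially. norm (1 / (N k)\<^sup>2 / (R k)\<^sup>2) \<le> 1 / (R k)\<^sup>2"
    proof (intro always_eventually allI)
      fix k
      have "1 / (N k)\<^sup>2 \<le> 1" using one_le_power[OF N1[of k], of 2] by (subst divide_le_eq_1) auto
      then have "1 / (N k)\<^sup>2 / (R k)\<^sup>2 \<le> 1 / (R k)\<^sup>2" by (rule divide_right_mono) simp
      then show "norm (1 / (N k)\<^sup>2 / (R k)\<^sup>2) \<le> 1 / (R k)\<^sup>2" by simp
    qed
  qed
  have b: "(\<lambda>k. S k / (N k)\<^sup>2) \<longlonglongrightarrow> 0"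
  proof (rule Lim_null_comparison)
    show "\<forall>\<^sub>F k in sequentially. norm (S k / (N k)\<^sup>2) \<le> S k / (R k)\<^sup>2 * (1 / (R k)\<^sup>2)"
    proof (intro always_eventually allI)
      fix k
      have "((R k)\<^sup>2)\<^sup>2 \<le> (N k)\<^sup>2" using N[of k] by (intro power_mono) auto
      moreover have "0 < N k" using N1[of k] by linarith
      ultimately have "S k / (N k)\<^sup>2 \<le> S k / ((R k)\<^sup>2)\<^sup>2" using S0[of k] Rpos[of k] by (intro divide_left_mono) auto
      also have "\<dots> = S k / (R k)\<^sup>2 * (1 / (R k)\<^sup>2)" by (simp add: power2_eq_square)
      finally show "norm (S k / (N k)\<^sup>2) \<le> S k / (R k)\<^sup>2 * (1 / (R k)\<^sup>2)" using S0[of k] by simp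
    qed
    show "(\<lambda>k. S k / (R k)\<^sup>2 * (1 / (R k)\<^sup>2)) \<longlonglongrightarrow> 0" using tendsto_mult[OF S R2] by simp
  qed
  have eq: "R k powr n * (2 * kernel_deriv n (N k) (S k))
     = (S k / (R k)\<^sup>2 + 1 / (N k)\<^sup>2 / (R k)\<^sup>2) powr (- n/2) * (max 0 (1 - S k / (N k)\<^sup>2))\<^sup>2" for k
  proof -
    have "((S k + 1 / (N k)\<^sup>2) / (R k)\<^sup>2) powr (- n/2) = (S k + 1 / (N k)\<^sup>2) powr (- n/2) / ((R k)\<^sup>2) powr (- n/2)"
      using S0[of k] by (intro powr_divide)
    also have "((R k)\<^sup>2) powr (- n/2) = R k powr (- n)" using Rpos[of k] by (simp add: square_powr)
    also have "(S k + 1 / (N k)\<^sup>2) powr (- n/2) / R k powr (- n) = R k powr n * (S k + 1 / (N k)\<^sup>2) powr (- n/2)"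
    proof -
      have "u / r powr (- q) = r powr q * u" for u r q :: real
        by (simp add: powr_minus divide_inverse)
      then show ?thesis .
    qed
    finally have "(S k / (R k)\<^sup>2 + 1 / (N k)\<^sup>2 / (R k)\<^sup>2) powr (- n/2) = R k powr n * (S k + 1 / (N k)\<^sup>2) powr (- n/2)"
      by (simp only: add_divide_distrib)
    then show ?thesis by (simp only: kernel_deriv_def)
  qed
  have "(\<lambda>k. (S k / (R k)\<^sup>2 + 1 / (N k)\<^sup>2 / (R k)\<^sup>2) powr (- n/2) * (max 0 (1 - S k / (N k)\<^sup>2))\<^sup>2)
      \<longlonglongrightarrow> (1 + 0) powr (- n/2) * (max 0 (1 - 0))\<^sup>2"
    by (rule tendsto_mult[OF tendsto_powr[OF tendsto_add[OF S a] tendsto_const]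
          tendsto_power[OF tendsto_max[OF tendsto_const tendsto_diff[OF tendsto_const b]]]]) simp
  then show ?thesis unfolding eq by simp
qed

context water_wave
begin

lemma sq_dist_ge: "(norm (x - x\<^sub>0))\<^sup>2 \<le> sq_dist x\<^sub>0 x"
  by (simp add: sq_dist_def)

lemma sq_dist_nonneg: "0 \<le> sq_dist x\<^sub>0 x"
  by (simp add: sq_dist_def)

lemma eta_diff_le: "\<bar>\<eta> x - \<eta> y\<bar> \<le> 2 * K"
  using eta_bounded[of x] eta_bounded[of y] by linarith

lemma sq_dist_meas[measurable]: "sq_dist x\<^sub>0 \<in> borel_measurable borel"
  unfolding sq_dist_def[abs_def] by measurable

lemma kernel_deriv_meas[measurable]:
  "0 < m \<Longrightarrow> (\<lambda>x. kernel_deriv n m (sq_dist x\<^sub>0 x)) \<in> borel_measurable borel"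
  unfolding kernel_deriv_def by measurable

lemma kernel_meas[measurable]:
  assumes "0 < m" shows "(\<lambda>x. kernel (real DIM('a \<times> real)) m (sq_dist x\<^sub>0 x)) \<in> borel_measurable borel"
proof -
  have "continuous_on UNIV (\<lambda>x. green_test m (surf x\<^sub>0) (surf x))"
    by (intro continuous_on_compose2[OF green_test_continuous(3)[OF assms, of UNIV] continuous_surf]) auto
  then show ?thesis
    unfolding green_test_def sq_dist_eq by (rule borel_measurable_continuous_onI)
qed

lemma kernel_deriv_bound:
  assumes "0 < m" "0 < r" "r\<^sup>2 \<le> s"
  shows "2 * kernel_deriv (real DIM('a \<times> real)) m s \<le> r powr (- (real DIM('a) + 1))"
proof -
  have s: "0 < s" using assms by (smt (verit) zero_less_power)
  have "2 * kernel_deriv (real DIM('a \<times> real)) m s \<le> s powr (- real DIM('a \<times> real)/2)"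
    using kernel_deriv_le[OF assms(1) s, of "real DIM('a \<times> real)"] by simp
  also have "\<dots> \<le> (r\<^sup>2) powr (- real DIM('a \<times> real)/2)"
    using assms s by (intro powr_mono2') auto
  also have "\<dots> = r powr (- (real DIM('a) + 1))"
  proof -
    have "2 * (- real DIM('a \<times> real)/2) = - (real DIM('a) + 1)" by simp
    then show ?thesis using square_powr[of r "- real DIM('a \<times> real)/2"] assms(2) by (simp only: less_imp_le)
  qed
  finally show ?thesis .
qed

text \<open>
  The normal derivative of the regularised kernel on the surface. The last factor is the
  height of \<open>surf x\<^sub>0\<close> relative to the tangent plane at \<open>surf x\<close>, up to sign.
\<close>

definition double_layer :: "real \<Rightarrow> 'a \<Rightarrow> 'a \<Rightarrow> real" where
  "double_layer m x\<^sub>0 x = 2 * kernel_deriv (real DIM('a \<times> real)) m (sq_dist x\<^sub>0 x)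
     * (\<eta> x - \<eta> x\<^sub>0 - D\<eta> x \<bullet> (x - x\<^sub>0))"

lemma double_layer_meas: "0 < m \<Longrightarrow> double_layer m x\<^sub>0 \<in> borel_measurable borel"
  unfolding double_layer_def[abs_def] by measurable

definition near_part :: "real \<Rightarrow> real \<Rightarrow> 'a \<Rightarrow> real" where
  "near_part \<beta> R x = indicator (ball 0 R) x * norm x powr (- \<beta>)"

definition far_part :: "real \<Rightarrow> real \<Rightarrow> 'a \<Rightarrow> real" where
  "far_part \<beta> R x = indicator (- ball 0 R) x * norm x powr (- \<beta>)"

lemma near_part_nonneg: "0 \<le> near_part \<beta> R x" and far_part_nonneg: "0 \<le> far_part \<beta> R x"
  unfolding near_part_def far_part_def by auto

lemma near_part_integral:
  assumes "\<beta> < real DIM('a)" "0 < R"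
  shows "integrable lborel (near_part \<beta> R)"
    "(\<integral>x. near_part \<beta> R x \<partial>lborel) = R powr (real DIM('a) - \<beta>) * (\<integral>x. near_part \<beta> 1 x \<partial>lborel)"
  using integral_ball_powr[where 'a='a, OF assms] unfolding near_part_def[abs_def] by simp_all

lemma far_part_integral:
  assumes "real DIM('a) < \<beta>" "0 < R"
  shows "integrable lborel (far_part \<beta> R)"
    "(\<integral>x. far_part \<beta> R x \<partial>lborel) = R powr (real DIM('a) - \<beta>) * (\<integral>x. far_part \<beta> 1 x \<partial>lborel)"
  using integral_tail_powr[where 'a='a, OF assms] unfolding far_part_def[abs_def] by simp_all

text \<open>
  Away from the origin the factor \<open>\<eta> x - \<eta> x\<^sub>0 - D\<eta> x \<bullet> (x - x\<^sub>0)\<close> is small: near \<open>x\<^sub>0\<close> by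
  Taylor's formula, which also cancels two powers of the singularity, and elsewhere by the
  decay of \<open>\<eta>\<close> and of its gradient.
\<close>

lemma double_layer_far_bound:
  assumes m: "0 < m" and R: "2 \<le> norm x\<^sub>0" and x: "norm x\<^sub>0 / 2 \<le> norm x"
  shows "\<bar>double_layer m x\<^sub>0 x\<bar>
    \<le> K * norm x\<^sub>0 powr (- (real DIM('a) + 2 + \<epsilon>)) * near_part (real DIM('a) - 1) (norm x\<^sub>0 / 2) (x - x\<^sub>0)
      + 2 * K * (norm x\<^sub>0 / 2) powr (- (real DIM('a) + \<epsilon>)) * far_part (real DIM('a) + 1) (norm x\<^sub>0 / 2) (x - x\<^sub>0)
      + K * (norm x\<^sub>0 / 2) powr (- real DIM('a)) * far_part (real DIM('a) + 1 + \<epsilon>) (norm x\<^sub>0 / 2) x"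
    (is "_ \<le> ?A + ?B + ?C")
proof -
  let ?d = "real DIM('a)" and ?R = "norm x\<^sub>0" and ?r = "norm (x - x\<^sub>0)"
  let ?k = "2 * kernel_deriv (real DIM('a \<times> real)) m (sq_dist x\<^sub>0 x)"
  have nn: "0 \<le> ?A" "0 \<le> ?B" "0 \<le> ?C"
    using K_nonneg near_part_nonneg far_part_nonneg by auto
  have k0: "0 \<le> ?k" using kernel_deriv_nonneg by simp
  show ?thesis
  proof (cases "x = x\<^sub>0")
    case True
    then have "double_layer m x\<^sub>0 x = 0" by (simp add: double_layer_def)
    then show ?thesis using nn by simp
  next
    case False
    then have r0: "0 < ?r" by simp
    have k: "?k \<le> ?r powr (- (?d + 1))" by (rule kernel_deriv_bound[OF m r0 sq_dist_ge])
    have eq: "\<bar>double_layer m x\<^sub>0 x\<bar> = ?k * \<bar>\<eta> x - \<eta> x\<^sub>0 - D\<eta> x \<bullet> (x - x\<^sub>0)\<bar>"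
      using k0 unfolding double_layer_def by (simp add: abs_mult)
    show ?thesis
    proof (cases "?r < ?R / 2")
      case True
      have "\<bar>\<eta> x - \<eta> x\<^sub>0 - D\<eta> x \<bullet> (x - x\<^sub>0)\<bar> \<le> K * ?R powr (- (?d + 2 + \<epsilon>)) * ?r\<^sup>2"
        using True R by (intro eta_taylor) auto
      then have "\<bar>double_layer m x\<^sub>0 x\<bar> \<le> ?r powr (- (?d + 1)) * (K * ?R powr (- (?d + 2 + \<epsilon>)) * ?r\<^sup>2)"
        unfolding eq by (intro mult_mono k) auto
      also have "\<dots> = K * ?R powr (- (?d + 2 + \<epsilon>)) * (?r powr (- (?d + 1)) * ?r powr 2)"
        using r0 by simp
      also have "?r powr (- (?d + 1)) * ?r powr 2 = ?r powr (- (?d - 1))"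
        by (simp only: powr_add[symmetric], rule arg_cong2[where f="(powr)", OF refl], simp)
      also have "K * ?R powr (- (?d + 2 + \<epsilon>)) * ?r powr (- (?d - 1)) = ?A"
        using True by (simp add: near_part_def)
      finally show ?thesis using nn by linarith
    next
      case False
      have b: "\<bar>\<eta> y\<bar> \<le> K * (?R/2) powr (- (?d + \<epsilon>))" if "?R / 2 \<le> norm y" for y
      proof -
        have "(1 + norm y) powr (- (?d + \<epsilon>)) \<le> (?R/2) powr (- (?d + \<epsilon>))"
          using that R eps_pos by (intro powr_mono2') auto
        then show ?thesis using order_trans[OF eta_decay mult_left_mono[OF _ K_nonneg]] by blast
      qed
      have "norm (D\<eta> x) \<le> K * norm x powr (- (?d + 1 + \<epsilon>))"
      proof -
        have "(1 + norm x) powr (- (?d + 1 + \<epsilon>)) \<le> norm x powr (- (?d + 1 + \<epsilon>))"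
          using x R eps_pos by (intro powr_mono2') auto
        then show ?thesis using order_trans[OF Deta_decay mult_left_mono[OF _ K_nonneg]] by blast
      qed
      then have D: "\<bar>D\<eta> x \<bullet> (x - x\<^sub>0)\<bar> \<le> (K * norm x powr (- (?d + 1 + \<epsilon>))) * ?r"
        by (intro order_trans[OF Cauchy_Schwarz_ineq2] mult_right_mono) auto
      have "\<bar>\<eta> x - \<eta> x\<^sub>0 - D\<eta> x \<bullet> (x - x\<^sub>0)\<bar> \<le> \<bar>\<eta> x\<bar> + \<bar>\<eta> x\<^sub>0\<bar> + \<bar>D\<eta> x \<bullet> (x - x\<^sub>0)\<bar>" by linarith
      also have "\<dots> \<le> 2 * K * (?R/2) powr (- (?d + \<epsilon>)) + (K * norm x powr (- (?d + 1 + \<epsilon>))) * ?r"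
        using b[OF x] b[of x\<^sub>0] D by auto
      finally have "\<bar>double_layer m x\<^sub>0 x\<bar>
        \<le> ?r powr (- (?d + 1)) * (2 * K * (?R/2) powr (- (?d + \<epsilon>)) + (K * norm x powr (- (?d + 1 + \<epsilon>))) * ?r)"
        unfolding eq by (intro mult_mono k) auto
      also have "\<dots> = ?B + K * (?r powr (- (?d + 1)) * ?r) * norm x powr (- (?d + 1 + \<epsilon>))"
        using False by (simp add: far_part_def algebra_simps)
      also have "?r powr (- (?d + 1)) * ?r = ?r powr (- ?d)"
        using powr_add[of ?r "- (?d + 1)" 1] r0 by simp
      also have "K * ?r powr (- ?d) * norm x powr (- (?d + 1 + \<epsilon>)) \<le> K * (?R/2) powr (- ?d) * norm x powr (- (?d + 1 + \<epsilon>))"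
        using False R K_nonneg by (intro mult_right_mono mult_left_mono powr_mono2') auto
      also have "\<dots> = ?C" using x by (simp add: far_part_def)
      finally show ?thesis using nn by linarith
    qed
  qed
qed

text \<open>
  The three terms of the pointwise bound integrate, by scaling, to the same power
  \<open>|x\<^sub>0|\<^sup>-\<^sup>d\<^sup>-\<^sup>1\<^sup>-\<^sup>\<epsilon>\<close>.
\<close>

lemma double_layer_far_tendsto:
  fixes X :: "nat \<Rightarrow> 'a" and N :: "nat \<Rightarrow> real"
  assumes X: "\<And>k. real k + 2 \<le> norm (X k)" and N: "\<And>k. 0 < N k"
  shows "(\<lambda>k. norm (X k) powr real DIM('a)
      * (\<integral>x. indicator (- ball 0 (norm (X k) / 2)) x * (\<psi> x * double_layer (N k) (X k) x) \<partial>lborel)) \<longlonglongrightarrow> 0"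
proof -
  let ?d = "real DIM('a)"
  obtain M where M: "0 \<le> M" "\<And>x. \<bar>\<psi> x\<bar> \<le> M" using psi_bounded by blast
  define B1 where "B1 = (\<integral>x. near_part (?d - 1) 1 x \<partial>lborel)"
  define B2 where "B2 = (\<integral>x. far_part (?d + 1) 1 x \<partial>lborel)"
  define B3 where "B3 = (\<integral>x. far_part (?d + 1 + \<epsilon>) 1 x \<partial>lborel)"
  define C where "C = M * (K * 2 powr (- 1) * B1 + 2 * K * 2 powr (?d + 1 + \<epsilon>) * B2 + K * 2 powr (?d + 1 + \<epsilon>) * B3)"
  have main: "\<bar>norm (X k) powr ?d * (\<integral>x. indicator (- ball 0 (norm (X k) / 2)) x * (\<psi> x * double_layer (N k) (X k) x) \<partial>lborel)\<bar>
      \<le> C * norm (X k) powr (- (1 + \<epsilon>))" for k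
  proof -
    let ?R = "norm (X k)"
    have R: "2 \<le> ?R" using X[of k] by linarith
    then have R0: "0 < ?R" "0 < ?R / 2" by auto
    let ?a = "\<lambda>x. near_part (?d - 1) (?R / 2) (x - X k)" and ?b = "\<lambda>x. far_part (?d + 1) (?R / 2) (x - X k)"
      and ?c = "\<lambda>x. far_part (?d + 1 + \<epsilon>) (?R / 2) x"
    let ?ka = "K * ?R powr (- (?d + 2 + \<epsilon>))" and ?kb = "2 * K * (?R / 2) powr (- (?d + \<epsilon>))" and ?kc = "K * (?R / 2) powr (- ?d)"
    note na = near_part_integral[of "?d - 1" "?R/2"] and nb = far_part_integral[of "?d + 1" "?R/2"]
      and nc = far_part_integral[of "?d + 1 + \<epsilon>" "?R/2"]
    have ia: "integrable lborel ?a" "(\<integral>x. ?a x \<partial>lborel) = (?R/2) powr 1 * B1"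
      using integral_shift[OF na(1), of "X k"] na(2) R0 unfolding B1_def by auto
    have ib: "integrable lborel ?b" "(\<integral>x. ?b x \<partial>lborel) = (?R/2) powr (- 1) * B2"
      using integral_shift[OF nb(1), of "X k"] nb(2) R0 unfolding B2_def by auto
    have ic: "integrable lborel ?c" "(\<integral>x. ?c x \<partial>lborel) = (?R/2) powr (- (1 + \<epsilon>)) * B3"
      using nc R0 eps_pos unfolding B3_def by (auto simp: algebra_simps)
    have "\<bar>\<integral>x. indicator (- ball 0 (?R / 2)) x * (\<psi> x * double_layer (N k) (X k) x) \<partial>lborel\<bar>
       \<le> (\<integral>x. M * (?ka * ?a x + ?kb * ?b x + ?kc * ?c x) \<partial>lborel)"
    proof (rule abs_integral_le)
      show "(\<lambda>x. indicator (- ball 0 (?R / 2)) x * (\<psi> x * double_layer (N k) (X k) x)) \<in> borel_measurable lborel"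
        using double_layer_meas[OF N, of k] by measurable
      show "integrable lborel (\<lambda>x. M * (?ka * ?a x + ?kb * ?b x + ?kc * ?c x))"
        by (intro integrable_mult_right Bochner_Integration.integrable_add ia ib ic)
      show "AE x in lborel. \<bar>indicator (- ball 0 (?R / 2)) x * (\<psi> x * double_layer (N k) (X k) x)\<bar> \<le> M * (?ka * ?a x + ?kb * ?b x + ?kc * ?c x)"
      proof (rule AE_I2)
        fix x :: 'a
        have nn: "0 \<le> ?ka * ?a x + ?kb * ?b x + ?kc * ?c x"
          using K_nonneg near_part_nonneg far_part_nonneg by (intro add_nonneg_nonneg mult_nonneg_nonneg) auto
        show "\<bar>indicator (- ball 0 (?R / 2)) x * (\<psi> x * double_layer (N k) (X k) x)\<bar> \<le> M * (?ka * ?a x + ?kb * ?b x + ?kc * ?c x)"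
        proof (cases "?R / 2 \<le> norm x")
          case True
          have "\<bar>\<psi> x\<bar> * \<bar>double_layer (N k) (X k) x\<bar> \<le> M * (?ka * ?a x + ?kb * ?b x + ?kc * ?c x)"
            using double_layer_far_bound[OF N R True] M by (intro mult_mono) auto
          then show ?thesis using True by (simp add: abs_mult)
        qed (use nn M(1) in \<open>simp add: indicator_def\<close>)
      qed
    qed
    also have "\<dots> = M * (?ka * ((?R/2) powr 1 * B1) + ?kb * ((?R/2) powr (- 1) * B2) + ?kc * ((?R/2) powr (- (1 + \<epsilon>)) * B3))"
      using ia ib ic by simp
    finally have le: "\<bar>\<integral>x. indicator (- ball 0 (?R / 2)) x * (\<psi> x * double_layer (N k) (X k) x) \<partial>lborel\<bar> \<le> \<dots>" .
    have e1: "?R powr ?d * (?ka * ((?R/2) powr 1 * B1)) = K * 2 powr (- 1) * B1 * ?R powr (- (1 + \<epsilon>))"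
    proof -
      have "?R powr ?d * ?R powr (- (?d + 2 + \<epsilon>)) * ?R powr 1 = ?R powr (- (1 + \<epsilon>))"
        by (simp only: powr_add[symmetric], rule arg_cong2[where f="(powr)", OF refl], simp)
      moreover have "?R powr ?d * (?ka * ((?R/2) powr 1 * B1))
         = K * 2 powr (- 1) * B1 * (?R powr ?d * ?R powr (- (?d + 2 + \<epsilon>)) * ?R powr 1)"
        unfolding powr_half[OF R0(1)] by (simp only: mult_ac)
      ultimately show ?thesis by (simp only:)
    qed
    have e2: "?R powr ?d * (?kb * ((?R/2) powr (- 1) * B2)) = 2 * K * 2 powr (?d + 1 + \<epsilon>) * B2 * ?R powr (- (1 + \<epsilon>))"
    proof -
      have "?R powr ?d * ?R powr (- (?d + \<epsilon>)) * ?R powr (- 1) = ?R powr (- (1 + \<epsilon>))"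
        by (simp only: powr_add[symmetric], rule arg_cong2[where f="(powr)", OF refl], simp)
      moreover have "2 powr (- (- (?d + \<epsilon>))) * 2 powr (- (- 1)) = 2 powr (?d + 1 + \<epsilon>)"
        by (simp only: powr_add[symmetric], rule arg_cong2[where f="(powr)", OF refl], simp)
      moreover have "?R powr ?d * (?kb * ((?R/2) powr (- 1) * B2))
         = 2 * K * (2 powr (- (- (?d + \<epsilon>))) * 2 powr (- (- 1))) * B2 * (?R powr ?d * ?R powr (- (?d + \<epsilon>)) * ?R powr (- 1))"
        unfolding powr_half[OF R0(1)] by (simp only: mult_ac)
      ultimately show ?thesis by (simp only:)
    qed
    have e3: "?R powr ?d * (?kc * ((?R/2) powr (- (1 + \<epsilon>)) * B3)) = K * 2 powr (?d + 1 + \<epsilon>) * B3 * ?R powr (- (1 + \<epsilon>))"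
    proof -
      have "?R powr ?d * ?R powr (- ?d) * ?R powr (- (1 + \<epsilon>)) = ?R powr (- (1 + \<epsilon>))"
        by (simp only: powr_add[symmetric], rule arg_cong2[where f="(powr)", OF refl], simp)
      moreover have "2 powr (- (- ?d)) * 2 powr (- (- (1 + \<epsilon>))) = 2 powr (?d + 1 + \<epsilon>)"
        by (simp only: powr_add[symmetric], rule arg_cong2[where f="(powr)", OF refl], simp)
      moreover have "?R powr ?d * (?kc * ((?R/2) powr (- (1 + \<epsilon>)) * B3))
         = K * (2 powr (- (- ?d)) * 2 powr (- (- (1 + \<epsilon>)))) * B3 * (?R powr ?d * ?R powr (- ?d) * ?R powr (- (1 + \<epsilon>)))"
        unfolding powr_half[OF R0(1)] by (simp only: mult_ac)
      ultimately show ?thesis by (simp only:)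
    qed
    have "?R powr ?d * (M * (?ka * ((?R/2) powr 1 * B1) + ?kb * ((?R/2) powr (- 1) * B2) + ?kc * ((?R/2) powr (- (1 + \<epsilon>)) * B3)))
      = M * (?R powr ?d * (?ka * ((?R/2) powr 1 * B1)) + ?R powr ?d * (?kb * ((?R/2) powr (- 1) * B2)) + ?R powr ?d * (?kc * ((?R/2) powr (- (1 + \<epsilon>)) * B3)))"
      by (simp only: distrib_left mult.left_commute)
    also have "\<dots> = C * ?R powr (- (1 + \<epsilon>))"
      unfolding e1 e2 e3 C_def by (simp only: distrib_left distrib_right mult.assoc)
    finally show ?thesis
      using mult_left_mono[OF le, of "?R powr ?d"] by (simp only: abs_mult powr_ge_zero abs_of_nonneg)
  qed
  have Xlim: "filterlim (\<lambda>k. norm (X k)) at_top sequentially"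
  proof (rule filterlim_at_top_mono[OF filterlim_real_sequentially], intro always_eventually allI)
    show "real k \<le> norm (X k)" for k using X[of k] by linarith
  qed
  have "((\<lambda>R::real. R powr (- (1 + \<epsilon>))) \<longlongrightarrow> 0) at_top"
    using eps_pos by (intro tendsto_neg_powr filterlim_ident) auto
  from filterlim_compose[OF this Xlim]
  have "(\<lambda>k. C * norm (X k) powr (- (1 + \<epsilon>))) \<longlonglongrightarrow> 0" by (intro tendsto_mult_right_zero)
  then show ?thesis
    by (rule Lim_null_comparison[rotated]) (use main in auto)
qed

end

section \<open>The dipole moment and the asymptotics on the surface\<close>

context water_wave
begin

definition dipole :: 'a where "dipole = (\<Sum>b\<in>Basis. (\<integral>x. \<psi> x * (D\<eta> x \<bullet> b) \<partial>lborel) *\<^sub>R b)"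

lemma psi_Deta_integrable: "integrable lborel (\<lambda>x. \<psi> x * (D\<eta> x \<bullet> v))"
  using psi_bounded bounded_Deta_integrable[OF psi_meas] by metis

lemma dipole_inner: "dipole \<bullet> v = (\<integral>x. \<psi> x * (D\<eta> x \<bullet> v) \<partial>lborel)"
proof -
  have "(\<integral>x. \<psi> x * (D\<eta> x \<bullet> v) \<partial>lborel) = (\<integral>x. (\<Sum>b\<in>Basis. (\<psi> x * (D\<eta> x \<bullet> b)) * (v \<bullet> b)) \<partial>lborel)"
    by (simp add: euclidean_inner[of "D\<eta> _" v] sum_distrib_left mult.assoc)
  also have "\<dots> = (\<Sum>b\<in>Basis. \<integral>x. (\<psi> x * (D\<eta> x \<bullet> b)) * (v \<bullet> b) \<partial>lborel)"
    by (rule Bochner_Integration.integral_sum) (intro integrable_mult_left psi_Deta_integrable)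
  also have "\<dots> = dipole \<bullet> v"
    by (simp only: dipole_def inner_sum_left inner_scaleR_left inner_commute[of v] integral_mult_left_zero)
  finally show ?thesis by simp
qed

text \<open>
  This links the two halves of the argument: the dipole moment that governs the decay of the
  potential also controls its energy.
\<close>

lemma energy_flux_dipole: "energy_flux = - (dipole \<bullet> c)"
  by (simp add: energy_flux_def dipole_inner)

lemma sq_dist_difference:
  "sq_dist x\<^sub>0 x - (norm x\<^sub>0)\<^sup>2 = (norm x)\<^sup>2 - 2 * (x \<bullet> x\<^sub>0) + (\<eta> x - \<eta> x\<^sub>0)\<^sup>2"
  unfolding sq_dist_def power2_norm_eq_inner by (simp add: algebra_simps inner_commute)

lemma eta_diff_square_le: "(\<eta> x - \<eta> y)\<^sup>2 \<le> (2 * K)\<^sup>2"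
  using eta_diff_le[of x y] K_nonneg by (intro abs_le_square_iff[THEN iffD1]) simp

text \<open>
  The leading term \<open>2 (x \<bullet> x\<^sub>0)\<close> is linear in \<open>|x\<^sub>0|\<close>; it produces the dipole moment of the
  single layer.
\<close>

lemma sq_dist_difference_le:
  "\<bar>sq_dist x\<^sub>0 x - (norm x\<^sub>0)\<^sup>2\<bar> \<le> (norm x)\<^sup>2 + (2 * K)\<^sup>2 + 2 * (norm x * norm x\<^sub>0)"
  using Cauchy_Schwarz_ineq2[of x x\<^sub>0] eta_diff_square_le[of x x\<^sub>0]
    zero_le_power2[of "norm x"] zero_le_power2[of "\<eta> x - \<eta> x\<^sub>0"]
  unfolding sq_dist_difference by linarith

lemma sq_dist_ratio:
  fixes X :: "nat \<Rightarrow> 'a"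
  assumes X: "filterlim (\<lambda>k. norm (X k)) at_top sequentially"
  shows "(\<lambda>k. sq_dist (X k) x / (norm (X k))\<^sup>2) \<longlonglongrightarrow> 1"
proof -
  let ?R = "\<lambda>k. norm (X k)"
  have i1: "(\<lambda>k. C / ?R k) \<longlonglongrightarrow> 0" for C
    by (intro tendsto_divide_0[OF tendsto_const] filterlim_at_top_imp_at_infinity X)
  have i2: "(\<lambda>k. C / (?R k)\<^sup>2) \<longlonglongrightarrow> 0" for C
    by (intro tendsto_divide_0[OF tendsto_const] filterlim_at_top_imp_at_infinity filterlim_pow_at_top X) auto
  have "(\<lambda>k. sq_dist (X k) x / (?R k)\<^sup>2 - 1) \<longlonglongrightarrow> 0"
  proof (rule Lim_null_comparison)
    show "(\<lambda>k. ((norm x)\<^sup>2 + (2 * K)\<^sup>2) / (?R k)\<^sup>2 + 2 * norm x / ?R k) \<longlonglongrightarrow> 0"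
      using tendsto_add[OF i2 i1] by simp
    show "\<forall>\<^sub>F k in sequentially. norm (sq_dist (X k) x / (?R k)\<^sup>2 - 1)
        \<le> ((norm x)\<^sup>2 + (2 * K)\<^sup>2) / (?R k)\<^sup>2 + 2 * norm x / ?R k"
      using X[unfolded filterlim_at_top_dense, rule_format, of 0]
    proof eventually_elim
      case (elim k)
      have "\<bar>sq_dist (X k) x - (?R k)\<^sup>2\<bar> \<le> (norm x)\<^sup>2 + (2 * K)\<^sup>2 + 2 * (norm x * ?R k)"
        by (rule sq_dist_difference_le)
      then have "\<bar>sq_dist (X k) x - (?R k)\<^sup>2\<bar> / (?R k)\<^sup>2 \<le> ((norm x)\<^sup>2 + (2 * K)\<^sup>2 + 2 * (norm x * ?R k)) / (?R k)\<^sup>2"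
        by (intro divide_right_mono) auto
      also have "\<dots> = ((norm x)\<^sup>2 + (2 * K)\<^sup>2) / (?R k)\<^sup>2 + 2 * norm x / ?R k"
        using elim by (simp add: add_divide_distrib power2_eq_square)
      also have "\<bar>sq_dist (X k) x - (?R k)\<^sup>2\<bar> / (?R k)\<^sup>2 = norm (sq_dist (X k) x / (?R k)\<^sup>2 - 1)"
      proof -
        have "sq_dist (X k) x / (?R k)\<^sup>2 - 1 = (sq_dist (X k) x - (?R k)\<^sup>2) / (?R k)\<^sup>2"
          using elim by (simp add: diff_divide_distrib)
        then show ?thesis by (simp only: real_norm_def abs_divide abs_power2)
      qed
      finally show ?case .
    qed
  qed
  from tendsto_add[OF this tendsto_const[of 1]] show ?thesis by simp
qed

lemma dist_in_near_region:
  assumes "norm x < R / 2" "R = norm x\<^sub>0"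
  shows "R / 2 \<le> norm (x - x\<^sub>0)" "norm (x - x\<^sub>0) \<le> 3/2 * R"
  using assms norm_triangle_ineq2[of x\<^sub>0 x] norm_triangle_ineq4[of x x\<^sub>0]
  by (auto simp: norm_minus_commute)

lemma rescaled_kernel_near_bound:
  assumes m: "0 < m" and R: "0 < R" and s: "(R/2)\<^sup>2 \<le> s"
  shows "R powr real DIM('a) * (2 * kernel_deriv (real DIM('a \<times> real)) m s) \<le> 2 powr (real DIM('a) + 1) / R"
proof -
  let ?d = "real DIM('a)"
  have "R powr ?d * (2 * kernel_deriv (real DIM('a \<times> real)) m s) \<le> R powr ?d * (R/2) powr (- (?d + 1))"
    using R by (intro mult_left_mono kernel_deriv_bound m s) auto
  also have "\<dots> = 2 powr (- (- (?d + 1))) * (R powr ?d * R powr (- (?d + 1)))"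
    unfolding powr_half[OF R] by (simp only: mult_ac)
  also have "R powr ?d * R powr (- (?d + 1)) = R powr (- 1)"
    by (simp only: powr_add[symmetric], rule arg_cong2[where f="(powr)", OF refl], simp)
  also have "R powr (- 1) = 1 / R" using R by (simp add: powr_minus inverse_eq_divide)
  also have "2 powr (- (- (?d + 1))) * (1 / R) = 2 powr (?d + 1) / R"
    by (simp only: minus_minus times_divide_eq_right mult_1_right)
  finally show ?thesis .
qed

definition profile_weight :: "'a \<Rightarrow> real" where
  "profile_weight x = (1 + norm x) powr (- (real DIM('a) + \<epsilon>))"

lemma profile_weight_integrable: "integrable lborel profile_weight"
  unfolding profile_weight_def[abs_def] using eps_pos by (intro integrable_decay) simp

lemma profile_weight_nonneg: "0 \<le> profile_weight x"
  by (simp add: profile_weight_def)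

lemma profile_weight_antimono: "norm x \<le> norm y \<Longrightarrow> profile_weight y \<le> profile_weight x"
  unfolding profile_weight_def using eps_pos by (intro powr_mono2') (auto intro: add_pos_nonneg)

lemma Deta_weight: "norm (D\<eta> x) * (1 + norm x) \<le> K * profile_weight x"
proof -
  have p: "0 < 1 + norm x" by (intro add_pos_nonneg) auto
  have "norm (D\<eta> x) * (1 + norm x) \<le> K * (1 + norm x) powr (- (real DIM('a) + 1 + \<epsilon>)) * (1 + norm x)"
    using Deta_decay[of x] by (intro mult_right_mono) auto
  also have "\<dots> = K * ((1 + norm x) powr (- (real DIM('a) + 1 + \<epsilon>)) * (1 + norm x) powr 1)"
    using p by simp
  also have "(1 + norm x) powr (- (real DIM('a) + 1 + \<epsilon>)) * (1 + norm x) powr 1 = profile_weight x"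
    unfolding profile_weight_def
    by (simp only: powr_add[symmetric], rule arg_cong2[where f="(powr)", OF refl], simp)
  finally show ?thesis .
qed

lemma Deta_le_weight: "norm (D\<eta> x) \<le> K * profile_weight x"
  using order_trans[OF _ Deta_weight, of "norm (D\<eta> x)" x] mult_left_mono[of 1 "1 + norm x" "norm (D\<eta> x)"] by simp

lemma eta_le_weight: "\<bar>\<eta> x\<bar> \<le> K * profile_weight x"
  using eta_decay unfolding profile_weight_def .

lemma integral_split_ball:
  fixes f :: "'a \<Rightarrow> real"
  assumes "integrable lborel f"
  shows "(\<integral>x. f x \<partial>lborel) = (\<integral>x. indicator (ball 0 r) x * f x \<partial>lborel) + (\<integral>x. indicator (- ball 0 r) x * f x \<partial>lborel)"
proof -
  have "integrable lborel (\<lambda>x. indicator (ball 0 r) x *\<^sub>R f x)" "integrable lborel (\<lambda>x. indicator (- ball 0 r) x *\<^sub>R f x)"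
    by (rule integrable_mult_indicator[OF _ assms], simp)+
  from Bochner_Integration.integral_add[OF this, symmetric]
  have "(\<integral>x. indicator (ball 0 r) x * f x \<partial>lborel) + (\<integral>x. indicator (- ball 0 r) x * f x \<partial>lborel)
     = (\<integral>x. indicator (ball 0 r) x * f x + indicator (- ball 0 r) x * f x \<partial>lborel)" by simp
  also have "(\<lambda>x. indicator (ball 0 r) x * f x + indicator (- ball 0 r) x * f x) = f"
    by (auto simp: indicator_def fun_eq_iff)
  finally show ?thesis by simp
qed

lemma kernel_surf_continuous:
  assumes "0 < m"
  shows "continuous_on UNIV (\<lambda>x. kernel_deriv (real DIM('a \<times> real)) m (sq_dist x\<^sub>0 x))"
    "continuous_on UNIV (\<lambda>x. kernel (real DIM('a \<times> real)) m (sq_dist x\<^sub>0 x))"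
  using continuous_on_compose2[OF continuous_kernel_norm(1)[OF assms, of UNIV "real DIM('a \<times> real)" "surf x\<^sub>0"] continuous_surf[of UNIV]]
    continuous_on_compose2[OF green_test_continuous(3)[OF assms, of UNIV "surf x\<^sub>0"] continuous_surf[of UNIV]]
  unfolding green_test_def sq_dist_eq by auto

lemma sq_dist_large:
  assumes "0 < m" "m + norm x\<^sub>0 < norm x" shows "m\<^sup>2 \<le> sq_dist x\<^sub>0 x"
proof -
  have "m \<le> norm (x - x\<^sub>0)" using assms norm_triangle_ineq2[of x x\<^sub>0] by linarith
  then have "m\<^sup>2 \<le> (norm (x - x\<^sub>0))\<^sup>2" using assms by (intro power_mono) auto
  then show ?thesis using sq_dist_ge[of x x\<^sub>0] by linarith
qed

lemma double_layer_integrable: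
  assumes "0 < m" shows "integrable lborel (\<lambda>x. \<psi> x * double_layer m x\<^sub>0 x)"
  unfolding double_layer_def
proof (rule integrable_compact_support[where r="m + norm x\<^sub>0"])
  show "continuous_on UNIV (\<lambda>x. \<psi> x * (2 * kernel_deriv (real DIM('a \<times> real)) m (sq_dist x\<^sub>0 x)
      * (\<eta> x - \<eta> x\<^sub>0 - D\<eta> x \<bullet> (x - x\<^sub>0))))"
    by (intro continuous_intros psi_cont kernel_surf_continuous assms eta_cont Deta_cont)
  show "\<psi> x * (2 * kernel_deriv (real DIM('a \<times> real)) m (sq_dist x\<^sub>0 x) * (\<eta> x - \<eta> x\<^sub>0 - D\<eta> x \<bullet> (x - x\<^sub>0))) = 0"
    if "m + norm x\<^sub>0 < norm x" for x
    using kernel_deriv_outside[OF assms sq_dist_large[OF assms that], of "real DIM('a \<times> real)"] by simp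
qed

lemma single_layer_integrable:
  assumes "0 < m"
  shows "integrable lborel (\<lambda>x. (kernel (real DIM('a \<times> real)) m (sq_dist x\<^sub>0 x) - q) * (D\<eta> x \<bullet> c))"
proof -
  have "integrable lborel (\<lambda>x. kernel (real DIM('a \<times> real)) m (sq_dist x\<^sub>0 x) * (D\<eta> x \<bullet> c))"
  proof (rule integrable_compact_support[where r="m + norm x\<^sub>0"])
    show "continuous_on UNIV (\<lambda>x. kernel (real DIM('a \<times> real)) m (sq_dist x\<^sub>0 x) * (D\<eta> x \<bullet> c))"
      by (intro continuous_intros kernel_surf_continuous assms Deta_cont)
    show "kernel (real DIM('a \<times> real)) m (sq_dist x\<^sub>0 x) * (D\<eta> x \<bullet> c) = 0" if "m + norm x\<^sub>0 < norm x" for x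
      using kernel_outside[OF assms sq_dist_large[OF assms that], of "real DIM('a \<times> real)"] by simp
  qed
  moreover have "integrable lborel (\<lambda>x. q * (D\<eta> x \<bullet> c))"
    using bounded_Deta_integrable[of "\<lambda>_. q" "\<bar>q\<bar>" c] by simp
  ultimately show ?thesis unfolding left_diff_distrib by (rule Bochner_Integration.integrable_diff)
qed

text \<open>
  For bounded \<open>x\<close> and \<open>|x\<^sub>0| \<rightarrow> \<infinity>\<close> the kernel factor is asymptotic to \<open>|x\<^sub>0|\<^sup>-\<^sup>d\<^sup>-\<^sup>1\<close>, and
  \<open>\<eta> x - \<eta> x\<^sub>0 - D\<eta> x \<bullet> (x - x\<^sub>0)\<close> equals \<open>D\<eta> x \<bullet> x\<^sub>0\<close> up to a bounded quantity. So the
  contribution of \<open>|x| < |x\<^sub>0| / 2\<close> is \<open>|x\<^sub>0|\<^sup>-\<^sup>d (p \<bullet> x\<^sub>0) / |x\<^sub>0|\<close> to leading order, by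
  dominated convergence; the rest is negligible. The parameter of the kernel is tied to the
  point only by \<open>|X k|\<^sup>2 \<le> N k\<close>.
\<close>

lemma double_layer_limit:
  fixes X :: "nat \<Rightarrow> 'a" and N :: "nat \<Rightarrow> real"
  assumes X: "\<And>k. real k + 2 \<le> norm (X k)" and N: "\<And>k. (norm (X k))\<^sup>2 \<le> N k"
  shows "(\<lambda>k. norm (X k) powr real DIM('a) * (\<integral>x. \<psi> x * double_layer (N k) (X k) x \<partial>lborel)
      - (dipole \<bullet> X k) / norm (X k)) \<longlonglongrightarrow> 0"
proof -
  let ?d = "real DIM('a)" and ?n = "real DIM('a \<times> real)"
  let ?R = "\<lambda>k. norm (X k)"
  have R2: "2 \<le> ?R k" for k using X[of k] by linarith
  have R0: "0 < ?R k" for k using R2[of k] by linarith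
  have N0: "0 < N k" for k using N[of k] R0[of k] zero_less_power[of "?R k" 2] by linarith
  have Xlim: "filterlim ?R at_top sequentially"
  proof (rule filterlim_at_top_mono[OF filterlim_real_sequentially], intro always_eventually allI)
    show "real k \<le> norm (X k)" for k using X[of k] by linarith
  qed
  obtain M where M: "0 \<le> M" "\<And>x. \<bar>\<psi> x\<bar> \<le> M" using psi_bounded by blast
  let ?u = "\<lambda>k x. indicator (ball 0 (?R k / 2)) x * (\<psi> x * (?R k powr ?d * double_layer (N k) (X k) x)) - \<psi> x * (D\<eta> x \<bullet> X k) / ?R k"
  let ?C = "M * (4 * K * 2 powr (?d + 1) + K)"
  have "(\<lambda>k. \<integral>x. ?u k x \<partial>lborel) \<longlonglongrightarrow> (\<integral>(x::'a). 0 \<partial>lborel)"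
  proof (rule integral_dominated_convergence[where w="\<lambda>x. ?C * profile_weight x"])
    show "?u k \<in> borel_measurable lborel" for k
      using double_layer_meas[OF N0, of k "X k"] by measurable
    show "integrable lborel (\<lambda>x. ?C * profile_weight x)"
      by (intro integrable_mult_right profile_weight_integrable)
    show "AE x in lborel. norm (?u k x) \<le> ?C * profile_weight x" for k
    proof (rule AE_I2)
      fix x :: 'a
      have b: "\<bar>\<psi> x * (D\<eta> x \<bullet> X k) / ?R k\<bar> \<le> M * (K * profile_weight x)"
      proof -
        have "\<bar>D\<eta> x \<bullet> X k\<bar> / ?R k \<le> norm (D\<eta> x)"
          using Cauchy_Schwarz_ineq2[of "D\<eta> x" "X k"] R0[of k] by (simp add: divide_le_eq)
        then have "\<bar>\<psi> x\<bar> * (\<bar>D\<eta> x \<bullet> X k\<bar> / ?R k) \<le> M * (K * profile_weight x)"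
          using M order_trans[OF _ Deta_le_weight[of x]] by (intro mult_mono) auto
        then show ?thesis by (simp add: abs_mult)
      qed
      have a: "\<bar>indicator (ball 0 (?R k / 2)) x * (\<psi> x * (?R k powr ?d * double_layer (N k) (X k) x))\<bar>
         \<le> M * (4 * K * 2 powr (?d + 1) * profile_weight x)"
      proof (cases "norm x < ?R k / 2")
        case True
        note near = dist_in_near_region[OF True refl]
        have sq: "(?R k / 2)\<^sup>2 \<le> sq_dist (X k) x"
          using R0[of k] by (intro order_trans[OF power_mono[OF near(1)] sq_dist_ge]) auto
        let ?A = "?R k powr ?d * (2 * kernel_deriv ?n (N k) (sq_dist (X k) x))"
        let ?B = "\<eta> x - \<eta> (X k) - D\<eta> x \<bullet> (x - X k)"
        have A: "?A \<le> 2 powr (?d + 1) / ?R k" by (rule rescaled_kernel_near_bound[OF N0 R0 sq])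
        have A0: "0 \<le> ?A" using kernel_deriv_nonneg by simp
        have "\<bar>D\<eta> x \<bullet> (x - X k)\<bar> \<le> norm (D\<eta> x) * (3/2 * ?R k)"
          using near(2) by (intro order_trans[OF Cauchy_Schwarz_ineq2] mult_left_mono) auto
        also have "\<dots> \<le> K * profile_weight x * (3/2 * ?R k)"
          using Deta_le_weight[of x] R0[of k] by (intro mult_right_mono) auto
        finally have D: "\<bar>D\<eta> x \<bullet> (x - X k)\<bar> \<le> K * profile_weight x * (3/2 * ?R k)" .
        have "profile_weight (X k) \<le> profile_weight x"
          using True R0[of k] by (intro profile_weight_antimono) linarith
        then have "\<bar>\<eta> (X k)\<bar> \<le> K * profile_weight x"
          using order_trans[OF eta_le_weight mult_left_mono[OF _ K_nonneg]] by blast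
        then have "\<bar>?B\<bar> \<le> K * profile_weight x + K * profile_weight x + K * profile_weight x * (3/2 * ?R k)"
          using eta_le_weight[of x] D by linarith
        also have "\<dots> = K * profile_weight x * (2 + 3/2 * ?R k)" by (simp add: algebra_simps)
        also have "\<dots> \<le> K * profile_weight x * (4 * ?R k)"
          using R2[of k] K_nonneg profile_weight_nonneg[of x] by (intro mult_left_mono) auto
        finally have B: "\<bar>?B\<bar> \<le> K * profile_weight x * (4 * ?R k)" .
        have "\<bar>?R k powr ?d * double_layer (N k) (X k) x\<bar> = ?A * \<bar>?B\<bar>"
        proof -
          have "?R k powr ?d * double_layer (N k) (X k) x = ?A * ?B" by (simp add: double_layer_def)
          then show ?thesis by (simp only: abs_mult_pos'[OF A0, symmetric])
        qed
        also have "\<dots> \<le> 2 powr (?d + 1) / ?R k * (K * profile_weight x * (4 * ?R k))"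
          using A B A0 R0[of k] by (intro mult_mono) auto
        also have "\<dots> = 4 * K * 2 powr (?d + 1) * profile_weight x" using R0[of k] by simp
        finally have "\<bar>?R k powr ?d * double_layer (N k) (X k) x\<bar> \<le> 4 * K * 2 powr (?d + 1) * profile_weight x" .
        then have "\<bar>\<psi> x\<bar> * \<bar>?R k powr ?d * double_layer (N k) (X k) x\<bar> \<le> M * (4 * K * 2 powr (?d + 1) * profile_weight x)"
          using M by (intro mult_mono) auto
        then show ?thesis using True by (simp add: abs_mult)
      next
        case False
        then show ?thesis using M(1) K_nonneg profile_weight_nonneg[of x] by simp
      qed
      have "norm (?u k x) \<le> M * (4 * K * 2 powr (?d + 1) * profile_weight x) + M * (K * profile_weight x)"
        using a b by (intro order_trans[OF norm_triangle_ineq4] add_mono) auto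
      then show "norm (?u k x) \<le> ?C * profile_weight x" by (simp add: algebra_simps)
    qed
    show "AE x in lborel. (\<lambda>k. ?u k x) \<longlonglongrightarrow> 0"
    proof (rule AE_I2)
      fix x :: 'a
      let ?Q = "\<lambda>k. ?R k powr ?n * (2 * kernel_deriv ?n (N k) (sq_dist (X k) x))"
      have Q: "?Q \<longlonglongrightarrow> 1"
        using R2 N by (intro scaled_kernel_limit[OF Xlim _ N] sq_dist_nonneg sq_dist_ratio[OF Xlim])
          (auto intro: order_trans[of 1 2])
      have Q1: "(\<lambda>k. ?Q k - 1) \<longlonglongrightarrow> 0" using tendsto_diff[OF Q tendsto_const[of 1]] by simp
      let ?E = "\<lambda>k. (\<eta> x - \<eta> (X k) - D\<eta> x \<bullet> x) / ?R k"
      have E: "?E \<longlonglongrightarrow> 0"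
      proof (rule Lim_null_comparison)
        show "\<forall>\<^sub>F k in sequentially. norm (?E k) \<le> (2 * K + \<bar>D\<eta> x \<bullet> x\<bar>) / ?R k"
        proof (intro always_eventually allI)
          fix k
          have "\<bar>\<eta> x - \<eta> (X k) - D\<eta> x \<bullet> x\<bar> \<le> 2 * K + \<bar>D\<eta> x \<bullet> x\<bar>"
            using eta_diff_le[of x "X k"] by linarith
          then have "\<bar>\<eta> x - \<eta> (X k) - D\<eta> x \<bullet> x\<bar> / ?R k \<le> (2 * K + \<bar>D\<eta> x \<bullet> x\<bar>) / ?R k"
            by (intro divide_right_mono) auto
          then show "norm (?E k) \<le> (2 * K + \<bar>D\<eta> x \<bullet> x\<bar>) / ?R k" by simp
        qed
        show "(\<lambda>k. (2 * K + \<bar>D\<eta> x \<bullet> x\<bar>) / ?R k) \<longlonglongrightarrow> 0"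
          by (intro tendsto_divide_0[OF tendsto_const] filterlim_at_top_imp_at_infinity Xlim)
      qed
      have T: "(\<lambda>k. (?Q k - 1) * ((D\<eta> x \<bullet> X k) / ?R k)) \<longlonglongrightarrow> 0"
      proof (rule Lim_null_comparison)
        show "\<forall>\<^sub>F k in sequentially. norm ((?Q k - 1) * ((D\<eta> x \<bullet> X k) / ?R k)) \<le> \<bar>?Q k - 1\<bar> * norm (D\<eta> x)"
        proof (intro always_eventually allI)
          fix k
          have "\<bar>D\<eta> x \<bullet> X k\<bar> / ?R k \<le> norm (D\<eta> x)"
            using Cauchy_Schwarz_ineq2[of "D\<eta> x" "X k"] R0[of k] by (simp add: divide_le_eq)
          then have "\<bar>?Q k - 1\<bar> * (\<bar>D\<eta> x \<bullet> X k\<bar> / ?R k) \<le> \<bar>?Q k - 1\<bar> * norm (D\<eta> x)"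
            by (intro mult_left_mono) auto
          then show "norm ((?Q k - 1) * ((D\<eta> x \<bullet> X k) / ?R k)) \<le> \<bar>?Q k - 1\<bar> * norm (D\<eta> x)"
            by (simp only: real_norm_def abs_mult abs_divide abs_norm_cancel)
        qed
        show "(\<lambda>k. \<bar>?Q k - 1\<bar> * norm (D\<eta> x)) \<longlonglongrightarrow> 0"
          by (intro tendsto_mult_left_zero tendsto_rabs_zero Q1)
      qed
      have lim: "(\<lambda>k. \<psi> x * ((?Q k - 1) * ((D\<eta> x \<bullet> X k) / ?R k) + ?Q k * ?E k)) \<longlonglongrightarrow> \<psi> x * (0 + 1 * 0)"
        by (intro tendsto_mult tendsto_add tendsto_const T Q E)
      have "\<forall>\<^sub>F k in sequentially. \<psi> x * ((?Q k - 1) * ((D\<eta> x \<bullet> X k) / ?R k) + ?Q k * ?E k) = ?u k x"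
        using Xlim[unfolded filterlim_at_top_dense, rule_format, of "2 * norm x"]
      proof eventually_elim
        case (elim k)
        have "?R k powr ?n = ?R k powr ?d * ?R k" using R0[of k] by (simp add: powr_add)
        then have "?Q k = (?R k powr ?d * (2 * kernel_deriv ?n (N k) (sq_dist (X k) x))) * ?R k"
          by (simp only: mult_ac)
        moreover have "D\<eta> x \<bullet> (x - X k) = D\<eta> x \<bullet> x - D\<eta> x \<bullet> X k" by (rule inner_diff_right)
        moreover have "\<psi> * ((A * R - 1) * (y / R) + A * R * ((a - b - w) / R)) = \<psi> * (A * (a - b - (w - y))) - \<psi> * y / R"
          if "0 < R" for \<psi> A R y a b w :: real
          using that by (simp add: field_simps)
        ultimately show ?case using elim R0[of k]
          by (simp only: double_layer_def mult.assoc[symmetric]) (simp add: mult_ac)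
      qed
      with lim show "(\<lambda>k. ?u k x) \<longlonglongrightarrow> 0" by (simp add: Lim_transform_eventually)
    qed
  qed simp
  then have near: "(\<lambda>k. \<integral>x. ?u k x \<partial>lborel) \<longlonglongrightarrow> 0" by simp
  have "(\<lambda>k. (\<integral>x. ?u k x \<partial>lborel) + ?R k powr ?d
      * (\<integral>x. indicator (- ball 0 (?R k / 2)) x * (\<psi> x * double_layer (N k) (X k) x) \<partial>lborel)) \<longlonglongrightarrow> 0"
    using tendsto_add[OF near double_layer_far_tendsto[OF X N0]] by simp
  moreover have "(\<integral>x. ?u k x \<partial>lborel) + ?R k powr ?d
      * (\<integral>x. indicator (- ball 0 (?R k / 2)) x * (\<psi> x * double_layer (N k) (X k) x) \<partial>lborel)
    = ?R k powr ?d * (\<integral>x. \<psi> x * double_layer (N k) (X k) x \<partial>lborel) - (dipole \<bullet> X k) / ?R k" for k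
  proof -
    let ?g = "\<lambda>x. indicator (ball 0 (?R k / 2)) x * (\<psi> x * double_layer (N k) (X k) x)"
    have int: "integrable lborel (\<lambda>x. \<psi> x * double_layer (N k) (X k) x)" by (rule double_layer_integrable[OF N0])
    have ig: "integrable lborel ?g" using integrable_mult_indicator[OF _ int, of "ball 0 (?R k / 2)"] by simp
    have ip: "integrable lborel (\<lambda>x. \<psi> x * (D\<eta> x \<bullet> X k) / ?R k)" by (intro integrable_divide psi_Deta_integrable)
    have "?u k = (\<lambda>x. ?R k powr ?d * ?g x - \<psi> x * (D\<eta> x \<bullet> X k) / ?R k)" by (auto simp: fun_eq_iff)
    then have "(\<integral>x. ?u k x \<partial>lborel) = ?R k powr ?d * (\<integral>x. ?g x \<partial>lborel) - (dipole \<bullet> X k) / ?R k"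
      using Bochner_Integration.integral_diff[OF integrable_mult_right[OF ig] ip, of "?R k powr ?d"]
      by (simp add: dipole_inner)
    then show ?thesis unfolding integral_split_ball[OF int, of "?R k / 2"] by (simp add: algebra_simps)
  qed
  ultimately show ?thesis by simp
qed

text \<open>
  Integrate the gradient of \<open>(x \<bullet> v) \<eta>\<close> and use that the displaced mass vanishes.
\<close>

lemma first_moment_zero: "(\<integral>x. (x \<bullet> v) * (D\<eta> x \<bullet> w) \<partial>lborel) = 0"
  and first_moment_integrable: "integrable lborel (\<lambda>x. (x \<bullet> v) * (D\<eta> x \<bullet> w))"
proof -
  have bound: "\<bar>x \<bullet> v\<bar> * \<bar>D\<eta> x \<bullet> w\<bar> \<le> norm v * norm w * (K * profile_weight x)" for x
  proof -
    have "\<bar>x \<bullet> v\<bar> * \<bar>D\<eta> x \<bullet> w\<bar> \<le> (norm x * norm v) * (norm (D\<eta> x) * norm w)"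
      by (intro mult_mono Cauchy_Schwarz_ineq2) auto
    also have "\<dots> = norm v * norm w * (norm (D\<eta> x) * norm x)" by (simp only: mult_ac)
    also have "\<dots> \<le> norm v * norm w * (norm (D\<eta> x) * (1 + norm x))" by (intro mult_left_mono) auto
    also have "\<dots> \<le> norm v * norm w * (K * profile_weight x)" by (intro mult_left_mono Deta_weight) auto
    finally show ?thesis .
  qed
  show int: "integrable lborel (\<lambda>x. (x \<bullet> v) * (D\<eta> x \<bullet> w))"
  proof (rule Bochner_Integration.integrable_bound)
    show "integrable lborel (\<lambda>x. norm v * norm w * (K * profile_weight x))"
      by (intro integrable_mult_right profile_weight_integrable)
    show "AE x in lborel. norm ((x \<bullet> v) * (D\<eta> x \<bullet> w)) \<le> norm (norm v * norm w * (K * profile_weight x))"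
      using bound by (intro AE_I2) (simp only: real_norm_def abs_mult[of "_ \<bullet> _"], rule order_trans[OF _ abs_ge_self])
  qed measurable
  have "(\<integral>x. ((x \<bullet> v) *\<^sub>R D\<eta> x + \<eta> x *\<^sub>R v) \<bullet> w \<partial>lborel) = 0"
  proof (rule integral_gradient_decay)
    have "GDERIV (\<lambda>x. x \<bullet> v) x :> v" for x :: 'a unfolding gderiv_def by (auto intro!: derivative_eq_intros)
    then show "GDERIV (\<lambda>x. (x \<bullet> v) * \<eta> x) x :> (x \<bullet> v) *\<^sub>R D\<eta> x + \<eta> x *\<^sub>R v" for x
      by (rule GDERIV_mult[OF _ eta_deriv])
    show "continuous_on UNIV (\<lambda>x. (x \<bullet> v) *\<^sub>R D\<eta> x + \<eta> x *\<^sub>R v)" by (intro continuous_intros Deta_cont eta_cont)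
    show "integrable lborel (\<lambda>x. (x \<bullet> v) * \<eta> x / (1 + norm x))"
    proof (rule Bochner_Integration.integrable_bound)
      show "integrable lborel (\<lambda>x. norm v * \<bar>\<eta> x\<bar>)" using eta_integrable by simp
      show "AE x in lborel. norm ((x \<bullet> v) * \<eta> x / (1 + norm x)) \<le> norm (norm v * \<bar>\<eta> x\<bar>)"
      proof (rule AE_I2)
        fix x :: 'a
        have p: "0 < 1 + norm x" by (intro add_pos_nonneg) auto
        have "\<bar>x \<bullet> v\<bar> \<le> (1 + norm x) * norm v"
          by (intro order_trans[OF Cauchy_Schwarz_ineq2] mult_right_mono) auto
        then have "\<bar>x \<bullet> v\<bar> / (1 + norm x) \<le> norm v" using p by (simp add: divide_le_eq mult.commute)
        then have "\<bar>x \<bullet> v\<bar> / (1 + norm x) * \<bar>\<eta> x\<bar> \<le> norm v * \<bar>\<eta> x\<bar>" by (intro mult_right_mono) auto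
        then show "norm ((x \<bullet> v) * \<eta> x / (1 + norm x)) \<le> norm (norm v * \<bar>\<eta> x\<bar>)" using p by (simp add: abs_mult)
      qed
    qed measurable
    show "integrable lborel (\<lambda>x. ((x \<bullet> v) *\<^sub>R D\<eta> x + \<eta> x *\<^sub>R v) \<bullet> w)"
      unfolding inner_add_left inner_scaleR_left
      by (intro Bochner_Integration.integrable_add int integrable_mult_left eta_integrable)
  qed
  then show "(\<integral>x. (x \<bullet> v) * (D\<eta> x \<bullet> w) \<partial>lborel) = 0"
    using Bochner_Integration.integral_add[OF int integrable_mult_left[OF eta_integrable, of "v \<bullet> w"]] total_mass_zero
    by (simp add: inner_add_left)
qed

text \<open>
  Combine the bound on differences of the kernel with the decay of \<open>\<nabla>\<eta>\<close>. The summands stand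
  for the singularity at \<open>x\<^sub>0\<close>, for points at distance at least \<open>|x\<^sub>0| / 2\<close> from it, and for
  the growth of the kernel at large distance.
\<close>

lemma single_layer_far_bound:
  assumes m: "0 < m" and R: "2 \<le> norm x\<^sub>0" and x: "norm x\<^sub>0 / 2 \<le> norm x" and ne: "x \<noteq> x\<^sub>0"
  shows "\<bar>(kernel (real DIM('a \<times> real)) m (sq_dist x\<^sub>0 x) - kernel (real DIM('a \<times> real)) m ((norm x\<^sub>0)\<^sup>2)) * (D\<eta> x \<bullet> c)\<bar>
    \<le> K * norm c * (2 * norm x\<^sub>0 powr (1/2) * (norm x\<^sub>0 / 2) powr (- (real DIM('a) + 1 + \<epsilon>)) * near_part (real DIM('a) - 1/2) (norm x\<^sub>0 / 2) (x - x\<^sub>0)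
      + 2 * norm x\<^sub>0 powr (1/2) * (norm x\<^sub>0 / 2) powr (- (real DIM('a) - 1/2)) * far_part (real DIM('a) + 1 + \<epsilon>) (norm x\<^sub>0 / 2) x
      + 2 * norm x\<^sub>0 powr (1/2 - real DIM('a)) * (3 + 2 * K) powr (1/2) * far_part (real DIM('a) + 1/2 + \<epsilon>) (norm x\<^sub>0 / 2) x)"
    (is "\<bar>?D * _\<bar> \<le> _ * (?A + ?B + ?C)")
proof -
  let ?d = "real DIM('a)" and ?R = "norm x\<^sub>0" and ?r = "norm (x - x\<^sub>0)" and ?s = "sq_dist x\<^sub>0 x"
  have r0: "0 < ?r" using ne by simp
  have R0: "0 < ?R" and x1: "1 \<le> norm x" using R x by auto
  have d1: "1 \<le> ?d" by (simp add: Suc_leI)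
  have h: "0 \<le> ?d - 1/2" using d1 by linarith
  have neg: "- ((?d - 1/2)/2) \<le> 0" "- (?d - 1/2) \<le> 0"
    using h divide_nonneg_nonneg[OF h, of 2] by (simp_all only: neg_le_0_iff_le zero_le_numeral)
  have s0: "0 < ?s" using sq_dist_ge[of x x\<^sub>0] r0 zero_less_power[OF r0, of 2] by linarith
  have n: "real DIM('a \<times> real)/2 - 3/4 = (?d - 1/2)/2" "3/2 - real DIM('a \<times> real) = 1/2 - ?d" by (auto simp: field_simps)
  have D1: "\<bar>?D\<bar> \<le> 2 * ?R powr (1/2) * ?s powr (- ((?d - 1/2)/2)) + 2 * ?R powr (1/2 - ?d) * ?s powr (1/4)"
    using kernel_difference_bound[OF m _ R0 s0, of "real DIM('a \<times> real)"] d1 unfolding n by simp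
  have "?s powr (- ((?d - 1/2)/2)) \<le> (?r\<^sup>2) powr (- ((?d - 1/2)/2))"
    using r0 by (intro powr_mono2'[OF neg(1) _ sq_dist_ge]) simp
  also have "\<dots> = ?r powr (2 * (- ((?d - 1/2)/2)))" by (rule square_powr) simp
  also have "2 * (- ((?d - 1/2)/2)) = - (?d - 1/2)" by (simp only: minus_mult_right[symmetric] times_divide_eq_right nonzero_mult_div_cancel_left[OF zero_neq_numeral[symmetric]])
  finally have s1: "?s powr (- ((?d - 1/2)/2)) \<le> ?r powr (- (?d - 1/2))" .
  have "?r \<le> norm x + ?R" by (rule norm_triangle_ineq4)
  then have r3: "?r + 2 * K \<le> (3 + 2 * K) * norm x"
  proof -
    have "K * 1 \<le> K * norm x" using x1 K_nonneg by (intro mult_left_mono) auto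
    then show ?thesis using \<open>?r \<le> norm x + ?R\<close> x by (simp add: algebra_simps)
  qed
  have "?s \<le> ?r\<^sup>2 + (2 * K)\<^sup>2" using eta_diff_square_le[of x x\<^sub>0] by (simp add: sq_dist_def)
  also have "\<dots> \<le> (?r + 2 * K)\<^sup>2" using r0 K_nonneg by (simp add: power2_sum)
  also have "\<dots> \<le> ((3 + 2 * K) * norm x)\<^sup>2" using r3 r0 K_nonneg by (intro power_mono) auto
  finally have "?s powr (1/4) \<le> (((3 + 2 * K) * norm x)\<^sup>2) powr (1/4)"
    using s0 by (intro powr_mono2) auto
  also have "\<dots> = ((3 + 2 * K) * norm x) powr (1/2)"
    using K_nonneg by (subst square_powr) auto
  also have "\<dots> = (3 + 2 * K) powr (1/2) * norm x powr (1/2)"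
    using K_nonneg by (intro powr_mult)
  finally have s2: "?s powr (1/4) \<le> (3 + 2 * K) powr (1/2) * norm x powr (1/2)" .
  have D2: "\<bar>?D\<bar> \<le> 2 * ?R powr (1/2) * ?r powr (- (?d - 1/2)) + 2 * ?R powr (1/2 - ?d) * ((3 + 2 * K) powr (1/2) * norm x powr (1/2))"
    by (rule order_trans[OF D1]) (intro add_mono mult_left_mono s1 s2; simp)
  have "(1 + norm x) powr (- (?d + 1 + \<epsilon>)) \<le> norm x powr (- (?d + 1 + \<epsilon>))"
    using x1 eps_pos by (intro powr_mono2') auto
  then have "norm (D\<eta> x) \<le> K * norm x powr (- (?d + 1 + \<epsilon>))"
    using order_trans[OF Deta_decay mult_left_mono[OF _ K_nonneg]] by blast
  then have E: "\<bar>D\<eta> x \<bullet> c\<bar> \<le> (K * norm x powr (- (?d + 1 + \<epsilon>))) * norm c"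
    by (intro order_trans[OF Cauchy_Schwarz_ineq2] mult_right_mono) auto
  let ?P = "norm x powr (- (?d + 1 + \<epsilon>))"
  have "\<bar>?D * (D\<eta> x \<bullet> c)\<bar> \<le> (2 * ?R powr (1/2) * ?r powr (- (?d - 1/2)) + 2 * ?R powr (1/2 - ?d) * ((3 + 2 * K) powr (1/2) * norm x powr (1/2)))
      * ((K * ?P) * norm c)"
    unfolding abs_mult using D2 E by (intro mult_mono) auto
  also have "\<dots> = K * norm c * (2 * ?R powr (1/2) * (?r powr (- (?d - 1/2)) * ?P)
      + 2 * ?R powr (1/2 - ?d) * (3 + 2 * K) powr (1/2) * (norm x powr (1/2) * ?P))"
    by (simp add: algebra_simps)
  also have "norm x powr (1/2) * ?P = far_part (?d + 1/2 + \<epsilon>) (?R / 2) x"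
  proof -
    have "norm x powr (1/2) * ?P = norm x powr (- (?d + 1/2 + \<epsilon>))"
      by (simp only: powr_add[symmetric], rule arg_cong2[where f="(powr)", OF refl], simp)
    then show ?thesis using x by (simp add: far_part_def)
  qed
  also have "?r powr (- (?d - 1/2)) * ?P \<le> (?R / 2) powr (- (?d + 1 + \<epsilon>)) * near_part (?d - 1/2) (?R / 2) (x - x\<^sub>0)
      + (?R / 2) powr (- (?d - 1/2)) * far_part (?d + 1 + \<epsilon>) (?R / 2) x" (is "?L \<le> ?U + ?V")
  proof (cases "?r < ?R / 2")
    case True
    have "?P \<le> (?R / 2) powr (- (?d + 1 + \<epsilon>))" using x R0 eps_pos by (intro powr_mono2') auto
    then have "?L \<le> ?r powr (- (?d - 1/2)) * (?R / 2) powr (- (?d + 1 + \<epsilon>))" by (intro mult_left_mono) auto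
    also have "\<dots> = ?U" using True by (simp add: near_part_def)
    also have "\<dots> \<le> ?U + ?V" using far_part_nonneg by simp
    finally show ?thesis .
  next
    case False
    have "?r powr (- (?d - 1/2)) \<le> (?R / 2) powr (- (?d - 1/2))" using False R0 by (intro powr_mono2'[OF neg(2)]) auto
    then have "?L \<le> (?R / 2) powr (- (?d - 1/2)) * ?P" by (intro mult_right_mono) auto
    also have "\<dots> = ?V" using x by (simp add: far_part_def)
    also have "\<dots> \<le> ?U + ?V" using near_part_nonneg by simp
    finally show ?thesis .
  qed
  then have "K * norm c * (2 * ?R powr (1/2) * ?L + 2 * ?R powr (1/2 - ?d) * (3 + 2 * K) powr (1/2) * far_part (?d + 1/2 + \<epsilon>) (?R / 2) x)
     \<le> K * norm c * (2 * ?R powr (1/2) * (?U + ?V) + 2 * ?R powr (1/2 - ?d) * (3 + 2 * K) powr (1/2) * far_part (?d + 1/2 + \<epsilon>) (?R / 2) x)"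
    using K_nonneg by (intro mult_left_mono add_right_mono) auto
  also have "\<dots> = K * norm c * (?A + ?B + ?C)" by (simp only: distrib_left mult.assoc)
  finally show ?thesis .
qed

lemma single_layer_far_tendsto:
  fixes X :: "nat \<Rightarrow> 'a" and N :: "nat \<Rightarrow> real"
  assumes X: "\<And>k. real k + 2 \<le> norm (X k)" and N: "\<And>k. 0 < N k"
  shows "(\<lambda>k. norm (X k) powr real DIM('a) * (\<integral>x. indicator (- ball 0 (norm (X k) / 2)) x *
      ((kernel (real DIM('a \<times> real)) (N k) (sq_dist (X k) x) - kernel (real DIM('a \<times> real)) (N k) ((norm (X k))\<^sup>2))
        * (D\<eta> x \<bullet> c)) \<partial>lborel)) \<longlonglongrightarrow> 0"
proof -
  let ?d = "real DIM('a)"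
  define B1 where "B1 = (\<integral>x. near_part (?d - 1/2) 1 x \<partial>lborel)"
  define B2 where "B2 = (\<integral>x. far_part (?d + 1 + \<epsilon>) 1 x \<partial>lborel)"
  define B3 where "B3 = (\<integral>x. far_part (?d + 1/2 + \<epsilon>) 1 x \<partial>lborel)"
  define C where "C = K * norm c * (2 * 2 powr (?d + 1/2 + \<epsilon>) * B1 + 2 * 2 powr (?d + 1/2 + \<epsilon>) * B2
      + 2 * (3 + 2 * K) powr (1/2) * 2 powr (1/2 + \<epsilon>) * B3)"
  let ?D = "\<lambda>k x. kernel (real DIM('a \<times> real)) (N k) (sq_dist (X k) x) - kernel (real DIM('a \<times> real)) (N k) ((norm (X k))\<^sup>2)"
  have main: "\<bar>norm (X k) powr ?d * (\<integral>x. indicator (- ball 0 (norm (X k) / 2)) x * (?D k x * (D\<eta> x \<bullet> c)) \<partial>lborel)\<bar>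
      \<le> C * norm (X k) powr (- \<epsilon>)" for k
  proof -
    let ?R = "norm (X k)"
    have R: "2 \<le> ?R" using X[of k] by linarith
    then have R0: "0 < ?R" "0 < ?R / 2" by auto
    let ?a = "\<lambda>x. near_part (?d - 1/2) (?R / 2) (x - X k)" and ?b = "\<lambda>x. far_part (?d + 1 + \<epsilon>) (?R / 2) x"
      and ?c = "\<lambda>x. far_part (?d + 1/2 + \<epsilon>) (?R / 2) x"
    let ?ka = "2 * ?R powr (1/2) * (?R / 2) powr (- (?d + 1 + \<epsilon>))"
    let ?kb = "2 * ?R powr (1/2) * (?R / 2) powr (- (?d - 1/2))"
    let ?kc = "2 * ?R powr (1/2 - ?d) * (3 + 2 * K) powr (1/2)"
    note na = near_part_integral[of "?d - 1/2" "?R/2"] and nb = far_part_integral[of "?d + 1 + \<epsilon>" "?R/2"]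
      and nc = far_part_integral[of "?d + 1/2 + \<epsilon>" "?R/2"]
    have ia: "integrable lborel ?a" "(\<integral>x. ?a x \<partial>lborel) = (?R/2) powr (1/2) * B1"
      using integral_shift[OF na(1), of "X k"] na(2) R0 unfolding B1_def by auto
    have ib: "integrable lborel ?b" "(\<integral>x. ?b x \<partial>lborel) = (?R/2) powr (- (1 + \<epsilon>)) * B2"
      using nb R0 eps_pos unfolding B2_def by (auto simp: algebra_simps)
    have ic: "integrable lborel ?c" "(\<integral>x. ?c x \<partial>lborel) = (?R/2) powr (- (1/2 + \<epsilon>)) * B3"
      using nc R0 eps_pos unfolding B3_def by (auto simp: algebra_simps)
    have "\<bar>\<integral>x. indicator (- ball 0 (?R / 2)) x * (?D k x * (D\<eta> x \<bullet> c)) \<partial>lborel\<bar>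
       \<le> (\<integral>x. K * norm c * (?ka * ?a x + ?kb * ?b x + ?kc * ?c x) \<partial>lborel)"
    proof (rule abs_integral_le)
      show "(\<lambda>x. indicator (- ball 0 (?R / 2)) x * (?D k x * (D\<eta> x \<bullet> c))) \<in> borel_measurable lborel"
        using kernel_meas[OF N, of k "X k"] by measurable
      show "integrable lborel (\<lambda>x. K * norm c * (?ka * ?a x + ?kb * ?b x + ?kc * ?c x))"
        by (intro integrable_mult_right Bochner_Integration.integrable_add ia ib ic)
      have "AE x in lborel. x \<noteq> X k" using AE_lborel_singleton[of "X k"] by simp
      then show "AE x in lborel. \<bar>indicator (- ball 0 (?R / 2)) x * (?D k x * (D\<eta> x \<bullet> c))\<bar> \<le> K * norm c * (?ka * ?a x + ?kb * ?b x + ?kc * ?c x)"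
      proof eventually_elim
        case (elim x)
        have nn: "0 \<le> K * norm c * (?ka * ?a x + ?kb * ?b x + ?kc * ?c x)"
          using K_nonneg near_part_nonneg far_part_nonneg by (intro mult_nonneg_nonneg add_nonneg_nonneg) auto
        show ?case
        proof (cases "?R / 2 \<le> norm x")
          case True
          then show ?thesis using single_layer_far_bound[OF N R True elim] by simp
        qed (use nn in \<open>simp add: indicator_def\<close>)
      qed
    qed
    also have "\<dots> = K * norm c * (?ka * ((?R/2) powr (1/2) * B1) + ?kb * ((?R/2) powr (- (1 + \<epsilon>)) * B2) + ?kc * ((?R/2) powr (- (1/2 + \<epsilon>)) * B3))"
      using ia ib ic by simp
    finally have le: "\<bar>\<integral>x. indicator (- ball 0 (?R / 2)) x * (?D k x * (D\<eta> x \<bullet> c)) \<partial>lborel\<bar> \<le> \<dots>" .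
    have e1: "?R powr ?d * (?ka * ((?R/2) powr (1/2) * B1)) = 2 * 2 powr (?d + 1/2 + \<epsilon>) * B1 * ?R powr (- \<epsilon>)"
    proof -
      have "?R powr ?d * ?R powr (1/2) * ?R powr (- (?d + 1 + \<epsilon>)) * ?R powr (1/2) = ?R powr (- \<epsilon>)"
        by (simp only: powr_add[symmetric], rule arg_cong2[where f="(powr)", OF refl], simp)
      moreover have "2 powr (- (- (?d + 1 + \<epsilon>))) * 2 powr (- (1/2)) = 2 powr (?d + 1/2 + \<epsilon>)"
        by (simp only: powr_add[symmetric], rule arg_cong2[where f="(powr)", OF refl], simp)
      moreover have "?R powr ?d * (?ka * ((?R/2) powr (1/2) * B1))
         = 2 * (2 powr (- (- (?d + 1 + \<epsilon>))) * 2 powr (- (1/2))) * B1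
           * (?R powr ?d * ?R powr (1/2) * ?R powr (- (?d + 1 + \<epsilon>)) * ?R powr (1/2))"
        unfolding powr_half[OF R0(1)] by (simp only: mult_ac)
      ultimately show ?thesis by (simp only:)
    qed
    have e2: "?R powr ?d * (?kb * ((?R/2) powr (- (1 + \<epsilon>)) * B2)) = 2 * 2 powr (?d + 1/2 + \<epsilon>) * B2 * ?R powr (- \<epsilon>)"
    proof -
      have "?R powr ?d * ?R powr (1/2) * ?R powr (- (?d - 1/2)) * ?R powr (- (1 + \<epsilon>)) = ?R powr (- \<epsilon>)"
        by (simp only: powr_add[symmetric], rule arg_cong2[where f="(powr)", OF refl], simp)
      moreover have "2 powr (- (- (?d - 1/2))) * 2 powr (- (- (1 + \<epsilon>))) = 2 powr (?d + 1/2 + \<epsilon>)"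
        by (simp only: powr_add[symmetric], rule arg_cong2[where f="(powr)", OF refl], simp)
      moreover have "?R powr ?d * (?kb * ((?R/2) powr (- (1 + \<epsilon>)) * B2))
         = 2 * (2 powr (- (- (?d - 1/2))) * 2 powr (- (- (1 + \<epsilon>)))) * B2
           * (?R powr ?d * ?R powr (1/2) * ?R powr (- (?d - 1/2)) * ?R powr (- (1 + \<epsilon>)))"
        unfolding powr_half[OF R0(1)] by (simp only: mult_ac)
      ultimately show ?thesis by (simp only:)
    qed
    have e3: "?R powr ?d * (?kc * ((?R/2) powr (- (1/2 + \<epsilon>)) * B3)) = 2 * (3 + 2 * K) powr (1/2) * 2 powr (1/2 + \<epsilon>) * B3 * ?R powr (- \<epsilon>)"
    proof -
      have "?R powr ?d * ?R powr (1/2 - ?d) * ?R powr (- (1/2 + \<epsilon>)) = ?R powr (- \<epsilon>)"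
        by (simp only: powr_add[symmetric], rule arg_cong2[where f="(powr)", OF refl], simp)
      moreover have "?R powr ?d * (?kc * ((?R/2) powr (- (1/2 + \<epsilon>)) * B3))
         = 2 * (3 + 2 * K) powr (1/2) * 2 powr (- (- (1/2 + \<epsilon>))) * B3
           * (?R powr ?d * ?R powr (1/2 - ?d) * ?R powr (- (1/2 + \<epsilon>)))"
        unfolding powr_half[OF R0(1)] by (simp only: mult_ac)
      ultimately show ?thesis by (simp only: minus_minus)
    qed
    have "?R powr ?d * (K * norm c * (?ka * ((?R/2) powr (1/2) * B1) + ?kb * ((?R/2) powr (- (1 + \<epsilon>)) * B2) + ?kc * ((?R/2) powr (- (1/2 + \<epsilon>)) * B3)))
      = K * norm c * (?R powr ?d * (?ka * ((?R/2) powr (1/2) * B1)) + ?R powr ?d * (?kb * ((?R/2) powr (- (1 + \<epsilon>)) * B2)) + ?R powr ?d * (?kc * ((?R/2) powr (- (1/2 + \<epsilon>)) * B3)))"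
      by (simp only: distrib_left mult.left_commute)
    also have "\<dots> = C * ?R powr (- \<epsilon>)"
      unfolding e1 e2 e3 C_def by (simp only: distrib_left distrib_right mult.assoc)
    finally show ?thesis
      using mult_left_mono[OF le, of "?R powr ?d"] by (simp only: abs_mult powr_ge_zero abs_of_nonneg)
  qed
  have Xlim: "filterlim (\<lambda>k. norm (X k)) at_top sequentially"
  proof (rule filterlim_at_top_mono[OF filterlim_real_sequentially], intro always_eventually allI)
    show "real k \<le> norm (X k)" for k using X[of k] by linarith
  qed
  have "((\<lambda>R::real. R powr (- \<epsilon>)) \<longlongrightarrow> 0) at_top"
    using eps_pos by (intro tendsto_neg_powr filterlim_ident) auto
  from filterlim_compose[OF this Xlim]
  have "(\<lambda>k. C * norm (X k) powr (- \<epsilon>)) \<longlonglongrightarrow> 0" by (intro tendsto_mult_right_zero)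
  then show ?thesis
    by (rule Lim_null_comparison[rotated]) (use main in auto)
qed

text \<open>
  By the mean value theorem the difference of kernel values is \<open>kernel_deriv\<close> at an
  intermediate point times the difference of squared distances, so to leading order it is
  \<open>- (x \<bullet> x\<^sub>0) / |x\<^sub>0|\<^sup>n\<close>. Integrated against \<open>c \<bullet> \<nabla>\<eta>\<close> this gives a first moment of \<open>\<nabla>\<eta>\<close>,
  which is zero.
\<close>

lemma single_layer_limit:
  fixes X :: "nat \<Rightarrow> 'a" and N :: "nat \<Rightarrow> real"
  assumes X: "\<And>k. real k + 2 \<le> norm (X k)" and N: "\<And>k. (norm (X k))\<^sup>2 \<le> N k"
  shows "(\<lambda>k. norm (X k) powr real DIM('a) * (\<integral>x. (kernel (real DIM('a \<times> real)) (N k) (sq_dist (X k) x)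
      - kernel (real DIM('a \<times> real)) (N k) ((norm (X k))\<^sup>2)) * (D\<eta> x \<bullet> c) \<partial>lborel)) \<longlonglongrightarrow> 0"
proof -
  let ?d = "real DIM('a)" and ?n = "real DIM('a \<times> real)"
  let ?R = "\<lambda>k. norm (X k)"
  have R2: "2 \<le> ?R k" for k using X[of k] by linarith
  have R0: "0 < ?R k" for k using R2[of k] by linarith
  have N0: "0 < N k" for k using N[of k] R0[of k] zero_less_power[of "?R k" 2] by linarith
  have Xlim: "filterlim ?R at_top sequentially"
  proof (rule filterlim_at_top_mono[OF filterlim_real_sequentially], intro always_eventually allI)
    show "real k \<le> norm (X k)" for k using X[of k] by linarith
  qed
  let ?D = "\<lambda>k x. kernel ?n (N k) (sq_dist (X k) x) - kernel ?n (N k) ((?R k)\<^sup>2)"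
  let ?u = "\<lambda>k x. indicator (ball 0 (?R k / 2)) x * (?R k powr ?d * (?D k x * (D\<eta> x \<bullet> c))) + (x \<bullet> X k) * (D\<eta> x \<bullet> c) / ?R k"
  let ?L = "2 powr (?d + 1) * (3 + 4 * K\<^sup>2)"
  let ?C = "(?L + 1) * norm c * K"
  have xX: "\<bar>x \<bullet> X k\<bar> / ?R k \<le> norm x" for x k
    using Cauchy_Schwarz_ineq2[of x "X k"] R0[of k] by (simp add: divide_le_eq)
  have mv: "\<exists>\<xi>. min (sq_dist (X k) x) ((?R k)\<^sup>2) \<le> \<xi> \<and> \<xi> \<le> max (sq_dist (X k) x) ((?R k)\<^sup>2)
      \<and> ?D k x = kernel_deriv ?n (N k) \<xi> * (sq_dist (X k) x - (?R k)\<^sup>2)" for k x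
    by (rule kernel_mean_value[OF N0 sq_dist_nonneg]) simp
  have "(\<lambda>k. \<integral>x. ?u k x \<partial>lborel) \<longlonglongrightarrow> (\<integral>(x::'a). 0 \<partial>lborel)"
  proof (rule integral_dominated_convergence[where w="\<lambda>x. ?C * profile_weight x"])
    show "?u k \<in> borel_measurable lborel" for k
      using kernel_meas[OF N0, of k "X k"] by measurable
    show "integrable lborel (\<lambda>x. ?C * profile_weight x)"
      by (intro integrable_mult_right profile_weight_integrable)
    show "AE x in lborel. norm (?u k x) \<le> ?C * profile_weight x" for k
    proof (rule AE_I2)
      fix x :: 'a
      have Dc: "\<bar>D\<eta> x \<bullet> c\<bar> * (1 + norm x) \<le> norm c * (K * profile_weight x)"
      proof -
        have "\<bar>D\<eta> x \<bullet> c\<bar> * (1 + norm x) \<le> (norm (D\<eta> x) * norm c) * (1 + norm x)"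
          by (intro mult_right_mono Cauchy_Schwarz_ineq2) auto
        also have "\<dots> = norm c * (norm (D\<eta> x) * (1 + norm x))" by (simp only: mult_ac)
        also have "\<dots> \<le> norm c * (K * profile_weight x)" by (intro mult_left_mono Deta_weight) auto
        finally show ?thesis .
      qed
      have b: "\<bar>(x \<bullet> X k) * (D\<eta> x \<bullet> c) / ?R k\<bar> \<le> norm c * (K * profile_weight x)"
      proof -
        have "\<bar>x \<bullet> X k\<bar> / ?R k * \<bar>D\<eta> x \<bullet> c\<bar> \<le> (1 + norm x) * \<bar>D\<eta> x \<bullet> c\<bar>"
          using order_trans[OF xX[of x k], of "1 + norm x"] by (intro mult_right_mono) auto
        then show ?thesis using Dc by (simp add: abs_mult mult.commute)
      qed
      have a: "\<bar>indicator (ball 0 (?R k / 2)) x * (?R k powr ?d * (?D k x * (D\<eta> x \<bullet> c)))\<bar> \<le> ?L * (norm c * (K * profile_weight x))"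
      proof (cases "norm x < ?R k / 2")
        case True
        note near = dist_in_near_region[OF True refl]
        have sq: "(?R k / 2)\<^sup>2 \<le> sq_dist (X k) x"
          using R0[of k] by (intro order_trans[OF power_mono[OF near(1)] sq_dist_ge]) auto
        have sq': "(?R k / 2)\<^sup>2 \<le> (?R k)\<^sup>2" by (intro power_mono) auto
        obtain \<xi> where \<xi>: "min (sq_dist (X k) x) ((?R k)\<^sup>2) \<le> \<xi>"
          "?D k x = kernel_deriv ?n (N k) \<xi> * (sq_dist (X k) x - (?R k)\<^sup>2)" using mv by blast
        have x1: "(?R k / 2)\<^sup>2 \<le> \<xi>" using sq sq' \<xi>(1) by linarith
        let ?A = "?R k powr ?d * kernel_deriv ?n (N k) \<xi>"
        have A0: "0 \<le> ?A" using kernel_deriv_nonneg by simp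
        have A: "?A \<le> 2 powr (?d + 1) / ?R k"
          using rescaled_kernel_near_bound[OF N0[of k] R0[of k] x1] A0 by (simp only: mult.left_commute[of _ 2])
        have "\<bar>sq_dist (X k) x - (?R k)\<^sup>2\<bar> \<le> (norm x)\<^sup>2 + (2 * K)\<^sup>2 + 2 * (norm x * ?R k)" by (rule sq_dist_difference_le)
        also have "\<dots> \<le> ?R k * ((3 + 4 * K\<^sup>2) * (1 + norm x))"
        proof -
          have "(norm x)\<^sup>2 \<le> norm x * ?R k" unfolding power2_eq_square using True norm_ge_zero[of x] by (intro mult_left_mono) linarith+
          moreover have "(2 * K)\<^sup>2 * 1 \<le> 4 * K\<^sup>2 * (?R k * (1 + norm x))"
          proof -
            have "1 * 1 \<le> ?R k * (1 + norm x)" using R2[of k] by (intro mult_mono) auto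
            then have "K\<^sup>2 * 1 \<le> K\<^sup>2 * (?R k * (1 + norm x))" by (intro mult_left_mono) auto
            then show ?thesis by (simp add: power_mult_distrib)
          qed
          moreover have "0 \<le> ?R k * 3" using R0[of k] by simp
          moreover have "?R k * ((3 + 4 * K\<^sup>2) * (1 + norm x))
            = ?R k * 3 + 3 * (norm x * ?R k) + 4 * K\<^sup>2 * (?R k * (1 + norm x))" by (simp add: algebra_simps)
          ultimately show ?thesis by linarith
        qed
        finally have B: "\<bar>sq_dist (X k) x - (?R k)\<^sup>2\<bar> \<le> ?R k * ((3 + 4 * K\<^sup>2) * (1 + norm x))" .
        have "\<bar>?R k powr ?d * ?D k x\<bar> = ?A * \<bar>sq_dist (X k) x - (?R k)\<^sup>2\<bar>"
        proof -
          have "?R k powr ?d * ?D k x = ?A * (sq_dist (X k) x - (?R k)\<^sup>2)" unfolding \<xi>(2) by (simp only: mult.assoc)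
          then show ?thesis by (simp only: abs_mult_pos'[OF A0, symmetric])
        qed
        also have "\<dots> \<le> 2 powr (?d + 1) / ?R k * (?R k * ((3 + 4 * K\<^sup>2) * (1 + norm x)))"
          using A B A0 R0[of k] by (intro mult_mono) auto
        also have "\<dots> = ?L * (1 + norm x)" using R0[of k] by simp
        finally have "\<bar>?R k powr ?d * ?D k x\<bar> * \<bar>D\<eta> x \<bullet> c\<bar> \<le> ?L * (1 + norm x) * \<bar>D\<eta> x \<bullet> c\<bar>"
          by (intro mult_right_mono) auto
        also have "\<dots> = ?L * (\<bar>D\<eta> x \<bullet> c\<bar> * (1 + norm x))" by (simp only: mult_ac)
        also have "\<dots> \<le> ?L * (norm c * (K * profile_weight x))" by (intro mult_left_mono Dc) auto
        finally show ?thesis using True by (simp add: abs_mult mult.assoc)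
      next
        case False
        then show ?thesis using K_nonneg profile_weight_nonneg[of x] by simp
      qed
      have "norm (?u k x) \<le> ?L * (norm c * (K * profile_weight x)) + norm c * (K * profile_weight x)"
        using a b by (intro order_trans[OF norm_triangle_ineq] add_mono) auto
      then show "norm (?u k x) \<le> ?C * profile_weight x" by (simp add: algebra_simps)
    qed
    show "AE x in lborel. (\<lambda>k. ?u k x) \<longlonglongrightarrow> 0"
    proof (rule AE_I2)
      fix x :: 'a
      obtain \<xi> where \<xi>: "\<And>k. min (sq_dist (X k) x) ((?R k)\<^sup>2) \<le> \<xi> k" "\<And>k. \<xi> k \<le> max (sq_dist (X k) x) ((?R k)\<^sup>2)"
        "\<And>k. ?D k x = kernel_deriv ?n (N k) (\<xi> k) * (sq_dist (X k) x - (?R k)\<^sup>2)" using mv[of _ x] by metis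
      have x0: "0 \<le> \<xi> k" for k using \<xi>(1)[of k] sq_dist_nonneg[of "X k" x] zero_le_power2[of "?R k"] by linarith
      have ratio: "(\<lambda>k. \<xi> k / (?R k)\<^sup>2) \<longlonglongrightarrow> 1"
      proof -
        have "(\<lambda>k. \<xi> k / (?R k)\<^sup>2 - 1) \<longlonglongrightarrow> 0"
        proof (rule Lim_null_comparison)
          show "(\<lambda>k. \<bar>sq_dist (X k) x / (?R k)\<^sup>2 - 1\<bar>) \<longlonglongrightarrow> 0"
            using tendsto_rabs_zero[OF tendsto_diff[OF sq_dist_ratio[OF Xlim] tendsto_const[of 1], simplified]] by simp
          show "\<forall>\<^sub>F k in sequentially. norm (\<xi> k / (?R k)\<^sup>2 - 1) \<le> \<bar>sq_dist (X k) x / (?R k)\<^sup>2 - 1\<bar>"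
          proof (intro always_eventually allI)
            fix k
            have p: "0 < (?R k)\<^sup>2" using R0[of k] by simp
            have eq: "y / (?R k)\<^sup>2 - 1 = (y - (?R k)\<^sup>2) / (?R k)\<^sup>2" for y using p by (simp add: diff_divide_distrib)
            have "\<bar>\<xi> k - (?R k)\<^sup>2\<bar> \<le> \<bar>sq_dist (X k) x - (?R k)\<^sup>2\<bar>" using \<xi>(1,2)[of k] by linarith
            then have "\<bar>\<xi> k - (?R k)\<^sup>2\<bar> / (?R k)\<^sup>2 \<le> \<bar>sq_dist (X k) x - (?R k)\<^sup>2\<bar> / (?R k)\<^sup>2"
              using p by (intro divide_right_mono) auto
            then show "norm (\<xi> k / (?R k)\<^sup>2 - 1) \<le> \<bar>sq_dist (X k) x / (?R k)\<^sup>2 - 1\<bar>"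
              unfolding eq by simp
          qed
        qed
        from tendsto_add[OF this tendsto_const[of 1]] show ?thesis by simp
      qed
      let ?Q = "\<lambda>k. ?R k powr ?n * (2 * kernel_deriv ?n (N k) (\<xi> k))"
      have Q: "?Q \<longlonglongrightarrow> 1"
        using R2 N by (intro scaled_kernel_limit[OF Xlim _ N x0 ratio]) (auto intro: order_trans[of 1 2])
      have Q1: "(\<lambda>k. ?Q k - 1) \<longlonglongrightarrow> 0" using tendsto_diff[OF Q tendsto_const[of 1]] by simp
      let ?E = "\<lambda>k. ((norm x)\<^sup>2 + (\<eta> x - \<eta> (X k))\<^sup>2) / ?R k"
      have E: "?E \<longlonglongrightarrow> 0"
      proof (rule Lim_null_comparison)
        show "\<forall>\<^sub>F k in sequentially. norm (?E k) \<le> ((norm x)\<^sup>2 + (2 * K)\<^sup>2) / ?R k"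
        proof (intro always_eventually allI)
          fix k
          have "?E k \<le> ((norm x)\<^sup>2 + (2 * K)\<^sup>2) / ?R k"
            using eta_diff_square_le[of x "X k"] by (intro divide_right_mono) auto
          moreover have "0 \<le> ?E k" by simp
          ultimately show "norm (?E k) \<le> ((norm x)\<^sup>2 + (2 * K)\<^sup>2) / ?R k" by simp
        qed
        show "(\<lambda>k. ((norm x)\<^sup>2 + (2 * K)\<^sup>2) / ?R k) \<longlonglongrightarrow> 0"
          by (intro tendsto_divide_0[OF tendsto_const] filterlim_at_top_imp_at_infinity Xlim)
      qed
      have T: "(\<lambda>k. (?Q k - 1) * ((x \<bullet> X k) / ?R k)) \<longlonglongrightarrow> 0"
      proof (rule Lim_null_comparison)
        show "\<forall>\<^sub>F k in sequentially. norm ((?Q k - 1) * ((x \<bullet> X k) / ?R k)) \<le> \<bar>?Q k - 1\<bar> * norm x"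
        proof (intro always_eventually allI)
          fix k
          have "\<bar>?Q k - 1\<bar> * (\<bar>x \<bullet> X k\<bar> / ?R k) \<le> \<bar>?Q k - 1\<bar> * norm x"
            using xX by (intro mult_left_mono) auto
          then show "norm ((?Q k - 1) * ((x \<bullet> X k) / ?R k)) \<le> \<bar>?Q k - 1\<bar> * norm x"
            by (simp only: real_norm_def abs_mult abs_divide abs_norm_cancel)
        qed
        show "(\<lambda>k. \<bar>?Q k - 1\<bar> * norm x) \<longlonglongrightarrow> 0"
          by (intro tendsto_mult_left_zero tendsto_rabs_zero Q1)
      qed
      have lim: "(\<lambda>k. (?Q k * (1/2 * ?E k) - (?Q k - 1) * ((x \<bullet> X k) / ?R k)) * (D\<eta> x \<bullet> c)) \<longlonglongrightarrow> (1 * (1/2 * 0) - 0) * (D\<eta> x \<bullet> c)"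
        by (intro tendsto_mult tendsto_diff tendsto_const T Q E)
      have "\<forall>\<^sub>F k in sequentially. (?Q k * (1/2 * ?E k) - (?Q k - 1) * ((x \<bullet> X k) / ?R k)) * (D\<eta> x \<bullet> c) = ?u k x"
        using Xlim[unfolded filterlim_at_top_dense, rule_format, of "2 * norm x"]
      proof eventually_elim
        case (elim k)
        let ?A = "?R k powr ?d * kernel_deriv ?n (N k) (\<xi> k)"
        have "?R k powr ?n = ?R k powr ?d * ?R k" using R0[of k] by (simp add: powr_add)
        then have q: "?Q k = 2 * ?A * ?R k" by (simp only: mult_ac)
        have d: "?R k powr ?d * (?D k x * (D\<eta> x \<bullet> c)) = ?A * ((norm x)\<^sup>2 - 2 * (x \<bullet> X k) + (\<eta> x - \<eta> (X k))\<^sup>2) * (D\<eta> x \<bullet> c)"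
          unfolding \<xi>(3) sq_dist_difference by (simp only: mult.assoc)
        have alg: "((2 * A * R) * (1/2 * ((a + b) / R)) - (2 * A * R - 1) * (y / R)) * z = A * (a - 2 * y + b) * z + y * z / R"
          if "0 < R" for A R y a b z :: real
          using that by (simp add: field_simps)
        have ind: "indicator (ball 0 (?R k / 2)) x = (1::real)" using elim by simp
        show ?case by (simp only: q d ind mult_1 alg[OF R0])
      qed
      with lim show "(\<lambda>k. ?u k x) \<longlonglongrightarrow> 0" by (simp add: Lim_transform_eventually)
    qed
  qed simp
  then have near: "(\<lambda>k. \<integral>x. ?u k x \<partial>lborel) \<longlonglongrightarrow> 0" by simp
  have "(\<lambda>k. (\<integral>x. ?u k x \<partial>lborel) + ?R k powr ?d
      * (\<integral>x. indicator (- ball 0 (?R k / 2)) x * (?D k x * (D\<eta> x \<bullet> c)) \<partial>lborel)) \<longlonglongrightarrow> 0"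
    using tendsto_add[OF near single_layer_far_tendsto[OF X N0]] by simp
  moreover have "(\<integral>x. ?u k x \<partial>lborel) + ?R k powr ?d
      * (\<integral>x. indicator (- ball 0 (?R k / 2)) x * (?D k x * (D\<eta> x \<bullet> c)) \<partial>lborel)
    = ?R k powr ?d * (\<integral>x. ?D k x * (D\<eta> x \<bullet> c) \<partial>lborel)" for k
  proof -
    let ?g = "\<lambda>x. indicator (ball 0 (?R k / 2)) x * (?D k x * (D\<eta> x \<bullet> c))"
    have int: "integrable lborel (\<lambda>x. ?D k x * (D\<eta> x \<bullet> c))" by (rule single_layer_integrable[OF N0])
    have ig: "integrable lborel ?g" using integrable_mult_indicator[OF _ int, of "ball 0 (?R k / 2)"] by simp
    have ip: "integrable lborel (\<lambda>x. (x \<bullet> X k) * (D\<eta> x \<bullet> c) / ?R k)" by (intro integrable_divide first_moment_integrable)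
    have "?u k = (\<lambda>x. ?R k powr ?d * ?g x + (x \<bullet> X k) * (D\<eta> x \<bullet> c) / ?R k)" by (auto simp: fun_eq_iff)
    then have "(\<integral>x. ?u k x \<partial>lborel) = ?R k powr ?d * (\<integral>x. ?g x \<partial>lborel)"
      using Bochner_Integration.integral_add[OF integrable_mult_right[OF ig] ip, of "?R k powr ?d"]
      by (simp add: first_moment_zero)
    then show ?thesis unfolding integral_split_ball[OF int, of "?R k / 2"] by (simp add: algebra_simps)
  qed
  ultimately show ?thesis by simp
qed

text \<open>
  Argue along a sequence of surface points that violates the claim. For each point choose the
  parameter of the kernel so large that Green's identity holds with a negligible error, and at
  least the square of the distance; then the limits of the two layers apply.
\<close>

lemma surface_asymptotics:
  "((\<lambda>x. norm x powr real DIM('a) * (half_mass TYPE('a \<times> real) * \<psi> x) - (dipole \<bullet> x) / norm x) \<longlongrightarrow> 0) at_infinity"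
    (is "(?f \<longlongrightarrow> 0) _")
proof (rule ccontr)
  assume "\<not> (?f \<longlongrightarrow> 0) at_infinity"
  then obtain e where e: "0 < e" "\<not> (\<forall>\<^sub>F x in at_infinity. dist (?f x) 0 < e)" unfolding tendsto_iff by blast
  have "\<exists>x. real k + 2 \<le> norm x \<and> e \<le> \<bar>?f x\<bar>" for k
    using e(2) unfolding eventually_at_infinity by (auto simp: not_less)
  then obtain X where X: "\<And>k. real k + 2 \<le> norm (X k)" "\<And>k. e \<le> \<bar>?f (X k)\<bar>" by metis
  let ?d = "real DIM('a)" and ?n = "real DIM('a \<times> real)" and ?m = "half_mass TYPE('a \<times> real)"
  let ?R = "\<lambda>k. norm (X k)"
  have R0: "0 < ?R k" for k using X(1)[of k] by linarith
  define G where "G k m = (\<integral>x. \<psi> x * double_layer m (X k) x \<partial>lborel)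
      + (\<integral>x. (kernel ?n m (sq_dist (X k) x) - kernel ?n m ((?R k)\<^sup>2)) * (D\<eta> x \<bullet> c) \<partial>lborel)" for k m
  have G: "(G k \<longlongrightarrow> ?m * \<psi> (X k)) at_top" for k
    unfolding G_def double_layer_def by (rule green_limit)
  have "\<exists>m. (?R k)\<^sup>2 \<le> m \<and> \<bar>G k m - ?m * \<psi> (X k)\<bar> < inverse (real (Suc k)) / ?R k powr ?d" for k
  proof -
    have "0 < inverse (real (Suc k)) / ?R k powr ?d" using R0[of k] by simp
    from tendstoD[OF G this] eventually_ge_at_top[of "(?R k)\<^sup>2"]
    have "\<forall>\<^sub>F m in at_top. (?R k)\<^sup>2 \<le> m \<and> \<bar>G k m - ?m * \<psi> (X k)\<bar> < inverse (real (Suc k)) / ?R k powr ?d"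
      by eventually_elim (simp add: dist_real_def)
    from eventually_happens[OF this] show ?thesis by simp
  qed
  then obtain N where N: "\<And>k. (?R k)\<^sup>2 \<le> N k"
    and GN: "\<And>k. \<bar>G k (N k) - ?m * \<psi> (X k)\<bar> < inverse (real (Suc k)) / ?R k powr ?d" by metis
  have lim: "(\<lambda>k. ?R k powr ?d * G k (N k) - (dipole \<bullet> X k) / ?R k) \<longlonglongrightarrow> 0"
    using tendsto_add[OF double_layer_limit[OF X(1) N] single_layer_limit[OF X(1) N]]
    unfolding G_def by (simp add: algebra_simps)
  have err: "(\<lambda>k. ?R k powr ?d * (?m * \<psi> (X k)) - ?R k powr ?d * G k (N k)) \<longlonglongrightarrow> 0"
  proof (rule Lim_null_comparison[OF _ LIMSEQ_inverse_real_of_nat])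
    show "\<forall>\<^sub>F k in sequentially. norm (?R k powr ?d * (?m * \<psi> (X k)) - ?R k powr ?d * G k (N k)) \<le> inverse (real (Suc k))"
    proof (intro always_eventually allI)
      fix k
      have p: "0 < ?R k powr ?d" using R0[of k] by simp
      have "norm (?R k powr ?d * (?m * \<psi> (X k)) - ?R k powr ?d * G k (N k)) = ?R k powr ?d * \<bar>G k (N k) - ?m * \<psi> (X k)\<bar>"
        unfolding right_diff_distrib[symmetric] real_norm_def abs_mult using p by (simp add: abs_minus_commute)
      also have "\<dots> \<le> ?R k powr ?d * (inverse (real (Suc k)) / ?R k powr ?d)"
        using GN[of k] p by (intro mult_left_mono) auto
      also have "\<dots> = inverse (real (Suc k))" using p by simp
      finally show "norm (?R k powr ?d * (?m * \<psi> (X k)) - ?R k powr ?d * G k (N k)) \<le> inverse (real (Suc k))" .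
    qed
  qed
  have "(\<lambda>k. ?f (X k)) \<longlonglongrightarrow> 0" using tendsto_add[OF err lim] by simp
  from tendstoD[OF this e(1)] have "\<forall>\<^sub>F k in sequentially. \<bar>?f (X k)\<bar> < e" by (simp add: dist_real_def)
  from eventually_happens[OF this] obtain k where "\<bar>?f (X k)\<bar> < e" by auto
  then show False using X(2)[of k] by linarith
qed

end

section \<open>Angular momentum\<close>

text \<open>
  Radial functions that converge to the indicator of the ball as \<open>k\<close> grows while being
  supported in it. For a rotational derivative a radial cutoff produces no error at all, so
  the sharp ball can be reached in the limit.
\<close>

definition ball_cutoff :: "real \<Rightarrow> nat \<Rightarrow> 'a::euclidean_space \<Rightarrow> real" where
  "ball_cutoff r k x = (max 0 (1 - ((norm x)\<^sup>2 / r\<^sup>2) ^ Suc k))\<^sup>2"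

definition ball_cutoff_factor :: "real \<Rightarrow> nat \<Rightarrow> 'a::euclidean_space \<Rightarrow> real" where
  "ball_cutoff_factor r k x = - 4 * real (Suc k) / r\<^sup>2 * max 0 (1 - ((norm x)\<^sup>2 / r\<^sup>2) ^ Suc k) * ((norm x)\<^sup>2 / r\<^sup>2) ^ k"

lemma GDERIV_ball_cutoff: "GDERIV (ball_cutoff r k) x :> ball_cutoff_factor r k x *\<^sub>R x"
proof -
  have 1: "((\<lambda>s. s / r\<^sup>2) has_real_derivative 1 / r\<^sup>2) (at s)" for s by (intro DERIV_cdivide DERIV_ident)
  have 2: "((\<lambda>s. 1 - (s / r\<^sup>2) ^ Suc k) has_real_derivative 0 - real (Suc k) * (s / r\<^sup>2) ^ k * (1 / r\<^sup>2)) (at s)" for s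
    using DERIV_diff[OF DERIV_const DERIV_power_Suc[OF 1]] by (simp add: mult_ac)
  have 3: "((\<lambda>s. max 0 (1 - (s / r\<^sup>2) ^ Suc k) ^ Suc (Suc 0)) has_real_derivative
      real (Suc (Suc 0)) * max 0 (1 - (s / r\<^sup>2) ^ Suc k) ^ Suc 0 * (0 - real (Suc k) * (s / r\<^sup>2) ^ k * (1 / r\<^sup>2))) (at s)" for s
    by (rule DERIV_chain2[OF positive_part_power_deriv 2])
  have eq: "ball_cutoff r k = (\<lambda>x::'a. max 0 (1 - ((norm (x - 0))\<^sup>2 / r\<^sup>2) ^ Suc k) ^ Suc (Suc 0))"
    by (simp add: ball_cutoff_def fun_eq_iff numeral_2_eq_2)
  show ?thesis
    unfolding eq by (rule GDERIV_subst[OF GDERIV_radial[OF 3]])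
      (simp only: diff_zero, rule arg_cong[where f="\<lambda>c. c *\<^sub>R x"], simp add: ball_cutoff_factor_def divide_inverse algebra_simps)
qed

lemma ball_cutoff_continuous: "continuous_on S (ball_cutoff r k)" "continuous_on S (\<lambda>x. ball_cutoff_factor r k x *\<^sub>R x)"
  unfolding ball_cutoff_def ball_cutoff_factor_def divide_inverse by (intro continuous_intros)+

lemma ball_cutoff_nonneg: "0 \<le> ball_cutoff r k x" and ball_cutoff_le_1: "ball_cutoff r k x \<le> 1"
proof -
  show "0 \<le> ball_cutoff r k x" by (simp add: ball_cutoff_def)
  show "ball_cutoff r k x \<le> 1" unfolding ball_cutoff_def by (intro power_le_one) auto
qed

lemma ball_cutoff_outside:
  assumes "0 < r" "r \<le> norm x" shows "ball_cutoff r k x = 0"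
proof -
  have "r\<^sup>2 \<le> (norm x)\<^sup>2" using assms by (intro power_mono) auto
  then have "1 \<le> (norm x)\<^sup>2 / r\<^sup>2" using assms by simp
  then have "1 \<le> ((norm x)\<^sup>2 / r\<^sup>2) ^ Suc k" by (rule one_le_power)
  then have "max 0 (1 - ((norm x)\<^sup>2 / r\<^sup>2) ^ Suc k) = 0" by linarith
  then show ?thesis by (simp only: ball_cutoff_def) simp
qed

lemma ball_cutoff_tendsto:
  assumes "0 < r" shows "(\<lambda>k. ball_cutoff r k x) \<longlonglongrightarrow> indicator (ball 0 r) x"
proof (cases "norm x < r")
  case True
  have "(norm x)\<^sup>2 < r\<^sup>2" using True by (intro power_strict_mono) auto
  then have "\<bar>(norm x)\<^sup>2 / r\<^sup>2\<bar> < 1" using assms by simp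
  then have "(\<lambda>k. ((norm x)\<^sup>2 / r\<^sup>2) ^ Suc k) \<longlonglongrightarrow> 0"
    by (intro LIMSEQ_Suc LIMSEQ_abs_realpow_zero2)
  from tendsto_power[OF tendsto_max[OF tendsto_const tendsto_diff[OF tendsto_const this]]]
  have "(\<lambda>k. (max 0 (1 - ((norm x)\<^sup>2 / r\<^sup>2) ^ Suc k))\<^sup>2) \<longlonglongrightarrow> (max 0 (1 - 0))\<^sup>2" .
  then show ?thesis using True by (simp add: ball_cutoff_def)
next
  case False
  then show ?thesis using ball_cutoff_outside[OF assms, of x] by simp
qed

context water_wave
begin

text \<open>
  The derivative of \<open>\<phi>\<close> along the rotation in the plane of \<open>v\<close> and the vertical: one component
  of \<open>x \<times> \<nabla>\<phi>\<close>.
\<close>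

definition rotation_derivative :: "'a \<Rightarrow> 'a \<times> real \<Rightarrow> real" where
  "rotation_derivative v x = (fst x \<bullet> v) * (D\<phi> x \<bullet> up) - snd x * (D\<phi> x \<bullet> (v, 0))"

lemma rotation_derivative_continuous: "continuous_on (closure \<Omega>) (rotation_derivative v)"
  unfolding rotation_derivative_def by (intro continuous_intros Dphi_cont)

text \<open>
  The rotation field is divergence free and annihilates the radial cutoff, so only the surface
  contributes.
\<close>

lemma rotation_flux_cutoff:
  assumes r: "0 < r"
  shows "(\<integral>x. indicator \<Omega> x * (ball_cutoff r k x * rotation_derivative v x) \<partial>lborel)
    = (\<integral>x. ball_cutoff r k (surf x) * (\<psi> x * (x \<bullet> v + \<eta> x * (D\<eta> x \<bullet> v))) \<partial>lborel)"
proof -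
  let ?z = "ball_cutoff r k" and ?v = "(v, 0) :: 'a \<times> real"
  let ?Dz = "\<lambda>x::'a \<times> real. ball_cutoff_factor r k x *\<^sub>R x"
  have Z: "C1_upto \<Omega> ?z ?Dz" by (intro C1_uptoI GDERIV_ball_cutoff ball_cutoff_continuous)
  note Zp = C1_upto_mult[OF Z phi]
  let ?Dp = "\<lambda>x. ?z x *\<^sub>R D\<phi> x + \<phi> x *\<^sub>R ?Dz x"
  note f1 = C1_upto_mult[OF Zp C1_upto_inner[of \<Omega> ?v]] and f2 = C1_upto_mult[OF Zp C1_upto_inner[of \<Omega> up]]
  let ?D1 = "\<lambda>x. (?z x * \<phi> x) *\<^sub>R ?v + (x \<bullet> ?v) *\<^sub>R ?Dp x"
  let ?D2 = "\<lambda>x. (?z x * \<phi> x) *\<^sub>R up + (x \<bullet> up) *\<^sub>R ?Dp x"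
  have z: "?z x * \<phi> x * y = 0" if "r \<le> norm x" for x y using ball_cutoff_outside[OF r that] by simp
  have g1: "integrable lborel (\<lambda>x. indicator \<Omega> x * (?D1 x \<bullet> up))"
    "(\<integral>x. indicator \<Omega> x * (?D1 x \<bullet> up) \<partial>lborel) = (\<integral>x. ?z (surf x) * \<phi> (surf x) * (surf x \<bullet> ?v) * (nrm x \<bullet> up) \<partial>lborel)"
    using gradient_theorem[OF f1, of r up] z by blast+
  have g2: "integrable lborel (\<lambda>x. indicator \<Omega> x * (?D2 x \<bullet> ?v))"
    "(\<integral>x. indicator \<Omega> x * (?D2 x \<bullet> ?v) \<partial>lborel) = (\<integral>x. ?z (surf x) * \<phi> (surf x) * (surf x \<bullet> up) * (nrm x \<bullet> ?v) \<partial>lborel)"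
    using gradient_theorem[OF f2, of r ?v] z by blast+
  \<comment> \<open>the gradient of the cutoff is radial, so its contributions to \<open>?D1\<close> and \<open>?D2\<close> cancel\<close>
  have eq: "indicator \<Omega> x * (?z x * rotation_derivative v x) = indicator \<Omega> x * (?D1 x \<bullet> up) - indicator \<Omega> x * (?D2 x \<bullet> ?v)" for x
    by (cases x) (simp add: rotation_derivative_def algebra_simps inner_commute[of v])
  have i: "integrable lborel (\<lambda>x. ?z (surf x) * \<phi> (surf x) * (surf x \<bullet> a) * w x)" if "continuous_on UNIV w" for a w
    using that z by (intro integrable_on_surf[where r=r] continuous_intros ball_cutoff_continuous phi_cont) auto
  have i1: "integrable lborel (\<lambda>x. ?z (surf x) * \<phi> (surf x) * (surf x \<bullet> ?v) * (nrm x \<bullet> up))"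
    and i2: "integrable lborel (\<lambda>x. ?z (surf x) * \<phi> (surf x) * (surf x \<bullet> up) * (nrm x \<bullet> ?v))"
    by (intro i continuous_intros continuous_nrm)+
  have "(\<integral>x. indicator \<Omega> x * (?z x * rotation_derivative v x) \<partial>lborel)
     = (\<integral>x. ?z (surf x) * \<phi> (surf x) * (surf x \<bullet> ?v) * (nrm x \<bullet> up) - ?z (surf x) * \<phi> (surf x) * (surf x \<bullet> up) * (nrm x \<bullet> ?v) \<partial>lborel)"
    unfolding eq Bochner_Integration.integral_diff[OF g1(1) g2(1)] Bochner_Integration.integral_diff[OF i1 i2] g1(2) g2(2) ..
  also have "\<dots> = (\<integral>x. ?z (surf x) * (\<psi> x * (x \<bullet> v + \<eta> x * (D\<eta> x \<bullet> v))) \<partial>lborel)"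
    by (intro Bochner_Integration.integral_cong refl) (simp add: nrm_def surf_def \<psi>_def algebra_simps)
  finally show ?thesis .
qed

lemma rotation_flux:
  assumes r: "0 < r"
  shows "(\<integral>x. indicator (\<Omega> \<inter> ball 0 r) x * rotation_derivative v x \<partial>lborel)
    = (\<integral>x. indicator (ball 0 r) (surf x) * (\<psi> x * (x \<bullet> v + \<eta> x * (D\<eta> x \<bullet> v))) \<partial>lborel)"
proof -
  have m1: "(\<lambda>x. indicator \<Omega> x * rotation_derivative v x) \<in> borel_measurable borel"
    using borel_measurable_continuous_on_indicator[OF sets_fluid continuous_on_subset[OF rotation_derivative_continuous closure_subset]]
    by simp
  have mz[measurable]: "ball_cutoff r k \<in> borel_measurable borel" for k
    by (rule borel_measurable_continuous_onI[OF ball_cutoff_continuous(1)])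
  have "(\<lambda>k. \<integral>x. ball_cutoff r k x * (indicator \<Omega> x * rotation_derivative v x) \<partial>lborel)
     \<longlonglongrightarrow> (\<integral>x. indicator (ball 0 r) x * (indicator \<Omega> x * rotation_derivative v x) \<partial>lborel)"
  proof (rule integral_dominated_convergence[where w="\<lambda>x. \<bar>indicator (closure \<Omega> \<inter> cball 0 r) x *\<^sub>R rotation_derivative v x\<bar>"])
    show "integrable lborel (\<lambda>x. \<bar>indicator (closure \<Omega> \<inter> cball 0 r) x *\<^sub>R rotation_derivative v x\<bar>)"
      by (intro integrable_abs borel_integrable_compact) (auto intro: continuous_on_subset[OF rotation_derivative_continuous])
    show "AE x in lborel. (\<lambda>k. ball_cutoff r k x * (indicator \<Omega> x * rotation_derivative v x))
        \<longlonglongrightarrow> indicator (ball 0 r) x * (indicator \<Omega> x * rotation_derivative v x)"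
      by (intro AE_I2 tendsto_mult tendsto_const ball_cutoff_tendsto r)
    show "AE x in lborel. norm (ball_cutoff r k x * (indicator \<Omega> x * rotation_derivative v x))
        \<le> \<bar>indicator (closure \<Omega> \<inter> cball 0 r) x *\<^sub>R rotation_derivative v x\<bar>" for k
    proof (rule AE_I2)
      fix x :: "'a \<times> real"
      show "norm (ball_cutoff r k x * (indicator \<Omega> x * rotation_derivative v x))
        \<le> \<bar>indicator (closure \<Omega> \<inter> cball 0 r) x *\<^sub>R rotation_derivative v x\<bar>"
      proof (cases "x \<in> \<Omega> \<and> norm x \<le> r")
        case True
        then have "x \<in> closure \<Omega>" using closure_subset by blast
        then show ?thesis
          using True mult_right_mono[OF ball_cutoff_le_1[of r k x], of "\<bar>rotation_derivative v x\<bar>"] ball_cutoff_nonneg[of r k x]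
          by (simp add: abs_mult)
      next
        case False
        then have "indicator \<Omega> x = (0::real) \<or> ball_cutoff r k x = 0"
          using ball_cutoff_outside[OF r, of x k] by (auto simp: indicator_def)
        then show ?thesis by auto
      qed
    qed
  qed (use m1 in measurable)
  moreover have "(\<lambda>k. \<integral>x. ball_cutoff r k (surf x) * (\<psi> x * (x \<bullet> v + \<eta> x * (D\<eta> x \<bullet> v))) \<partial>lborel)
     \<longlonglongrightarrow> (\<integral>x. indicator (ball 0 r) (surf x) * (\<psi> x * (x \<bullet> v + \<eta> x * (D\<eta> x \<bullet> v))) \<partial>lborel)"
  proof (rule integral_dominated_convergence[where w="\<lambda>x. \<bar>indicator (cball 0 r) x *\<^sub>R (\<psi> x * (x \<bullet> v + \<eta> x * (D\<eta> x \<bullet> v)))\<bar>"])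
    show "integrable lborel (\<lambda>x. \<bar>indicator (cball 0 r) x *\<^sub>R (\<psi> x * (x \<bullet> v + \<eta> x * (D\<eta> x \<bullet> v)))\<bar>)"
      by (intro integrable_abs borel_integrable_compact compact_cball continuous_intros eta_cont
          continuous_on_subset[OF psi_cont] continuous_on_subset[OF Deta_cont]) auto
    show "AE x in lborel. (\<lambda>k. ball_cutoff r k (surf x) * (\<psi> x * (x \<bullet> v + \<eta> x * (D\<eta> x \<bullet> v))))
        \<longlonglongrightarrow> indicator (ball 0 r) (surf x) * (\<psi> x * (x \<bullet> v + \<eta> x * (D\<eta> x \<bullet> v)))"
      by (intro AE_I2 tendsto_mult[OF ball_cutoff_tendsto[OF r] tendsto_const])
    show "AE x in lborel. norm (ball_cutoff r k (surf x) * (\<psi> x * (x \<bullet> v + \<eta> x * (D\<eta> x \<bullet> v))))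
        \<le> \<bar>indicator (cball 0 r) x *\<^sub>R (\<psi> x * (x \<bullet> v + \<eta> x * (D\<eta> x \<bullet> v)))\<bar>" for k
    proof (rule AE_I2)
      fix x :: 'a
      show "norm (ball_cutoff r k (surf x) * (\<psi> x * (x \<bullet> v + \<eta> x * (D\<eta> x \<bullet> v))))
        \<le> \<bar>indicator (cball 0 r) x *\<^sub>R (\<psi> x * (x \<bullet> v + \<eta> x * (D\<eta> x \<bullet> v)))\<bar>"
      proof (cases "norm x \<le> r")
        case True
        then show ?thesis
          using mult_right_mono[OF ball_cutoff_le_1[of r k "surf x"], of "\<bar>\<psi> x * (x \<bullet> v + \<eta> x * (D\<eta> x \<bullet> v))\<bar>"]
            ball_cutoff_nonneg[of r k "surf x"]
          by (simp add: abs_mult)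
      next
        case False
        then have "ball_cutoff r k (surf x) = 0"
          using norm_le_norm_surf[of x] by (intro ball_cutoff_outside r) linarith
        then show ?thesis by simp
      qed
    qed
    have "(\<lambda>x. ball_cutoff r k (surf x)) \<in> borel_measurable borel" for k
      using measurable_compose[OF surf_meas mz] .
    then show "(\<lambda>x. ball_cutoff r k (surf x) * (\<psi> x * (x \<bullet> v + \<eta> x * (D\<eta> x \<bullet> v)))) \<in> borel_measurable lborel" for k
      by measurable
    have "(\<lambda>x. indicator (ball 0 r) (surf x) :: real) \<in> borel_measurable borel"
      using measurable_compose[OF surf_meas borel_measurable_indicator[OF sets_ball_zero]] .
    then show "(\<lambda>x. indicator (ball 0 r) (surf x) * (\<psi> x * (x \<bullet> v + \<eta> x * (D\<eta> x \<bullet> v)))) \<in> borel_measurable lborel"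
      by measurable
  qed
  moreover have "(\<integral>x. ball_cutoff r k x * (indicator \<Omega> x * rotation_derivative v x) \<partial>lborel)
    = (\<integral>x. ball_cutoff r k (surf x) * (\<psi> x * (x \<bullet> v + \<eta> x * (D\<eta> x \<bullet> v))) \<partial>lborel)" for k
    using rotation_flux_cutoff[OF r, of k v] by (simp add: mult.left_commute)
  ultimately have "(\<integral>x. indicator (ball 0 r) x * (indicator \<Omega> x * rotation_derivative v x) \<partial>lborel)
    = (\<integral>x. indicator (ball 0 r) (surf x) * (\<psi> x * (x \<bullet> v + \<eta> x * (D\<eta> x \<bullet> v))) \<partial>lborel)"
    using LIMSEQ_unique by force
  moreover have "indicator (ball 0 r) x * (indicator \<Omega> x * rotation_derivative v x) = indicator (\<Omega> \<inter> ball 0 r) x * rotation_derivative v x" for x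
    by (simp add: indicator_inter_arith mult_ac)
  ultimately show ?thesis by simp
qed

text \<open>
  The integrand is homogeneous of degree \<open>1 - d\<close>, whence the linear growth. It vanishes only
  on a hyperplane, so the constant is positive.
\<close>

lemma dipole_square_integral:
  assumes p: "p \<noteq> 0"
  defines "h \<equiv> \<lambda>x::'a. (p \<bullet> x)\<^sup>2 * norm x powr (- (real DIM('a) + 1))"
  obtains J where "0 < J" "\<And>R. 0 < R \<Longrightarrow> integrable lborel (\<lambda>x. indicator (ball 0 R) x * h x)"
    "\<And>R. 0 < R \<Longrightarrow> (\<integral>x. indicator (ball 0 R) x * h x \<partial>lborel) = R * J"
proof -
  let ?d = "real DIM('a)"
  define J where "J = (\<integral>x. indicator (ball 0 1) x * h x \<partial>lborel)"
  have [measurable]: "h \<in> borel_measurable borel" unfolding h_def by measurable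
  have h0: "0 \<le> h x" for x by (simp add: h_def)
  have h_le: "h x \<le> (norm p)\<^sup>2 * norm x powr (- (?d - 1))" for x
  proof (cases "x = 0")
    case False
    have "(p \<bullet> x)\<^sup>2 \<le> (norm p * norm x)\<^sup>2"
      using Cauchy_Schwarz_ineq2[of p x] by (intro abs_le_square_iff[THEN iffD1]) simp
    then have "h x \<le> (norm p * norm x)\<^sup>2 * norm x powr (- (?d + 1))" unfolding h_def by (intro mult_right_mono) auto
    also have "\<dots> = (norm p)\<^sup>2 * (norm x powr 2 * norm x powr (- (?d + 1)))" using False by (simp add: power_mult_distrib)
    also have "norm x powr 2 * norm x powr (- (?d + 1)) = norm x powr (- (?d - 1))"
      by (simp only: powr_add[symmetric], rule arg_cong2[where f="(powr)", OF refl], simp)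
    finally show ?thesis .
  qed (simp add: h_def)
  have int: "integrable lborel (\<lambda>x. indicator (ball 0 R) x * h x)" if "0 < R" for R
  proof (rule Bochner_Integration.integrable_bound)
    show "integrable lborel (\<lambda>x::'a. (norm p)\<^sup>2 * (indicator (ball 0 R) x * norm x powr (- (?d - 1))))"
      by (intro integrable_mult_right integral_ball_powr that) simp
    show "AE x in lborel. norm (indicator (ball 0 R) x * h x) \<le> norm ((norm p)\<^sup>2 * (indicator (ball 0 R) x * norm x powr (- (?d - 1))))"
      using h_le h0 by (intro AE_I2) (auto simp: indicator_def)
  qed measurable
  have scale: "(\<integral>x. indicator (ball 0 R) x * h x \<partial>lborel) = R * J" if R: "0 < R" for R
  proof -
    have hR: "h (R *\<^sub>R x) = R powr (1 - ?d) * h x" for x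
    proof -
      have "R powr 2 * R powr (- (?d + 1)) = R powr (1 - ?d)"
        by (simp only: powr_add[symmetric], rule arg_cong2[where f="(powr)", OF refl], simp)
      moreover have "h (R *\<^sub>R x) = (R powr 2 * R powr (- (?d + 1))) * h x"
        using R by (simp add: h_def power_mult_distrib powr_mult mult_ac)
      ultimately show ?thesis by simp
    qed
    have "(\<integral>x. indicator (ball 0 R) x * h x \<partial>lborel) = \<bar>R\<bar> ^ DIM('a) * (\<integral>x. indicator (ball 0 R) (0 + R *\<^sub>R x) * h (0 + R *\<^sub>R x) \<partial>lborel)"
      using R by (intro lborel_integral_affine) auto
    also have "(\<lambda>x. indicator (ball 0 R) (0 + R *\<^sub>R x) * h (0 + R *\<^sub>R x)) = (\<lambda>x. R powr (1 - ?d) * (indicator (ball 0 1) x * h x))"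
      using R by (auto simp: indicator_def hR fun_eq_iff)
    also have "\<bar>R\<bar> ^ DIM('a) * (\<integral>x. R powr (1 - ?d) * (indicator (ball 0 1) x * h x) \<partial>lborel) = (R powr ?d * R powr (1 - ?d)) * J"
      unfolding J_def integral_mult_right_zero using R by (simp add: powr_realpow)
    also have "R powr ?d * R powr (1 - ?d) = R" using R by (simp only: powr_add[symmetric]) simp
    finally show ?thesis .
  qed
  have "0 \<le> J" unfolding J_def using h0 by (intro integral_nonneg_AE AE_I2) (simp add: indicator_def)
  moreover have "J \<noteq> 0"
  proof
    assume "J = 0"
    then have "AE x in lborel. indicator (ball 0 1) x * h x = 0"
      unfolding J_def using int[of 1] h0 by (subst (asm) integral_nonneg_eq_0_iff_AE) (auto simp: indicator_def)
    moreover have "AE x in lborel. p \<bullet> x \<noteq> 0"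
      using even_half_space_integral(2)[of "\<lambda>_::'a. 0" p] p by simp
    ultimately have "AE x in lborel. x \<notin> ball (0::'a) 1"
      by eventually_elim (auto simp: h_def indicator_def)
    then have "emeasure lborel (ball (0::'a) 1) = 0"
      by (subst (asm) AE_iff_measurable[where N="ball 0 1"]) auto
    then have "measure lborel (ball (0::'a) 1) = 0" by (simp add: measure_def)
    then show False using content_ball_gt_0_iff[of "0::'a" 1] by simp
  qed
  ultimately have "0 < J" by simp
  from that[OF this int scale] show thesis .
qed

text \<open>
  Insert the asymptotics of \<open>\<psi>\<close> into the surface integral for the angular momentum in the
  plane of the dipole moment and the vertical. The main term is \<open>\<integral> (p \<bullet> x)\<^sup>2 / |x|\<^sup>n\<close> over the
  ball, which grows linearly; the remainder of the asymptotics contributes \<open>o(r)\<close>, and the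
  term with \<open>\<eta> (p \<bullet> \<nabla>\<eta>)\<close> stays bounded. The region cut out on the surface by the ball lies
  between the balls of radius \<open>r - K\<close> and \<open>r\<close>.
\<close>

lemma angular_momentum_grows:
  assumes p: "dipole \<noteq> 0"
  shows "filterlim (\<lambda>r. \<bar>\<integral>x. indicator (\<Omega> \<inter> ball 0 r) x * rotation_derivative dipole x \<partial>lborel\<bar>) at_top at_top"
proof -
  let ?d = "real DIM('a)" and ?m = "half_mass TYPE('a \<times> real)" and ?p = dipole
  let ?h = "\<lambda>x::'a. (?p \<bullet> x)\<^sup>2 * norm x powr (- (?d + 1))"
  obtain J where J: "0 < J" "\<And>R. 0 < R \<Longrightarrow> integrable lborel (\<lambda>x. indicator (ball 0 R) x * ?h x)"
    "\<And>R. 0 < R \<Longrightarrow> (\<integral>x. indicator (ball 0 R) x * ?h x \<partial>lborel) = R * J"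
    using dipole_square_integral[OF p] by blast
  have m0: "0 < ?m" by (rule half_mass_pos)
  obtain M where M: "0 \<le> M" "\<And>x. \<bar>\<psi> x\<bar> \<le> M" using psi_bounded by blast
  define e where "e x = norm x powr ?d * (?m * \<psi> x) - (?p \<bullet> x) / norm x" for x
  have em[measurable]: "e \<in> borel_measurable borel" unfolding e_def by measurable
  have e0: "(e \<longlongrightarrow> 0) at_infinity" using surface_asymptotics unfolding e_def .
  obtain Me where Me: "\<And>x. \<bar>e x\<bar> \<le> Me"
  proof -
    have "\<forall>\<^sub>F x in at_infinity. \<bar>e x\<bar> < 1" using tendstoD[OF e0, of 1] by simp
    then obtain b where b: "\<And>x. b \<le> norm x \<Longrightarrow> \<bar>e x\<bar> < 1" unfolding eventually_at_infinity by blast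
    have "\<bar>e x\<bar> \<le> max 1 (\<bar>b\<bar> powr ?d * (?m * M) + norm ?p)" for x
    proof (cases "b \<le> norm x")
      case False
      have "\<bar>(?p \<bullet> x) / norm x\<bar> \<le> norm ?p"
        using Cauchy_Schwarz_ineq2[of ?p x] by (cases "x = 0") (auto simp: divide_le_eq)
      moreover have "norm x powr ?d * (?m * \<bar>\<psi> x\<bar>) \<le> \<bar>b\<bar> powr ?d * (?m * M)"
        using False m0 M by (intro mult_mono powr_mono2) auto
      ultimately have "\<bar>e x\<bar> \<le> \<bar>b\<bar> powr ?d * (?m * M) + norm ?p"
        unfolding e_def using m0 by (intro order_trans[OF abs_triangle_ineq4] add_mono) (auto simp: abs_mult)
      then show ?thesis by simp
    qed (use b in \<open>force intro: order_trans[OF less_imp_le]\<close>)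
    then show thesis using that by blast
  qed
  let ?E = "\<lambda>r. r powr ((?d - 1) - ?d) * (\<integral>x. indicator (ball 0 r) x * (\<bar>e x\<bar> * norm x powr (- (?d - 1))) \<partial>lborel)"
  have E: "(?E \<longlongrightarrow> 0) at_top" by (rule cesaro_ball[OF em Me e0]) simp
  define C where "C = (\<integral>x. \<bar>(\<psi> x * \<eta> x) * (D\<eta> x \<bullet> ?p)\<bar> \<partial>lborel)"
  have psieta: "\<bar>\<psi> x * \<eta> x\<bar> \<le> M * K" for x
    using M eta_bounded by (auto simp: abs_mult intro!: mult_mono)
  have iC: "integrable lborel (\<lambda>x. (\<psi> x * \<eta> x) * (D\<eta> x \<bullet> ?p))"
    by (intro bounded_Deta_integrable[OF _ psieta]) measurable
  let ?A = "\<lambda>r. \<integral>x. indicator (\<Omega> \<inter> ball 0 r) x * rotation_derivative ?p x \<partial>lborel"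
  \<comment> \<open>main term, asymptotic remainder, and the quadratic term in \<open>\<eta>\<close>, in this order\<close>
  have lower: "\<forall>\<^sub>F r in at_top. r * (J - norm ?p * ?E r) - (K * J + ?m * C) \<le> ?m * \<bar>?A r\<bar>"
    using eventually_gt_at_top[of "K + 1"]
  proof eventually_elim
    case (elim r)
    have r0: "0 < r" "0 < r - K" using elim K_nonneg by linarith+
    let ?I = "\<lambda>x. indicator (ball 0 r) (surf x) :: real"
    have Im[measurable]: "?I \<in> borel_measurable borel"
      using measurable_compose[OF surf_meas borel_measurable_indicator[OF sets_ball_zero]] .
    have I_le: "?I x \<le> indicator (ball 0 r) x" for x
      using norm_le_norm_surf[of x] by (auto simp: indicator_def)
    have I_ge: "indicator (ball 0 (r - K)) x \<le> ?I x" for x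
    proof -
      have "norm (surf x) \<le> norm x + \<bar>\<eta> x\<bar>" unfolding surf_def using norm_Pair_le[of x "\<eta> x"] by simp
      then show ?thesis using eta_bounded[of x] by (auto simp: indicator_def)
    qed
    have I01: "0 \<le> ?I x" "?I x \<le> 1" for x by (auto simp: indicator_def)
    let ?h1 = "\<lambda>x. ?I x * ?h x" and ?h2 = "\<lambda>x. ?I x * (e x * (norm x powr (- ?d) * (x \<bullet> ?p)))"
    let ?h3 = "\<lambda>x. ?I x * (?m * ((\<psi> x * \<eta> x) * (D\<eta> x \<bullet> ?p)))"
    have i1: "integrable lborel ?h1"
    proof (rule Bochner_Integration.integrable_bound[OF J(2)[OF r0(1)]])
      show "AE x in lborel. norm (?h1 x) \<le> norm (indicator (ball 0 r) x * ?h x)"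
        using I_le I01 by (intro AE_I2) (simp add: abs_mult mult_right_mono)
    qed measurable
    have ie: "integrable lborel (\<lambda>x. norm ?p * (indicator (ball 0 r) x * (\<bar>e x\<bar> * norm x powr (- (?d - 1)))))"
    proof (rule integrable_mult_right, rule Bochner_Integration.integrable_bound)
      show "integrable lborel (\<lambda>x::'a. Me * (indicator (ball 0 r) x * norm x powr (- (?d - 1))))"
        by (intro integrable_mult_right integral_ball_powr r0) simp
      have "0 \<le> Me" using Me[of 0] by linarith
      then show "AE x in lborel. norm (indicator (ball 0 r) x * (\<bar>e x\<bar> * norm x powr (- (?d - 1))))
          \<le> norm (Me * (indicator (ball 0 r) x * norm x powr (- (?d - 1))))"
        using Me by (intro AE_I2) (auto simp: indicator_def abs_mult intro!: mult_right_mono)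
    qed measurable
    have h2_le: "\<bar>?h2 x\<bar> \<le> norm ?p * (indicator (ball 0 r) x * (\<bar>e x\<bar> * norm x powr (- (?d - 1))))" for x
    proof (cases "x = 0")
      case False
      have "norm x powr (- ?d) * \<bar>x \<bullet> ?p\<bar> \<le> norm x powr (- ?d) * (norm x * norm ?p)"
        by (intro mult_left_mono Cauchy_Schwarz_ineq2) auto
      also have "\<dots> = (norm x powr (- ?d) * norm x powr 1) * norm ?p" using False by simp
      also have "norm x powr (- ?d) * norm x powr 1 = norm x powr (- (?d - 1))"
        by (simp only: powr_add[symmetric], rule arg_cong2[where f="(powr)", OF refl], simp)
      finally have AB: "norm x powr (- ?d) * \<bar>x \<bullet> ?p\<bar> \<le> norm x powr (- (?d - 1)) * norm ?p" .
      have "?I x * (\<bar>e x\<bar> * (norm x powr (- ?d) * \<bar>x \<bullet> ?p\<bar>))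
          \<le> indicator (ball 0 r) x * (\<bar>e x\<bar> * (norm x powr (- (?d - 1)) * norm ?p))"
        by (rule mult_mono[OF I_le mult_left_mono[OF AB abs_ge_zero]]) auto
      also have "\<dots> = norm ?p * (indicator (ball 0 r) x * (\<bar>e x\<bar> * norm x powr (- (?d - 1))))" by (simp only: mult_ac)
      also have "?I x * (\<bar>e x\<bar> * (norm x powr (- ?d) * \<bar>x \<bullet> ?p\<bar>)) = \<bar>?h2 x\<bar>"
        using I01(1)[of x] by (simp only: abs_mult abs_of_nonneg powr_ge_zero)
      finally show ?thesis .
    qed simp
    have i2: "integrable lborel ?h2"
    proof (rule Bochner_Integration.integrable_bound[OF ie])
      show "AE x in lborel. norm (?h2 x) \<le> norm (norm ?p * (indicator (ball 0 r) x * (\<bar>e x\<bar> * norm x powr (- (?d - 1)))))"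
        by (intro AE_I2) (simp only: real_norm_def, rule order_trans[OF h2_le abs_ge_self])
    qed measurable
    have h3_le: "\<bar>?h3 x\<bar> \<le> ?m * \<bar>(\<psi> x * \<eta> x) * (D\<eta> x \<bullet> ?p)\<bar>" for x
      using mult_right_mono[OF I01(2)[of x], of "?m * \<bar>(\<psi> x * \<eta> x) * (D\<eta> x \<bullet> ?p)\<bar>"] I01(1)[of x] m0
      by (simp add: abs_mult)
    have iC': "integrable lborel (\<lambda>x. ?m * \<bar>(\<psi> x * \<eta> x) * (D\<eta> x \<bullet> ?p)\<bar>)"
      by (intro integrable_mult_right integrable_abs iC)
    have i3: "integrable lborel ?h3"
    proof (rule Bochner_Integration.integrable_bound[OF iC'])
      show "AE x in lborel. norm (?h3 x) \<le> norm (?m * \<bar>(\<psi> x * \<eta> x) * (D\<eta> x \<bullet> ?p)\<bar>)"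
        by (intro AE_I2) (simp only: real_norm_def, rule order_trans[OF h3_le abs_ge_self])
    qed measurable
    have pt: "?m * (?I x * (\<psi> x * (x \<bullet> ?p + \<eta> x * (D\<eta> x \<bullet> ?p)))) = ?h1 x + ?h2 x + ?h3 x" for x
    proof -
      have key: "?m * \<psi> x * (x \<bullet> ?p) = ?h x + e x * (norm x powr (- ?d) * (x \<bullet> ?p))"
      proof (cases "x = 0")
        case False
        have a: "norm x powr (- (?d + 1)) = norm x powr (- ?d) / norm x"
          using False powr_add[of "norm x" "- ?d" "- 1"] by (simp add: powr_minus divide_inverse)
        have b: "norm x powr ?d * norm x powr (- ?d) = 1" using False by (simp add: powr_minus)
        have "e x * (norm x powr (- ?d) * (x \<bullet> ?p))
          = (norm x powr ?d * norm x powr (- ?d)) * (?m * \<psi> x * (x \<bullet> ?p)) - (?p \<bullet> x) * (x \<bullet> ?p) * (norm x powr (- ?d) / norm x)"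
          unfolding e_def by (simp add: algebra_simps)
        then show ?thesis unfolding b a by (simp add: power2_eq_square inner_commute)
      qed simp
      have "?m * (?I x * (\<psi> x * (x \<bullet> ?p + \<eta> x * (D\<eta> x \<bullet> ?p)))) = ?I x * (?m * \<psi> x * (x \<bullet> ?p)) + ?h3 x"
        by (simp add: algebra_simps)
      then show ?thesis by (simp only: key distrib_left)
    qed
    have "?m * ?A r = (\<integral>x. ?m * (?I x * (\<psi> x * (x \<bullet> ?p + \<eta> x * (D\<eta> x \<bullet> ?p)))) \<partial>lborel)"
      unfolding rotation_flux[OF r0(1)] integral_mult_right_zero ..
    also have "\<dots> = (\<integral>x. ?h1 x \<partial>lborel) + (\<integral>x. ?h2 x \<partial>lborel) + (\<integral>x. ?h3 x \<partial>lborel)"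
      unfolding pt using i1 i2 i3 by simp
    finally have A: "?m * ?A r = (\<integral>x. ?h1 x \<partial>lborel) + (\<integral>x. ?h2 x \<partial>lborel) + (\<integral>x. ?h3 x \<partial>lborel)" .
    have b1: "(r - K) * J \<le> (\<integral>x. ?h1 x \<partial>lborel)"
      unfolding J(3)[OF r0(2), symmetric]
      by (intro integral_mono J(2) r0 i1 mult_right_mono I_ge) auto
    have b2: "\<bar>\<integral>x. ?h2 x \<partial>lborel\<bar> \<le> r * (norm ?p * ?E r)"
    proof -
      have "\<bar>\<integral>x. ?h2 x \<partial>lborel\<bar> \<le> (\<integral>x. norm ?p * (indicator (ball 0 r) x * (\<bar>e x\<bar> * norm x powr (- (?d - 1)))) \<partial>lborel)"
        using abs_integral_le[OF borel_measurable_integrable[OF i2] ie] h2_le by (simp only: AE_I2)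
      also have "\<dots> = r * (norm ?p * ?E r)" using r0 by (simp add: powr_minus)
      finally show ?thesis .
    qed
    have b3: "\<bar>\<integral>x. ?h3 x \<partial>lborel\<bar> \<le> ?m * C"
      unfolding C_def integral_mult_right_zero[symmetric]
      using abs_integral_le[OF borel_measurable_integrable[OF i3] iC'] h3_le by (simp only: AE_I2)
    have "(r - K) * J - r * (norm ?p * ?E r) - ?m * C \<le> ?m * ?A r" unfolding A using b1 b2 b3 by linarith
    also have "\<dots> \<le> ?m * \<bar>?A r\<bar>" using m0 by (intro mult_left_mono) auto
    finally show ?case by (simp add: algebra_simps)
  qed
  have lim: "filterlim (\<lambda>r. r * (J - norm ?p * ?E r) - (K * J + ?m * C)) at_top at_top"
  proof -
    have "((\<lambda>r. J - norm ?p * ?E r) \<longlongrightarrow> J - norm ?p * 0) at_top" by (intro tendsto_diff tendsto_mult tendsto_const E)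
    then have "filterlim (\<lambda>r. (J - norm ?p * ?E r) * r) at_top at_top"
      using J(1) by (intro filterlim_tendsto_pos_mult_at_top[OF _ _ filterlim_ident]) auto
    then have "filterlim (\<lambda>r. - (K * J + ?m * C) + (J - norm ?p * ?E r) * r) at_top at_top"
      by (rule filterlim_tendsto_add_at_top[OF tendsto_const])
    moreover have "- b + a * r = r * a - b" for a b r :: real by simp
    ultimately show ?thesis by (simp only:)
  qed
  have "filterlim (\<lambda>r. ?m * \<bar>?A r\<bar>) at_top at_top" by (rule filterlim_at_top_mono[OF lim lower])
  from filterlim_tendsto_pos_mult_at_top[OF tendsto_const[of "1/?m"] _ this]
  show ?thesis using m0 by simp
qed

text \<open>
  Vanishing energy makes \<open>\<phi>\<close> constant on vertical half lines, along which it tends to zero.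
  Then the kinematic condition says that \<open>\<eta>\<close> is constant on lines parallel to \<open>c\<close>.
\<close>

lemma no_dipole_trivial:
  assumes p: "dipole = 0" and c: "c \<noteq> 0"
  shows "\<And>x. x \<in> closure \<Omega> \<Longrightarrow> \<phi> x = 0" and "\<And>x. \<eta> x = 0"
proof -
  have flux: "energy_flux = 0" unfolding energy_flux_dipole p by simp
  have D0: "D\<phi> x = 0" if x: "x \<in> \<Omega>" for x
  proof (rule ccontr)
    assume ne: "D\<phi> x \<noteq> 0"
    define r where "r = norm x + 1"
    let ?f = "\<lambda>x. indicator (\<Omega> \<inter> ball 0 r) x * (norm (D\<phi> x))\<^sup>2"
    have "(\<integral>x. ?f x \<partial>lborel) = 0"
    proof (rule antisym)
      show "(\<integral>x. ?f x \<partial>lborel) \<le> 0" using energy_bound(2)[of r] flux by simp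
      show "0 \<le> (\<integral>x. ?f x \<partial>lborel)" by (intro integral_nonneg_AE AE_I2) simp
    qed
    then have "AE x in lborel. ?f x = 0"
      using integral_nonneg_eq_0_iff_AE[OF energy_bound(1)] by auto
    \<comment> \<open>a nonempty open set is not negligible\<close>
    define U where "U = (\<Omega> \<inter> ball 0 r) \<inter> D\<phi> -` (- {0})"
    have "open U" unfolding U_def
      by (intro continuous_open_preimage continuous_on_subset[OF Dphi_cont] open_Int open_fluid)
        (use closure_subset[of \<Omega>] in auto)
    have "AE x in lborel. x \<notin> U" using \<open>AE x in lborel. ?f x = 0\<close> by eventually_elim (auto simp: U_def)
    then have "emeasure lborel U = 0" using \<open>open U\<close>
      by (subst (asm) AE_iff_measurable[where N=U]) auto
    then have "U \<in> null_sets lebesgue" using \<open>open U\<close> by (intro null_setsI) auto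
    then have "negligible U" by (simp add: negligible_iff_null_sets)
    then have "U = {}" using open_not_negligible[OF \<open>open U\<close>] by blast
    moreover have "x \<in> U" unfolding U_def r_def using x ne by simp
    ultimately show False by blast
  qed
  have phi0: "\<phi> x = 0" if x: "x \<in> \<Omega>" for x
  proof -
    obtain x1 xn where xe: "x = (x1, xn)" by (cases x)
    have xn: "xn < \<eta> x1" using x by (simp add: xe fluid_domain_def)
    have const: "\<phi> (x1, s) = \<phi> (x1, xn)" if "s < xn" for s
    proof -
      have d: "((\<lambda>s. \<phi> (x1, s)) has_real_derivative 0) (at t)" if "t \<le> xn" for t
      proof -
        have mem: "(x1, t) \<in> \<Omega>" using that xn by (simp add: fluid_domain_def)
        have "(\<phi> has_derivative inner (D\<phi> (x1, t))) (at (x1, t))"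
          using phi mem by (auto simp: C1_upto_def gderiv_inner)
        moreover have "((\<lambda>s. (x1, s)) has_derivative (\<lambda>h. (0, h))) (at t)" by (auto intro!: derivative_eq_intros)
        ultimately have "((\<lambda>s. \<phi> (x1, s)) has_derivative (\<lambda>h. D\<phi> (x1, t) \<bullet> (0, h))) (at t)"
          by (rule has_derivative_compose[rotated])
        then show ?thesis using D0[OF mem] by (simp add: has_field_derivative_def lambda_zero)
      qed
      from MVT2[OF that, of "\<lambda>s. \<phi> (x1, s)" "\<lambda>_. 0"] d show ?thesis by auto
    qed
    have far: "filterlim (\<lambda>k. (x1, xn - real (Suc k))) at_infinity sequentially"
    proof (rule filterlim_norm_at_top_imp_at_infinity, rule filterlim_at_top_mono)
      show "filterlim (\<lambda>k. - \<bar>xn\<bar> + real (Suc k)) at_top sequentially"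
        by (intro filterlim_tendsto_add_at_top[OF tendsto_const] filterlim_compose[OF filterlim_real_sequentially filterlim_Suc])
      show "\<forall>\<^sub>F k in sequentially. - \<bar>xn\<bar> + real (Suc k) \<le> norm (x1, xn - real (Suc k))"
      proof (intro always_eventually allI)
        fix k
        have "- \<bar>xn\<bar> + real (Suc k) \<le> norm (xn - real (Suc k))" unfolding real_norm_def by linarith
        also have "\<dots> \<le> norm (x1, xn - real (Suc k))" by (rule norm_snd_le)
        finally show "- \<bar>xn\<bar> + real (Suc k) \<le> norm (x1, xn - real (Suc k))" .
      qed
    qed
    have "(\<lambda>k. indicator (closure \<Omega>) (x1, xn - real (Suc k)) * \<phi> (x1, xn - real (Suc k))) \<longlonglongrightarrow> 0"
      by (rule filterlim_compose[OF phi_lim far])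
    moreover have "indicator (closure \<Omega>) (x1, xn - real (Suc k)) * \<phi> (x1, xn - real (Suc k)) = \<phi> x" for k
    proof -
      have "(x1, xn - real (Suc k)) \<in> closure \<Omega>" using xn by (simp add: closure_fluid)
      then show ?thesis using const[of "xn - real (Suc k)"] by (simp add: xe)
    qed
    ultimately show ?thesis by (simp add: LIMSEQ_const_iff)
  qed
  have ext0: "f x = 0" if "continuous_on (closure \<Omega>) f" "\<And>x. x \<in> \<Omega> \<Longrightarrow> f x = 0" "x \<in> closure \<Omega>"
    for f :: "'a \<times> real \<Rightarrow> 'c::real_normed_vector" and x
    by (rule continuous_constant_on_closure[OF that(1,2,3)])
  show "\<phi> x = 0" if "x \<in> closure \<Omega>" for x by (rule ext0[OF phi_cont phi0 that])
  have "D\<phi> (surf x) = 0" for x by (rule ext0[OF Dphi_cont D0]) auto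
  then have cD: "c \<bullet> D\<eta> x = 0" for x using kinematic[of x] by simp
  show "\<eta> x = 0" for x
  proof -
    have const: "\<eta> (x + t *\<^sub>R c) = \<eta> x" if "0 < t" for t
    proof -
      have "((\<lambda>t. \<eta> (x + t *\<^sub>R c)) has_real_derivative 0) (at s)" for s
      proof -
        have "(\<eta> has_derivative inner (D\<eta> (x + s *\<^sub>R c))) (at (x + s *\<^sub>R c))"
          using eta_deriv by (simp add: gderiv_inner)
        moreover have "((\<lambda>t. x + t *\<^sub>R c) has_derivative (\<lambda>h. h *\<^sub>R c)) (at s)" by (auto intro!: derivative_eq_intros)
        ultimately have "((\<lambda>t. \<eta> (x + t *\<^sub>R c)) has_derivative (\<lambda>h. D\<eta> (x + s *\<^sub>R c) \<bullet> (h *\<^sub>R c))) (at s)"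
          by (rule has_derivative_compose[rotated])
        then show ?thesis using cD by (simp add: has_field_derivative_def lambda_zero inner_commute)
      qed
      from MVT2[OF that, of "\<lambda>t. \<eta> (x + t *\<^sub>R c)" "\<lambda>_. 0"] this show ?thesis by auto
    qed
    have "(\<lambda>k. K * (1 + norm (x + real (Suc k) *\<^sub>R c)) powr (- (real DIM('a) + \<epsilon>))) \<longlonglongrightarrow> 0"
    proof (intro tendsto_mult_right_zero tendsto_neg_powr)
      show "- (real DIM('a) + \<epsilon>) < 0" using eps_pos by simp
      have "filterlim (\<lambda>k. norm c * real (Suc k)) at_top sequentially"
        using c by (intro filterlim_tendsto_pos_mult_at_top[OF tendsto_const] filterlim_compose[OF filterlim_real_sequentially filterlim_Suc]) auto
      then have "filterlim (\<lambda>k. (1 - norm x) + norm c * real (Suc k)) at_top sequentially"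
        by (rule filterlim_tendsto_add_at_top[OF tendsto_const])
      then show "filterlim (\<lambda>k. 1 + norm (x + real (Suc k) *\<^sub>R c)) at_top sequentially"
      proof (rule filterlim_at_top_mono, intro always_eventually allI)
        fix k
        have "norm (real (Suc k) *\<^sub>R c) \<le> norm (x + real (Suc k) *\<^sub>R c) + norm x"
          using norm_triangle_ineq4[of "x + real (Suc k) *\<^sub>R c" x] by simp
        then show "(1 - norm x) + norm c * real (Suc k) \<le> 1 + norm (x + real (Suc k) *\<^sub>R c)" by (simp add: mult.commute)
      qed
    qed
    moreover have "\<bar>\<eta> x\<bar> \<le> K * (1 + norm (x + real (Suc k) *\<^sub>R c)) powr (- (real DIM('a) + \<epsilon>))" for k
      using eta_decay[of "x + real (Suc k) *\<^sub>R c"] const[of "real (Suc k)"] by simp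
    ultimately have "\<bar>\<eta> x\<bar> \<le> 0" by (intro LIMSEQ_le_const) auto
    then show ?thesis by simp
  qed
qed

end

section \<open>Classical derivatives of the wave\<close>

lemma gradient_GDERIV:
  fixes f :: "'a::euclidean_space \<Rightarrow> real"
  assumes "f differentiable (at x)"
  shows "GDERIV f x :> gradient f x"
proof -
  have D: "(f has_derivative frechet_derivative f (at x)) (at x)"
    using assms by (simp add: frechet_derivative_works)
  have lin: "linear (frechet_derivative f (at x))" by (rule linear_frechet_derivative[OF assms])
  have "frechet_derivative f (at x) = inner (gradient f x)"
  proof
    fix h
    have "frechet_derivative f (at x) h = frechet_derivative f (at x) (\<Sum>b\<in>Basis. (h \<bullet> b) *\<^sub>R b)"
      by (simp add: euclidean_representation)
    also have "\<dots> = (\<Sum>b\<in>Basis. (h \<bullet> b) * frechet_derivative f (at x) b)"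
      using lin by (simp add: linear_sum linear_cmul)
    also have "\<dots> = gradient f x \<bullet> h"
      unfolding gradient_def partial_deriv_def inner_sum_left inner_scaleR_left
      by (simp only: mult.commute inner_commute[of _ h])
    finally show "frechet_derivative f (at x) h = gradient f x \<bullet> h" .
  qed
  then show ?thesis using D by (simp add: gderiv_inner)
qed

lemma partial_deriv_eqI:
  assumes "GDERIV f x :> D" shows "partial_deriv b f x = D \<bullet> b"
  using assms unfolding gderiv_inner partial_deriv_def by (simp add: frechet_derivative_at[symmetric])

lemma gradient_inner_Basis: "b \<in> Basis \<Longrightarrow> gradient f x \<bullet> b = partial_deriv b f x"
  by (simp add: gradient_def)

text \<open>
  The second difference quotient is a value of the mixed derivative at a nearby point, by
  applying the mean value theorem twice. Symmetry of the second derivatives follows, because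
  the second difference does not depend on the order of the directions.
\<close>

lemma second_difference:
  fixes f :: "'a::euclidean_space \<Rightarrow> real"
  assumes f: "C2_on U f" and i: "i \<in> Basis" and j: "j \<in> Basis" and h: "0 < h"
    and U: "\<And>s t. 0 \<le> s \<Longrightarrow> s \<le> h \<Longrightarrow> 0 \<le> t \<Longrightarrow> t \<le> h \<Longrightarrow> x + s *\<^sub>R i + t *\<^sub>R j \<in> U"
  shows "\<exists>s t. 0 \<le> s \<and> s \<le> h \<and> 0 \<le> t \<and> t \<le> h \<and>
    f (x + h *\<^sub>R i + h *\<^sub>R j) - f (x + h *\<^sub>R i) - f (x + h *\<^sub>R j) + f x
      = h\<^sup>2 * partial_deriv j (partial_deriv i f) (x + s *\<^sub>R i + t *\<^sub>R j)"
proof -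
  have G: "GDERIV f y :> gradient f y" "GDERIV (partial_deriv i f) y :> gradient (partial_deriv i f) y" if "y \<in> U" for y
    using f that i unfolding C2_on_def C1_on_def by (auto intro: gradient_GDERIV)
  have line: "((\<lambda>s. F (y + s *\<^sub>R b)) has_real_derivative (D \<bullet> b)) (at s)" if "GDERIV F (y + s *\<^sub>R b) :> D" for F y s b and D :: 'a
  proof -
    have "((\<lambda>t. F ((y + s *\<^sub>R b) + t *\<^sub>R b)) has_real_derivative (D \<bullet> b)) (at (s - s))"
      using GDERIV_line[OF that, of b] by simp
    then have "((\<lambda>t. F ((y + s *\<^sub>R b) + (t - s) *\<^sub>R b)) has_real_derivative (D \<bullet> b) * 1) (at s)"
      by (intro DERIV_chain2[where g="\<lambda>t. t - s" and f="\<lambda>t. F ((y + s *\<^sub>R b) + t *\<^sub>R b)"]) (auto intro!: derivative_eq_intros)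
    then show ?thesis by (simp add: algebra_simps)
  qed
  let ?g = "\<lambda>s. f ((x + h *\<^sub>R j) + s *\<^sub>R i) - f (x + s *\<^sub>R i)"
  let ?g' = "\<lambda>s. partial_deriv i f ((x + h *\<^sub>R j) + s *\<^sub>R i) - partial_deriv i f (x + s *\<^sub>R i)"
  have dg: "(?g has_real_derivative ?g' s) (at s)" if s: "0 \<le> s" "s \<le> h" for s
  proof -
    have "(x + h *\<^sub>R j) + s *\<^sub>R i \<in> U" "x + s *\<^sub>R i \<in> U"
      using U[of s h] U[of s 0] s h by (simp_all add: algebra_simps)
    from DERIV_diff[OF line[OF G(1)[OF this(1)]] line[OF G(1)[OF this(2)]]] show ?thesis
      by (simp only: gradient_inner_Basis[OF i])
  qed
  obtain s where s: "0 < s" "s < h" "?g h - ?g 0 = h * ?g' s"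
    using MVT2[OF h, of ?g ?g'] dg by auto
  have dt: "((\<lambda>t. partial_deriv i f ((x + s *\<^sub>R i) + t *\<^sub>R j)) has_real_derivative partial_deriv j (partial_deriv i f) ((x + s *\<^sub>R i) + t *\<^sub>R j)) (at t)"
    if "0 \<le> t" "t \<le> h" for t
  proof -
    have "(x + s *\<^sub>R i) + t *\<^sub>R j \<in> U" using U[of s t] that s by simp
    from line[OF G(2)[OF this]] show ?thesis by (simp only: gradient_inner_Basis[OF j])
  qed
  obtain t where t: "0 < t" "t < h"
    "partial_deriv i f ((x + s *\<^sub>R i) + h *\<^sub>R j) - partial_deriv i f ((x + s *\<^sub>R i) + 0 *\<^sub>R j)
       = h * partial_deriv j (partial_deriv i f) ((x + s *\<^sub>R i) + t *\<^sub>R j)"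
    using MVT2[OF h, of "\<lambda>t. partial_deriv i f ((x + s *\<^sub>R i) + t *\<^sub>R j)"
        "\<lambda>t. partial_deriv j (partial_deriv i f) ((x + s *\<^sub>R i) + t *\<^sub>R j)"] dt by auto
  have "?g' s = h * partial_deriv j (partial_deriv i f) ((x + s *\<^sub>R i) + t *\<^sub>R j)"
    using t(3) by (simp add: algebra_simps)
  then have "f (x + h *\<^sub>R i + h *\<^sub>R j) - f (x + h *\<^sub>R i) - f (x + h *\<^sub>R j) + f x
      = h\<^sup>2 * partial_deriv j (partial_deriv i f) (x + s *\<^sub>R i + t *\<^sub>R j)"
    using s(3) by (simp add: power2_eq_square algebra_simps)
  then show ?thesis using s t by (intro exI[of _ s] exI[of _ t]) auto
qed

lemma partial_deriv_commute:
  fixes f :: "'a::euclidean_space \<Rightarrow> real"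
  assumes U: "open U" and f: "C2_on U f" and x: "x \<in> U" and i: "i \<in> Basis" and j: "j \<in> Basis"
  shows "partial_deriv i (partial_deriv j f) x = partial_deriv j (partial_deriv i f) x"
proof -
  obtain \<delta> where \<delta>: "0 < \<delta>" "ball x \<delta> \<subseteq> U" using U x by (meson open_contains_ball)
  define h where "h k = \<delta> / 3 * inverse (real (Suc k))" for k :: nat
  have h: "0 < h k" "h k \<le> \<delta> / 3" for k
    using \<delta>(1) mult_left_mono[of "inverse (real (Suc k))" 1 "\<delta> / 3"] unfolding h_def by (auto simp: inverse_le_1_iff)
  have h0: "h \<longlonglongrightarrow> 0"
    using tendsto_mult_left[OF LIMSEQ_inverse_real_of_nat, of "\<delta> / 3"] unfolding h_def by simp
  have near: "norm (s *\<^sub>R a + t *\<^sub>R b) \<le> 2 * h k" if "0 \<le> s" "s \<le> h k" "0 \<le> t" "t \<le> h k" "a \<in> Basis" "b \<in> Basis" for s t k and a b :: 'a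
    using norm_triangle_ineq[of "s *\<^sub>R a" "t *\<^sub>R b"] that by simp
  have mem: "x + s *\<^sub>R a + t *\<^sub>R b \<in> U" if "0 \<le> s" "s \<le> h k" "0 \<le> t" "t \<le> h k" "a \<in> Basis" "b \<in> Basis" for s t k and a b :: 'a
  proof -
    have "norm (s *\<^sub>R a + t *\<^sub>R b) < \<delta>" using near[OF that] h(2)[of k] \<delta>(1) by linarith
    then have "dist (x + (s *\<^sub>R a + t *\<^sub>R b)) x < \<delta>" by (simp add: dist_norm)
    then have "x + s *\<^sub>R a + t *\<^sub>R b \<in> ball x \<delta>" by (simp only: mem_ball dist_commute add.assoc)
    then show ?thesis using \<delta>(2) by blast
  qed
  let ?S = "\<lambda>k a b. f (x + h k *\<^sub>R a + h k *\<^sub>R b) - f (x + h k *\<^sub>R a) - f (x + h k *\<^sub>R b) + f x"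
  have lim: "(\<lambda>k. ?S k a b / (h k)\<^sup>2) \<longlonglongrightarrow> partial_deriv b (partial_deriv a f) x" if ab: "a \<in> Basis" "b \<in> Basis" for a b
  proof -
    have "\<exists>s t. 0 \<le> s \<and> s \<le> h k \<and> 0 \<le> t \<and> t \<le> h k \<and> ?S k a b = (h k)\<^sup>2 * partial_deriv b (partial_deriv a f) (x + s *\<^sub>R a + t *\<^sub>R b)" for k
      using second_difference[OF f ab h(1)] mem[OF _ _ _ _ ab] by blast
    then obtain s t where st: "\<And>k. 0 \<le> s k" "\<And>k. s k \<le> h k" "\<And>k. 0 \<le> t k" "\<And>k. t k \<le> h k"
      "\<And>k. ?S k a b = (h k)\<^sup>2 * partial_deriv b (partial_deriv a f) (x + s k *\<^sub>R a + t k *\<^sub>R b)" by metis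
    let ?y = "\<lambda>k. x + s k *\<^sub>R a + t k *\<^sub>R b"
    have "(\<lambda>k. ?y k - x) \<longlonglongrightarrow> 0"
    proof (rule Lim_null_comparison)
      show "\<forall>\<^sub>F k in sequentially. norm (?y k - x) \<le> 2 * h k"
        using near[OF st(1,2,3,4) ab] by (intro always_eventually allI) (simp add: add.assoc)
      show "(\<lambda>k. 2 * h k) \<longlonglongrightarrow> 0" by (intro tendsto_mult_right_zero h0)
    qed
    then have y: "?y \<longlonglongrightarrow> x" by (rule LIM_zero_cancel)
    have "continuous_on U (partial_deriv b (partial_deriv a f))"
      using f ab unfolding C2_on_def C1_on_def by auto
    then have "(\<lambda>k. partial_deriv b (partial_deriv a f) (?y k)) \<longlonglongrightarrow> partial_deriv b (partial_deriv a f) x"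
      by (rule continuous_on_tendsto_compose[OF _ y x]) (intro always_eventually allI mem[OF st(1,2,3,4) ab])
    moreover have "(h k)\<^sup>2 \<noteq> 0" for k using h(1)[of k] by (metis less_irrefl power_eq_0_iff)
    ultimately show ?thesis unfolding st(5) by simp
  qed
  have "?S k i j = ?S k j i" for k by (simp add: algebra_simps)
  then show ?thesis using LIMSEQ_unique[OF lim[OF j i]] lim[OF i j] by (simp only:)
qed

text \<open>
  Near the origin the function is bounded by continuity, so the decay holds on the whole space
  with the weight \<open>1 + |x|\<close>.
\<close>

lemma bigo_decay_bound:
  fixes f :: "'a::euclidean_space \<Rightarrow> real"
  assumes f: "continuous_on UNIV f" and \<beta>: "0 \<le> \<beta>"
    and O: "f \<in> O[at_infinity](\<lambda>x. 1 / norm x powr \<beta>)"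
  obtains K where "0 \<le> K" "\<And>x. \<bar>f x\<bar> \<le> K * (1 + norm x) powr (- \<beta>)"
proof -
  obtain C where C: "0 < C" "\<forall>\<^sub>F x in at_infinity. norm (f x) \<le> C * norm (1 / norm x powr \<beta>)"
    using landau_o.bigE[OF O] by blast
  obtain b where b: "\<And>x. b \<le> norm x \<Longrightarrow> norm (f x) \<le> C * norm (1 / norm x powr \<beta>)"
    using C(2) unfolding eventually_at_infinity by blast
  define R where "R = max b 1"
  obtain B where B: "0 \<le> B" "\<And>x. x \<in> cball 0 R \<Longrightarrow> norm (f x) \<le> B"
    using continuous_bounded_on_compact[OF compact_cball continuous_on_subset[OF f]] by blast
  define K where "K = max (C * 2 powr \<beta>) (B * (1 + R) powr \<beta>)"
  have "\<bar>f x\<bar> \<le> K * (1 + norm x) powr (- \<beta>)" for x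
  proof -
    have p: "0 < 1 + norm x" by (intro add_pos_nonneg) auto
    show ?thesis
    proof (cases "norm x \<le> R")
      case True
      have "1 \<le> (1 + R) powr \<beta> * (1 + norm x) powr (- \<beta>)"
      proof -
        have "(1 + norm x) powr \<beta> \<le> (1 + R) powr \<beta>" using True \<beta> by (intro powr_mono2) auto
        then have "(1 + norm x) powr \<beta> * (1 + norm x) powr (- \<beta>) \<le> (1 + R) powr \<beta> * (1 + norm x) powr (- \<beta>)"
          by (intro mult_right_mono) auto
        moreover have "(1 + norm x) powr \<beta> * (1 + norm x) powr (- \<beta>) = 1"
          using p by (simp add: powr_minus)
        ultimately show ?thesis by simp
      qed
      then have "B * 1 \<le> B * ((1 + R) powr \<beta> * (1 + norm x) powr (- \<beta>))" using B(1) by (intro mult_left_mono) auto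
      also have "\<dots> \<le> K * (1 + norm x) powr (- \<beta>)"
        unfolding K_def mult.assoc[symmetric] by (intro mult_right_mono) auto
      finally show ?thesis using B(2)[of x] True by simp
    next
      case False
      then have x: "b \<le> norm x" "1 \<le> norm x" unfolding R_def by auto
      have "\<bar>f x\<bar> \<le> C * norm x powr (- \<beta>)" using b[OF x(1)] x(2) by (simp add: powr_minus divide_inverse)
      also have "norm x powr (- \<beta>) \<le> ((1 + norm x) / 2) powr (- \<beta>)"
        using x(2) \<beta> p by (intro powr_mono2') auto
      also have "((1 + norm x) / 2) powr (- \<beta>) = 2 powr \<beta> * (1 + norm x) powr (- \<beta>)"
        using powr_half[OF p, of "- \<beta>"] by simp
      finally have "\<bar>f x\<bar> \<le> C * 2 powr \<beta> * (1 + norm x) powr (- \<beta>)" using C(1) by simp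
      also have "\<dots> \<le> K * (1 + norm x) powr (- \<beta>)" unfolding K_def by (intro mult_right_mono) auto
      finally show ?thesis .
    qed
  qed
  moreover have "0 \<le> K" unfolding K_def using C(1) by (simp add: le_max_iff_disj)
  ultimately show thesis using that by blast
qed

lemma second_order_taylor:
  fixes f :: "'a::euclidean_space \<Rightarrow> real"
  assumes D: "\<And>x. GDERIV f x :> Df x"
    and D2: "\<And>i x. i \<in> Basis \<Longrightarrow> GDERIV (\<lambda>x. Df x \<bullet> i) x :> G i x"
    and B: "\<And>i z. i \<in> Basis \<Longrightarrow> z \<in> S \<Longrightarrow> norm (G i z) \<le> B" and S: "convex S" "x \<in> S" "y \<in> S"
  shows "\<bar>f x - f y - Df x \<bullet> (x - y)\<bar> \<le> real DIM('a) * B * (norm (x - y))\<^sup>2"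
proof -
  have B0: "0 \<le> B" using B[OF SOME_Basis S(2)] norm_ge_zero order_trans by blast
  have lip: "norm (Df z - Df x) \<le> real DIM('a) * (B * norm (x - y))" if z: "z \<in> closed_segment x y" for z
  proof -
    have zS: "z \<in> S" using closed_segment_subset[OF S(2,3,1)] z by blast
    have "norm (Df z - Df x) \<le> (\<Sum>i\<in>Basis. \<bar>(Df z - Df x) \<bullet> i\<bar>)" by (rule norm_le_l1)
    also have "\<dots> \<le> (\<Sum>i\<in>(Basis::'a set). B * norm (x - y))"
    proof (rule sum_mono)
      fix i :: 'a assume i: "i \<in> Basis"
      have "\<bar>Df z \<bullet> i - Df x \<bullet> i\<bar> \<le> B * norm (z - x)"
        using GDERIV_bound[OF S(1), of "\<lambda>x. Df x \<bullet> i" "G i" B z x] D2[OF i] B[OF i] zS S(2) by blast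
      also have "\<dots> \<le> B * norm (x - y)"
        using segment_bound(1)[OF z] B0 by (intro mult_left_mono) (auto simp: norm_minus_commute)
      finally show "\<bar>(Df z - Df x) \<bullet> i\<bar> \<le> B * norm (x - y)" by (simp add: inner_diff_left)
    qed
    also have "\<dots> = real DIM('a) * (B * norm (x - y))" by simp
    finally show ?thesis .
  qed
  have "\<bar>(f x - Df x \<bullet> x) - (f y - Df x \<bullet> y)\<bar> \<le> real DIM('a) * (B * norm (x - y)) * norm (x - y)"
  proof (rule GDERIV_bound[of "closed_segment x y" _ "\<lambda>z. Df z - Df x"])
    show "GDERIV (\<lambda>z. f z - Df x \<bullet> z) z :> Df z - Df x" for z
      by (intro GDERIV_diff D) (auto simp: gderiv_inner intro!: derivative_eq_intros)
  qed (use lip in auto)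
  then show ?thesis by (simp add: inner_diff_right power2_eq_square algebra_simps)
qed

text \<open>
  The horizontal components of the unit normal are continuously differentiable, so that its
  divergence can be computed and integrated by parts.
\<close>

lemma normalized_gradient_deriv:
  fixes D :: "'a::euclidean_space \<Rightarrow> 'a"
  assumes D2: "\<And>i x. i \<in> Basis \<Longrightarrow> GDERIV (\<lambda>x. D x \<bullet> i) x :> G i x"
    and cD: "continuous_on UNIV D" and cG: "\<And>i. i \<in> Basis \<Longrightarrow> continuous_on UNIV (G i)"
  obtains E E0 where "\<And>i x. i \<in> Basis \<Longrightarrow> GDERIV (\<lambda>x. (D x \<bullet> i) / sqrt (1 + (norm (D x))\<^sup>2)) x :> E i x"
    "\<And>i. i \<in> Basis \<Longrightarrow> continuous_on UNIV (E i)"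
    "\<And>x. GDERIV (\<lambda>x. 1 / sqrt (1 + (norm (D x))\<^sup>2)) x :> E0 x"
proof -
  let ?q = "\<lambda>x. 1 + (norm (D x))\<^sup>2"
  have qp: "0 < ?q x" for x by (intro add_pos_nonneg) auto
  let ?Q = "\<lambda>x. \<Sum>i\<in>Basis. (2 * (D x \<bullet> i)) *\<^sub>R G i x"
  have sumrule: "GDERIV (\<lambda>x. \<Sum>i\<in>I. (D x \<bullet> i) * (D x \<bullet> i)) x :> (\<Sum>i\<in>I. (2 * (D x \<bullet> i)) *\<^sub>R G i x)"
    if "finite I" "I \<subseteq> Basis" for I x
    using that
  proof (induction I rule: finite_induct)
    case empty then show ?case by (simp add: GDERIV_const)
  next
    case (insert i I)
    have "GDERIV (\<lambda>x. (D x \<bullet> i) * (D x \<bullet> i)) x :> (D x \<bullet> i) *\<^sub>R G i x + (D x \<bullet> i) *\<^sub>R G i x"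
      using insert.prems by (intro GDERIV_mult D2) auto
    then have "GDERIV (\<lambda>x. (D x \<bullet> i) * (D x \<bullet> i)) x :> (2 * (D x \<bullet> i)) *\<^sub>R G i x"
      by (rule GDERIV_subst) (simp add: scaleR_2[symmetric])
    then show ?case using GDERIV_add[OF _ insert.IH] insert by simp
  qed
  have q: "GDERIV ?q x :> ?Q x" for x
    using GDERIV_add[OF GDERIV_const sumrule[OF finite_Basis order_refl], of 1 x]
    by (simp add: power2_norm_eq_inner euclidean_inner[of "D _" "D _"])
  define E0 where "E0 x = (- (inverse (sqrt (?q x)) / 2) / ?q x) *\<^sub>R ?Q x" for x
  have dinv: "((\<lambda>t. 1 / sqrt t) has_real_derivative - (inverse (sqrt t) / 2) / t) (at t)" if "0 < t" for t
  proof -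
    have "((\<lambda>t. inverse (sqrt t)) has_real_derivative - (inverse (sqrt t) * (inverse (sqrt t) / 2) * inverse (sqrt t))) (at t)"
      using that by (intro DERIV_inverse' DERIV_real_sqrt) auto
    moreover have "inverse (sqrt t) * (inverse (sqrt t) / 2) * inverse (sqrt t) = (inverse (sqrt t) / 2) / t"
    proof -
      have "inverse (sqrt t) * inverse (sqrt t) = inverse t"
        using that by (simp add: inverse_eq_divide)
      moreover have "inverse (sqrt t) * (inverse (sqrt t) / 2) * inverse (sqrt t)
        = (inverse (sqrt t) / 2) * (inverse (sqrt t) * inverse (sqrt t))" by simp
      ultimately show ?thesis by (simp only: divide_inverse)
    qed
    ultimately show ?thesis by (simp only: inverse_eq_divide minus_divide_left)
  qed
  have E0: "GDERIV (\<lambda>x. 1 / sqrt (?q x)) x :> E0 x" for x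
    unfolding E0_def by (rule GDERIV_DERIV_compose[OF q dinv[OF qp]])
  define E where "E i x = (D x \<bullet> i) *\<^sub>R E0 x + (1 / sqrt (?q x)) *\<^sub>R G i x" for i x
  have E: "GDERIV (\<lambda>x. (D x \<bullet> i) / sqrt (?q x)) x :> E i x" if "i \<in> Basis" for i x
    using GDERIV_mult[OF D2[OF that] E0, of x] unfolding E_def by simp
  have "continuous_on UNIV E0"
    unfolding E0_def divide_inverse using qp
    by (intro continuous_intros cD cG) (auto simp: less_imp_neq[symmetric] real_sqrt_eq_0_iff)
  then have "continuous_on UNIV (E i)" if "i \<in> Basis" for i
    unfolding E_def using qp that
    by (intro continuous_intros cD cG) (auto simp: less_imp_neq[symmetric] real_sqrt_eq_0_iff)
  from that[OF E this E0] show thesis .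
qed

lemma partial_deriv_fst:
  fixes h :: "'a::euclidean_space \<Rightarrow> real"
  assumes "GDERIV h (fst x) :> D"
  shows "partial_deriv b (\<lambda>y::'a \<times> real. h (fst y)) x = D \<bullet> fst b"
proof -
  have "(h has_derivative inner D) (at (fst x))" using assms by (simp add: gderiv_inner)
  moreover have "(fst has_derivative fst) (at x)" by (intro derivative_intros)
  ultimately have "((\<lambda>y. h (fst y)) has_derivative (\<lambda>v. D \<bullet> fst v)) (at x)" by (rule has_derivative_compose[rotated])
  then show ?thesis unfolding partial_deriv_def by (simp add: frechet_derivative_at[symmetric])
qed

lemma tendsto_at_infinity_in:
  fixes f :: "'a::real_normed_vector \<Rightarrow> real"
  shows "(f \<longlongrightarrow> 0) (at_infinity_in A) \<longleftrightarrow> ((\<lambda>x. indicator A x * f x) \<longlongrightarrow> 0) at_infinity"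
  unfolding tendsto_iff at_infinity_in_def eventually_inf_principal
  by (intro all_cong imp_cong refl arg_cong2[where f=eventually] ext) (auto simp: indicator_def)

text \<open>
  The boundary values of the velocity are defined as limits from inside the fluid, hence they
  agree with the continuous extension of the gradient. The Taylor estimate follows from the
  decay of the second derivatives on the ball around \<open>y\<close> of radius \<open>|y| / 2\<close>, which stays away
  from the origin.
\<close>

lemma solitary_wave_is_water_wave:
  fixes \<eta> :: "'a::euclidean_space \<Rightarrow> real" and \<phi> :: "'a \<times> real \<Rightarrow> real"
  assumes g: "0 < g" and \<epsilon>: "0 < \<epsilon>"
    and w: "solitary_wave g \<sigma> (c, 0) \<eta> \<phi>" and d: "decay_conditions \<epsilon> \<eta> \<phi>"
  obtains D\<eta> D\<phi> H D\<nu> K where "water_wave \<eta> D\<eta> \<phi> D\<phi> H c D\<nu> g \<sigma> \<epsilon> K"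
    "\<And>x. x \<in> fluid_domain \<eta> \<Longrightarrow> gradient \<phi> x = D\<phi> x"
proof -
  let ?\<Omega> = "fluid_domain \<eta>" and ?d = "real DIM('a)"
  have C2\<eta>: "C2_on UNIV \<eta>" and C2\<phi>: "C2_closure ?\<Omega> \<phi>"
    and lap: "\<And>x. x \<in> ?\<Omega> \<Longrightarrow> laplacian \<phi> x = 0"
    and kin: "\<And>x. x \<in> free_surface \<eta> \<Longrightarrow> gradient_ext ?\<Omega> \<phi> x \<bullet> unit_normal \<eta> x = (c, 0) \<bullet> unit_normal \<eta> x"
    and dyn: "\<And>x. x \<in> free_surface \<eta> \<Longrightarrow> 1/2 * (norm (gradient_ext ?\<Omega> \<phi> x))\<^sup>2 - (c, 0) \<bullet> gradient_ext ?\<Omega> \<phi> x + g * \<eta> (fst x)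
        = - \<sigma> * divergence (unit_normal \<eta>) x"
    and phi0: "(\<phi> \<longlongrightarrow> 0) (at_infinity_in (closure ?\<Omega>))"
    using w unfolding solitary_wave_def Let_def by auto
  let ?D\<eta> = "gradient \<eta>"
  have eta_deriv: "GDERIV \<eta> x :> ?D\<eta> x" for x
    using C2\<eta> unfolding C2_on_def C1_on_def by (auto intro: gradient_GDERIV)
  have cp: "continuous_on UNIV (partial_deriv i \<eta>)" if "i \<in> Basis" for i
    using C2\<eta> that unfolding C2_on_def C1_on_def by auto
  have Deta_cont: "continuous_on UNIV ?D\<eta>"
    unfolding gradient_def[abs_def] by (intro continuous_intros cp)
  have cpp: "continuous_on UNIV (partial_deriv j (partial_deriv i \<eta>))" if "i \<in> Basis" "j \<in> Basis" for i j
    using C2\<eta> that unfolding C2_on_def C1_on_def by auto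
  have D2: "GDERIV (\<lambda>x. ?D\<eta> x \<bullet> i) x :> gradient (partial_deriv i \<eta>) x" if "i \<in> Basis" for i x
    using C2\<eta> that unfolding C2_on_def C1_on_def by (auto simp: gradient_inner_Basis intro: gradient_GDERIV)
  have cG: "continuous_on UNIV (gradient (partial_deriv i \<eta>))" if "i \<in> Basis" for i
    unfolding gradient_def[abs_def] by (intro continuous_intros cpp that)
  interpret C1_graph \<eta> ?D\<eta>
    by unfold_locales (rule eta_deriv, rule Deta_cont)
  have C2\<Omega>: "C2_on ?\<Omega> \<phi>" and phi_cont: "continuous_on (closure ?\<Omega>) \<phi>"
    using C2\<phi> unfolding C2_closure_def by auto
  have "\<forall>i\<in>Basis. \<exists>F. continuous_on (closure ?\<Omega>) F \<and> (\<forall>x\<in>?\<Omega>. F x = partial_deriv i \<phi> x)"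
    using C2\<phi> unfolding C2_closure_def extends_continuously_def by auto
  then obtain P where P: "\<And>i. i \<in> Basis \<Longrightarrow> continuous_on (closure ?\<Omega>) (P i)"
    "\<And>i x. i \<in> Basis \<Longrightarrow> x \<in> ?\<Omega> \<Longrightarrow> P i x = partial_deriv i \<phi> x" by metis
  have "\<forall>i\<in>Basis. \<forall>j\<in>Basis. \<exists>F. continuous_on (closure ?\<Omega>) F \<and> (\<forall>x\<in>?\<Omega>. F x = partial_deriv i (partial_deriv j \<phi>) x)"
    using C2\<phi> unfolding C2_closure_def extends_continuously_def by auto
  then obtain Q where Q: "\<And>i j. i \<in> Basis \<Longrightarrow> j \<in> Basis \<Longrightarrow> continuous_on (closure ?\<Omega>) (Q i j)"
    "\<And>i j x. i \<in> Basis \<Longrightarrow> j \<in> Basis \<Longrightarrow> x \<in> ?\<Omega> \<Longrightarrow> Q i j x = partial_deriv i (partial_deriv j \<phi>) x" by metis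
  define D\<phi> where "D\<phi> x = (\<Sum>b\<in>Basis. P b x *\<^sub>R b)" for x
  define H where "H v x = (\<Sum>j\<in>Basis. (v \<bullet> j) *\<^sub>R (\<Sum>i\<in>Basis. Q i j x *\<^sub>R i))" for v x :: "'a \<times> real"
  have D\<phi>: "gradient \<phi> x = D\<phi> x" if "x \<in> ?\<Omega>" for x
    unfolding D\<phi>_def gradient_def using P(2) that by simp
  have cD\<phi>: "continuous_on (closure ?\<Omega>) D\<phi>"
    unfolding D\<phi>_def[abs_def] by (intro continuous_intros P(1))
  \<comment> \<open>surface points are limit points of the fluid domain, so the limit is unique\<close>
  have ext: "gradient_ext ?\<Omega> \<phi> (surf x) = D\<phi> (surf x)" for x
    unfolding gradient_ext_def
  proof (rule tendsto_Lim)
    have "surf x \<notin> ?\<Omega>" by (simp add: surf_def fluid_domain_def)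
    moreover have "surf x \<in> closure ?\<Omega>" by simp
    ultimately have "surf x islimpt ?\<Omega>" by (auto simp: closure_def)
    then show "\<not> trivial_limit (at (surf x) within ?\<Omega>)" by (simp add: trivial_limit_within)
    have "(D\<phi> \<longlongrightarrow> D\<phi> (surf x)) (at (surf x) within closure ?\<Omega>)"
      using cD\<phi> by (simp add: continuous_on)
    then have "(D\<phi> \<longlongrightarrow> D\<phi> (surf x)) (at (surf x) within ?\<Omega>)"
      by (rule tendsto_within_subset) (rule closure_subset)
    then show "(gradient \<phi> \<longlongrightarrow> D\<phi> (surf x)) (at (surf x) within ?\<Omega>)"
      by (rule Lim_transform_eventually) (auto simp: eventually_at_filter D\<phi>)
  qed
  have GP: "GDERIV (partial_deriv j \<phi>) x :> (\<Sum>i\<in>Basis. Q i j x *\<^sub>R i)" if "j \<in> Basis" "x \<in> ?\<Omega>" for j x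
  proof -
    have "GDERIV (partial_deriv j \<phi>) x :> gradient (partial_deriv j \<phi>) x"
      using C2\<Omega> that unfolding C2_on_def C1_on_def by (auto intro: gradient_GDERIV)
    then show ?thesis unfolding gradient_def using Q(2) that by simp
  qed
  have C1phi: "C1_upto ?\<Omega> \<phi> D\<phi>"
    unfolding C1_upto_def
  proof (intro conjI ballI phi_cont cD\<phi>)
    fix x assume "x \<in> ?\<Omega>"
    then show "GDERIV \<phi> x :> D\<phi> x"
      using C2\<Omega> D\<phi> gradient_GDERIV[of \<phi> x] unfolding C2_on_def C1_on_def by auto
  qed
  have C1Dphi: "C1_upto ?\<Omega> (\<lambda>x. D\<phi> x \<bullet> v) (H v)" for v
  proof -
    have 1: "C1_upto ?\<Omega> (P j) (\<lambda>x. \<Sum>i\<in>Basis. Q i j x *\<^sub>R i)" if j: "j \<in> Basis" for j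
      unfolding C1_upto_def
    proof (intro conjI ballI P(1) j)
      show "continuous_on (closure ?\<Omega>) (\<lambda>x. \<Sum>i\<in>Basis. Q i j x *\<^sub>R i)" by (intro continuous_intros Q(1) j)
      fix x assume x: "x \<in> ?\<Omega>"
      have "(partial_deriv j \<phi> has_derivative inner (\<Sum>i\<in>Basis. Q i j x *\<^sub>R i)) (at x)"
        using GP[OF j x] by (simp add: gderiv_inner)
      then have "(P j has_derivative inner (\<Sum>i\<in>Basis. Q i j x *\<^sub>R i)) (at x)"
        by (rule has_derivative_transform_within_open[OF _ open_fluid x]) (simp add: P(2) j)
      then show "GDERIV (P j) x :> (\<Sum>i\<in>Basis. Q i j x *\<^sub>R i)" by (simp add: gderiv_inner)
    qed
    have "C1_upto ?\<Omega> (\<lambda>x. \<Sum>j\<in>Basis. (v \<bullet> j) * P j x) (\<lambda>x. \<Sum>j\<in>Basis. (v \<bullet> j) *\<^sub>R (\<Sum>i\<in>Basis. Q i j x *\<^sub>R i))"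
      by (intro C1_upto_sum C1_upto_cmult 1)
    moreover have "(\<Sum>j\<in>Basis. (v \<bullet> j) * P j x) = D\<phi> x \<bullet> v" for x
      by (simp add: D\<phi>_def inner_sum_left mult.commute inner_commute[of v])
    ultimately show ?thesis unfolding H_def by simp
  qed
  have Hvw: "H v x \<bullet> u = (\<Sum>j\<in>Basis. \<Sum>i\<in>Basis. (v \<bullet> j) * (u \<bullet> i) * Q i j x)" for v u x
    by (simp add: H_def inner_sum_left sum_distrib_left inner_commute[of u] mult_ac)
  have Qsym: "Q i j x = Q j i x" if "i \<in> Basis" "j \<in> Basis" "x \<in> ?\<Omega>" for i j x
    using Q(2)[OF that(1,2,3)] Q(2)[OF that(2,1,3)] partial_deriv_commute[OF open_fluid C2\<Omega> that(3,1,2)] by simp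
  have H_sym: "H v x \<bullet> u = H u x \<bullet> v" if "x \<in> ?\<Omega>" for v u x
  proof -
    have "H v x \<bullet> u = (\<Sum>i\<in>Basis. \<Sum>j\<in>Basis. (v \<bullet> j) * (u \<bullet> i) * Q i j x)"
      unfolding Hvw by (rule sum.swap)
    also have "\<dots> = H u x \<bullet> v"
      unfolding Hvw using Qsym[OF _ _ that] by (intro sum.cong refl) (simp add: mult_ac)
    finally show ?thesis .
  qed
  have harm: "(\<Sum>b\<in>Basis. H b x \<bullet> b) = 0" if x: "x \<in> ?\<Omega>" for x
  proof -
    have "H b x \<bullet> b = partial_deriv b (partial_deriv b \<phi>) x" if "b \<in> Basis" for b
      using partial_deriv_eqI[OF GP[OF that x], of b] that
      by (simp add: H_def inner_Basis if_distrib if_distribR sum.delta cong: if_cong)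
    then show ?thesis using lap[OF x] unfolding laplacian_def by simp
  qed
  let ?q = "\<lambda>x. 1 + (norm (?D\<eta> x))\<^sup>2"
  have qp: "0 < sqrt (?q x)" for x by (simp add: add_pos_nonneg)
  have N: "unit_normal \<eta> y = (1 / sqrt (?q (fst y))) *\<^sub>R (- ?D\<eta> (fst y), 1)" for y
    by (simp add: unit_normal_def)
  have kinematic: "D\<phi> (surf x) \<bullet> nrm x = - (c \<bullet> ?D\<eta> x)" for x
  proof -
    have "gradient_ext ?\<Omega> \<phi> (surf x) \<bullet> unit_normal \<eta> (surf x) = (c, 0) \<bullet> unit_normal \<eta> (surf x)"
      by (rule kin) (simp add: free_surface_def surf_def)
    moreover have "unit_normal \<eta> (surf x) = (1 / sqrt (?q x)) *\<^sub>R nrm x"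
      unfolding N by (simp add: surf_def nrm_def)
    ultimately have "D\<phi> (surf x) \<bullet> nrm x = (c, 0) \<bullet> nrm x" using qp[of x] by (simp add: ext)
    then show ?thesis by (simp add: nrm_def)
  qed
  obtain D\<nu> E0 where nu: "\<And>i x. i \<in> Basis \<Longrightarrow> GDERIV (\<lambda>x. (?D\<eta> x \<bullet> i) / sqrt (?q x)) x :> D\<nu> i x"
    "\<And>i. i \<in> Basis \<Longrightarrow> continuous_on UNIV (D\<nu> i)" "\<And>x. GDERIV (\<lambda>x. 1 / sqrt (?q x)) x :> E0 x"
    using normalized_gradient_deriv[OF D2 Deta_cont cG] by blast
  \<comment> \<open>the vertical component of the normal does not depend on height\<close>
  have divN: "divergence (unit_normal \<eta>) (surf x) = - (\<Sum>i\<in>Basis. D\<nu> i x \<bullet> i)" for x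
  proof -
    have h: "partial_deriv (i, 0) (\<lambda>y. unit_normal \<eta> y \<bullet> (i, 0)) (surf x) = - (D\<nu> i x \<bullet> i)" if "i \<in> Basis" for i :: 'a
    proof -
      have "GDERIV (\<lambda>x. - ((?D\<eta> x \<bullet> i) / sqrt (?q x))) x :> - D\<nu> i x" by (rule GDERIV_minus[OF nu(1)[OF that]])
      then have "partial_deriv (i, 0) (\<lambda>y::'a \<times> real. - ((?D\<eta> (fst y) \<bullet> i) / sqrt (?q (fst y)))) (surf x) = (- D\<nu> i x) \<bullet> fst (i, 0 :: real)"
        by (intro partial_deriv_fst) (simp add: surf_def)
      moreover have "(\<lambda>y. unit_normal \<eta> y \<bullet> (i, 0)) = (\<lambda>y. - ((?D\<eta> (fst y) \<bullet> i) / sqrt (?q (fst y))))"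
        by (simp add: N fun_eq_iff)
      ultimately show ?thesis by simp
    qed
    have v: "partial_deriv (0, 1) (\<lambda>y. unit_normal \<eta> y \<bullet> (0, 1)) (surf x) = 0"
    proof -
      have "partial_deriv (0, 1) (\<lambda>y::'a \<times> real. 1 / sqrt (?q (fst y))) (surf x) = E0 x \<bullet> fst (0 :: 'a, 1 :: real)"
        using nu(3)[of x] by (intro partial_deriv_fst) (simp add: surf_def)
      moreover have "(\<lambda>y. unit_normal \<eta> y \<bullet> (0, 1)) = (\<lambda>y. 1 / sqrt (?q (fst y)))" by (simp add: N fun_eq_iff)
      ultimately show ?thesis by simp
    qed
    have split: "(\<Sum>b\<in>Basis. F b) = (\<Sum>i\<in>Basis. F (i, 0)) + F (0, 1)" for F :: "'a \<times> real \<Rightarrow> real"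
      unfolding Basis_prod_def by (subst sum.union_disjoint) (auto simp: sum.reindex inj_on_def)
    show ?thesis
      unfolding divergence_def split v by (simp add: h sum_negf)
  qed
  have dynamic: "1/2 * (norm (D\<phi> (surf x)))\<^sup>2 - D\<phi> (surf x) \<bullet> (c, 0) + g * \<eta> x = \<sigma> * (\<Sum>i\<in>Basis. D\<nu> i x \<bullet> i)" for x
    using dyn[of "surf x"] by (simp add: free_surface_def surf_def[of x] ext[unfolded surf_def] divN[unfolded surf_def] inner_commute)
  have phi_lim: "((\<lambda>x. indicator (closure ?\<Omega>) x * \<phi> x) \<longlongrightarrow> 0) at_infinity"
    using phi0 by (simp only: tendsto_at_infinity_in)
  have o: "\<phi> \<in> o[at_infinity_in (closure ?\<Omega>)](\<lambda>x. 1 / norm x ^ (DIM('a \<times> real) - 2))"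
    and O0: "\<eta> \<in> O[at_infinity](\<lambda>x. 1 / norm x powr (real DIM('a \<times> real) - 1 + \<epsilon>))"
    and O1: "\<And>i. i \<in> Basis \<Longrightarrow> partial_deriv i \<eta> \<in> O[at_infinity](\<lambda>x. 1 / norm x powr (real DIM('a \<times> real) + \<epsilon>))"
    and O2: "\<And>i j. i \<in> Basis \<Longrightarrow> j \<in> Basis \<Longrightarrow> partial_deriv i (partial_deriv j \<eta>)
        \<in> O[at_infinity](\<lambda>x. 1 / norm x powr (real DIM('a \<times> real) + 1 + \<epsilon>))"
    using d unfolding decay_conditions_def Let_def by blast+
  have phi_decay: "((\<lambda>x. indicator (closure ?\<Omega>) x * (\<phi> x * norm x ^ (DIM('a) - 1))) \<longlongrightarrow> 0) at_infinity"
    unfolding tendsto_at_infinity_in[symmetric]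
  proof (rule tendstoI)
    fix e :: real assume e: "0 < e"
    have "\<forall>\<^sub>F x in at_infinity_in (closure ?\<Omega>). norm (\<phi> x) \<le> e / 2 * norm (1 / norm x ^ (DIM('a \<times> real) - 2))"
      by (rule landau_o.smallD[OF o]) (use e in simp)
    moreover have "\<forall>\<^sub>F x in at_infinity_in (closure ?\<Omega>). 1 \<le> norm x"
      unfolding at_infinity_in_def eventually_inf_principal eventually_at_infinity by (intro exI[of _ 1]) auto
    ultimately show "\<forall>\<^sub>F x in at_infinity_in (closure ?\<Omega>). dist (\<phi> x * norm x ^ (DIM('a) - 1)) 0 < e"
    proof eventually_elim
      case (elim x)
      have p: "0 < norm x ^ (DIM('a) - 1)" using elim(2) by (intro zero_less_power) linarith
      have "\<bar>\<phi> x\<bar> * norm x ^ (DIM('a) - 1) \<le> e / 2 * (1 / norm x ^ (DIM('a) - 1)) * norm x ^ (DIM('a) - 1)"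
        using elim(1) p by (intro mult_right_mono) auto
      also have "\<dots> = e / 2" using p by (simp only: mult.assoc divide_inverse mult_1_left) (metis less_irrefl left_inverse mult_1_right)
      also have "\<dots> < e" using e by simp
      finally show ?case by (simp add: abs_mult)
    qed
  qed
  obtain K0 where K0: "0 \<le> K0" "\<And>x. \<bar>\<eta> x\<bar> \<le> K0 * (1 + norm x) powr (- (?d + \<epsilon>))"
    using bigo_decay_bound[OF eta_cont _ O0] \<epsilon> by (auto simp: algebra_simps)
  have "\<forall>i\<in>Basis. \<exists>K. 0 \<le> K \<and> (\<forall>x. \<bar>partial_deriv i \<eta> x\<bar> \<le> K * (1 + norm x) powr (- (?d + 1 + \<epsilon>)))"
  proof
    fix i :: 'a assume i: "i \<in> Basis"
    show "\<exists>K. 0 \<le> K \<and> (\<forall>x. \<bar>partial_deriv i \<eta> x\<bar> \<le> K * (1 + norm x) powr (- (?d + 1 + \<epsilon>)))"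
      by (rule bigo_decay_bound[OF cp[OF i] _ O1[OF i]]) (use \<epsilon> in \<open>auto simp: algebra_simps\<close>)
  qed
  then obtain k1 where k1: "\<And>i. i \<in> Basis \<Longrightarrow> 0 \<le> k1 i"
    "\<And>i x. i \<in> Basis \<Longrightarrow> \<bar>partial_deriv i \<eta> x\<bar> \<le> k1 i * (1 + norm x) powr (- (?d + 1 + \<epsilon>))" by metis
  define K1 where "K1 = (\<Sum>i\<in>Basis. k1 i)"
  have K1: "norm (?D\<eta> x) \<le> K1 * (1 + norm x) powr (- (?d + 1 + \<epsilon>))" for x
  proof -
    have "norm (?D\<eta> x) \<le> (\<Sum>i\<in>Basis. \<bar>?D\<eta> x \<bullet> i\<bar>)" by (rule norm_le_l1)
    also have "\<dots> \<le> (\<Sum>i\<in>Basis. k1 i * (1 + norm x) powr (- (?d + 1 + \<epsilon>)))"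
      by (intro sum_mono) (simp only: gradient_inner_Basis k1(2))
    also have "\<dots> = K1 * (1 + norm x) powr (- (?d + 1 + \<epsilon>))" unfolding K1_def by (rule sum_distrib_right[symmetric])
    finally show ?thesis .
  qed
  have "\<forall>j\<in>Basis. \<forall>i\<in>Basis. \<exists>K. 0 \<le> K \<and> (\<forall>x. \<bar>partial_deriv i (partial_deriv j \<eta>) x\<bar> \<le> K * (1 + norm x) powr (- (?d + 2 + \<epsilon>)))"
  proof (intro ballI)
    fix i j :: 'a assume i: "i \<in> Basis" and j: "j \<in> Basis"
    show "\<exists>K. 0 \<le> K \<and> (\<forall>x. \<bar>partial_deriv i (partial_deriv j \<eta>) x\<bar> \<le> K * (1 + norm x) powr (- (?d + 2 + \<epsilon>)))"
      by (rule bigo_decay_bound[OF cpp[OF j i] _ O2[OF i j]]) (use \<epsilon> in \<open>auto simp: algebra_simps\<close>)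
  qed
  then have "\<exists>k. \<forall>j\<in>Basis. \<forall>i\<in>Basis. 0 \<le> k j i \<and> (\<forall>x. \<bar>partial_deriv i (partial_deriv j \<eta>) x\<bar> \<le> k j i * (1 + norm x) powr (- (?d + 2 + \<epsilon>)))"
    by (simp only: bchoice_iff)
  then obtain k2 where k2: "\<And>i j. i \<in> Basis \<Longrightarrow> j \<in> Basis \<Longrightarrow> 0 \<le> k2 j i"
    "\<And>i j x. i \<in> Basis \<Longrightarrow> j \<in> Basis \<Longrightarrow> \<bar>partial_deriv i (partial_deriv j \<eta>) x\<bar> \<le> k2 j i * (1 + norm x) powr (- (?d + 2 + \<epsilon>))"
    by blast
  define K2 where "K2 = (\<Sum>j\<in>Basis. \<Sum>i\<in>Basis. k2 j i)"
  have K2_nonneg: "0 \<le> K2" unfolding K2_def by (intro sum_nonneg k2(1))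
  have K2: "norm (gradient (partial_deriv j \<eta>) x) \<le> K2 * (1 + norm x) powr (- (?d + 2 + \<epsilon>))" if j: "j \<in> Basis" for j x
  proof -
    have "norm (gradient (partial_deriv j \<eta>) x) \<le> (\<Sum>i\<in>Basis. \<bar>gradient (partial_deriv j \<eta>) x \<bullet> i\<bar>)" by (rule norm_le_l1)
    also have "\<dots> \<le> (\<Sum>i\<in>Basis. k2 j i * (1 + norm x) powr (- (?d + 2 + \<epsilon>)))"
      by (intro sum_mono) (simp only: gradient_inner_Basis k2(2) j)
    also have "\<dots> = (\<Sum>i\<in>Basis. k2 j i) * (1 + norm x) powr (- (?d + 2 + \<epsilon>))" by (rule sum_distrib_right[symmetric])
    also have "\<dots> \<le> K2 * (1 + norm x) powr (- (?d + 2 + \<epsilon>))"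
      unfolding K2_def using member_le_sum[OF j, of "\<lambda>j. \<Sum>i\<in>Basis. k2 j i"] k2(1)
      by (intro mult_right_mono) (auto intro!: sum_nonneg)
    finally show ?thesis .
  qed
  define K3 where "K3 = ?d * (K2 * 2 powr (?d + 2 + \<epsilon>))"
  have taylor: "\<bar>\<eta> x - \<eta> y - ?D\<eta> x \<bullet> (x - y)\<bar> \<le> K3 * norm y powr (- (?d + 2 + \<epsilon>)) * (norm (x - y))\<^sup>2"
    if y: "1 \<le> norm y" and xy: "norm (x - y) \<le> norm y / 2" for x y
  proof -
    have "\<bar>\<eta> x - \<eta> y - ?D\<eta> x \<bullet> (x - y)\<bar> \<le> ?d * (K2 * (2 powr (?d + 2 + \<epsilon>) * norm y powr (- (?d + 2 + \<epsilon>)))) * (norm (x - y))\<^sup>2"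
    proof (rule second_order_taylor[OF eta_deriv D2, where S="cball y (norm y / 2)"])
      fix j z :: 'a assume j: "j \<in> Basis" and z: "z \<in> cball y (norm y / 2)"
      have y0: "0 < norm y" using y by linarith
      have "norm y / 2 \<le> norm z"
        using z norm_triangle_ineq2[of y "y - z"] by (simp add: dist_norm)
      then have "(1 + norm z) powr (- (?d + 2 + \<epsilon>)) \<le> (norm y / 2) powr (- (?d + 2 + \<epsilon>))"
        using y0 \<epsilon> by (intro powr_mono2') auto
      also have "\<dots> = 2 powr (?d + 2 + \<epsilon>) * norm y powr (- (?d + 2 + \<epsilon>))"
        using powr_half[OF y0, of "- (?d + 2 + \<epsilon>)"] by (simp only: minus_minus)
      finally show "norm (gradient (partial_deriv j \<eta>) z) \<le> K2 * (2 powr (?d + 2 + \<epsilon>) * norm y powr (- (?d + 2 + \<epsilon>)))"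
        using order_trans[OF K2[OF j] mult_left_mono[OF _ K2_nonneg]] by blast
    qed (use xy in \<open>auto simp: dist_norm norm_minus_commute\<close>)
    then show ?thesis unfolding K3_def by (simp only: mult.assoc)
  qed
  define K where "K = max K0 (max K1 K3)"
  have Kge: "K0 \<le> K" "K1 \<le> K" "K3 \<le> K" unfolding K_def by auto
  have "water_wave \<eta> ?D\<eta> \<phi> D\<phi> H c D\<nu> g \<sigma> \<epsilon> K"
  proof (unfold_locales)
    show "0 \<le> K" using K0(1) Kge(1) by linarith
    show "\<bar>\<eta> x\<bar> \<le> K * (1 + norm x) powr (- (?d + \<epsilon>))" for x
      by (rule order_trans[OF K0(2) mult_right_mono[OF Kge(1)]]) simp
    show "norm (?D\<eta> x) \<le> K * (1 + norm x) powr (- (?d + 1 + \<epsilon>))" for x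
      by (rule order_trans[OF K1 mult_right_mono[OF Kge(2)]]) simp
    show "\<bar>\<eta> x - \<eta> y - ?D\<eta> x \<bullet> (x - y)\<bar> \<le> K * norm y powr (- (?d + 2 + \<epsilon>)) * (norm (x - y))\<^sup>2"
      if "1 \<le> norm y" "norm (x - y) \<le> norm y / 2" for x y
      by (rule order_trans[OF taylor[OF that]]) (intro mult_right_mono Kge; simp)
  qed (fact C1phi C1Dphi H_sym harm kinematic dynamic nu(1) nu(2) phi_lim phi_decay \<epsilon> g)+
  then show thesis using that D\<phi> by blast
qed

section \<open>The dichotomy\<close>

text \<open>
  The hypothesis \<open>rot\<close> says that every rotational derivative in a vertical plane is a
  component of the cross product, which covers the planar and the spatial case at once. A
  single component that tends to infinity is enough.
\<close>

lemma angular_momentum_dichotomy: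
  fixes cross :: "'a::euclidean_space \<times> real \<Rightarrow> 'a \<times> real \<Rightarrow> 'b::euclidean_space"
  assumes g: "0 < g" and \<epsilon>: "0 < \<epsilon>" and c: "c \<noteq> 0"
    and w: "solitary_wave g \<sigma> (c, 0) \<eta> \<phi>" and d: "decay_conditions \<epsilon> \<eta> \<phi>"
    and cont: "continuous_on UNIV (\<lambda>z. cross (fst z) (snd z))"
    and rot: "\<And>p. \<exists>a. \<forall>x v. cross x v \<bullet> a = (fst x \<bullet> p) * (v \<bullet> (0, 1)) - snd x * (v \<bullet> (p, 0))"
  shows "infinite_angular_momentum cross \<eta> \<phi> \<or> trivial_wave \<eta> \<phi>"
proof -
  obtain D\<eta> D\<phi> H D\<nu> K where ww: "water_wave \<eta> D\<eta> \<phi> D\<phi> H c D\<nu> g \<sigma> \<epsilon> K"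
    and D\<phi>: "\<And>x. x \<in> fluid_domain \<eta> \<Longrightarrow> gradient \<phi> x = D\<phi> x"
    using solitary_wave_is_water_wave[OF g \<epsilon> w d] by blast
  interpret water_wave \<eta> D\<eta> \<phi> D\<phi> H c D\<nu> g \<sigma> \<epsilon> K by (rule ww)
  show ?thesis
  proof (cases "dipole = 0")
    case True
    then show ?thesis using no_dipole_trivial[OF True c] unfolding trivial_wave_def by blast
  next
    case False
    obtain a where a: "\<And>x v. cross x v \<bullet> a = (fst x \<bullet> dipole) * (v \<bullet> up) - snd x * (v \<bullet> (dipole, 0))"
      using rot[of dipole] by blast
    let ?M = "\<lambda>r. LINT x:\<Omega> \<inter> ball 0 r|lborel. cross x (gradient \<phi> x)"
    have int: "integrable lborel (\<lambda>x. indicator (\<Omega> \<inter> ball 0 r) x *\<^sub>R cross x (gradient \<phi> x))" for r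
    proof -
      have "continuous_on (closure \<Omega> \<inter> cball 0 r) (\<lambda>x. cross x (D\<phi> x))"
      proof -
        have "continuous_on (closure \<Omega> \<inter> cball 0 r) (\<lambda>x. (x, D\<phi> x))"
          by (intro continuous_on_Pair continuous_on_id continuous_on_subset[OF Dphi_cont]) auto
        from continuous_on_compose2[OF cont this] show ?thesis by simp
      qed
      then have "integrable lborel (\<lambda>x. indicator (closure \<Omega> \<inter> cball 0 r) x *\<^sub>R cross x (D\<phi> x))"
        by (intro borel_integrable_compact closed_Int_compact) auto
      then have "integrable lborel (\<lambda>x. indicator (\<Omega> \<inter> ball 0 r) x *\<^sub>R (indicator (closure \<Omega> \<inter> cball 0 r) x *\<^sub>R cross x (D\<phi> x)))"
        by (rule integrable_mult_indicator[rotated]) simp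
      also have "(\<lambda>x. indicator (\<Omega> \<inter> ball 0 r) x *\<^sub>R (indicator (closure \<Omega> \<inter> cball 0 r) x *\<^sub>R cross x (D\<phi> x)))
        = (\<lambda>x. indicator (\<Omega> \<inter> ball 0 r) x *\<^sub>R cross x (gradient \<phi> x))"
      proof
        fix x
        show "indicator (\<Omega> \<inter> ball 0 r) x *\<^sub>R (indicator (closure \<Omega> \<inter> cball 0 r) x *\<^sub>R cross x (D\<phi> x))
          = indicator (\<Omega> \<inter> ball 0 r) x *\<^sub>R cross x (gradient \<phi> x)"
          using closure_subset[of \<Omega>] D\<phi>[of x] by (auto simp: indicator_def)
      qed
      finally show ?thesis .
    qed
    have proj: "?M r \<bullet> a = (\<integral>x. indicator (\<Omega> \<inter> ball 0 r) x * rotation_derivative dipole x \<partial>lborel)" for r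
    proof -
      have "?M r \<bullet> a = (\<integral>x. (indicator (\<Omega> \<inter> ball 0 r) x *\<^sub>R cross x (gradient \<phi> x)) \<bullet> a \<partial>lborel)"
        unfolding set_lebesgue_integral_def using int[of r] by (intro integral_inner_left[symmetric]) auto
      also have "\<dots> = (\<integral>x. indicator (\<Omega> \<inter> ball 0 r) x * rotation_derivative dipole x \<partial>lborel)"
        using D\<phi> by (intro Bochner_Integration.integral_cong refl) (auto simp: indicator_def a rotation_derivative_def)
      finally show ?thesis .
    qed
    have "filterlim (\<lambda>r. \<bar>?M r \<bullet> a\<bar>) at_top at_top"
      unfolding proj by (rule angular_momentum_grows[OF False])
    then have "filterlim (\<lambda>r. norm a * norm (?M r)) at_top at_top"
      by (rule filterlim_at_top_mono) (auto intro!: always_eventually order_trans[OF Cauchy_Schwarz_ineq2] simp: mult.commute)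
    moreover have a0: "a \<noteq> 0"
    proof
      assume "a = 0"
      then have "(fst x \<bullet> dipole) * (v \<bullet> up) - snd x * (v \<bullet> (dipole, 0)) = 0" for x v using a[of x v] by simp
      from this[of "(dipole, 0)" up] show False using False by simp
    qed
    ultimately have "filterlim (\<lambda>r. (1 / norm a) * (norm a * norm (?M r))) at_top at_top"
      by (intro filterlim_tendsto_pos_mult_at_top[OF tendsto_const, of "1 / norm a"]) (simp_all only: zero_less_divide_1_iff zero_less_norm_iff not_False_eq_True)
    moreover have "(1 / norm a) * (norm a * y) = y" for y using a0 by simp
    ultimately have "filterlim (\<lambda>r. norm (?M r)) at_top at_top" by (simp only:)
    then show ?thesis unfolding infinite_angular_momentum_def by blast
  qed
qed

theorem corollary3:
  fixes g \<sigma> \<epsilon> :: real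
  assumes "g > 0" and "\<sigma> \<ge> 0" and "0 < \<epsilon>" and "\<epsilon> < 1"
  shows
    "(\<forall>(c::real \<times> real) \<eta> \<phi>.
        snd c = 0 \<longrightarrow> c \<noteq> 0 \<longrightarrow> solitary_wave g \<sigma> c \<eta> \<phi> \<longrightarrow> decay_conditions \<epsilon> \<eta> \<phi> \<longrightarrow>
        infinite_angular_momentum cross_planar \<eta> \<phi> \<or> trivial_wave \<eta> \<phi>) \<and>
     (\<forall>(c::(real^2) \<times> real) \<eta> \<phi>.
        snd c = 0 \<longrightarrow> c \<noteq> 0 \<longrightarrow> solitary_wave g \<sigma> c \<eta> \<phi> \<longrightarrow> decay_conditions \<epsilon> \<eta> \<phi> \<longrightarrow>
        infinite_angular_momentum cross_spatial \<eta> \<phi> \<or> trivial_wave \<eta> \<phi>)"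
proof (intro conjI allI impI)
  fix c :: "real \<times> real" and \<eta> \<phi>
  assume c: "snd c = 0" "c \<noteq> 0" and w: "solitary_wave g \<sigma> c \<eta> \<phi>" and d: "decay_conditions \<epsilon> \<eta> \<phi>"
  have ce: "c = (fst c, 0)" using c(1) by (cases c) simp
  show "infinite_angular_momentum cross_planar \<eta> \<phi> \<or> trivial_wave \<eta> \<phi>"
  proof (rule angular_momentum_dichotomy[OF assms(1,3) _ _ d])
    show "fst c \<noteq> 0" using c by (auto simp: prod_eq_iff)
    show "solitary_wave g \<sigma> (fst c, 0) \<eta> \<phi>" using w ce by simp
    show "continuous_on UNIV (\<lambda>z. cross_planar (fst z) (snd z))"
      unfolding cross_planar_def by (intro continuous_intros)
    \<comment> \<open>for \<open>n = 2\<close> the cross product is scalar and \<open>p\<close> is a number\<close>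
    show "\<exists>a. \<forall>x v. cross_planar x v \<bullet> a = (fst x \<bullet> p) * (v \<bullet> (0, 1)) - snd x * (v \<bullet> (p, 0))" for p :: real
      by (intro exI[of _ p]) (auto simp: cross_planar_def algebra_simps)
  qed
next
  fix c :: "(real^2) \<times> real" and \<eta> \<phi>
  assume c: "snd c = 0" "c \<noteq> 0" and w: "solitary_wave g \<sigma> c \<eta> \<phi>" and d: "decay_conditions \<epsilon> \<eta> \<phi>"
  have ce: "c = (fst c, 0)" using c(1) by (cases c) simp
  show "infinite_angular_momentum cross_spatial \<eta> \<phi> \<or> trivial_wave \<eta> \<phi>"
  proof (rule angular_momentum_dichotomy[OF assms(1,3) _ _ d])
    show "fst c \<noteq> 0" using c by (auto simp: prod_eq_iff)
    show "solitary_wave g \<sigma> (fst c, 0) \<eta> \<phi>" using w ce by simp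
    have v: "continuous_on UNIV (\<lambda>z. to_vec3 (f z))" if "continuous_on UNIV f" for f :: "((real^2) \<times> real) \<times> ((real^2) \<times> real) \<Rightarrow> (real^2) \<times> real"
      unfolding to_vec3_def
    proof (rule continuous_on_vec_lambda[where f="\<lambda>i z. (vector [fst (f z) $ 1, fst (f z) $ 2, snd (f z)] :: real^3) $ i", unfolded vec_lambda_eta])
      have "\<forall>i. continuous_on UNIV (\<lambda>z. (vector [fst (f z) $ 1, fst (f z) $ 2, snd (f z)] :: real^3) $ i)"
        unfolding forall_3 vector_3 by (intro conjI continuous_intros that)
      then show "continuous_on UNIV (\<lambda>z. (vector [fst (f z) $ 1, fst (f z) $ 2, snd (f z)] :: real^3) $ i)" for i by blast
    qed
    show "continuous_on UNIV (\<lambda>z. cross_spatial (fst z) (snd z))"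
      unfolding cross_spatial_def by (intro continuous_on_cross v continuous_intros)
    \<comment> \<open>the horizontal axis perpendicular to \<open>p\<close>\<close>
    show "\<exists>a. \<forall>x v. cross_spatial x v \<bullet> a = (fst x \<bullet> p) * (v \<bullet> (0, 1)) - snd x * (v \<bullet> (p, 0))" for p :: "real^2"
      by (intro exI[of _ "vector [p $ 2, - p $ 1, 0]"])
        (auto simp: cross_spatial_def to_vec3_def cross3_def inner_vec_def sum_2 sum_3 vector_3 algebra_simps)
  qed
qed


end
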